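(* Let $\mathcal{C}=\mathcal{C}^{q-q^{-1},0}_{-q^{-1},1}(-,1,1)$, scaled so that $\varsigma=1$ and $a=1$. The category $\mathcal{C}$ is isomorphic (as a strict monoidal supercategory) to the periplectic $q$-Brauer category $\mathcal{B}$. Consequently also $\mathrm{Hom}_{\mathcal{C}}(n,n)\cong\mathcal{A}_q(n)$ as algebras, for all $n$. Furthermore, if we specialize $q=q^{-1}$ to one, we get the periplectic Brauer category; hence $\mathcal{C}^{0,0}_{-1,1}(-,1,1)$ is isomorphic to the periplectic Brauer category.
   Context: $\mathbb{K}$ is a field of characteristic different from 2 and $q$ is a formal variable; $\mathcal{C}$, $\mathcal{B}$ and $\mathcal{A}_q(n)$ are defined over $\mathbb{K}(q)$, and the categories at $q=1$ over $\mathbb{K}$. A strict monoidal supercategory is a strict monoidal category enriched over $\mathbb{Z}/2$-graded vector spaces, with interchange law $(f\otimes g)\circ(h\otimes k)=(-1)^{|g||h|}(f\circ h)\otimes(g\circ k)$. All categories have one generating object $\bullet$; $m$ denotes $\bullet^{\otimes m}$, $I$ the identity of $\bullet$, $1_2$ the identity of $\bullet^{\otimes2}$; $H\in\mathrm{Hom}(2,2)$ is even, $A\in\mathrm{Hom}(2,0)$ and $U\in\mathrm{Hom}(0,2)$ are odd. $\mathcal{C}$ is generated by $H$ (invertible), $A,U$ with relations: $HU=qU$, $AH=-q^{-1}A$; $AU=0$; $(A\otimes I)(I\otimes U)=I$, $(I\otimes A)(U\otimes I)=-I$; $(A\otimes I)(I\otimes H)(U\otimes I)=-qI$; $H^2=1_2+(q-q^{-1})H$;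 $(H\otimes I)(I\otimes U)=(I\otimes H)(U\otimes I)+(q-q^{-1})(I\otimes U)$; $(H\otimes I)(I\otimes H)(U\otimes I)=I\otimes U$; $(I\otimes A)(H\otimes I)=-(q-q^{-1})(A\otimes I)+(A\otimes I)(I\otimes H)$; $(A\otimes I)(I\otimes H)(H\otimes I)=(1-q^2)(A\otimes I)+(q-q^{-1})(A\otimes I)(I\otimes H)+I\otimes A$; $(H\otimes I)(I\otimes H)(H\otimes I)=(I\otimes H)(H\otimes I)(I\otimes H)$. $\mathcal{C}^{0,0}_{-1,1}(-,1,1)$ is the category over $\mathbb{K}$ presented by the same relations with $q=1$. The periplectic $q$-Brauer category $\mathcal{B}$ is generated by even $H,\bar H\in\mathrm{Hom}(2,2)$ and odd $A,U$ with relations: $H\bar H=1_2=\bar HH$; $(H\otimes I)(I\otimes H)(H\otimes I)=(I\otimes H)(H\otimes I)(I\otimes H)$; $H-\bar H=(q-q^{-1})1_2$; $(A\otimes I)(I\otimes U)=I$, $(I\otimes A)(U\otimes I)=-I$; $HU=qU$; $(I\otimes H)(U\otimes I)=(\bar H\otimes I)(I\otimes U)$; $AU=0$. The periplectic $q$-Brauer algebra $\mathcal{A}_q(n)$ is the unital associative $\mathbb{K}(q)$-algebra generated by $g_i,e_i$ ($1\le i\le n-1$) with relations: $(g_i-q)(g_i+q^{-1})=0$; $e_i^2=0$; $e_ig_i=-q^{-1}e_i$; $g_ie_i=qe_i$; $g_ig_j=g_jg_i$, $g_ie_j=e_jg_i$, $e_ie_j=e_je_i$ for $|i-j|\ge2$;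 $g_ig_{i+1}g_i=g_{i+1}g_ig_{i+1}$; $e_{i+1}e_ie_{i+1}=-e_{i+1}$; $e_ie_{i+1}e_i=-e_i$; $g_ie_{i+1}e_i=-g_{i+1}e_i+(q-q^{-1})e_{i+1}e_i$; $e_{i+1}e_ig_{i+1}=-e_{i+1}g_i+(q-q^{-1})e_{i+1}e_i$. The periplectic Brauer category is generated over $\mathbb{K}$ by even $H$ and odd $A,U$ with relations: $H^2=1_2$; $(H\otimes I)(I\otimes H)(H\otimes I)=(I\otimes H)(H\otimes I)(I\otimes H)$; $(A\otimes I)(I\otimes U)=I$; $(I\otimes A)(U\otimes I)=-I$; $(I\otimes H)(U\otimes I)=(H\otimes I)(I\otimes U)$; $HU=U$. *)

theory Defs
  imports
    "HOL-Algebra.Module"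
    "HOL-Algebra.QuotRing"
    "HOL-Computational_Algebra.Fraction_Field"
    "HOL-Computational_Algebra.Polynomial"
    "HOL-Library.Z2"
begin

section \<open>Linear algebra over a field given as a type\<close>

definition scalars :: "'k::field ring" where
  "scalars = \<lparr>carrier = UNIV, monoid.mult = (*), one = 1, zero = 0, add = (+)\<rparr>"

text \<open>The library locale \<open>algebra\<close> of \<open>HOL-Algebra\<close> is restricted to commutative algebras.\<close>

locale assoc_algebra =
  fixes A :: "('k::field, 'a) module" (structure)
  assumes is_module: "Module.module scalars A"
    and is_ring: "Ring.ring A"
    and smult_mult_left:
      "\<And>c x y. x \<in> carrier A \<Longrightarrow> y \<in> carrier A \<Longrightarrow> (c \<odot> x) \<otimes> y = c \<odot> (x \<otimes> y)"
    and smult_mult_right: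
      "\<And>c x y. x \<in> carrier A \<Longrightarrow> y \<in> carrier A \<Longrightarrow> x \<otimes> (c \<odot> y) = c \<odot> (x \<otimes> y)"

definition algebra_isomorphic :: "('k::field, 'a) module \<Rightarrow> ('k, 'b) module \<Rightarrow> bool" where
  "algebra_isomorphic A B \<longleftrightarrow> assoc_algebra A \<and> assoc_algebra B \<and>
     (\<exists>h \<in> ring_iso A B. \<forall>c. \<forall>x \<in> carrier A. h (c \<odot>\<^bsub>A\<^esub> x) = c \<odot>\<^bsub>B\<^esub> h x)"

section \<open>Strict monoidal supercategories\<close>

text \<open>Parities are elements of the two-element field \<open>bit\<close>.\<close>

definition koszul_sign :: "bit \<Rightarrow> bit \<Rightarrow> 'k::field" where
  "koszul_sign p r = (if p = 1 \<and> r = 1 then - 1 else 1)"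

text \<open>\<open>Cmp f g\<close> is \<open>f\<close> after \<open>g\<close>; \<open>Hom\<^sub>p C p a b\<close> is the homogeneous part of parity \<open>p\<close>.\<close>

record ('o, 'm, 'k) supercat =
  Obj :: "'o set"
  Hom :: "'o \<Rightarrow> 'o \<Rightarrow> 'm set"
  Hom\<^sub>p :: "bit \<Rightarrow> 'o \<Rightarrow> 'o \<Rightarrow> 'm set"
  Zero :: "'o \<Rightarrow> 'o \<Rightarrow> 'm"
  Add :: "'m \<Rightarrow> 'm \<Rightarrow> 'm"
  Smul :: "'k \<Rightarrow> 'm \<Rightarrow> 'm"
  Ident :: "'o \<Rightarrow> 'm"
  Cmp :: "'m \<Rightarrow> 'm \<Rightarrow> 'm"
  UnitO :: "'o"
  TensO :: "'o \<Rightarrow> 'o \<Rightarrow> 'o"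
  Tens :: "'m \<Rightarrow> 'm \<Rightarrow> 'm"

text \<open>The module record has slots for a multiplication and a unit, which are meaningless
  unless \<open>a = b\<close>; the locale \<open>Module.module\<close> does not look at them.\<close>

definition hom_space :: "('o, 'm, 'k) supercat \<Rightarrow> 'o \<Rightarrow> 'o \<Rightarrow> ('k, 'm) module" where
  "hom_space C a b = \<lparr>carrier = Hom C a b, monoid.mult = Cmp C, one = Ident C a,
     zero = Zero C a b, add = Add C, module.smult = Smul C\<rparr>"

abbreviation End_algebra :: "('o, 'm, 'k) supercat \<Rightarrow> 'o \<Rightarrow> ('k, 'm) module" where
  "End_algebra C a \<equiv> hom_space C a a"

locale strict_monoidal_supercategory =
  fixes C :: "('o, 'm, 'k::field) supercat"
  assumes hom_disjoint:
      "\<lbrakk>a \<in> Obj C; b \<in> Obj C; a' \<in> Obj C; b' \<in> Obj C; f \<in> Hom C a b; f \<in> Hom C a' b'\<rbrakk>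
        \<Longrightarrow> a = a' \<and> b = b'"
    \<comment> \<open>morphism spaces are \<open>\<int>/2\<close>-graded vector spaces\<close>
    and hom_module: "\<lbrakk>a \<in> Obj C; b \<in> Obj C\<rbrakk> \<Longrightarrow> Module.module scalars (hom_space C a b)"
    and part_submodule:
      "\<lbrakk>a \<in> Obj C; b \<in> Obj C\<rbrakk> \<Longrightarrow> submodule (Hom\<^sub>p C p a b) scalars (hom_space C a b)"
    and part_direct_sum:
      "\<lbrakk>a \<in> Obj C; b \<in> Obj C; f \<in> Hom C a b\<rbrakk>
        \<Longrightarrow> \<exists>!(f0, f1). f0 \<in> Hom\<^sub>p C 0 a b \<and> f1 \<in> Hom\<^sub>p C 1 a b \<and> f = Add C f0 f1"
    \<comment> \<open>the category structure\<close>
    and id_part: "a \<in> Obj C \<Longrightarrow> Ident C a \<in> Hom\<^sub>p C 0 a a"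
    and comp_hom:
      "\<lbrakk>a \<in> Obj C; b \<in> Obj C; c \<in> Obj C; f \<in> Hom C b c; g \<in> Hom C a b\<rbrakk>
        \<Longrightarrow> Cmp C f g \<in> Hom C a c"
    and comp_part:
      "\<lbrakk>a \<in> Obj C; b \<in> Obj C; c \<in> Obj C; f \<in> Hom\<^sub>p C p b c; g \<in> Hom\<^sub>p C r a b\<rbrakk>
        \<Longrightarrow> Cmp C f g \<in> Hom\<^sub>p C (p + r) a c"
    and comp_assoc:
      "\<lbrakk>a \<in> Obj C; b \<in> Obj C; c \<in> Obj C; d \<in> Obj C;
        f \<in> Hom C c d; g \<in> Hom C b c; h \<in> Hom C a b\<rbrakk>
        \<Longrightarrow> Cmp C (Cmp C f g) h = Cmp C f (Cmp C g h)"
    and comp_id_left: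
      "\<lbrakk>a \<in> Obj C; b \<in> Obj C; f \<in> Hom C a b\<rbrakk> \<Longrightarrow> Cmp C (Ident C b) f = f"
    and comp_id_right:
      "\<lbrakk>a \<in> Obj C; b \<in> Obj C; f \<in> Hom C a b\<rbrakk> \<Longrightarrow> Cmp C f (Ident C a) = f"
    and comp_add_left:
      "\<lbrakk>a \<in> Obj C; b \<in> Obj C; c \<in> Obj C; f \<in> Hom C b c; f' \<in> Hom C b c; g \<in> Hom C a b\<rbrakk>
        \<Longrightarrow> Cmp C (Add C f f') g = Add C (Cmp C f g) (Cmp C f' g)"
    and comp_add_right:
      "\<lbrakk>a \<in> Obj C; b \<in> Obj C; c \<in> Obj C; f \<in> Hom C b c; g \<in> Hom C a b; g' \<in> Hom C a b\<rbrakk>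
        \<Longrightarrow> Cmp C f (Add C g g') = Add C (Cmp C f g) (Cmp C f g')"
    and comp_smul_left:
      "\<lbrakk>a \<in> Obj C; b \<in> Obj C; c \<in> Obj C; f \<in> Hom C b c; g \<in> Hom C a b\<rbrakk>
        \<Longrightarrow> Cmp C (Smul C z f) g = Smul C z (Cmp C f g)"
    and comp_smul_right:
      "\<lbrakk>a \<in> Obj C; b \<in> Obj C; c \<in> Obj C; f \<in> Hom C b c; g \<in> Hom C a b\<rbrakk>
        \<Longrightarrow> Cmp C f (Smul C z g) = Smul C z (Cmp C f g)"
    \<comment> \<open>the strict monoidal structure\<close>
    and unit_obj: "UnitO C \<in> Obj C"
    and tens_obj: "\<lbrakk>a \<in> Obj C; b \<in> Obj C\<rbrakk> \<Longrightarrow> TensO C a b \<in> Obj C"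
    and tens_obj_assoc:
      "\<lbrakk>a \<in> Obj C; b \<in> Obj C; c \<in> Obj C\<rbrakk>
        \<Longrightarrow> TensO C (TensO C a b) c = TensO C a (TensO C b c)"
    and tens_obj_unit_left: "a \<in> Obj C \<Longrightarrow> TensO C (UnitO C) a = a"
    and tens_obj_unit_right: "a \<in> Obj C \<Longrightarrow> TensO C a (UnitO C) = a"
    and tens_hom:
      "\<lbrakk>a \<in> Obj C; b \<in> Obj C; c \<in> Obj C; d \<in> Obj C; f \<in> Hom C a b; g \<in> Hom C c d\<rbrakk>
        \<Longrightarrow> Tens C f g \<in> Hom C (TensO C a c) (TensO C b d)"
    and tens_part:
      "\<lbrakk>a \<in> Obj C; b \<in> Obj C; c \<in> Obj C; d \<in> Obj C; f \<in> Hom\<^sub>p C p a b; g \<in> Hom\<^sub>p C r c d\<rbrakk>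
        \<Longrightarrow> Tens C f g \<in> Hom\<^sub>p C (p + r) (TensO C a c) (TensO C b d)"
    and tens_assoc:
      "\<lbrakk>a \<in> Obj C; b \<in> Obj C; c \<in> Obj C; d \<in> Obj C; x \<in> Obj C; y \<in> Obj C;
        f \<in> Hom C a b; g \<in> Hom C c d; h \<in> Hom C x y\<rbrakk>
        \<Longrightarrow> Tens C (Tens C f g) h = Tens C f (Tens C g h)"
    and tens_unit_left:
      "\<lbrakk>a \<in> Obj C; b \<in> Obj C; f \<in> Hom C a b\<rbrakk> \<Longrightarrow> Tens C (Ident C (UnitO C)) f = f"
    and tens_unit_right:
      "\<lbrakk>a \<in> Obj C; b \<in> Obj C; f \<in> Hom C a b\<rbrakk> \<Longrightarrow> Tens C f (Ident C (UnitO C)) = f"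
    and tens_id:
      "\<lbrakk>a \<in> Obj C; b \<in> Obj C\<rbrakk> \<Longrightarrow> Tens C (Ident C a) (Ident C b) = Ident C (TensO C a b)"
    and tens_add_left:
      "\<lbrakk>a \<in> Obj C; b \<in> Obj C; c \<in> Obj C; d \<in> Obj C;
        f \<in> Hom C a b; f' \<in> Hom C a b; g \<in> Hom C c d\<rbrakk>
        \<Longrightarrow> Tens C (Add C f f') g = Add C (Tens C f g) (Tens C f' g)"
    and tens_add_right:
      "\<lbrakk>a \<in> Obj C; b \<in> Obj C; c \<in> Obj C; d \<in> Obj C;
        f \<in> Hom C a b; g \<in> Hom C c d; g' \<in> Hom C c d\<rbrakk>
        \<Longrightarrow> Tens C f (Add C g g') = Add C (Tens C f g) (Tens C f g')"
    and tens_smul_left: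
      "\<lbrakk>a \<in> Obj C; b \<in> Obj C; c \<in> Obj C; d \<in> Obj C; f \<in> Hom C a b; g \<in> Hom C c d\<rbrakk>
        \<Longrightarrow> Tens C (Smul C z f) g = Smul C z (Tens C f g)"
    and tens_smul_right:
      "\<lbrakk>a \<in> Obj C; b \<in> Obj C; c \<in> Obj C; d \<in> Obj C; f \<in> Hom C a b; g \<in> Hom C c d\<rbrakk>
        \<Longrightarrow> Tens C f (Smul C z g) = Smul C z (Tens C f g)"
    and super_interchange:
      "\<lbrakk>a \<in> Obj C; b \<in> Obj C; c \<in> Obj C; a' \<in> Obj C; b' \<in> Obj C; c' \<in> Obj C;
        f \<in> Hom\<^sub>p C p b c; g \<in> Hom\<^sub>p C r b' c'; h \<in> Hom\<^sub>p C s a b; k \<in> Hom\<^sub>p C t a' b'\<rbrakk>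
        \<Longrightarrow> Cmp C (Tens C f g) (Tens C h k)
           = Smul C (koszul_sign r s) (Tens C (Cmp C f h) (Cmp C g k))"

locale strict_monoidal_superfunctor =
  fixes C :: "('o, 'm, 'k::field) supercat" and D :: "('p, 'n, 'k) supercat"
    and F :: "'o \<Rightarrow> 'p" and \<Phi> :: "'m \<Rightarrow> 'n"
  assumes obj: "a \<in> Obj C \<Longrightarrow> F a \<in> Obj D"
    and obj_unit: "F (UnitO C) = UnitO D"
    and obj_tens: "\<lbrakk>a \<in> Obj C; b \<in> Obj C\<rbrakk> \<Longrightarrow> F (TensO C a b) = TensO D (F a) (F b)"
    and part: "\<lbrakk>a \<in> Obj C; b \<in> Obj C; f \<in> Hom\<^sub>p C p a b\<rbrakk> \<Longrightarrow> \<Phi> f \<in> Hom\<^sub>p D p (F a) (F b)"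
    and hom: "\<lbrakk>a \<in> Obj C; b \<in> Obj C; f \<in> Hom C a b\<rbrakk> \<Longrightarrow> \<Phi> f \<in> Hom D (F a) (F b)"
    and add: "\<lbrakk>a \<in> Obj C; b \<in> Obj C; f \<in> Hom C a b; g \<in> Hom C a b\<rbrakk>
        \<Longrightarrow> \<Phi> (Add C f g) = Add D (\<Phi> f) (\<Phi> g)"
    and smul: "\<lbrakk>a \<in> Obj C; b \<in> Obj C; f \<in> Hom C a b\<rbrakk> \<Longrightarrow> \<Phi> (Smul C z f) = Smul D z (\<Phi> f)"
    and ident: "a \<in> Obj C \<Longrightarrow> \<Phi> (Ident C a) = Ident D (F a)"
    and comp: "\<lbrakk>a \<in> Obj C; b \<in> Obj C; c \<in> Obj C; f \<in> Hom C b c; g \<in> Hom C a b\<rbrakk>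
        \<Longrightarrow> \<Phi> (Cmp C f g) = Cmp D (\<Phi> f) (\<Phi> g)"
    and tens: "\<lbrakk>a \<in> Obj C; b \<in> Obj C; c \<in> Obj C; d \<in> Obj C; f \<in> Hom C a b; g \<in> Hom C c d\<rbrakk>
        \<Longrightarrow> \<Phi> (Tens C f g) = Tens D (\<Phi> f) (\<Phi> g)"

definition supercat_isomorphic ::
    "('o, 'm, 'k::field) supercat \<Rightarrow> ('p, 'n, 'k) supercat \<Rightarrow> bool" where
  "supercat_isomorphic C D \<longleftrightarrow>
     strict_monoidal_supercategory C \<and> strict_monoidal_supercategory D \<and>
     (\<exists>F \<Phi>. strict_monoidal_superfunctor C D F \<Phi> \<and> bij_betw F (Obj C) (Obj D) \<and>
       (\<forall>a \<in> Obj C. \<forall>b \<in> Obj C. bij_betw \<Phi> (Hom C a b) (Hom D (F a) (F b))))"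

section \<open>Presentations by generators and relations\<close>

subsection \<open>Strict monoidal supercategories with one generating object\<close>

text \<open>The object \<open>n :: nat\<close> is the \<open>n\<close>-th tensor power of the generating object.\<close>

record 'g signature =
  gens :: "'g set"
  gsrc :: "'g \<Rightarrow> nat"
  gtgt :: "'g \<Rightarrow> nat"
  gpar :: "'g \<Rightarrow> bit"

datatype ('g, 'k) tm =
    TId nat
  | TGen 'g
  | TZero nat nat
  | TComp "('g, 'k) tm" "('g, 'k) tm"  (infixl "\<cdot>" 70)
  | TTens "('g, 'k) tm" "('g, 'k) tm"  (infixl "\<star>" 75)
  | TAdd "('g, 'k) tm" "('g, 'k) tm"  (infixl "+\<^sub>t" 65)
  | TSmul 'k "('g, 'k) tm"  (infixr "*\<^sub>t" 68)

inductive wt :: "'g signature \<Rightarrow> nat \<Rightarrow> nat \<Rightarrow> ('g, 'k) tm \<Rightarrow> bool" for S where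
  wt_id: "wt S m m (TId m)"
| wt_gen: "g \<in> gens S \<Longrightarrow> wt S (gsrc S g) (gtgt S g) (TGen g)"
| wt_zero: "wt S m n (TZero m n)"
| wt_comp: "wt S l n f \<Longrightarrow> wt S m l g \<Longrightarrow> wt S m n (f \<cdot> g)"
| wt_tens: "wt S m n f \<Longrightarrow> wt S m' n' g \<Longrightarrow> wt S (m + m') (n + n') (f \<star> g)"
| wt_add: "wt S m n f \<Longrightarrow> wt S m n g \<Longrightarrow> wt S m n (f +\<^sub>t g)"
| wt_smul: "wt S m n f \<Longrightarrow> wt S m n (c *\<^sub>t f)"

text \<open>\<open>wtp S p m n f\<close>: the expression \<open>f\<close> is homogeneous of parity \<open>p\<close>.\<close>

inductive wtp :: "'g signature \<Rightarrow> bit \<Rightarrow> nat \<Rightarrow> nat \<Rightarrow> ('g, 'k) tm \<Rightarrow> bool" for S where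
  wtp_id: "wtp S 0 m m (TId m)"
| wtp_gen: "g \<in> gens S \<Longrightarrow> wtp S (gpar S g) (gsrc S g) (gtgt S g) (TGen g)"
| wtp_zero: "wtp S p m n (TZero m n)"
| wtp_comp: "wtp S p l n f \<Longrightarrow> wtp S r m l g \<Longrightarrow> wtp S (p + r) m n (f \<cdot> g)"
| wtp_tens: "wtp S p m n f \<Longrightarrow> wtp S r m' n' g \<Longrightarrow> wtp S (p + r) (m + m') (n + n') (f \<star> g)"
| wtp_add: "wtp S p m n f \<Longrightarrow> wtp S p m n g \<Longrightarrow> wtp S p m n (f +\<^sub>t g)"
| wtp_smul: "wtp S p m n f \<Longrightarrow> wtp S p m n (c *\<^sub>t f)"

fun tm_type :: "'g signature \<Rightarrow> ('g, 'k) tm \<Rightarrow> (bit \<times> nat \<times> nat) option" where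
  "tm_type S (TId m) = Some (0, m, m)"
| "tm_type S (TGen x) = (if x \<in> gens S then Some (gpar S x, gsrc S x, gtgt S x) else None)"
| "tm_type S (TZero m n) = Some (0, m, n)"
| "tm_type S (f \<cdot> g) = (case (tm_type S f, tm_type S g) of (Some (p, l, n), Some (r, m, l')) \<Rightarrow>
     if l = l' then Some (p + r, m, n) else None | _ \<Rightarrow> None)"
| "tm_type S (f \<star> g) = (case (tm_type S f, tm_type S g) of (Some (p, m, n), Some (r, m', n')) \<Rightarrow>
     Some (p + r, m + m', n + n') | _ \<Rightarrow> None)"
| "tm_type S (f +\<^sub>t g) = (case (tm_type S f, tm_type S g) of (Some (p, m, n), Some (r, m', n')) \<Rightarrow>
     if p = r \<and> m = m' \<and> n = n' then Some (p, m, n) else None | _ \<Rightarrow> None)"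
| "tm_type S (c *\<^sub>t f) = tm_type S f"

lemma tm_type_wtp: "tm_type S f = Some (p, m, n) \<Longrightarrow> wtp S p m n f"
proof (induction f arbitrary: p m n)
  case (TComp f g)
  then obtain p1 l r where "tm_type S f = Some (p1, l, n)" "tm_type S g = Some (r, m, l)" "p = p1 + r"
    by (auto split: option.splits if_splits simp del: add_bit_eq_xor)
  with TComp show ?case by (blast intro: wtp_comp)
next
  case (TTens f g)
  then obtain p1 r m1 n1 m2 n2 where "tm_type S f = Some (p1, m1, n1)" "tm_type S g = Some (r, m2, n2)"
    "p = p1 + r" "m = m1 + m2" "n = n1 + n2"
    by (auto split: option.splits if_splits simp del: add_bit_eq_xor)
  with TTens show ?case by (blast intro: wtp_tens)
qed (auto intro!: wtp_add intro: wtp.intros split: option.splits if_splits)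

text \<open>The congruence on expressions generated by the axioms of a strict monoidal
  supercategory and the relations \<open>R\<close>. The typing premises of \<open>eqv_rel\<close> discard nothing in the
  presentations below: see the lemmas \<open>C_rel_homogeneous\<close>, \<open>B_rel_homogeneous\<close> and
  \<open>periplectic_Brauer_rel_homogeneous\<close>.\<close>

inductive eqv :: "'g signature \<Rightarrow> (('g, 'k::field) tm \<Rightarrow> ('g, 'k) tm \<Rightarrow> bool) \<Rightarrow>
    ('g, 'k) tm \<Rightarrow> ('g, 'k) tm \<Rightarrow> bool" for S R where
  eqv_rel: "R f g \<Longrightarrow> wt S m n f \<Longrightarrow> wt S m n g \<Longrightarrow> eqv S R f g"
| eqv_refl: "wt S m n f \<Longrightarrow> eqv S R f f"
| eqv_sym: "eqv S R f g \<Longrightarrow> eqv S R g f"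
| eqv_trans: "eqv S R f g \<Longrightarrow> eqv S R g h \<Longrightarrow> eqv S R f h"
| eqv_cong_comp: "eqv S R f f' \<Longrightarrow> eqv S R g g' \<Longrightarrow> wt S l n f \<Longrightarrow> wt S m l g
    \<Longrightarrow> eqv S R (f \<cdot> g) (f' \<cdot> g')"
| eqv_cong_tens: "eqv S R f f' \<Longrightarrow> eqv S R g g' \<Longrightarrow> eqv S R (f \<star> g) (f' \<star> g')"
| eqv_cong_add: "eqv S R f f' \<Longrightarrow> eqv S R g g' \<Longrightarrow> wt S m n f \<Longrightarrow> wt S m n g
    \<Longrightarrow> eqv S R (f +\<^sub>t g) (f' +\<^sub>t g')"
| eqv_cong_smul: "eqv S R f f' \<Longrightarrow> eqv S R (c *\<^sub>t f) (c *\<^sub>t f')"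
| eqv_add_assoc: "wt S m n f \<Longrightarrow> wt S m n g \<Longrightarrow> wt S m n h
    \<Longrightarrow> eqv S R (f +\<^sub>t g +\<^sub>t h) (f +\<^sub>t (g +\<^sub>t h))"
| eqv_add_commute: "wt S m n f \<Longrightarrow> wt S m n g \<Longrightarrow> eqv S R (f +\<^sub>t g) (g +\<^sub>t f)"
| eqv_add_zero: "wt S m n f \<Longrightarrow> eqv S R (f +\<^sub>t TZero m n) f"
| eqv_add_inverse: "wt S m n f \<Longrightarrow> eqv S R (f +\<^sub>t (- 1) *\<^sub>t f) (TZero m n)"
| eqv_smul_add: "wt S m n f \<Longrightarrow> wt S m n g \<Longrightarrow> eqv S R (c *\<^sub>t (f +\<^sub>t g)) (c *\<^sub>t f +\<^sub>t c *\<^sub>t g)"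
| eqv_add_smul: "wt S m n f \<Longrightarrow> eqv S R ((c + d) *\<^sub>t f) (c *\<^sub>t f +\<^sub>t d *\<^sub>t f)"
| eqv_smul_smul: "wt S m n f \<Longrightarrow> eqv S R (c *\<^sub>t d *\<^sub>t f) ((c * d) *\<^sub>t f)"
| eqv_smul_one: "wt S m n f \<Longrightarrow> eqv S R (1 *\<^sub>t f) f"
| eqv_comp_assoc: "wt S k n f \<Longrightarrow> wt S l k g \<Longrightarrow> wt S m l h
    \<Longrightarrow> eqv S R (f \<cdot> g \<cdot> h) (f \<cdot> (g \<cdot> h))"
| eqv_comp_id_left: "wt S m n f \<Longrightarrow> eqv S R (TId n \<cdot> f) f"
| eqv_comp_id_right: "wt S m n f \<Longrightarrow> eqv S R (f \<cdot> TId m) f"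
| eqv_comp_add_left: "wt S l n f \<Longrightarrow> wt S l n f' \<Longrightarrow> wt S m l g
    \<Longrightarrow> eqv S R ((f +\<^sub>t f') \<cdot> g) (f \<cdot> g +\<^sub>t f' \<cdot> g)"
| eqv_comp_add_right: "wt S l n f \<Longrightarrow> wt S m l g \<Longrightarrow> wt S m l g'
    \<Longrightarrow> eqv S R (f \<cdot> (g +\<^sub>t g')) (f \<cdot> g +\<^sub>t f \<cdot> g')"
| eqv_comp_smul_left: "wt S l n f \<Longrightarrow> wt S m l g \<Longrightarrow> eqv S R ((c *\<^sub>t f) \<cdot> g) (c *\<^sub>t (f \<cdot> g))"
| eqv_comp_smul_right: "wt S l n f \<Longrightarrow> wt S m l g \<Longrightarrow> eqv S R (f \<cdot> (c *\<^sub>t g)) (c *\<^sub>t (f \<cdot> g))"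
| eqv_tens_assoc: "wt S m n f \<Longrightarrow> wt S m' n' g \<Longrightarrow> wt S m'' n'' h
    \<Longrightarrow> eqv S R (f \<star> g \<star> h) (f \<star> (g \<star> h))"
| eqv_tens_unit_left: "wt S m n f \<Longrightarrow> eqv S R (TId 0 \<star> f) f"
| eqv_tens_unit_right: "wt S m n f \<Longrightarrow> eqv S R (f \<star> TId 0) f"
| eqv_tens_id: "eqv S R (TId m \<star> TId n) (TId (m + n))"
| eqv_tens_add_left: "wt S m n f \<Longrightarrow> wt S m n f' \<Longrightarrow> wt S m' n' g
    \<Longrightarrow> eqv S R ((f +\<^sub>t f') \<star> g) (f \<star> g +\<^sub>t f' \<star> g)"
| eqv_tens_add_right: "wt S m n f \<Longrightarrow> wt S m' n' g \<Longrightarrow> wt S m' n' g'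
    \<Longrightarrow> eqv S R (f \<star> (g +\<^sub>t g')) (f \<star> g +\<^sub>t f \<star> g')"
| eqv_tens_smul_left: "wt S m n f \<Longrightarrow> wt S m' n' g \<Longrightarrow> eqv S R ((c *\<^sub>t f) \<star> g) (c *\<^sub>t (f \<star> g))"
| eqv_tens_smul_right: "wt S m n f \<Longrightarrow> wt S m' n' g \<Longrightarrow> eqv S R (f \<star> (c *\<^sub>t g)) (c *\<^sub>t (f \<star> g))"
| eqv_interchange: "wtp S p l n f \<Longrightarrow> wtp S r l' n' g \<Longrightarrow> wtp S s m l h \<Longrightarrow> wtp S t m' l' k
    \<Longrightarrow> eqv S R ((f \<star> g) \<cdot> (h \<star> k)) (koszul_sign r s *\<^sub>t ((f \<cdot> h) \<star> (g \<cdot> k)))"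

definition eqv_class ::
    "'g signature \<Rightarrow> (('g, 'k::field) tm \<Rightarrow> ('g, 'k) tm \<Rightarrow> bool) \<Rightarrow> ('g, 'k) tm \<Rightarrow> ('g, 'k) tm set" where
  "eqv_class S R f = {f'. eqv S R f f'}"

definition presented_supercat ::
    "'g signature \<Rightarrow> (('g, 'k::field) tm \<Rightarrow> ('g, 'k) tm \<Rightarrow> bool) \<Rightarrow> (nat, ('g, 'k) tm set, 'k) supercat" where
  "presented_supercat S R =
    \<lparr>Obj = UNIV,
     Hom = (\<lambda>m n. eqv_class S R ` {f. wt S m n f}),
     Hom\<^sub>p = (\<lambda>p m n. eqv_class S R ` {f. wtp S p m n f}),
     Zero = (\<lambda>m n. eqv_class S R (TZero m n)),
     Add = (\<lambda>X Y. \<Union>f\<in>X. \<Union>g\<in>Y. eqv_class S R (f +\<^sub>t g)),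
     Smul = (\<lambda>c X. \<Union>f\<in>X. eqv_class S R (c *\<^sub>t f)),
     Ident = (\<lambda>m. eqv_class S R (TId m)),
     Cmp = (\<lambda>X Y. \<Union>f\<in>X. \<Union>g\<in>Y. eqv_class S R (f \<cdot> g)),
     UnitO = 0,
     TensO = (+),
     Tens = (\<lambda>X Y. \<Union>f\<in>X. \<Union>g\<in>Y. eqv_class S R (f \<star> g))\<rparr>"

subsection \<open>Unital associative algebras\<close>

datatype ('g, 'k) atm =
    AOne
  | AGen 'g
  | AZero
  | AMul "('g, 'k) atm" "('g, 'k) atm"  (infixl "*\<^sub>a" 70)
  | AAdd "('g, 'k) atm" "('g, 'k) atm"  (infixl "+\<^sub>a" 65)
  | ASmul 'k "('g, 'k) atm"  (infixr "\<cdot>\<^sub>a" 68)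

definition atms :: "'g set \<Rightarrow> ('g, 'k) atm set" where
  "atms G = {x. set1_atm x \<subseteq> G}"

text \<open>The congruence on expressions in the generators \<open>G\<close> generated by the axioms of a unital
  associative algebra and the relations \<open>R\<close>.\<close>

inductive aeqv :: "'g set \<Rightarrow> (('g, 'k::field) atm \<Rightarrow> ('g, 'k) atm \<Rightarrow> bool) \<Rightarrow>
    ('g, 'k) atm \<Rightarrow> ('g, 'k) atm \<Rightarrow> bool" for G R where
  aeqv_rel: "R x y \<Longrightarrow> x \<in> atms G \<Longrightarrow> y \<in> atms G \<Longrightarrow> aeqv G R x y"
| aeqv_refl: "x \<in> atms G \<Longrightarrow> aeqv G R x x"
| aeqv_sym: "aeqv G R x y \<Longrightarrow> aeqv G R y x"
| aeqv_trans: "aeqv G R x y \<Longrightarrow> aeqv G R y z \<Longrightarrow> aeqv G R x z"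
| acong_mul: "aeqv G R x x' \<Longrightarrow> aeqv G R y y' \<Longrightarrow> aeqv G R (x *\<^sub>a y) (x' *\<^sub>a y')"
| acong_add: "aeqv G R x x' \<Longrightarrow> aeqv G R y y' \<Longrightarrow> aeqv G R (x +\<^sub>a y) (x' +\<^sub>a y')"
| acong_smul: "aeqv G R x x' \<Longrightarrow> aeqv G R (c \<cdot>\<^sub>a x) (c \<cdot>\<^sub>a x')"
| aadd_assoc: "x \<in> atms G \<Longrightarrow> y \<in> atms G \<Longrightarrow> z \<in> atms G
    \<Longrightarrow> aeqv G R (x +\<^sub>a y +\<^sub>a z) (x +\<^sub>a (y +\<^sub>a z))"
| aadd_commute: "x \<in> atms G \<Longrightarrow> y \<in> atms G \<Longrightarrow> aeqv G R (x +\<^sub>a y) (y +\<^sub>a x)"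
| aadd_zero: "x \<in> atms G \<Longrightarrow> aeqv G R (x +\<^sub>a AZero) x"
| aadd_inverse: "x \<in> atms G \<Longrightarrow> aeqv G R (x +\<^sub>a (- 1) \<cdot>\<^sub>a x) AZero"
| asmul_add: "x \<in> atms G \<Longrightarrow> y \<in> atms G \<Longrightarrow> aeqv G R (c \<cdot>\<^sub>a (x +\<^sub>a y)) (c \<cdot>\<^sub>a x +\<^sub>a c \<cdot>\<^sub>a y)"
| aadd_smul: "x \<in> atms G \<Longrightarrow> aeqv G R ((c + d) \<cdot>\<^sub>a x) (c \<cdot>\<^sub>a x +\<^sub>a d \<cdot>\<^sub>a x)"
| asmul_smul: "x \<in> atms G \<Longrightarrow> aeqv G R (c \<cdot>\<^sub>a d \<cdot>\<^sub>a x) ((c * d) \<cdot>\<^sub>a x)"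
| asmul_one: "x \<in> atms G \<Longrightarrow> aeqv G R (1 \<cdot>\<^sub>a x) x"
| amul_assoc: "x \<in> atms G \<Longrightarrow> y \<in> atms G \<Longrightarrow> z \<in> atms G
    \<Longrightarrow> aeqv G R (x *\<^sub>a y *\<^sub>a z) (x *\<^sub>a (y *\<^sub>a z))"
| amul_one_left: "x \<in> atms G \<Longrightarrow> aeqv G R (AOne *\<^sub>a x) x"
| amul_one_right: "x \<in> atms G \<Longrightarrow> aeqv G R (x *\<^sub>a AOne) x"
| amul_add_left: "x \<in> atms G \<Longrightarrow> y \<in> atms G \<Longrightarrow> z \<in> atms G
    \<Longrightarrow> aeqv G R ((x +\<^sub>a y) *\<^sub>a z) (x *\<^sub>a z +\<^sub>a y *\<^sub>a z)"
| amul_add_right: "x \<in> atms G \<Longrightarrow> y \<in> atms G \<Longrightarrow> z \<in> atms G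
    \<Longrightarrow> aeqv G R (x *\<^sub>a (y +\<^sub>a z)) (x *\<^sub>a y +\<^sub>a x *\<^sub>a z)"
| amul_smul_left: "x \<in> atms G \<Longrightarrow> y \<in> atms G \<Longrightarrow> aeqv G R ((c \<cdot>\<^sub>a x) *\<^sub>a y) (c \<cdot>\<^sub>a (x *\<^sub>a y))"
| amul_smul_right: "x \<in> atms G \<Longrightarrow> y \<in> atms G \<Longrightarrow> aeqv G R (x *\<^sub>a (c \<cdot>\<^sub>a y)) (c \<cdot>\<^sub>a (x *\<^sub>a y))"

definition aeqv_class ::
    "'g set \<Rightarrow> (('g, 'k::field) atm \<Rightarrow> ('g, 'k) atm \<Rightarrow> bool) \<Rightarrow> ('g, 'k) atm \<Rightarrow> ('g, 'k) atm set" where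
  "aeqv_class G R x = {x'. aeqv G R x x'}"

definition presented_algebra ::
    "'g set \<Rightarrow> (('g, 'k::field) atm \<Rightarrow> ('g, 'k) atm \<Rightarrow> bool) \<Rightarrow> ('k, ('g, 'k) atm set) module" where
  "presented_algebra G R =
    \<lparr>carrier = aeqv_class G R ` atms G,
     monoid.mult = (\<lambda>X Y. \<Union>x\<in>X. \<Union>y\<in>Y. aeqv_class G R (x *\<^sub>a y)),
     one = aeqv_class G R AOne,
     zero = aeqv_class G R AZero,
     add = (\<lambda>X Y. \<Union>x\<in>X. \<Union>y\<in>Y. aeqv_class G R (x +\<^sub>a y)),
     module.smult = (\<lambda>c X. \<Union>x\<in>X. aeqv_class G R (c \<cdot>\<^sub>a x))\<rparr>"

section \<open>The categories and algebras\<close>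

datatype gen = GH | GH' | GA | GU

abbreviation (input) H :: "(gen, 'k) tm" where "H \<equiv> TGen GH"
abbreviation (input) H' :: "(gen, 'k) tm" where "H' \<equiv> TGen GH'"
abbreviation (input) A :: "(gen, 'k) tm" where "A \<equiv> TGen GA"
abbreviation (input) U :: "(gen, 'k) tm" where "U \<equiv> TGen GU"
abbreviation (input) I :: "(gen, 'k) tm" where "I \<equiv> TId 1"

definition sig :: "gen set \<Rightarrow> gen signature" where
  "sig G = \<lparr>gens = G,
     gsrc = (\<lambda>g. case g of GH \<Rightarrow> 2 | GH' \<Rightarrow> 2 | GA \<Rightarrow> 2 | GU \<Rightarrow> 0),
     gtgt = (\<lambda>g. case g of GH \<Rightarrow> 2 | GH' \<Rightarrow> 2 | GA \<Rightarrow> 0 | GU \<Rightarrow> 2),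
     gpar = (\<lambda>g. case g of GH \<Rightarrow> 0 | GH' \<Rightarrow> 0 | GA \<Rightarrow> 1 | GU \<Rightarrow> 1)\<rparr>"

text \<open>Here \<open>H'\<close> is the inverse of \<open>H\<close>, adjoined as a generator to express that \<open>H\<close> is invertible.\<close>

inductive C_rel :: "'f::field \<Rightarrow> (gen, 'f) tm \<Rightarrow> (gen, 'f) tm \<Rightarrow> bool" for q :: 'f where
  "C_rel q (H \<cdot> H') (TId 2)"
| "C_rel q (H' \<cdot> H) (TId 2)"
| "C_rel q (H \<cdot> U) (q *\<^sub>t U)"
| "C_rel q (A \<cdot> H) (- inverse q *\<^sub>t A)"
| "C_rel q (A \<cdot> U) (TZero 0 0)"
| "C_rel q ((A \<star> I) \<cdot> (I \<star> U)) I"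
| "C_rel q ((I \<star> A) \<cdot> (U \<star> I)) (- 1 *\<^sub>t I)"
| "C_rel q ((A \<star> I) \<cdot> (I \<star> H) \<cdot> (U \<star> I)) (- q *\<^sub>t I)"
| "C_rel q (H \<cdot> H) (TId 2 +\<^sub>t (q - inverse q) *\<^sub>t H)"
| "C_rel q ((H \<star> I) \<cdot> (I \<star> U))
     ((I \<star> H) \<cdot> (U \<star> I) +\<^sub>t (q - inverse q) *\<^sub>t (I \<star> U))"
| "C_rel q ((H \<star> I) \<cdot> (I \<star> H) \<cdot> (U \<star> I)) (I \<star> U)"
| "C_rel q ((I \<star> A) \<cdot> (H \<star> I))
     (- (q - inverse q) *\<^sub>t (A \<star> I) +\<^sub>t (A \<star> I) \<cdot> (I \<star> H))"
| "C_rel q ((A \<star> I) \<cdot> (I \<star> H) \<cdot> (H \<star> I))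
     ((1 - q\<^sup>2) *\<^sub>t (A \<star> I) +\<^sub>t (q - inverse q) *\<^sub>t ((A \<star> I) \<cdot> (I \<star> H)) +\<^sub>t I \<star> A)"
| "C_rel q ((H \<star> I) \<cdot> (I \<star> H) \<cdot> (H \<star> I)) ((I \<star> H) \<cdot> (H \<star> I) \<cdot> (I \<star> H))"

lemma C_rel_homogeneous: "C_rel q f g \<Longrightarrow> \<exists>p m n. wtp (sig UNIV) p m n f \<and> wtp (sig UNIV) p m n g"
proof -
  assume "C_rel q f g"
  then have "tm_type (sig UNIV) f = tm_type (sig UNIV) g \<and> tm_type (sig UNIV) f \<noteq> None"
    by (induction rule: C_rel.induct) (simp_all add: sig_def)
  then show ?thesis using tm_type_wtp by (metis option.exhaust_sel prod.exhaust_sel)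
qed

definition cat_C :: "'f::field \<Rightarrow> (nat, (gen, 'f) tm set, 'f) supercat" where
  "cat_C q = presented_supercat (sig UNIV) (C_rel q)"

text \<open>Here \<open>H'\<close> is the generator written as \<open>H\<close> with a bar.\<close>

inductive B_rel :: "'f::field \<Rightarrow> (gen, 'f) tm \<Rightarrow> (gen, 'f) tm \<Rightarrow> bool" for q :: 'f where
  "B_rel q (H \<cdot> H') (TId 2)"
| "B_rel q (H' \<cdot> H) (TId 2)"
| "B_rel q ((H \<star> I) \<cdot> (I \<star> H) \<cdot> (H \<star> I)) ((I \<star> H) \<cdot> (H \<star> I) \<cdot> (I \<star> H))"
| "B_rel q (H +\<^sub>t - 1 *\<^sub>t H') ((q - inverse q) *\<^sub>t TId 2)"
| "B_rel q ((A \<star> I) \<cdot> (I \<star> U)) I"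
| "B_rel q ((I \<star> A) \<cdot> (U \<star> I)) (- 1 *\<^sub>t I)"
| "B_rel q (H \<cdot> U) (q *\<^sub>t U)"
| "B_rel q ((I \<star> H) \<cdot> (U \<star> I)) ((H' \<star> I) \<cdot> (I \<star> U))"
| "B_rel q (A \<cdot> U) (TZero 0 0)"

lemma B_rel_homogeneous: "B_rel q f g \<Longrightarrow> \<exists>p m n. wtp (sig UNIV) p m n f \<and> wtp (sig UNIV) p m n g"
proof -
  assume "B_rel q f g"
  then have "tm_type (sig UNIV) f = tm_type (sig UNIV) g \<and> tm_type (sig UNIV) f \<noteq> None"
    by (induction rule: B_rel.induct) (simp_all add: sig_def)
  then show ?thesis using tm_type_wtp by (metis option.exhaust_sel prod.exhaust_sel)
qed

definition cat_B :: "'f::field \<Rightarrow> (nat, (gen, 'f) tm set, 'f) supercat" where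
  "cat_B q = presented_supercat (sig UNIV) (B_rel q)"

inductive periplectic_Brauer_rel :: "(gen, 'k::field) tm \<Rightarrow> (gen, 'k) tm \<Rightarrow> bool" where
  "periplectic_Brauer_rel (H \<cdot> H) (TId 2)"
| "periplectic_Brauer_rel ((H \<star> I) \<cdot> (I \<star> H) \<cdot> (H \<star> I)) ((I \<star> H) \<cdot> (H \<star> I) \<cdot> (I \<star> H))"
| "periplectic_Brauer_rel ((A \<star> I) \<cdot> (I \<star> U)) I"
| "periplectic_Brauer_rel ((I \<star> A) \<cdot> (U \<star> I)) (- 1 *\<^sub>t I)"
| "periplectic_Brauer_rel ((I \<star> H) \<cdot> (U \<star> I)) ((H \<star> I) \<cdot> (I \<star> U))"
| "periplectic_Brauer_rel (H \<cdot> U) U"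

lemma periplectic_Brauer_rel_homogeneous: "periplectic_Brauer_rel f g \<Longrightarrow>
  \<exists>p m n. wtp (sig {GH, GA, GU}) p m n f \<and> wtp (sig {GH, GA, GU}) p m n g"
proof -
  assume "periplectic_Brauer_rel f g"
  then have "tm_type (sig {GH, GA, GU}) f = tm_type (sig {GH, GA, GU}) g \<and>
      tm_type (sig {GH, GA, GU}) f \<noteq> None"
    by (induction rule: periplectic_Brauer_rel.induct) (simp_all add: sig_def)
  then show ?thesis using tm_type_wtp by (metis option.exhaust_sel prod.exhaust_sel)
qed

definition periplectic_Brauer_cat :: "(nat, (gen, 'k::field) tm set, 'k) supercat" where
  "periplectic_Brauer_cat = presented_supercat (sig {GH, GA, GU}) periplectic_Brauer_rel"

datatype agen = Gg nat | Ge nat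

abbreviation (input) g :: "nat \<Rightarrow> (agen, 'f) atm" where "g i \<equiv> AGen (Gg i)"
abbreviation (input) e :: "nat \<Rightarrow> (agen, 'f) atm" where "e i \<equiv> AGen (Ge i)"

text \<open>The relations are stated for all indices; \<open>presented_algebra\<close> uses exactly those instances
  in which only generators of the algebra occur.\<close>

inductive A_rel :: "'f::field \<Rightarrow> (agen, 'f) atm \<Rightarrow> (agen, 'f) atm \<Rightarrow> bool" for q :: 'f where
  "A_rel q ((g i +\<^sub>a - q \<cdot>\<^sub>a AOne) *\<^sub>a (g i +\<^sub>a inverse q \<cdot>\<^sub>a AOne)) AZero"
| "A_rel q (e i *\<^sub>a e i) AZero"
| "A_rel q (e i *\<^sub>a g i) (- inverse q \<cdot>\<^sub>a e i)"
| "A_rel q (g i *\<^sub>a e i) (q \<cdot>\<^sub>a e i)"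
| "\<bar>int i - int j\<bar> \<ge> 2 \<Longrightarrow> A_rel q (g i *\<^sub>a g j) (g j *\<^sub>a g i)"
| "\<bar>int i - int j\<bar> \<ge> 2 \<Longrightarrow> A_rel q (g i *\<^sub>a e j) (e j *\<^sub>a g i)"
| "\<bar>int i - int j\<bar> \<ge> 2 \<Longrightarrow> A_rel q (e i *\<^sub>a e j) (e j *\<^sub>a e i)"
| "A_rel q (g i *\<^sub>a g (i + 1) *\<^sub>a g i) (g (i + 1) *\<^sub>a g i *\<^sub>a g (i + 1))"
| "A_rel q (e (i + 1) *\<^sub>a e i *\<^sub>a e (i + 1)) (- 1 \<cdot>\<^sub>a e (i + 1))"
| "A_rel q (e i *\<^sub>a e (i + 1) *\<^sub>a e i) (- 1 \<cdot>\<^sub>a e i)"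
| "A_rel q (g i *\<^sub>a e (i + 1) *\<^sub>a e i)
     (- 1 \<cdot>\<^sub>a (g (i + 1) *\<^sub>a e i) +\<^sub>a (q - inverse q) \<cdot>\<^sub>a (e (i + 1) *\<^sub>a e i))"
| "A_rel q (e (i + 1) *\<^sub>a e i *\<^sub>a g (i + 1))
     (- 1 \<cdot>\<^sub>a (e (i + 1) *\<^sub>a g i) +\<^sub>a (q - inverse q) \<cdot>\<^sub>a (e (i + 1) *\<^sub>a e i))"

definition periplectic_q_Brauer_algebra ::
    "'f::field \<Rightarrow> nat \<Rightarrow> ('f, (agen, 'f) atm set) module" where
  "periplectic_q_Brauer_algebra q n =
     presented_algebra {x. \<exists>i. 1 \<le> i \<and> i + 1 \<le> n \<and> (x = Gg i \<or> x = Ge i)} (A_rel q)"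

definition qvar :: "'k::field poly fract" where
  "qvar = Fraction_Field.Fract [:0, 1:] 1"

hide_const (open) H H' A U I g e

end

theory Submission imports Defs begin

text \<open>
  Bending a strand with the zigzag relations shows that the cap slides through a crossing just as the
  cup does; together with the skein relation this turns the relations of \<open>B\<close> into those of \<open>C\<close> and back,
  so both presentations generate the same congruence. At \<open>q = 1\<close> the two crossings coincide, and
  \<open>AU = 0\<close> follows from \<open>AU = AHU = - AU\<close> as 2 is invertible.

  The algebra maps to the endomorphisms by sending \<open>e\<close> to the cup after the cap. This is onto because a cap
  composed with a Hecke element and a cup reduces to Hecke elements and smaller cup-caps. The algebra is
  spanned by \<open>(2 n - 1)!!\<close> elements (a filtration by Hecke cosets), while as many endomorphisms,
  indexed by matchings of the \<open>2 n\<close> end points, are independent: their matrices in the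
  representation on tensor powers of an \<open>(N|N)\<close>-dimensional superspace are triangular for \<open>N = n\<close>.
  Hence the map is injective.
\<close>

section \<open>A spanning set of the algebra\<close>

fun odd_fact :: "nat \<Rightarrow> nat" where
  "odd_fact 0 = 1"
| "odd_fact (Suc r) = (2 * r + 1) * odd_fact r"

locale q_Brauer_elements = vector_space scale
  for scale :: "'f::field \<Rightarrow> 'a::ring_1 \<Rightarrow> 'a" (infixr "*s" 75) +
  fixes q :: 'f and n :: nat and g e :: "nat \<Rightarrow> 'a"
  assumes q_nonzero: "q \<noteq> 0"
    and scale_mult_left: "(c *s x) * y = c *s (x * y)"
    and scale_mult_right: "x * (c *s y) = c *s (x * y)"
    and g_square: "1 \<le> i \<Longrightarrow> i < n \<Longrightarrow> g i * g i = 1 + (q - inverse q) *s g i"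
    and e_square: "1 \<le> i \<Longrightarrow> i < n \<Longrightarrow> e i * e i = 0"
    and e_g: "1 \<le> i \<Longrightarrow> i < n \<Longrightarrow> e i * g i = (- inverse q) *s e i"
    and g_e: "1 \<le> i \<Longrightarrow> i < n \<Longrightarrow> g i * e i = q *s e i"
    and g_g_far: "1 \<le> i \<Longrightarrow> i + 2 \<le> j \<Longrightarrow> j < n \<Longrightarrow> g j * g i = g i * g j"
    and g_e_far: "1 \<le> i \<Longrightarrow> i + 2 \<le> j \<Longrightarrow> j < n \<Longrightarrow> g j * e i = e i * g j"
    and e_g_far: "1 \<le> i \<Longrightarrow> i + 2 \<le> j \<Longrightarrow> j < n \<Longrightarrow> e j * g i = g i * e j"
    and e_e_far: "1 \<le> i \<Longrightarrow> i + 2 \<le> j \<Longrightarrow> j < n \<Longrightarrow> e j * e i = e i * e j"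
    and g_braid: "1 \<le> i \<Longrightarrow> Suc i < n \<Longrightarrow> g i * g (Suc i) * g i = g (Suc i) * g i * g (Suc i)"
    and e_e_e_up: "1 \<le> i \<Longrightarrow> Suc i < n \<Longrightarrow> e (Suc i) * e i * e (Suc i) = - e (Suc i)"
    and e_e_e_down: "1 \<le> i \<Longrightarrow> Suc i < n \<Longrightarrow> e i * e (Suc i) * e i = - e i"
    and g_e_e: "1 \<le> i \<Longrightarrow> Suc i < n \<Longrightarrow>
      g i * e (Suc i) * e i = - (g (Suc i) * e i) + (q - inverse q) *s (e (Suc i) * e i)"
    and e_e_g: "1 \<le> i \<Longrightarrow> Suc i < n \<Longrightarrow>
      e (Suc i) * e i * g (Suc i) = - (e (Suc i) * g i) + (q - inverse q) *s (e (Suc i) * e i)"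
begin

abbreviation z :: 'f where "z \<equiv> q - inverse q"

definition gb :: "nat \<Rightarrow> 'a" where "gb i = g i - z *s 1"

lemma scale_one_mult: "(c *s 1) * x = c *s x" "x * (c *s 1) = c *s x"
  by (simp_all add: scale_mult_left scale_mult_right)

lemma g_gb: "1 \<le> i \<Longrightarrow> i < n \<Longrightarrow> g i * gb i = 1"
  and gb_g: "1 \<le> i \<Longrightarrow> i < n \<Longrightarrow> gb i * g i = 1"
  by (simp_all add: gb_def right_diff_distrib left_diff_distrib g_square scale_one_mult)

lemma gb_g_cancel: "1 \<le> i \<Longrightarrow> i < n \<Longrightarrow> gb i * (g i * x) = x"
  and g_gb_cancel: "1 \<le> i \<Longrightarrow> i < n \<Longrightarrow> g i * (gb i * x) = x"
  by (simp_all add: mult.assoc[symmetric] g_gb gb_g)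

lemma e_gb: "1 \<le> i \<Longrightarrow> i < n \<Longrightarrow> e i * gb i = (- q) *s e i"
  and gb_e: "1 \<le> i \<Longrightarrow> i < n \<Longrightarrow> gb i * e i = inverse q *s e i"
  by (simp_all add: gb_def right_diff_distrib left_diff_distrib e_g g_e scale_one_mult
      scale_left_diff_distrib)

lemma e_up_e: "e (Suc i) * e i = - (g i * g (Suc i) * e i)" if "1 \<le> i" "Suc i < n"
proof -
  have "gb i * (e (Suc i) * e i) = - (g (Suc i) * e i)"
    using g_e_e[OF that] by (simp add: gb_def left_diff_distrib scale_one_mult mult.assoc)
  then have "g i * (gb i * (e (Suc i) * e i)) = g i * - (g (Suc i) * e i)" by simp
  with that show ?thesis by (simp add: g_gb_cancel mult.assoc)
qed

lemma e_up_e': "e (Suc i) * e i = - (e (Suc i) * g i * g (Suc i))" if "1 \<le> i" "Suc i < n"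
proof -
  have "(e (Suc i) * e i) * gb (Suc i) = - (e (Suc i) * g i)"
    using e_e_g[OF that] by (simp add: gb_def right_diff_distrib scale_one_mult)
  then have "e (Suc i) * e i * gb (Suc i) * g (Suc i) = - (e (Suc i) * g i) * g (Suc i)" by simp
  with that show ?thesis by (simp add: gb_g mult.assoc)
qed

lemma e_down_e: "e i * e (Suc i) = e i * gb (Suc i) * gb i" if "1 \<le> i" "Suc i < n"
proof -
  have "e i = e i * e (Suc i) * g i * g (Suc i)"
    using e_e_e_down[OF that] e_up_e'[OF that] by (simp add: mult.assoc)
  then have "e i * gb (Suc i) * gb i = e i * e (Suc i) * g i * g (Suc i) * gb (Suc i) * gb i"
    by simp
  with that show ?thesis by (simp add: mult.assoc g_gb_cancel g_gb)
qed

lemma e_Suc_conj: "e (Suc i) = g i * g (Suc i) * e i * gb (Suc i) * gb i" if "1 \<le> i" "Suc i < n"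
proof -
  have "e (Suc i) = - (e (Suc i) * e i * e (Suc i))" using e_e_e_up[OF that] by simp
  also have "\<dots> = g i * g (Suc i) * (e i * e (Suc i))"
    unfolding e_up_e[OF that] by (simp add: mult.assoc)
  finally show ?thesis unfolding e_down_e[OF that] by (simp add: mult.assoc)
qed

lemma e_conj: "e i = gb (Suc i) * gb i * e (Suc i) * g i * g (Suc i)" if "1 \<le> i" "Suc i < n"
  using that by (subst e_Suc_conj) (simp_all add: mult.assoc gb_g_cancel gb_g)

lemma e_g_e: "e (Suc i) * g i * e (Suc i) = inverse q *s e (Suc i)" if "1 \<le> i" "Suc i < n"
proof -
  have "e (Suc i) * g i = - (e (Suc i) * e i * gb (Suc i))"
    unfolding e_up_e'[OF that] using that by (simp add: mult.assoc g_gb)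
  then have "e (Suc i) * g i * e (Suc i) = - (e (Suc i) * e i * (gb (Suc i) * e (Suc i)))"
    by (simp add: mult.assoc)
  with that e_e_e_up[OF that] show ?thesis by (simp add: gb_e scale_mult_right)
qed

lemma g_g_e: "g (Suc i) * g i * e (Suc i)
    = e i * e (Suc i) + z *s (g i * e (Suc i)) + (z * inverse q) *s e (Suc i)"
  if "1 \<le> i" "Suc i < n"
proof -
  have "gb (Suc i) * gb i * e (Suc i) = e i * e (Suc i)"
    using that by (subst e_Suc_conj) (simp_all add: mult.assoc gb_g_cancel e_down_e)
  moreover have "g (Suc i) * g i * e (Suc i) = (gb (Suc i) + z *s 1) * (gb i + z *s 1) * e (Suc i)"
    by (simp add: gb_def)
  moreover have "gb (Suc i) * e (Suc i) = inverse q *s e (Suc i)" using gb_e that by simp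
  moreover have "gb i * e (Suc i) = g i * e (Suc i) - z *s e (Suc i)"
    by (simp add: gb_def left_diff_distrib scale_one_mult)
  ultimately show ?thesis
    by (simp add: distrib_left distrib_right scale_mult_left scale_mult_right mult.assoc
        scale_right_diff_distrib scale_right_distrib mult.commute)
qed

definition gs :: "nat \<Rightarrow> nat \<Rightarrow> 'a" where "gs j m = prod_list (map g [j..<m])"
definition gd :: "nat \<Rightarrow> nat \<Rightarrow> 'a" where "gd j m = prod_list (map g (rev [j..<m]))"

lemma gs_same [simp]: "gs j j = 1" and gd_same [simp]: "gd j j = 1"
  by (simp_all add: gs_def gd_def)

lemma gs_Suc: "j \<le> m \<Longrightarrow> gs j (Suc m) = gs j m * g m"
  and gd_Suc: "j \<le> m \<Longrightarrow> gd j (Suc m) = g m * gd j m"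
  by (simp_all add: gs_def gd_def)

lemma gs_Cons: "j < m \<Longrightarrow> gs j m = g j * gs (Suc j) m"
  and gd_Cons: "j < m \<Longrightarrow> gd j m = gd (Suc j) m * g j"
  by (simp_all add: gs_def gd_def upt_conv_Cons)

inductive_set Alg :: "nat \<Rightarrow> 'a set" for m where
  Alg_one: "1 \<in> Alg m"
| Alg_g: "1 \<le> i \<Longrightarrow> i < m \<Longrightarrow> g i \<in> Alg m"
| Alg_e: "1 \<le> i \<Longrightarrow> i < m \<Longrightarrow> e i \<in> Alg m"
| Alg_mult: "x \<in> Alg m \<Longrightarrow> y \<in> Alg m \<Longrightarrow> x * y \<in> Alg m"
| Alg_add: "x \<in> Alg m \<Longrightarrow> y \<in> Alg m \<Longrightarrow> x + y \<in> Alg m"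
| Alg_scale: "x \<in> Alg m \<Longrightarrow> c *s x \<in> Alg m"

inductive_set Hecke :: "nat \<Rightarrow> nat \<Rightarrow> 'a set" for l m where
  Hecke_one: "1 \<in> Hecke l m"
| Hecke_g: "l \<le> i \<Longrightarrow> i < m \<Longrightarrow> g i \<in> Hecke l m"
| Hecke_mult: "x \<in> Hecke l m \<Longrightarrow> y \<in> Hecke l m \<Longrightarrow> x * y \<in> Hecke l m"
| Hecke_add: "x \<in> Hecke l m \<Longrightarrow> y \<in> Hecke l m \<Longrightarrow> x + y \<in> Hecke l m"
| Hecke_scale: "x \<in> Hecke l m \<Longrightarrow> c *s x \<in> Hecke l m"

lemma Hecke_subset_Alg: "1 \<le> l \<Longrightarrow> x \<in> Hecke l m \<Longrightarrow> x \<in> Alg m"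
  by (rotate_tac, induction rule: Hecke.induct) (auto intro: Alg.intros)

lemma Alg_mono: "x \<in> Alg m \<Longrightarrow> m \<le> m' \<Longrightarrow> x \<in> Alg m'"
  by (induction rule: Alg.induct) (auto intro: Alg.intros)

lemma Hecke_mono: "x \<in> Hecke l m \<Longrightarrow> l' \<le> l \<Longrightarrow> m \<le> m' \<Longrightarrow> x \<in> Hecke l' m'"
  by (induction rule: Hecke.induct) (auto intro: Hecke.intros)

lemma Hecke_gb: "l \<le> i \<Longrightarrow> i < m \<Longrightarrow> gb i \<in> Hecke l m"
  using Hecke_add[OF Hecke_g Hecke_scale[OF Hecke_one, where c = "- z"]]
  unfolding gb_def by (metis diff_conv_add_uminus scale_minus_left)

lemma Hecke_gs: "l \<le> j \<Longrightarrow> k \<le> m \<Longrightarrow> gs j k \<in> Hecke l m"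
  and Hecke_gd: "l \<le> j \<Longrightarrow> k \<le> m \<Longrightarrow> gd j k \<in> Hecke l m"
proof -
  have "prod_list xs \<in> Hecke l m" if "set xs \<subseteq> g ` {l..<m}" for xs
    using that by (induction xs) (auto intro!: Hecke.intros)
  from this[of "map g [j..<k]"] this[of "map g (rev [j..<k])"]
    image_mono[of "{j..<k}" "{l..<m}" g]
  show "l \<le> j \<Longrightarrow> k \<le> m \<Longrightarrow> gs j k \<in> Hecke l m"
    and "l \<le> j \<Longrightarrow> k \<le> m \<Longrightarrow> gd j k \<in> Hecke l m"
    by (auto simp: gs_def gd_def)
qed

lemma commute_Hecke:
  assumes "x \<in> Hecke l m" "\<And>i. l \<le> i \<Longrightarrow> i < m \<Longrightarrow> g i * y = y * g i"
  shows "x * y = y * x"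
  using assms(1)
proof (induction rule: Hecke.induct)
  case (Hecke_mult x x')
  then show ?case by (metis mult.assoc)
qed (simp_all add: assms(2) distrib_left distrib_right scale_mult_left scale_mult_right)

lemma commute_Alg:
  assumes "x \<in> Alg m" "\<And>i. 1 \<le> i \<Longrightarrow> i < m \<Longrightarrow> g i * y = y * g i"
    "\<And>i. 1 \<le> i \<Longrightarrow> i < m \<Longrightarrow> e i * y = y * e i"
  shows "x * y = y * x"
  using assms(1)
proof (induction rule: Alg.induct)
  case (Alg_mult x x')
  then show ?case by (metis mult.assoc)
qed (simp_all add: assms(2,3) distrib_left distrib_right scale_mult_left scale_mult_right)

lemma Hecke_Alg_commute:
  assumes "x \<in> Hecke l m" "y \<in> Alg m'" "m' < l" "m \<le> n"
  shows "x * y = y * x"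
proof (rule commute_Hecke[OF assms(1)])
  fix i assume i: "l \<le> i" "i < m"
  have "y * g i = g i * y"
    using assms(3,4) i by (intro commute_Alg[OF assms(2)]) (auto simp: g_g_far g_e_far)
  then show "g i * y = y * g i" by simp
qed

lemma e_Alg_commute:
  assumes "y \<in> Alg m'" "m' < l" "l < n"
  shows "e l * y = y * e l"
  using assms by (intro commute_Alg[OF assms(1), symmetric]) (auto simp: e_g_far e_e_far)

lemma g_gs: "1 \<le> j \<Longrightarrow> j < i \<Longrightarrow> i < m \<Longrightarrow> m \<le> n \<Longrightarrow> g i * gs j m = gs j m * g (i - 1)"
proof (induction m)
  case (Suc m)
  show ?case
  proof (cases "i < m")
    case True
    then have "g i * gs j (Suc m) = gs j m * (g (i - 1) * g m)"
      using Suc by (simp add: gs_Suc flip: mult.assoc)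
    also have "g (i - 1) * g m = g m * g (i - 1)" using True Suc.prems by (subst g_g_far) auto
    finally show ?thesis using Suc by (simp add: gs_Suc mult.assoc)
  next
    case False
    then obtain p where p: "m = Suc p" "i = Suc p" "j \<le> p" using Suc.prems
      by (metis Suc_diff_1 Suc_leI less_Suc_eq less_imp_Suc_add less_or_eq_imp_le linorder_neqE_nat not_less_eq diff_Suc_1)
    have "g (Suc p) * gs j p = gs j p * g (Suc p)"
      by (rule Hecke_Alg_commute[of _ "Suc p" "Suc (Suc p)" _ p])
        (use p Suc.prems in \<open>auto intro!: Hecke_g Hecke_gs Hecke_subset_Alg[of 1]\<close>)
    moreover have "g (Suc p) * g p * g (Suc p) = g p * g (Suc p) * g p"
      using p Suc.prems by (intro g_braid[symmetric]) auto
    ultimately have "g (Suc p) * (gs j p * (g p * g (Suc p))) = gs j p * (g p * (g (Suc p) * g p))"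
      by (metis mult.assoc)
    then show ?thesis using p by (simp add: gs_Suc mult.assoc)
  qed
qed simp


lemma gd_g: "1 \<le> j \<Longrightarrow> j < i \<Longrightarrow> i < m \<Longrightarrow> m \<le> n \<Longrightarrow> gd j m * g i = g (i - 1) * gd j m"
proof (induction m)
  case (Suc m)
  show ?case
  proof (cases "i < m")
    case True
    then have "gd j (Suc m) * g i = g m * g (i - 1) * gd j m"
      using Suc by (simp add: gd_Suc mult.assoc)
    also have "g m * g (i - 1) = g (i - 1) * g m" using True Suc.prems by (subst g_g_far) auto
    finally show ?thesis using Suc by (simp add: gd_Suc mult.assoc)
  next
    case False
    then obtain p where p: "m = Suc p" "i = Suc p" "j \<le> p" using Suc.prems
      by (metis Suc_leI less_Suc_eq less_imp_Suc_add less_or_eq_imp_le not_less_eq)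
    have "g (Suc p) * gd j p = gd j p * g (Suc p)"
      by (rule Hecke_Alg_commute[of _ "Suc p" "Suc (Suc p)" _ p])
        (use p Suc.prems in \<open>auto intro!: Hecke_g Hecke_gd Hecke_subset_Alg[of 1]\<close>)
    moreover have "g (Suc p) * g p * g (Suc p) = g p * g (Suc p) * g p"
      using p Suc.prems by (intro g_braid[symmetric]) auto
    ultimately have "g (Suc p) * (g p * (gd j p * g (Suc p))) = g p * (g (Suc p) * (g p * gd j p))"
      by (metis mult.assoc)
    then show ?thesis using p by (simp add: gd_Suc mult.assoc)
  qed
qed simp

fun E :: "nat \<Rightarrow> 'a" where
  "E 0 = 1"
| "E (Suc k) = E k * e (2 * k + 1)"

lemma E_in_Alg: "2 * k \<le> m \<Longrightarrow> E k \<in> Alg m"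
  by (induction k) (auto intro!: Alg.intros)

lemma e_commute_E: "2 * k < i \<Longrightarrow> i < n \<Longrightarrow> e i * E k = E k * e i"
  by (rule e_Alg_commute[OF E_in_Alg[OF order_refl]]) auto

lemma Hecke_commute_E: "x \<in> Hecke l m \<Longrightarrow> 2 * k < l \<Longrightarrow> m \<le> n \<Longrightarrow> x * E k = E k * x"
  by (rule Hecke_Alg_commute[OF _ E_in_Alg[OF order_refl]])

definition LI :: "nat \<Rightarrow> nat \<Rightarrow> 'a set" where "LI k m = {x * E k | x. x \<in> Alg m}"

lemma LI_I: "x \<in> Alg m \<Longrightarrow> x * E k \<in> LI k m"
  by (auto simp: LI_def)

lemma E_in_LI: "E k \<in> LI k m"
  using LI_I[OF Alg_one] by simp

lemma LI_mult: "a \<in> Alg m \<Longrightarrow> y \<in> LI k m \<Longrightarrow> a * y \<in> LI k m"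
  unfolding LI_def by (auto intro: Alg_mult simp flip: mult.assoc)

lemma LI_mult_Hecke:
  assumes "y \<in> LI k m" "a \<in> Hecke l m" "2 * k < l" "m \<le> n"
  shows "y * a \<in> LI k m"
proof -
  obtain x where x: "x \<in> Alg m" "y = x * E k" using assms(1) by (auto simp: LI_def)
  then have "y * a = (x * a) * E k"
    using Hecke_commute_E[OF assms(2-4)] by (simp add: mult.assoc)
  moreover have "a \<in> Alg m" using assms(2,3) by (intro Hecke_subset_Alg) auto
  ultimately show ?thesis using x(1) by (auto intro: LI_I Alg_mult)
qed

lemma LI_mono: "m \<le> m' \<Longrightarrow> y \<in> LI k m \<Longrightarrow> y \<in> LI k m'"
  unfolding LI_def using Alg_mono by blast

lemma LI_Suc_subset:
  assumes "y \<in> LI (Suc k) m" "2 * k + 1 < m" "m \<le> n"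
  shows "y \<in> LI k m"
proof -
  obtain x where x: "x \<in> Alg m" "y = x * E (Suc k)" using assms(1) by (auto simp: LI_def)
  have "E k * e (2 * k + 1) = e (2 * k + 1) * E k" using assms by (intro e_commute_E[symmetric]) auto
  then have "y = (x * e (2 * k + 1)) * E k" using x(2) by (simp add: mult.assoc)
  then show ?thesis using x(1) assms(2) by (auto intro!: LI_I Alg_mult Alg_e)
qed

lemma LI_commute:
  assumes "y \<in> LI k m" "2 * k \<le> m" "m < l" "l \<le> n"
  shows "l < n \<Longrightarrow> e l * y = y * e l" "a \<in> Hecke l l' \<Longrightarrow> l' \<le> n \<Longrightarrow> a * y = y * a"
proof -
  obtain x where x: "x \<in> Alg m" "y = x * E k" using assms(1) by (auto simp: LI_def)
  then have y: "y \<in> Alg m" using E_in_Alg[OF assms(2)] by (auto intro: Alg_mult)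
  show "l < n \<Longrightarrow> e l * y = y * e l" "a \<in> Hecke l l' \<Longrightarrow> l' \<le> n \<Longrightarrow> a * y = y * a"
    using e_Alg_commute[OF y assms(3)] Hecke_Alg_commute[OF _ y assms(3)] by auto
qed

lemma e_shift:
  assumes "1 \<le> i" "i + l < n"
  shows "\<exists>h t. h \<in> Hecke i (i + l + 1) \<and> t \<in> Hecke i (i + l + 1) \<and> e (i + l) = h * e i * t"
  using assms(2)
proof (induction l)
  case 0
  have "e i = 1 * e i * 1" by simp
  then show ?case using Hecke_one by force
next
  case (Suc l)
  then obtain h t where ht: "h \<in> Hecke i (i + l + 1)" "t \<in> Hecke i (i + l + 1)"
    "e (i + l) = h * e i * t" by auto
  have "e (i + Suc l) = (g (i + l) * g (Suc (i + l)) * h) * e i * (t * gb (Suc (i + l)) * gb (i + l))"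
    using e_Suc_conj[of "i + l"] Suc.prems assms(1) ht(3) by (simp add: mult.assoc)
  moreover have "h \<in> Hecke i (i + Suc l + 1)" "t \<in> Hecke i (i + Suc l + 1)"
    using ht Hecke_mono[of _ i "i + l + 1"] by auto
  then have "g (i + l) * g (Suc (i + l)) * h \<in> Hecke i (i + Suc l + 1)"
    "t * gb (Suc (i + l)) * gb (i + l) \<in> Hecke i (i + Suc l + 1)"
    by (auto intro!: Hecke_mult Hecke_g Hecke_gb)
  ultimately show ?case by blast
qed

lemma LI_e_last:
  assumes "2 * k + 1 < m" "m \<le> n"
  obtains h t where "h \<in> Hecke (2 * k + 1) m" "t \<in> Hecke (2 * k + 1) m"
    "\<And>y. y \<in> LI k m \<Longrightarrow> \<exists>y'\<in>LI (Suc k) m. y * e (m - 1) = y' * t"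
proof -
  obtain l where l: "m = (2 * k + 1) + l + 1" using assms(1) by (metis add.commute less_imp_Suc_add plus_1_eq_Suc)
  then obtain h t where ht: "h \<in> Hecke (2 * k + 1) m" "t \<in> Hecke (2 * k + 1) m"
      "e (m - 1) = h * e (2 * k + 1) * t"
    using e_shift[of "2 * k + 1" l] assms by auto
  have "\<exists>y'\<in>LI (Suc k) m. y * e (m - 1) = y' * t" if y: "y \<in> LI k m" for y
  proof -
    obtain x where x: "x \<in> Alg m" "y = x * E k" using y by (auto simp: LI_def)
    have "y * e (m - 1) = x * (E k * h) * e (2 * k + 1) * t"
      unfolding x(2) ht(3) by (simp add: mult.assoc)
    also have "E k * h = h * E k" using Hecke_commute_E[OF ht(1), of k] assms by simp
    finally have "y * e (m - 1) = (x * h) * E (Suc k) * t" by (simp add: mult.assoc)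
    moreover have "x * h \<in> Alg m" using x(1) Hecke_subset_Alg[OF _ ht(1)] by (auto intro!: Alg_mult)
    ultimately show ?thesis using LI_I by blast
  qed
  with ht(1,2) that show thesis by blast
qed

definition strand_last :: "nat \<Rightarrow> nat \<Rightarrow> 'a set" where
  "strand_last k m = {gs j m * x | j x. 1 \<le> j \<and> j \<le> m \<and> x \<in> LI k (m - 1)}"
definition cap_last :: "nat \<Rightarrow> nat \<Rightarrow> 'a set" where
  "cap_last k m = {y * e (m - 1) * gd i (m - 1) | i y. 2 * k < i \<and> i < m \<and> y \<in> LI k m}"
definition NF :: "nat \<Rightarrow> nat \<Rightarrow> 'a set" where
  "NF k m = span (strand_last k m \<union> cap_last k m)"

lemma strand_last_NF: "1 \<le> j \<Longrightarrow> j \<le> m \<Longrightarrow> x \<in> LI k (m - 1) \<Longrightarrow> gs j m * x \<in> NF k m"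
  unfolding NF_def strand_last_def by (blast intro: span_base)

lemma cap_last_NF: "2 * k < i \<Longrightarrow> i < m \<Longrightarrow> y \<in> LI k m \<Longrightarrow> y * e (m - 1) * gd i (m - 1) \<in> NF k m"
  unfolding NF_def cap_last_def by (blast intro: span_base)

lemma LI_NF: "1 \<le> m \<Longrightarrow> x \<in> LI k (m - 1) \<Longrightarrow> x \<in> NF k m"
  using strand_last_NF[of m m x k] by simp

lemma NF_add: "x \<in> NF k m \<Longrightarrow> y \<in> NF k m \<Longrightarrow> x + y \<in> NF k m"
  and NF_scale: "x \<in> NF k m \<Longrightarrow> c *s x \<in> NF k m"
  and NF_minus: "x \<in> NF k m \<Longrightarrow> - x \<in> NF k m"
  and NF_zero: "0 \<in> NF k m"
  unfolding NF_def by (auto intro: span_add span_scale span_neg span_zero)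

lemma span_mult_mem:
  assumes "x \<in> span S" "subspace V" "\<And>s. s \<in> S \<Longrightarrow> a * s * b \<in> V"
  shows "a * x * b \<in> V"
  using assms(1)
proof (induction rule: span_induct_alt)
  case base
  then show ?case using subspace_0[OF assms(2)] by simp
next
  case (step c x y)
  then have "c *s (a * x * b) + a * y * b \<in> V"
    using subspace_add[OF assms(2) subspace_scale[OF assms(2)]] assms(3) by blast
  then show ?case by (simp add: distrib_left distrib_right scale_mult_left scale_mult_right)
qed

lemma subspace_NF: "subspace (NF k m)"
  by (simp add: NF_def)

lemma g_NF:
  assumes "x \<in> NF k m" "1 \<le> i" "i < m" "m \<le> n"
  shows "g i * x \<in> NF k m"
proof -
  have "g i * s * 1 \<in> NF k m" if "s \<in> strand_last k m \<union> cap_last k m" for s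
    using that
  proof
    assume "s \<in> strand_last k m"
    then obtain j x where s: "s = gs j m * x" and j: "1 \<le> j" "j \<le> m" and x: "x \<in> LI k (m - 1)"
      by (auto simp: strand_last_def)
    consider "i + 1 < j" | "Suc i = j" | "i = j" | "j < i" by linarith
    then show ?thesis
    proof cases
      case 1
      have "g i * gs j m = gs j m * g i"
        by (rule Hecke_Alg_commute[of _ j m _ "Suc i", symmetric])
          (use 1 assms j in \<open>auto intro!: Hecke_gs Alg_g\<close>)
      then have "g i * s = gs j m * (g i * x)" by (simp add: s flip: mult.assoc)
      moreover have "g i * x \<in> LI k (m - 1)" using 1 x j assms by (intro LI_mult Alg_g) auto
      ultimately show ?thesis using strand_last_NF j by auto
    next
      case 2
      then have "g i * s = gs i m * x" using j by (simp add: s gs_Cons[of i m] mult.assoc)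
      then show ?thesis using strand_last_NF[of i m x] 2 assms x by auto
    next
      case 3
      have js: "gs j m = g i * gs (Suc i) m" using gs_Cons[of i m] 3 assms by simp
      have "g i * s = g i * g i * (gs (Suc i) m * x)"
        by (simp add: s js mult.assoc)
      also have "\<dots> = gs (Suc i) m * x + z *s (gs i m * x)"
        using assms by (simp add: g_square distrib_right scale_mult_left gs_Cons[of i m] mult.assoc)
      finally show ?thesis using strand_last_NF[of i m x] strand_last_NF[of "Suc i" m x] assms x
        by (auto intro!: NF_add NF_scale)
    next
      case 4
      then have "g i * s = gs j m * (g (i - 1) * x)"
        using g_gs[of j i m] j assms by (simp add: s flip: mult.assoc)
      moreover have "g (i - 1) * x \<in> LI k (m - 1)" using 4 x j assms by (intro LI_mult Alg_g) auto
      ultimately show ?thesis using strand_last_NF j by auto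
    qed
  next
    assume "s \<in> cap_last k m"
    then obtain j y where s: "s = y * e (m - 1) * gd j (m - 1)" "2 * k < j" "j < m" "y \<in> LI k m"
      by (auto simp: cap_last_def)
    then have "g i * y \<in> LI k m" using assms by (auto intro!: LI_mult Alg_g)
    with s(2,3) show ?thesis using cap_last_NF[of k j m "g i * y"] by (simp add: s(1) mult.assoc)
  qed
  from span_mult_mem[OF assms(1)[unfolded NF_def] subspace_NF this] show ?thesis by simp
qed

lemma Hecke_NF:
  assumes "a \<in> Hecke l m" "x \<in> NF k m" "1 \<le> l" "m \<le> n"
  shows "a * x \<in> NF k m"
  using assms(1,2)
proof (induction arbitrary: x rule: Hecke.induct)
  case (Hecke_g i)
  then show ?case using assms(3,4) by (auto intro: g_NF)
qed (auto simp: mult.assoc distrib_right scale_mult_left intro: NF_add NF_scale)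

lemma NF_g:
  assumes "x \<in> NF k m" "2 * k < i" "i + 2 \<le> m" "m \<le> n"
  shows "x * g i \<in> NF k m"
proof -
  have "1 * s * g i \<in> NF k m" if "s \<in> strand_last k m \<union> cap_last k m" for s
    using that
  proof
    assume "s \<in> strand_last k m"
    then obtain j x where s: "s = gs j m * x" "1 \<le> j" "j \<le> m" "x \<in> LI k (m - 1)"
      by (auto simp: strand_last_def)
    have "x * g i \<in> LI k (m - 1)" using s(4)
      by (rule LI_mult_Hecke[of _ _ _ _ "2 * k + 1"]) (use assms in \<open>auto intro: Hecke_g\<close>)
    then show ?thesis using s(2,3) by (simp add: s(1) mult.assoc strand_last_NF)
  next
    assume "s \<in> cap_last k m"
    then obtain j y where s: "s = y * e (m - 1) * gd j (m - 1)" and j: "2 * k < j" "j < m"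
      and y: "y \<in> LI k m" by (auto simp: cap_last_def)
    have yg: "y * g l \<in> LI k m" if "2 * k < l" "l < m" for l
      using y by (rule LI_mult_Hecke[of _ _ _ _ "2 * k + 1"]) (use that assms in \<open>auto intro: Hecke_g\<close>)
    have eg: "y * e (m - 1) * g l = (y * g l) * e (m - 1)" if "1 \<le> l" "l + 2 < m" for l
      using that assms by (simp add: e_g_far mult.assoc)
    consider "j < i" | "j = i" | "j = Suc i" | "Suc i < j" by linarith
    then show ?thesis
    proof cases
      case 1
      have "s * g i = y * e (m - 1) * g (i - 1) * gd j (m - 1)"
        using gd_g[of j i "m - 1"] 1 j assms by (simp add: s mult.assoc)
      also have "\<dots> = (y * g (i - 1)) * e (m - 1) * gd j (m - 1)"
        using eg[of "i - 1"] 1 j assms by simp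
      finally have "s * g i = (y * g (i - 1)) * e (m - 1) * gd j (m - 1)" .
      moreover have "2 * k < i - 1" "i - 1 < m" using 1 j assms by auto
      ultimately show ?thesis using cap_last_NF[OF j yg[of "i - 1"]] by simp
    next
      case 2
      have "s * g i = y * e (m - 1) * gd (Suc i) (m - 1) * (g i * g i)"
        using 2 assms gd_Cons[of i "m - 1"] by (simp add: s mult.assoc)
      also have "\<dots> = y * e (m - 1) * gd (Suc i) (m - 1) + z *s s"
        using 2 assms gd_Cons[of i "m - 1"]
        by (simp add: s mult.assoc g_square distrib_left scale_mult_right)
      finally show ?thesis using cap_last_NF[of k "Suc i" m y] cap_last_NF[OF j y] 2 j assms y s
        by (auto intro!: NF_add NF_scale)
    next
      case 3
      then have "s * g i = y * e (m - 1) * gd i (m - 1)"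
        using gd_Cons[of i "m - 1"] assms by (simp add: s mult.assoc)
      then show ?thesis using cap_last_NF[of k i m y] 3 assms y by auto
    next
      case 4
      have "gd j (m - 1) * g i = g i * gd j (m - 1)"
        by (rule Hecke_Alg_commute[of _ j "m - 1" _ "Suc i"])
          (use 4 assms j in \<open>auto intro!: Hecke_gd Alg_g\<close>)
      then have "s * g i = (y * e (m - 1) * g i) * gd j (m - 1)" by (simp add: s mult.assoc)
      also have "\<dots> = (y * g i) * e (m - 1) * gd j (m - 1)"
        using eg[of i] 4 j assms by simp
      finally show ?thesis using cap_last_NF[OF j yg[of i]] 4 j assms by simp
    qed
  qed
  from span_mult_mem[OF assms(1)[unfolded NF_def] subspace_NF this] show ?thesis by simp
qed

lemma NF_Hecke:
  assumes "a \<in> Hecke l (m - 1)" "x \<in> NF k m" "2 * k < l" "m \<le> n"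
  shows "x * a \<in> NF k m"
  using assms(1,2)
proof (induction arbitrary: x rule: Hecke.induct)
  case (Hecke_g i)
  then show ?case using assms(3,4) by (auto intro!: NF_g)
qed (auto simp: distrib_left scale_mult_right intro: NF_add NF_scale simp flip: mult.assoc)

lemma NF_Suc_subset:
  assumes "x \<in> NF (Suc k) m" "2 * k + 2 < m" "m \<le> n"
  shows "x \<in> NF k m"
proof -
  have "1 * s * 1 \<in> NF k m" if "s \<in> strand_last (Suc k) m \<union> cap_last (Suc k) m" for s
  proof -
    have sub: "LI (Suc k) m \<subseteq> LI k m" "LI (Suc k) (m - 1) \<subseteq> LI k (m - 1)"
      using assms(2,3) by (auto elim!: LI_Suc_subset)
    have "strand_last (Suc k) m \<subseteq> strand_last k m" "cap_last (Suc k) m \<subseteq> cap_last k m"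
      unfolding strand_last_def cap_last_def using sub by fastforce+
    then show ?thesis using that unfolding NF_def by (auto intro: span_base)
  qed
  from span_mult_mem[OF assms(1)[unfolded NF_def] subspace_NF this] show ?thesis by simp
qed

lemma e_gd_e:
  assumes "1 \<le> i" "Suc i \<le> m" "m < n"
  shows "\<exists>h\<in>Hecke i (Suc m). e m * gd (Suc i) m * e i = h * e i"
  using assms(2,3)
proof (induction m rule: dec_induct)
  case base
  then show ?case using e_up_e[of i] assms(1)
    Hecke_scale[OF Hecke_mult[OF Hecke_g Hecke_g, of i i "Suc (Suc i)" "Suc i"], of "- 1"]
    by (intro bexI[of _ "(- 1) *s (g i * g (Suc i))"]) (auto simp: scale_mult_left)
next
  case (step m)
  then obtain h where h: "h \<in> Hecke i (Suc m)" "e m * gd (Suc i) m * e i = h * e i" by auto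
  have far: "gb (Suc m) * y = y * gb (Suc m)" if "y \<in> Alg m" for y
    using that step by (intro Hecke_Alg_commute[of _ "Suc m" "Suc (Suc m)" _ m]) (auto intro: Hecke_gb)
  have "gd (Suc i) m * e i \<in> Alg m"
    using step assms by (auto intro!: Alg_mult Alg_e Hecke_subset_Alg[OF _ Hecke_gd, of 1])
  note c1 = far[OF this]
  have c2: "gb (Suc m) * e i = e i * gb (Suc m)" using step assms by (intro far Alg_e) auto
  have "e (Suc m) * gd (Suc i) (Suc m) * e i = e (Suc m) * g m * (gd (Suc i) m * e i)"
    using step by (simp add: gd_Suc mult.assoc)
  also have "e (Suc m) * g m = g m * g (Suc m) * e m * gb (Suc m)"
    using step assms by (subst e_Suc_conj) (auto simp: mult.assoc gb_g)
  also have "\<dots> * (gd (Suc i) m * e i) = g m * g (Suc m) * (e m * gd (Suc i) m * e i) * gb (Suc m)"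
    using c1 by (simp add: mult.assoc)
  also have "\<dots> = (g m * g (Suc m) * h * gb (Suc m)) * e i"
    unfolding h(2) using c2 by (simp add: mult.assoc)
  finally have "e (Suc m) * gd (Suc i) (Suc m) * e i = (g m * g (Suc m) * h * gb (Suc m)) * e i" .
  moreover have "h \<in> Hecke i (Suc (Suc m))" using h(1) by (rule Hecke_mono) auto
  ultimately show ?case using step
    by (intro bexI[of _ "g m * g (Suc m) * h * gb (Suc m)"]) (auto intro!: Hecke_mult Hecke_g Hecke_gb)
qed


lemma Alg_closed_NF_induct:
  assumes "subspace V" "x \<in> V" "a \<in> Alg m"
    "\<And>i x. 1 \<le> i \<Longrightarrow> i < m \<Longrightarrow> x \<in> V \<Longrightarrow> g i * x \<in> V"
    "\<And>x. 2 \<le> m \<Longrightarrow> x \<in> V \<Longrightarrow> e (m - 1) * x \<in> V" "m \<le> n"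
  shows "a * x \<in> V"
proof -
  have gb: "gb i * x \<in> V" if "1 \<le> i" "i < m" "x \<in> V" for i x
    using subspace_diff[OF assms(1) assms(4)[OF that] subspace_scale[OF assms(1) that(3), of z]]
    by (simp add: gb_def left_diff_distrib scale_one_mult)
  have e: "e i * x \<in> V" if "1 \<le> i" "i < m" "x \<in> V" for i x
  proof -
    have "i \<le> m - 1" using that by simp
    then show ?thesis using that
    proof (induction i arbitrary: x rule: inc_induct)
      case base
      then show ?case using assms(5) by simp
    next
      case (step i)
      then have "e (Suc i) * (g i * (g (Suc i) * x)) \<in> V" by (auto intro!: step.IH assms(4))
      then have "gb (Suc i) * (gb i * (e (Suc i) * (g i * (g (Suc i) * x)))) \<in> V"
        using step by (auto intro!: gb)
      then show ?case using step assms(6) by (subst e_conj) (auto simp: mult.assoc)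
    qed
  qed
  show ?thesis using assms(3,2)
    by (induction arbitrary: x rule: Alg.induct)
      (auto simp: mult.assoc distrib_right scale_mult_left intro: assms(4) e subspace_add[OF assms(1)]
        subspace_scale[OF assms(1)])
qed

definition NF0 :: "nat \<Rightarrow> 'a set" where
  "NF0 k = span {gs j (2 * k - 1) * e (2 * k - 1) * x | j x.
     1 \<le> j \<and> j < 2 * k \<and> x \<in> LI (k - 1) (2 * k - 2)}"

lemma NF0_I: "1 \<le> j \<Longrightarrow> j < 2 * k \<Longrightarrow> x \<in> LI (k - 1) (2 * k - 2) \<Longrightarrow>
    gs j (2 * k - 1) * e (2 * k - 1) * x \<in> NF0 k"
  unfolding NF0_def by (blast intro: span_base)

lemma subspace_NF0: "subspace (NF0 k)"
  by (simp add: NF0_def)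

lemmas NF0_add = subspace_add[OF subspace_NF0] and NF0_scale = subspace_scale[OF subspace_NF0]

lemma g_NF0:
  assumes "x \<in> NF0 k" "1 \<le> i" "i + 1 < 2 * k" "2 * k \<le> n"
  shows "g i * x \<in> NF0 k"
proof -
  have "g i * s * 1 \<in> NF0 k" if s_in: "s \<in> {gs j (2 * k - 1) * e (2 * k - 1) * x | j x.
     1 \<le> j \<and> j < 2 * k \<and> x \<in> LI (k - 1) (2 * k - 2)}" for s
  proof -
    define m where "m = 2 * k - 1"
    then have m: "2 * k = Suc m" "i < m" "Suc m \<le> n" "2 * k - 2 = m - 1" "1 \<le> m" using assms by auto
    from s_in obtain j x where s: "s = gs j m * e m * x" and j: "1 \<le> j" "j \<le> m"
      and x: "x \<in> LI (k - 1) (m - 1)" by (auto simp: m(1,4))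
    have I: "gs j m * e m * x \<in> NF0 k" if "1 \<le> j" "j \<le> m" "x \<in> LI (k - 1) (m - 1)" for j x
      using NF0_I[of j k x] that m by simp
    have far: "g l * e m * x = e m * (g l * x)" "g l * x \<in> LI (k - 1) (m - 1)"
      if "1 \<le> l" "l + 1 < m" for l
      using that m x by (auto simp: e_g_far simp flip: mult.assoc intro!: LI_mult Alg_g)
    consider "i + 1 < j" | "Suc i = j" | "i = j" | "j < i" by linarith
    then have "g i * s \<in> NF0 k"
    proof cases
      case 1
      have "g i * gs j m = gs j m * g i"
        by (rule Hecke_Alg_commute[of _ j m _ "Suc i", symmetric])
          (use 1 assms m j in \<open>auto intro!: Hecke_gs Alg_g\<close>)
      then have "g i * s = gs j m * (g i * e m * x)" by (simp add: s mult.assoc) (metis mult.assoc)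
      also have "\<dots> = gs j m * e m * (g i * x)" using far(1)[of i] 1 j assms by (simp add: mult.assoc)
      finally show ?thesis using I[OF j far(2)[of i]] 1 j assms by simp
    next
      case 2
      then have "g i * s = gs i m * e m * x" using m by (simp add: s gs_Cons[of i m] mult.assoc)
      then show ?thesis using I[of i x] m assms x by auto
    next
      case 3
      have js: "gs j m = g i * gs (Suc i) m" using gs_Cons[of i m] 3 m by simp
      have "g i * s = g i * g i * (gs (Suc i) m * e m * x)" by (simp add: s js mult.assoc)
      also have "\<dots> = gs (Suc i) m * e m * x + z *s s"
        using assms m by (simp add: s js g_square distrib_right scale_mult_left mult.assoc)
      finally show ?thesis using I[of "Suc i" x] I[OF j x] s m x by (auto intro!: NF0_add NF0_scale)
    next
      case 4
      then have "g i * s = gs j m * (g (i - 1) * e m * x)"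
        using g_gs[of j i m] j m by (simp add: s flip: mult.assoc)
      also have "\<dots> = gs j m * e m * (g (i - 1) * x)"
        using far(1)[of "i - 1"] 4 j m by (simp add: mult.assoc)
      finally show ?thesis using I[OF j far(2)[of "i - 1"]] 4 j m by simp
    qed
    then show ?thesis by simp
  qed
  from span_mult_mem[OF assms(1)[unfolded NF0_def] subspace_NF0 this] show ?thesis by simp
qed

lemma Hecke_NF0:
  assumes "a \<in> Hecke l (2 * k - 1)" "x \<in> NF0 k" "1 \<le> l" "2 * k \<le> n"
  shows "a * x \<in> NF0 k"
  using assms(1,2)
proof (induction arbitrary: x rule: Hecke.induct)
  case (Hecke_g i)
  then show ?case using assms(3,4) by (auto intro!: g_NF0)
qed (auto simp: mult.assoc distrib_right scale_mult_left intro: NF0_add NF0_scale)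

lemma LI_subset_NF0:
  assumes "1 \<le> k" "2 * k \<le> n"
  shows "LI k (2 * k) \<subseteq> NF0 k"
  using assms
proof (induction k rule: less_induct)
  case (less k)
  define m where "m = 2 * k - 1"
  then have m: "2 * k = Suc m" "Suc m \<le> n" "2 * k - 2 = m - 1" "1 \<le> m" "2 * (k - 1) = m - 1"
    "2 * k - 1 = m" using less.prems by auto
  have I: "gs j m * e m * x \<in> NF0 k" if "1 \<le> j" "j \<le> m" "x \<in> LI (k - 1) (m - 1)" for j x
    using NF0_I[of j k x] that m by simp
  have e_e: "e (m - 1) * e m * x \<in> NF0 k" if "2 \<le> m" "x \<in> LI (k - 1) (m - 1)" for x
  proof -
    have k: "2 \<le> k" "3 \<le> m" "2 * (k - 1) - 2 = m - 3" "2 * (k - 1) - 1 = m - 2"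
      using that(1) m by presburger+
    have "LI (k - 1) (m - 1) \<subseteq> NF0 (k - 1)" using less.IH[of "k - 1"] k m less.prems by simp
    then have x: "x \<in> NF0 (k - 1)" using that(2) by auto
    have "e (m - 1) * e m * s * 1 \<in> NF0 k"
      if s_in: "s \<in> {gs j (2 * (k - 1) - 1) * e (2 * (k - 1) - 1) * x | j x.
       1 \<le> j \<and> j < 2 * (k - 1) \<and> x \<in> LI (k - 1 - 1) (2 * (k - 1) - 2)}" for s
    proof -
      obtain p where p: "m = Suc (Suc p)" "1 \<le> p" using k by (metis One_nat_def Suc_le_D Suc_le_mono numeral_3_eq_3)
      from s_in obtain j y where s: "s = gs j p * e p * y" and j: "1 \<le> j" "j \<le> p"
        and y: "y \<in> LI (k - 2) (p - 1)"
        using k p by (auto simp: diff_Suc numeral_2_eq_2 split: nat.splits)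
      have gsA: "gs j p \<in> Alg p" using j by (intro Hecke_subset_Alg[OF _ Hecke_gs]) auto
      have c: "e m * gs j p = gs j p * e m" "e (Suc p) * gs j p = gs j p * e (Suc p)"
        using e_Alg_commute[OF gsA] p m by auto
      have "e (m - 1) * e m * s = e (Suc p) * (e m * gs j p) * e p * y"
        by (simp add: s p mult.assoc)
      also have "\<dots> = (e (Suc p) * gs j p) * (e m * e p) * y" by (simp only: c(1) mult.assoc)
      also have "\<dots> = gs j p * (e (Suc p) * e p) * e m * y"
        unfolding c using e_e_far[of p m] p m by (simp add: mult.assoc)
      also have "\<dots> = - (gs j p * g p * g (Suc p) * (e p * e m) * y)"
        using e_up_e[of p] p m by (simp add: mult.assoc)
      also have "e p * e m = e m * e p" using e_e_far[of p m] p m by simp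
      also have "gs j p * g p * g (Suc p) = gs j m" using j p by (simp add: gs_Suc)
      finally have eq: "e (m - 1) * e m * s = (- 1) *s (gs j m * e m * (e p * y))"
        by (simp add: mult.assoc)
      have "e p * y \<in> LI (k - 1) (m - 1)"
      proof -
        obtain w where w: "w \<in> Alg (p - 1)" "y = w * E (k - 2)" using y by (auto simp: LI_def)
        have kk: "k - 1 = Suc (k - 2)" "2 * (k - 2) + 1 = p" using k p m by auto
        have "y \<in> Alg (p - 1)" using w E_in_Alg[of "k - 2" "p - 1"] kk by (auto intro: Alg_mult)
        then have "e p * y = y * e p" using p m by (intro e_Alg_commute) auto
        also have "\<dots> = w * E (k - 1)" unfolding kk(1) w(2) using kk(2) by (simp add: mult.assoc)
        finally show ?thesis using Alg_mono[OF w(1), of "m - 1"] p by (auto intro: LI_I)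
      qed
      then show ?thesis using eq I[of j "e p * y"] NF0_scale[of _ k "- 1"] j p by (auto simp del: scale_minus_left)
    qed
    from span_mult_mem[OF x[unfolded NF0_def] subspace_NF0 this] show ?thesis by simp
  qed
  have g: "g i * x \<in> NF0 k" if "1 \<le> i" "i < 2 * k" "x \<in> NF0 k" for i x
  proof (cases "i = m")
    case False
    then show ?thesis using g_NF0[OF that(3,1)] that m by auto
  next
    case True
    have "g m * s * 1 \<in> NF0 k" if s_in: "s \<in> {gs j (2 * k - 1) * e (2 * k - 1) * x | j x.
       1 \<le> j \<and> j < 2 * k \<and> x \<in> LI (k - 1) (2 * k - 2)}" for s
    proof -
      from s_in obtain j x where s: "s = gs j m * e m * x" and j: "1 \<le> j" "j \<le> m"
        and x: "x \<in> LI (k - 1) (m - 1)" by (auto simp: m)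
      show ?thesis
      proof (cases "j = m")
        case True
        then have "g m * s = q *s s" using s m by (simp add: g_e scale_mult_left flip: mult.assoc)
        then show ?thesis using I[OF j x] s by (auto intro: NF0_scale)
      next
        case False
        then obtain p where p: "m = Suc p" "j \<le> p" "1 \<le> p" using j by (cases m) auto
        have A: "gs j p \<in> Alg p" using j by (intro Hecke_subset_Alg[OF _ Hecke_gs]) auto
        have H: "g m \<in> Hecke m (Suc m)" by (auto intro: Hecke_g)
        have "g m * s = (g m * gs j p) * g p * e m * x" using p by (simp add: s gs_Suc mult.assoc)
        also have "g m * gs j p = gs j p * g m" using Hecke_Alg_commute[OF H A] p m by simp
        also have "\<dots> * g p * e m * x = gs j p * (g m * g p * e m) * x" by (simp add: mult.assoc)
        also have "g m * g p * e m = e p * e m + z *s (g p * e m) + (z * inverse q) *s e m"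
          using g_g_e[of p] p m by simp
        also have "gs j p * \<dots> * x = gs j p * (e p * e m * x) + z *s (gs j m * e m * x)
            + (z * inverse q) *s (gs j p * (gs m m * e m * x))"
          using p by (simp add: distrib_left distrib_right scale_mult_left scale_mult_right mult.assoc gs_Suc)
        finally have "g m * s = \<dots>" .
        moreover have "gs j p \<in> Hecke 1 (2 * k - 1)" using j p m by (intro Hecke_gs) auto
        note Hecke_NF0[OF this]
        moreover have "gs m m * e m * x \<in> NF0 k" using I[of m x] m x by simp
        moreover have "e p * e m * x \<in> NF0 k" using e_e[of x] p x by simp
        ultimately show ?thesis using I[OF j x] less.prems by (auto intro!: NF0_add NF0_scale)
      qed
    qed
    from span_mult_mem[OF that(3)[unfolded NF0_def] subspace_NF0 this] show ?thesis using True by simp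
  qed
  have e: "e (2 * k - 1) * x \<in> NF0 k" if "x \<in> NF0 k" for x
  proof -
    have "e m * s * 1 \<in> NF0 k" if s_in: "s \<in> {gs j (2 * k - 1) * e (2 * k - 1) * x | j x.
       1 \<le> j \<and> j < 2 * k \<and> x \<in> LI (k - 1) (2 * k - 2)}" for s
    proof -
      from s_in obtain j x where s: "s = gs j m * e m * x" and j: "1 \<le> j" "j \<le> m"
        and x: "x \<in> LI (k - 1) (m - 1)" by (auto simp: m)
      show ?thesis
      proof (cases "j = m")
        case True
        then have "e m * s = e m * e m * x" by (simp add: s mult.assoc)
        also have "\<dots> = 0" using e_square[of m] m by simp
        finally show ?thesis using subspace_0[OF subspace_NF0] by simp
      next
        case False
        then obtain p where p: "m = Suc p" "j \<le> p" "1 \<le> p" using j by (cases m) auto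
        have A: "gs j p \<in> Alg p" using j by (intro Hecke_subset_Alg[OF _ Hecke_gs]) auto
        have "e m * s = (e m * gs j p) * g p * e m * x" using p by (simp add: s gs_Suc mult.assoc)
        also have "e m * gs j p = gs j p * e m" using e_Alg_commute[OF A] p m by simp
        also have "\<dots> * g p * e m * x = gs j p * (e m * g p * e m) * x" by (simp add: mult.assoc)
        also have "e m * g p * e m = inverse q *s e m" using e_g_e[of p] p m by simp
        also have "gs j p * \<dots> * x = inverse q *s (gs j p * (gs m m * e m * x))"
          by (simp add: scale_mult_left scale_mult_right mult.assoc)
        finally have "e m * s = \<dots>" .
        moreover have "gs j p \<in> Hecke 1 (2 * k - 1)" using j p m by (intro Hecke_gs) auto
        note Hecke_NF0[OF this]
        moreover have "gs m m * e m * x \<in> NF0 k" using I[of m x] m x by simp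
        ultimately show ?thesis using less.prems by (auto intro!: NF0_scale)
      qed
    qed
    from span_mult_mem[OF that[unfolded NF0_def] subspace_NF0 this] show ?thesis using m by simp
  qed
  have "E k \<in> NF0 k"
  proof -
    have "k = Suc (k - 1)" "2 * (k - 1) + 1 = m" using m less.prems by auto
    then have "E k = E (k - 1) * e m" by (metis E.simps(2))
    also have "\<dots> = e m * E (k - 1)" using e_commute_E[of "k - 1" m] m by simp
    finally show ?thesis using I[of m "E (k - 1)"] m E_in_LI by simp
  qed
  then show ?case unfolding LI_def
    using Alg_closed_NF_induct[OF subspace_NF0 _ _ g e] less.prems by auto
qed

end

context q_Brauer_elements begin

lemma e_gd_LI:
  assumes IH: "\<And>k' m'. m' < m \<Longrightarrow> 2 * k' < m' \<Longrightarrow> LI k' m' \<subseteq> NF k' m'"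
    and "m \<le> n"
  shows "2 * k \<le> r \<Longrightarrow> 1 \<le> r \<Longrightarrow> r < m \<Longrightarrow> x \<in> LI k r \<Longrightarrow> e (m - 1) * gd r (m - 1) * x \<in> NF k m"
proof (induction "r - 2 * k" arbitrary: k r x rule: less_induct)
  case less
  show ?case
  proof (cases "r = 2 * k")
    case True
    then have k: "1 \<le> k" "2 * k \<le> n" "2 * (k - 1) = r - 2" "k - 1 + 1 = k" using less.prems assms(2) by auto
    obtain p where p: "r = Suc p" "1 \<le> p" using True k by (intro that[of "r - 1"]) auto
    have kp: "2 * k - 1 = p" "2 * k - 2 = p - 1" "2 * k = Suc p" using True p by auto
    have x: "x \<in> NF0 k" using LI_subset_NF0[OF k(1,2)] less.prems True by auto
    have "e (m - 1) * gd r (m - 1) * s * 1 \<in> NF k m"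
      if s_in: "s \<in> {gs j (2 * k - 1) * e (2 * k - 1) * x | j x.
       1 \<le> j \<and> j < 2 * k \<and> x \<in> LI (k - 1) (2 * k - 2)}" for s
    proof -
      from s_in obtain j w where s: "s = gs j p * e p * (w * E (k - 1))" and j: "1 \<le> j" "j < Suc p"
        and w: "w \<in> Alg (p - 1)" unfolding kp(1,2) unfolding kp(3) LI_def by blast
      have E_Alg: "E (k - 1) \<in> Alg (p - 1)" using k(3) p by (intro E_in_Alg) auto
      have A: "gs j p \<in> Alg p" using j by (intro Hecke_subset_Alg[OF _ Hecke_gs]) auto
      have pm: "Suc p \<le> m - 1" "m - 1 < n" "Suc (m - 1) = m" using p less.prems assms(2) by auto
      have "\<exists>h\<in>Hecke p m. e (m - 1) * gd r (m - 1) * e p = h * e p"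
        using e_gd_e[OF p(2) pm(1,2)] by (simp only: pm(3) p(1))
      then obtain h where h: "h \<in> Hecke p m" "e (m - 1) * gd r (m - 1) * e p = h * e p" by blast
      have H: "gd r (m - 1) \<in> Hecke r m" by (intro Hecke_gd) auto
      have c: "gd r (m - 1) * gs j p = gs j p * gd r (m - 1)" "e (m - 1) * gs j p = gs j p * e (m - 1)"
        by (rule Hecke_Alg_commute[OF H A] e_Alg_commute[OF A]; use p less.prems assms(2) in simp)+
      have c2: "e p * y = y * e p" "h * y = y * h" if "y \<in> Alg (p - 1)" for y
        by (rule e_Alg_commute[OF that] Hecke_Alg_commute[OF h(1) that]; use p pm assms(2) in simp)+
      have "e (m - 1) * gd r (m - 1) * s = e (m - 1) * (gd r (m - 1) * gs j p) * e p * (w * E (k - 1))"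
        by (simp add: s mult.assoc)
      also have "\<dots> = (e (m - 1) * gs j p) * gd r (m - 1) * e p * (w * E (k - 1))"
        unfolding c(1) by (simp add: mult.assoc)
      also have "\<dots> = gs j p * (e (m - 1) * gd r (m - 1) * e p) * (w * E (k - 1))"
        unfolding c(2) by (simp add: mult.assoc)
      also have "\<dots> = gs j p * h * (e p * (w * E (k - 1)))" unfolding h(2) by (simp add: mult.assoc)
      also have "e p * (w * E (k - 1)) = (w * E (k - 1)) * e p"
        using w E_Alg by (intro c2 Alg_mult)
      also have "\<dots> = w * E k"
      proof -
        have "k = Suc (k - 1)" "2 * (k - 1) + 1 = p" using k p by auto
        then have "E k = E (k - 1) * e p" by (metis E.simps(2))
        then show ?thesis by (simp add: mult.assoc)
      qed
      finally have eq: "e (m - 1) * gd r (m - 1) * s = (gs j p * h) * (w * E k)" .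
      have "w \<in> Alg (m - 1)" using w by (rule Alg_mono) (use p less.prems in auto)
      then have "w * E k \<in> NF k m" using less.prems by (intro LI_NF LI_I) auto
      moreover have "h \<in> Hecke 1 m" using h(1) by (rule Hecke_mono) (use p in auto)
      then have "gs j p * h \<in> Hecke 1 m" using j p less.prems by (intro Hecke_mult Hecke_gs) auto
      ultimately show ?thesis using eq Hecke_NF assms(2) by auto
    qed
    from span_mult_mem[OF x[unfolded NF0_def] subspace_NF this] show ?thesis by simp
  next
    case False
    then have r: "2 * k < r" using less.prems by simp
    then have x: "x \<in> NF k r" using IH[of r k] less.prems by auto
    have "e (m - 1) * gd r (m - 1) * s * 1 \<in> NF k m" if "s \<in> strand_last k r \<union> cap_last k r" for s
      using that
    proof
      assume "s \<in> strand_last k r"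
      then obtain j x where s: "s = gs j r * x" and j: "1 \<le> j" "j \<le> r" and x: "x \<in> LI k (r - 1)"
        by (auto simp: strand_last_def)
      show ?thesis
      proof (cases "j = r")
        case True
        have "e (m - 1) * (gd r (m - 1) * x) = x * e (m - 1) * gd r (m - 1)"
        proof -
          have H: "gd r (m - 1) \<in> Hecke r m" by (intro Hecke_gd) auto
          have "e (m - 1) * x = x * e (m - 1)" "gd r (m - 1) * x = x * gd r (m - 1)"
            using LI_commute(1)[OF x, of "m - 1"] LI_commute(2)[OF x _ _ _ H] r less.prems assms(2) by auto
          then show ?thesis by (metis mult.assoc)
        qed
        moreover have "x \<in> LI k m" using x by (rule LI_mono[rotated]) (use less.prems in auto)
        ultimately show ?thesis using cap_last_NF[of k r m x] r less.prems True s by (simp add: mult.assoc)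
      next
        case False
        then obtain p where p: "r = Suc p" "j \<le> p" "1 \<le> p" using j by (cases r) auto
        have A: "gs j p \<in> Alg p" using j by (intro Hecke_subset_Alg[OF _ Hecke_gs]) auto
        have H: "gd r (m - 1) \<in> Hecke r m" by (intro Hecke_gd) auto
        have c: "gd r (m - 1) * gs j p = gs j p * gd r (m - 1)" "e (m - 1) * gs j p = gs j p * e (m - 1)"
          by (rule Hecke_Alg_commute[OF H A] e_Alg_commute[OF A]; use p less.prems assms(2) in simp)+
        have "e (m - 1) * gd r (m - 1) * s = e (m - 1) * (gd r (m - 1) * gs j p) * g p * x"
          using p by (simp add: s gs_Suc mult.assoc)
        also have "\<dots> = (e (m - 1) * gs j p) * (gd r (m - 1) * g p) * x"
          unfolding c(1) by (simp add: mult.assoc)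
        also have "gd r (m - 1) * g p = gd p (m - 1)" using gd_Cons[of p "m - 1"] p less.prems by simp
        also have "(e (m - 1) * gs j p) * \<dots> * x = gs j p * (e (m - 1) * gd p (m - 1) * x)"
          unfolding c(2) by (simp add: mult.assoc)
        finally have "e (m - 1) * gd r (m - 1) * s = \<dots>" .
        moreover have "e (m - 1) * gd p (m - 1) * x \<in> NF k m"
          using x p r less.prems by (intro less.hyps) auto
        moreover have "gs j p \<in> Hecke 1 m" using j p less.prems by (intro Hecke_gs) auto
        ultimately show ?thesis using Hecke_NF assms(2) by auto
      qed
    next
      assume "s \<in> cap_last k r"
      then obtain j y where s: "s = y * e (r - 1) * gd j (r - 1)" and j: "2 * k < j" "j < r"
        and y: "y \<in> LI k r" by (auto simp: cap_last_def)
      obtain t y' where t: "t \<in> Hecke (2 * k + 1) r" "y' \<in> LI (Suc k) r" "y * e (r - 1) = y' * t"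
        using LI_e_last[of k r] j y less.prems assms(2) by (metis Suc_eq_plus1 Suc_leI less_trans_Suc less_imp_le_nat order.trans)
      have "e (m - 1) * gd r (m - 1) * y' \<in> NF (Suc k) m"
        using t(2) j less.prems by (intro less.hyps) auto
      then have N: "e (m - 1) * gd r (m - 1) * y' \<in> NF k m"
        using j less.prems assms(2) by (elim NF_Suc_subset) auto
      have "t * gd j (r - 1) \<in> Hecke (2 * k + 1) (m - 1)"
      proof (intro Hecke_mult)
        show "t \<in> Hecke (2 * k + 1) (m - 1)" using t(1) by (rule Hecke_mono) (use less.prems in auto)
        show "gd j (r - 1) \<in> Hecke (2 * k + 1) (m - 1)" using j less.prems by (intro Hecke_gd) auto
      qed
      from NF_Hecke[OF this N] show ?thesis using t(3) assms(2) by (simp add: s mult.assoc)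
    qed
    from span_mult_mem[OF x[unfolded NF_def] subspace_NF this] show ?thesis by simp
  qed
qed

lemma LI_subset_NF:
  assumes "m \<le> n" "2 * k < m"
  shows "LI k m \<subseteq> NF k m"
  using assms
proof (induction m arbitrary: k rule: less_induct)
  case (less m)
  have T: "e (m - 1) * x \<in> NF k m" if "2 \<le> m" "x \<in> LI k (m - 1)" for x
    using e_gd_LI[of m k "m - 1" x] less that by simp
  have e: "e (m - 1) * x \<in> NF k m" if m: "2 \<le> m" "x \<in> NF k m" for x
  proof -
    have "e (m - 1) * s * 1 \<in> NF k m" if "s \<in> strand_last k m \<union> cap_last k m" for s
      using that
    proof
      assume "s \<in> strand_last k m"
      then obtain j x where s: "s = gs j m * x" and j: "1 \<le> j" "j \<le> m" and x: "x \<in> LI k (m - 1)"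
        by (auto simp: strand_last_def)
      consider "j = m" | "Suc j = m" | "j + 2 \<le> m" using j by linarith
      then show ?thesis
      proof cases
        case 1
        then show ?thesis using T[OF m(1) x] s by simp
      next
        case 2
        then have "e (m - 1) * s = e j * g j * x" using s gs_Cons[of j m] by (auto simp: mult.assoc)
        then have "e (m - 1) * s = (- inverse q) *s (e (m - 1) * x)"
          using 2 e_g[of j] j less.prems by (auto simp: scale_mult_left)
        then show ?thesis using T[OF m(1) x] NF_scale[of "e (m - 1) * x" k m "- inverse q"] by simp
      next
        case 3
        then obtain p where p: "m = Suc (Suc p)" "j \<le> p" by (intro that[of "m - 2"]) auto
        have A: "gs j p \<in> Alg p" using j by (intro Hecke_subset_Alg[OF _ Hecke_gs]) auto
        have "e (m - 1) * s = (e (Suc p) * gs j p) * g p * g (Suc p) * x"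
          using p by (simp add: s gs_Suc mult.assoc)
        also have "e (Suc p) * gs j p = gs j p * e (Suc p)"
          using e_Alg_commute[OF A, of "Suc p"] p less.prems by simp
        also have "\<dots> * g p * g (Suc p) * x = gs j p * (e (Suc p) * g p * g (Suc p)) * x"
          by (simp add: mult.assoc)
        also have "e (Suc p) * g p * g (Suc p) = - (e (Suc p) * e p)"
          using e_up_e'[of p] p j less.prems by simp
        also have "gs j p * \<dots> * x = - (gs j p * (e (m - 1) * (e p * x)))"
          using p by (simp add: mult.assoc)
        finally have "e (m - 1) * s = \<dots>" .
        moreover have "e p * x \<in> LI k (m - 1)" using x p j by (intro LI_mult Alg_e) auto
        then have "e (m - 1) * (e p * x) \<in> NF k m" by (rule T[OF m(1)])
        moreover have "gs j p \<in> Hecke 1 m" using j p by (intro Hecke_gs) auto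
        ultimately show ?thesis using Hecke_NF less.prems by (auto intro: NF_minus)
      qed
    next
      assume "s \<in> cap_last k m"
      then obtain j y where s: "s = y * e (m - 1) * gd j (m - 1)" "2 * k < j" "j < m" "y \<in> LI k m"
        by (auto simp: cap_last_def)
      then have "e (m - 1) * y \<in> LI k m" using m by (auto intro!: LI_mult Alg_e)
      with s(2,3) show ?thesis using cap_last_NF[of k j m "e (m - 1) * y"] by (simp add: s(1) mult.assoc)
    qed
    from span_mult_mem[OF m(2)[unfolded NF_def] subspace_NF this] show ?thesis by simp
  qed
  have "E k \<in> NF k m" using less.prems by (intro LI_NF E_in_LI) auto
  then show ?case unfolding LI_def
    using Alg_closed_NF_induct[OF subspace_NF _ _ g_NF e] less.prems by auto
qed

lemma finite_spanning_union:
  assumes "finite J" "card J \<le> a" "\<And>j. j \<in> J \<Longrightarrow> finite (B j) \<and> card (B j) \<le> b"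
  shows "finite (\<Union>j\<in>J. B j) \<and> card (\<Union>j\<in>J. B j) \<le> a * b"
proof
  show "finite (\<Union>j\<in>J. B j)" using assms by auto
  have "card (\<Union>j\<in>J. B j) \<le> (\<Sum>j\<in>J. card (B j))" using assms(1) by (rule card_UN_le)
  also have "\<dots> \<le> card J * b" using assms(3) by (intro sum_bounded_above[where K = b, simplified]) auto
  also have "\<dots> \<le> a * b" using assms(2) by simp
  finally show "card (\<Union>j\<in>J. B j) \<le> a * b" .
qed

lemma span_image_mult:
  assumes "x \<in> span B"
  shows "a * x * b \<in> span ((\<lambda>x. a * x * b) ` B)"
  by (rule span_mult_mem[OF assms]) (auto intro: span_base)

lemma LI_spanned:
  assumes "m \<le> n" "2 * k \<le> m"
  shows "\<exists>B. finite B \<and> card B \<le> odd_fact (m - k) \<and> LI k m \<subseteq> span B"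
  using assms
proof (induction "m - k" arbitrary: m k)
  case 0
  then have mk: "m = 0" "k = 0" by auto
  have "\<exists>c. x = c *s 1" if "x \<in> Alg 0" for x
    using that
  proof (induction rule: Alg.induct)
    case Alg_one
    have "1 = (1 :: 'f) *s (1 :: 'a)" by simp
    then show ?case by blast
  next
    case (Alg_mult x y)
    then show ?case by (auto simp: scale_mult_left)
  next
    case (Alg_add x y)
    then show ?case by (metis scale_left_distrib)
  next
    case (Alg_scale x c)
    then show ?case by auto
  qed auto
  then have "Alg 0 \<subseteq> span {1}" by (auto simp: span_singleton)
  then have "LI 0 0 \<subseteq> span {1}" by (auto simp: LI_def)
  then show ?case using mk by (intro exI[of _ "{1}"]) auto
next
  case (Suc r)
  show ?case
  proof (cases "m = 2 * k")
    case True
    then have k: "1 \<le> k" "r = 2 * k - 2 - (k - 1)" "2 * k - 2 \<le> n" "2 * (k - 1) \<le> 2 * k - 2" "r = k - 1" using Suc by auto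
    from Suc.hyps(1)[OF k(2-4)] obtain B where B: "finite B" "card B \<le> odd_fact r"
      "LI (k - 1) (2 * k - 2) \<subseteq> span B" unfolding k(2)[symmetric] by blast
    let ?B = "\<Union>j\<in>{1..<2 * k}. (\<lambda>x. gs j (2 * k - 1) * e (2 * k - 1) * x * 1) ` B"
    have "finite ?B \<and> card ?B \<le> (2 * r + 1) * odd_fact r"
      by (intro finite_spanning_union) (use B k in \<open>auto intro: order.trans[OF card_image_le]\<close>)
    moreover have "NF0 k \<subseteq> span ?B" unfolding NF0_def
    proof (intro span_minimal subspace_span subsetI)
      fix s assume "s \<in> {gs j (2 * k - 1) * e (2 * k - 1) * x | j x.
        1 \<le> j \<and> j < 2 * k \<and> x \<in> LI (k - 1) (2 * k - 2)}"
      then obtain j x where s: "s = gs j (2 * k - 1) * e (2 * k - 1) * x * 1" "j \<in> {1..<2 * k}" "x \<in> span B"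
        using B(3) by auto
      from span_image_mult[OF s(3)] have "s \<in> span ((\<lambda>x. gs j (2 * k - 1) * e (2 * k - 1) * x * 1) ` B)"
        unfolding s(1) .
      then show "s \<in> span ?B" by (rule subsetD[OF span_mono, rotated]) (use s(2) in blast)
    qed
    ultimately show ?thesis
      using LI_subset_NF0[OF k(1)] Suc.prems Suc.hyps(2) True by (intro exI[of _ ?B]) (auto simp flip: Suc.hyps(2))
  next
    case False
    then have m: "2 * k < m" using Suc.prems by simp
    have r: "r = m - 1 - k" "m - 1 \<le> n" "2 * k \<le> m - 1" using Suc.hyps(2) m Suc.prems by auto
    obtain B where B: "finite B" "card B \<le> odd_fact r" "LI k (m - 1) \<subseteq> span B"
      using Suc.hyps(1)[OF r] unfolding r(1)[symmetric] by blast
    have nf: "LI k m \<subseteq> NF k m" using LI_subset_NF Suc.prems m by simp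
    let ?B = "\<Union>j\<in>{1..m}. (\<lambda>x. gs j m * x * 1) ` B"
    have fB: "finite ?B \<and> card ?B \<le> m * odd_fact r"
      by (intro finite_spanning_union) (use B in \<open>auto intro: order.trans[OF card_image_le]\<close>)
    have sB: "strand_last k m \<subseteq> span ?B"
    proof
      fix s assume "s \<in> strand_last k m"
      then obtain j x where s: "s = gs j m * x * 1" "j \<in> {1..m}" "x \<in> span B"
        using B(3) by (auto simp: strand_last_def)
      from span_image_mult[OF s(3)] have "s \<in> span ((\<lambda>x. gs j m * x * 1) ` B)"
        unfolding s(1) .
      then show "s \<in> span ?B" by (rule subsetD[OF span_mono, rotated]) (use s(2) in blast)
    qed
    obtain B' where fB': "finite B' \<and> card B' \<le> (m - 2 * k - 1) * odd_fact r"
      and sB': "cap_last k m \<subseteq> span B'"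
    proof (cases "m = 2 * k + 1")
      case True
      then have "cap_last k m = {}" by (auto simp: cap_last_def)
      then show thesis using that[of "{}"] by simp
    next
      case False
      with m have m2: "2 * k + 1 < m" by simp
      have rS: "r = m - Suc k" "2 * Suc k \<le> m" using Suc.hyps(2) m2 by auto
      obtain C where C: "finite C" "card C \<le> odd_fact r" "LI (Suc k) m \<subseteq> span C"
        using Suc.hyps(1)[OF rS(1) Suc.prems(1) rS(2)] unfolding rS(1)[symmetric] by blast
      obtain t where t: "\<And>y. y \<in> LI k m \<Longrightarrow> \<exists>y'\<in>LI (Suc k) m. y * e (m - 1) = y' * t"
        using LI_e_last[OF m2] Suc.prems by metis
      let ?C = "\<Union>j\<in>{2 * k <..< m}. (\<lambda>x. 1 * x * (t * gd j (m - 1))) ` C"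
      have "finite ?C \<and> card ?C \<le> (m - 2 * k - 1) * odd_fact r"
        by (intro finite_spanning_union) (use C in \<open>auto intro: order.trans[OF card_image_le]\<close>)
      moreover have "cap_last k m \<subseteq> span ?C"
      proof
        fix s assume "s \<in> cap_last k m"
        then obtain j y where s: "s = y * e (m - 1) * gd j (m - 1)" "j \<in> {2 * k <..< m}" "y \<in> LI k m"
          by (auto simp: cap_last_def)
        with t obtain y' where y': "y' \<in> LI (Suc k) m" "y * e (m - 1) = y' * t" by blast
        then have eq: "s = 1 * y' * (t * gd j (m - 1))" by (simp add: s mult.assoc)
        from span_image_mult[of y' C 1 "t * gd j (m - 1)"]
        have "s \<in> span ((\<lambda>x. 1 * x * (t * gd j (m - 1))) ` C)"
          unfolding eq using y'(1) C(3) by blast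
        then show "s \<in> span ?C" by (rule subsetD[OF span_mono, rotated]) (use s(2) in blast)
      qed
      ultimately show thesis by (rule that)
    qed
    have "finite (?B \<union> B')" using fB fB' by blast
    moreover have "card (?B \<union> B') \<le> odd_fact (m - k)"
    proof -
      have "card (?B \<union> B') \<le> m * odd_fact r + (m - 2 * k - 1) * odd_fact r"
        using card_Un_le[of ?B B'] fB fB' by linarith
      also have "\<dots> = (m + (m - 2 * k - 1)) * odd_fact r" by (simp add: add_mult_distrib)
      also have "m + (m - 2 * k - 1) = 2 * r + 1" using m Suc.hyps(2) by linarith
      finally show ?thesis by (simp flip: Suc.hyps(2))
    qed
    moreover have "NF k m \<subseteq> span (?B \<union> B')" unfolding NF_def
      using sB sB' span_mono[of ?B "?B \<union> B'"] span_mono[of B' "?B \<union> B'"]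
      by (intro span_minimal subspace_span) blast
    ultimately show ?thesis using nf by (meson order.trans)
  qed
qed

theorem Alg_spanned: "\<exists>B. finite B \<and> card B \<le> odd_fact n \<and> Alg n \<subseteq> span B"
proof -
  have "LI 0 n = Alg n" by (auto simp: LI_def)
  then show ?thesis using LI_spanned[of n 0] by simp
qed

end

lemma wt_simps:
  "wt S m n (TId k) \<longleftrightarrow> m = k \<and> n = k"
  "wt S m n (TGen x) \<longleftrightarrow> x \<in> gens S \<and> m = gsrc S x \<and> n = gtgt S x"
  "wt S m n (TZero k l) \<longleftrightarrow> m = k \<and> n = l"
  "wt S m n (f \<cdot> g) \<longleftrightarrow> (\<exists>l. wt S l n f \<and> wt S m l g)"
  "wt S m n (f \<star> g) \<longleftrightarrow>
     (\<exists>m1 m2 n1 n2. m = m1 + m2 \<and> n = n1 + n2 \<and> wt S m1 n1 f \<and> wt S m2 n2 g)"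
  "wt S m n (f +\<^sub>t g) \<longleftrightarrow> wt S m n f \<and> wt S m n g"
  "wt S m n (c *\<^sub>t f) \<longleftrightarrow> wt S m n f"
  by (auto elim: wt.cases intro: wt.intros) (erule wt.cases; force)

lemma wt_unique: "wt S m n f \<Longrightarrow> wt S m' n' f \<Longrightarrow> m = m' \<and> n = n'"
proof (induction arbitrary: m' n' rule: wt.induct)
  case (wt_comp l n f m g)
  from wt_comp.prems obtain l' where "wt S l' n' f" "wt S m' l' g" by (auto simp: wt_simps)
  with wt_comp.IH show ?case by blast
next
  case (wt_tens m n f k l g)
  from wt_tens.prems obtain m1 m2 n1 n2 where "m' = m1 + m2" "n' = n1 + n2" "wt S m1 n1 f" "wt S m2 n2 g"
    by (auto simp: wt_simps)
  with wt_tens.IH show ?case by blast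
next
  case (wt_add m n f g)
  then show ?case unfolding wt_simps by blast
next
  case (wt_smul m n f c)
  then show ?case unfolding wt_simps by blast
qed (simp_all add: wt_simps)

lemma wtp_wt: "wtp S p m n f \<Longrightarrow> wt S m n f"
  by (induction rule: wtp.induct) (auto intro: wt.intros)

lemma eqv_wt: "eqv S R f g \<Longrightarrow> \<exists>m n. wt S m n f \<and> wt S m n g"
proof (induction rule: eqv.induct)
  case (eqv_trans f g h)
  then show ?case using wt_unique by blast
next
  case (eqv_cong_comp f f' g g' l n m)
  then have "wt S l n f'" "wt S m l g'" using wt_unique by blast+
  with eqv_cong_comp show ?case by (blast intro: wt.intros)
next
  case (eqv_cong_tens f f' g g')
  then show ?case by (blast intro: wt.intros)
next
  case (eqv_cong_add f f' g g' m n)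
  then have "wt S m n f'" "wt S m n g'" using wt_unique by blast+
  with eqv_cong_add show ?case by (blast intro: wt.intros)
next
  case (eqv_tens_assoc m n f m' n' g m'' n'' h)
  then have "wt S (m + m' + m'') (n + n' + n'') (f \<star> g \<star> h)"
    "wt S (m + (m' + m'')) (n + (n' + n'')) (f \<star> (g \<star> h))"
    by (auto intro!: wt_tens)
  then show ?case by (auto simp: add.assoc)
next
  case (eqv_tens_unit_left m n f)
  then show ?case using wt_tens[OF wt_id, of S m n f 0] by auto
next
  case (eqv_tens_unit_right m n f)
  then show ?case using wt_tens[OF _ wt_id, of S m n f 0] by auto
next
  case (eqv_interchange p l n f r l' n' g s m h t m' k)
  then have "wt S l n f" "wt S l' n' g" "wt S m l h" "wt S m' l' k" by (blast dest: wtp_wt)+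
  then have "wt S (m + m') (n + n') ((f \<star> g) \<cdot> (h \<star> k))"
    "wt S (m + m') (n + n') (koszul_sign r s *\<^sub>t ((f \<cdot> h) \<star> (g \<cdot> k)))"
    by (auto intro!: wt.intros)
  then show ?case by blast
next
  case (eqv_sym f g)
  then show ?case by blast
next
  case (eqv_cong_smul f f' c)
  then show ?case by (auto intro: wt.intros)
qed (blast intro: wt.intros)+

lemma eqv_wt_iff: "eqv S R f g \<Longrightarrow> wt S m n f \<longleftrightarrow> wt S m n g"
  using eqv_wt wt_unique by metis

lemma koszul_sign_zero [simp]: "koszul_sign 0 p = 1" "koszul_sign p 0 = 1"
  by (simp_all add: koszul_sign_def)

lemma koszul_sign_add_left: "koszul_sign (p + p') r = koszul_sign p r * koszul_sign p' r"
  and koszul_sign_add_right: "koszul_sign p (r + r') = koszul_sign p r * koszul_sign p r'"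
  by (cases p; cases p'; cases r; simp add: koszul_sign_def)
    (cases p; cases r; cases r'; simp add: koszul_sign_def)

lemma koszul_sign_square: "koszul_sign p r * koszul_sign p r = 1"
  by (simp add: koszul_sign_def)

lemma eqv_class_eqI:
  assumes "\<And>m n. wt S m n f \<Longrightarrow> eqv S R f g" "\<And>m n. wt S m n g \<Longrightarrow> eqv S R g f"
  shows "eqv_class S R f = eqv_class S R g"
proof (cases "\<exists>m n. wt S m n f \<or> wt S m n g")
  case True
  then have "eqv S R f g" using assms eqv_sym by blast
  then show ?thesis unfolding eqv_class_def using eqv_sym eqv_trans by blast
next
  case False
  then have "\<not> eqv S R f h" "\<not> eqv S R g h" for h using eqv_wt by blast+
  then show ?thesis by (simp add: eqv_class_def)
qed

lemma eqv_class_eq: "eqv S R f g \<Longrightarrow> eqv_class S R f = eqv_class S R g"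
  unfolding eqv_class_def using eqv_sym eqv_trans by blast

lemma eqv_class_eqD: "eqv_class S R f = eqv_class S R g \<Longrightarrow> wt S m n f \<Longrightarrow> eqv S R f g"
  using eqv_refl[of S m n f R] unfolding eqv_class_def by (blast intro: eqv_sym)

lemma eqv_class_cong:
  assumes "eqv_class S R f = eqv_class S R f'" "eqv_class S R g = eqv_class S R g'"
  shows "eqv_class S R (f \<cdot> g) = eqv_class S R (f' \<cdot> g')"
    and "eqv_class S R (f \<star> g) = eqv_class S R (f' \<star> g')"
    and "eqv_class S R (f +\<^sub>t g) = eqv_class S R (f' +\<^sub>t g')"
    and "eqv_class S R (c *\<^sub>t f) = eqv_class S R (c *\<^sub>t f')"
proof -
  note e = eqv_class_eqD[OF assms(1)] eqv_class_eqD[OF assms(2)]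
    eqv_class_eqD[OF assms(1)[symmetric]] eqv_class_eqD[OF assms(2)[symmetric]]
  show "eqv_class S R (f \<cdot> g) = eqv_class S R (f' \<cdot> g')"
    by (rule eqv_class_eqI) (auto simp: wt_simps intro: eqv_cong_comp e)
  show "eqv_class S R (f \<star> g) = eqv_class S R (f' \<star> g')"
    by (rule eqv_class_eqI) (auto simp: wt_simps intro: eqv_cong_tens e)
  show "eqv_class S R (f +\<^sub>t g) = eqv_class S R (f' +\<^sub>t g')"
    by (rule eqv_class_eqI) (auto simp: wt_simps intro: eqv_cong_add e)
  show "eqv_class S R (c *\<^sub>t f) = eqv_class S R (c *\<^sub>t f')"
    by (rule eqv_class_eqI) (auto simp: wt_simps intro: eqv_cong_smul e)
qed

lemmas [trans] = eqv_trans

lemma eqv_smul_zero: "wt S m n f \<Longrightarrow> eqv S R (0 *\<^sub>t f) (TZero m n)"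
proof -
  assume f: "wt S m n f"
  have "eqv S R (0 *\<^sub>t f) ((1 + - 1) *\<^sub>t f)" using eqv_refl[OF wt_smul[OF f]] by simp
  also have "eqv S R \<dots> (1 *\<^sub>t f +\<^sub>t (- 1) *\<^sub>t f)" by (rule eqv_add_smul[OF f])
  also have "eqv S R \<dots> (f +\<^sub>t (- 1) *\<^sub>t f)"
    using f by (intro eqv_cong_add[of _ _ _ _ _ _ m n] eqv_smul_one eqv_refl wt_smul)
  also have "eqv S R \<dots> (TZero m n)" by (rule eqv_add_inverse[OF f])
  finally show ?thesis .
qed

text \<open>Representatives make the operations on classes total, so that the associative, commutative and
  distributive laws hold for arbitrary sets of expressions, without typing premises.\<close>

locale presentation =
  fixes S :: "'g signature" and R :: "('g, 'k::field) tm \<Rightarrow> ('g, 'k) tm \<Rightarrow> bool"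
begin

abbreviation cls :: "('g, 'k) tm \<Rightarrow> ('g, 'k) tm set" where "cls \<equiv> eqv_class S R"

definition rp :: "('g, 'k) tm set \<Rightarrow> ('g, 'k) tm" where "rp X = (SOME f. cls f = X)"

definition cmp (infixl "\<odot>" 70) where "X \<odot> Y = cls (rp X \<cdot> rp Y)"
definition tns (infixl "\<boxtimes>" 75) where "X \<boxtimes> Y = cls (rp X \<star> rp Y)"
definition add (infixl "\<boxplus>" 65) where "X \<boxplus> Y = cls (rp X +\<^sub>t rp Y)"
definition sml (infixr "\<boxdot>" 68) where "c \<boxdot> X = cls (c *\<^sub>t rp X)"
definition idn where "idn n = cls (TId n)"
definition zer where "zer m n = cls (TZero m n)"
definition ar where "ar m n X \<longleftrightarrow> (\<exists>f. wt S m n f \<and> X = cls f)"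
definition arp where "arp p m n X \<longleftrightarrow> (\<exists>f. wtp S p m n f \<and> X = cls f)"

lemma cls_rp [simp]: "cls (rp (cls f)) = cls f"
  unfolding rp_def by (rule someI) (rule refl)

lemma cls_ops:
  "cls (f \<cdot> g) = cls f \<odot> cls g" "cls (f \<star> g) = cls f \<boxtimes> cls g"
  "cls (f +\<^sub>t g) = cls f \<boxplus> cls g" "cls (c *\<^sub>t f) = c \<boxdot> cls f"
  "cls (TId n) = idn n" "cls (TZero m n) = zer m n"
  unfolding cmp_def tns_def add_def sml_def idn_def zer_def
  by (rule eqv_class_cong; simp)+ simp_all

lemma cls_arI: "wt S m n f \<Longrightarrow> ar m n (cls f)" and cls_arpI: "wtp S p m n f \<Longrightarrow> arp p m n (cls f)"
  by (auto simp: ar_def arp_def)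

lemma arp_ar: "arp p m n X \<Longrightarrow> ar m n X"
  unfolding arp_def ar_def using wtp_wt by blast

lemma total_laws:
  "X \<odot> Y \<odot> Z = X \<odot> (Y \<odot> Z)" "X \<boxtimes> Y \<boxtimes> Z = X \<boxtimes> (Y \<boxtimes> Z)" "X \<boxplus> Y \<boxplus> Z = X \<boxplus> (Y \<boxplus> Z)" "X \<boxplus> Y = Y \<boxplus> X"
  "X \<odot> (Y \<boxplus> Z) = X \<odot> Y \<boxplus> X \<odot> Z" "(X \<boxplus> Y) \<odot> Z = X \<odot> Z \<boxplus> Y \<odot> Z"
  "X \<boxtimes> (Y \<boxplus> Z) = X \<boxtimes> Y \<boxplus> X \<boxtimes> Z" "(X \<boxplus> Y) \<boxtimes> Z = X \<boxtimes> Z \<boxplus> Y \<boxtimes> Z"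
  "(c \<boxdot> X) \<odot> Y = c \<boxdot> (X \<odot> Y)" "X \<odot> (c \<boxdot> Y) = c \<boxdot> (X \<odot> Y)"
  "(c \<boxdot> X) \<boxtimes> Y = c \<boxdot> (X \<boxtimes> Y)" "X \<boxtimes> (c \<boxdot> Y) = c \<boxdot> (X \<boxtimes> Y)"
  "c \<boxdot> d \<boxdot> X = (c * d) \<boxdot> X" "c \<boxdot> (X \<boxplus> Y) = c \<boxdot> X \<boxplus> c \<boxdot> Y" "(c + d) \<boxdot> X = c \<boxdot> X \<boxplus> d \<boxdot> X"
proof -
  define f g h where "f = rp X" and "g = rp Y" and "h = rp Z"
  have fgh: "cls (rp X) = cls f" "cls (rp Y) = cls g" "cls (rp Z) = cls h"
    by (simp_all add: f_def g_def h_def)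
  have cmp_red:
    "\<And>W. X \<odot> W = cls f \<odot> W" "\<And>W. Y \<odot> W = cls g \<odot> W" "\<And>W. W \<odot> Y = W \<odot> cls g" "\<And>W. W \<odot> Z = W \<odot> cls h"
    unfolding cmp_def by (rule eqv_class_cong(1); simp add: fgh)+
  have tns_red:
    "\<And>W. X \<boxtimes> W = cls f \<boxtimes> W" "\<And>W. Y \<boxtimes> W = cls g \<boxtimes> W" "\<And>W. W \<boxtimes> Y = W \<boxtimes> cls g" "\<And>W. W \<boxtimes> Z = W \<boxtimes> cls h"
    unfolding tns_def by (rule eqv_class_cong(2); simp add: fgh)+
  have add_red:
    "\<And>W. X \<boxplus> W = cls f \<boxplus> W" "\<And>W. Y \<boxplus> W = cls g \<boxplus> W" "\<And>W. W \<boxplus> X = W \<boxplus> cls f"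
    "\<And>W. W \<boxplus> Y = W \<boxplus> cls g" "\<And>W. W \<boxplus> Z = W \<boxplus> cls h"
    unfolding add_def by (rule eqv_class_cong(3); simp add: fgh)+
  have sml_red: "\<And>c. c \<boxdot> X = c \<boxdot> cls f" "\<And>c. c \<boxdot> Y = c \<boxdot> cls g"
    unfolding sml_def by (rule eqv_class_cong(4); simp add: fgh)+
  note X = cmp_red tns_red add_red sml_red
  show "X \<odot> Y \<odot> Z = X \<odot> (Y \<odot> Z)"
    unfolding X unfolding cls_ops[symmetric]
    by (rule eqv_class_eqI; simp only: wt_simps; blast intro: eqv_comp_assoc eqv_sym)
  show "X \<boxtimes> Y \<boxtimes> Z = X \<boxtimes> (Y \<boxtimes> Z)"
    unfolding X unfolding cls_ops[symmetric]
    by (rule eqv_class_eqI; simp only: wt_simps; blast intro: eqv_tens_assoc eqv_sym)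
  show "X \<boxplus> Y \<boxplus> Z = X \<boxplus> (Y \<boxplus> Z)"
    unfolding X unfolding cls_ops[symmetric]
    by (rule eqv_class_eqI; simp only: wt_simps; blast intro: eqv_add_assoc eqv_sym)
  show "X \<boxplus> Y = Y \<boxplus> X"
    unfolding X unfolding cls_ops[symmetric]
    by (rule eqv_class_eqI; simp only: wt_simps; blast intro: eqv_add_commute)
  show "X \<odot> (Y \<boxplus> Z) = X \<odot> Y \<boxplus> X \<odot> Z"
    unfolding X unfolding cls_ops[symmetric]
  proof (rule eqv_class_eqI; simp only: wt_simps)
    fix m n assume "(\<exists>l. wt S l n f \<and> wt S m l g) \<and> (\<exists>l. wt S l n f \<and> wt S m l h)"
    then have "\<exists>l. wt S l n f \<and> wt S m l g \<and> wt S m l h" using wt_unique by metis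
    then show "eqv S R (f \<cdot> g +\<^sub>t f \<cdot> h) (f \<cdot> (g +\<^sub>t h))" by (blast intro: eqv_comp_add_right eqv_sym)
  qed (blast intro: eqv_comp_add_right)
  show "(X \<boxplus> Y) \<odot> Z = X \<odot> Z \<boxplus> Y \<odot> Z"
    unfolding X unfolding cls_ops[symmetric]
  proof (rule eqv_class_eqI; simp only: wt_simps)
    fix m n assume "(\<exists>l. wt S l n f \<and> wt S m l h) \<and> (\<exists>l. wt S l n g \<and> wt S m l h)"
    then have "\<exists>l. wt S l n f \<and> wt S l n g \<and> wt S m l h" using wt_unique by metis
    then show "eqv S R (f \<cdot> h +\<^sub>t g \<cdot> h) ((f +\<^sub>t g) \<cdot> h)" by (blast intro: eqv_comp_add_left eqv_sym)
  qed (blast intro: eqv_comp_add_left)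
  show "X \<boxtimes> (Y \<boxplus> Z) = X \<boxtimes> Y \<boxplus> X \<boxtimes> Z"
    unfolding X unfolding cls_ops[symmetric]
  proof (rule eqv_class_eqI; simp only: wt_simps)
    fix m n assume *: "(\<exists>m1 m2 n1 n2. m = m1 + m2 \<and> n = n1 + n2 \<and> wt S m1 n1 f \<and> wt S m2 n2 g) \<and>
      (\<exists>m1 m2 n1 n2. m = m1 + m2 \<and> n = n1 + n2 \<and> wt S m1 n1 f \<and> wt S m2 n2 h)"
    then obtain m1 m2 n1 n2 m1' m2' n1' n2' where
      "m = m1 + m2" "n = n1 + n2" "wt S m1 n1 f" "wt S m2 n2 g"
      "m = m1' + m2'" "n = n1' + n2'" "wt S m1' n1' f" "wt S m2' n2' h" by blast
    moreover from this have "m1 = m1' \<and> n1 = n1'" using wt_unique by blast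
    ultimately show "eqv S R (f \<star> g +\<^sub>t f \<star> h) (f \<star> (g +\<^sub>t h))"
      by (intro eqv_sym[OF eqv_tens_add_right[of _ m1 n1 _ m2 n2]]) auto
  qed (blast intro: eqv_tens_add_right)
  show "(X \<boxplus> Y) \<boxtimes> Z = X \<boxtimes> Z \<boxplus> Y \<boxtimes> Z"
    unfolding X unfolding cls_ops[symmetric]
  proof (rule eqv_class_eqI; simp only: wt_simps)
    fix m n assume *: "(\<exists>m1 m2 n1 n2. m = m1 + m2 \<and> n = n1 + n2 \<and> wt S m1 n1 f \<and> wt S m2 n2 h) \<and>
      (\<exists>m1 m2 n1 n2. m = m1 + m2 \<and> n = n1 + n2 \<and> wt S m1 n1 g \<and> wt S m2 n2 h)"
    then obtain m1 m2 n1 n2 m1' m2' n1' n2' where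
      "m = m1 + m2" "n = n1 + n2" "wt S m1 n1 f" "wt S m2 n2 h"
      "m = m1' + m2'" "n = n1' + n2'" "wt S m1' n1' g" "wt S m2' n2' h" by blast
    moreover from this have "m2 = m2' \<and> n2 = n2'" using wt_unique by blast
    ultimately show "eqv S R (f \<star> h +\<^sub>t g \<star> h) ((f +\<^sub>t g) \<star> h)"
      by (intro eqv_sym[OF eqv_tens_add_left[of _ m1 n1 _ _ m2 n2]]) auto
  qed (blast intro: eqv_tens_add_left)
  show "(c \<boxdot> X) \<odot> Y = c \<boxdot> (X \<odot> Y)"
    unfolding X unfolding cls_ops[symmetric]
    by (rule eqv_class_eqI; simp only: wt_simps; blast intro: eqv_comp_smul_left eqv_sym)
  show "X \<odot> (c \<boxdot> Y) = c \<boxdot> (X \<odot> Y)"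
    unfolding X unfolding cls_ops[symmetric]
    by (rule eqv_class_eqI; simp only: wt_simps; blast intro: eqv_comp_smul_right eqv_sym)
  show "(c \<boxdot> X) \<boxtimes> Y = c \<boxdot> (X \<boxtimes> Y)"
    unfolding X unfolding cls_ops[symmetric]
    by (rule eqv_class_eqI; simp only: wt_simps; blast intro: eqv_tens_smul_left eqv_sym)
  show "X \<boxtimes> (c \<boxdot> Y) = c \<boxdot> (X \<boxtimes> Y)"
    unfolding X unfolding cls_ops[symmetric]
    by (rule eqv_class_eqI; simp only: wt_simps; blast intro: eqv_tens_smul_right eqv_sym)
  show "c \<boxdot> d \<boxdot> X = (c * d) \<boxdot> X"
    unfolding X unfolding cls_ops[symmetric]
    by (rule eqv_class_eqI; simp only: wt_simps; blast intro: eqv_smul_smul eqv_sym)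
  show "c \<boxdot> (X \<boxplus> Y) = c \<boxdot> X \<boxplus> c \<boxdot> Y"
    unfolding X unfolding cls_ops[symmetric]
    by (rule eqv_class_eqI; simp only: wt_simps; blast intro: eqv_smul_add eqv_sym)
  show "(c + d) \<boxdot> X = c \<boxdot> X \<boxplus> d \<boxdot> X"
    unfolding X unfolding cls_ops[symmetric]
    by (rule eqv_class_eqI; simp only: wt_simps; blast intro: eqv_add_smul eqv_sym)
qed

end

section \<open>Presented monoidal supercategories\<close>

definition parity_graded :: "'g signature \<Rightarrow> bool" where
  "parity_graded S \<longleftrightarrow> (\<forall>x\<in>gens S. \<exists>k::int. int (gtgt S x) - int (gsrc S x) = 2 * k \<and> gpar S x = of_int k)"

context presentation begin

lemma ar_cmp: "ar l n X \<Longrightarrow> ar m l Y \<Longrightarrow> ar m n (X \<odot> Y)"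
  and ar_tns: "ar m n X \<Longrightarrow> ar m' n' Y \<Longrightarrow> ar (m + m') (n + n') (X \<boxtimes> Y)"
  and ar_add: "ar m n X \<Longrightarrow> ar m n Z \<Longrightarrow> ar m n (X \<boxplus> Z)"
  and ar_sml: "ar m n X \<Longrightarrow> ar m n (c \<boxdot> X)"
  and ar_idn: "ar n n (idn n)" and ar_zer: "ar m n (zer m n)"
  unfolding ar_def
  by (elim exE conjE, simp only: cls_ops[symmetric], blast intro: wt.intros)+
    (auto simp flip: cls_ops intro: wt.intros)

lemma arp_cmp: "arp p l n X \<Longrightarrow> arp r m l Y \<Longrightarrow> arp (p + r) m n (X \<odot> Y)"
  and arp_tns: "arp p m n X \<Longrightarrow> arp r m' n' Y \<Longrightarrow> arp (p + r) (m + m') (n + n') (X \<boxtimes> Y)"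
  and arp_add: "arp p m n X \<Longrightarrow> arp p m n Z \<Longrightarrow> arp p m n (X \<boxplus> Z)"
  and arp_sml: "arp p m n X \<Longrightarrow> arp p m n (c \<boxdot> X)"
  and arp_idn: "arp 0 n n (idn n)" and arp_zer: "arp p m n (zer m n)"
  unfolding arp_def
  by (elim exE conjE, simp only: cls_ops[symmetric], blast intro: wtp.intros)+
    (auto simp flip: cls_ops intro: wtp.intros)

lemma ar_unique: "ar m n X \<Longrightarrow> ar m' n' X \<Longrightarrow> m = m' \<and> n = n'"
  unfolding ar_def using eqv_class_eqD eqv_wt_iff wt_unique by (metis (no_types))

lemma unit_laws:
  assumes "ar m n X"
  shows "idn n \<odot> X = X" "X \<odot> idn m = X" "idn 0 \<boxtimes> X = X" "X \<boxtimes> idn 0 = X" "1 \<boxdot> X = X"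
    "X \<boxplus> zer m n = X" "X \<boxplus> (- 1) \<boxdot> X = zer m n" "0 \<boxdot> X = zer m n"
proof -
  obtain f where f: "wt S m n f" "X = cls f" using assms by (auto simp: ar_def)
  show "idn n \<odot> X = X" "X \<odot> idn m = X" "idn 0 \<boxtimes> X = X" "X \<boxtimes> idn 0 = X" "1 \<boxdot> X = X"
    "X \<boxplus> zer m n = X" "X \<boxplus> (- 1) \<boxdot> X = zer m n" "0 \<boxdot> X = zer m n"
    unfolding f(2) cls_ops[symmetric]
    by (rule eqv_class_eq; rule eqv_comp_id_left[OF f(1)] eqv_comp_id_right[OF f(1)]
        eqv_tens_unit_left[OF f(1)] eqv_tens_unit_right[OF f(1)] eqv_smul_one[OF f(1)]
        eqv_add_zero[OF f(1)] eqv_add_inverse[OF f(1)] eqv_smul_zero[OF f(1)])+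
qed

lemma idn_tns: "idn m \<boxtimes> idn n = idn (m + n)"
  unfolding cls_ops[symmetric] by (rule eqv_class_eq) (rule eqv_tens_id)

lemma idn_idn: "idn m \<odot> idn m = idn m"
  by (rule unit_laws(1)[OF ar_idn])

lemma zer_laws:
  assumes "ar m n X"
  shows "zer n k \<odot> X = zer m k" "X \<odot> zer k m = zer k n"
    "zer k l \<boxtimes> X = zer (k + m) (l + n)" "X \<boxtimes> zer k l = zer (m + k) (n + l)" "c \<boxdot> zer k l = zer k l"
proof -
  have z: "zer k l = 0 \<boxdot> zer k l" for k l using unit_laws(8)[OF ar_zer] by simp
  show "zer n k \<odot> X = zer m k" by (subst z, unfold total_laws) (rule unit_laws(8)[OF ar_cmp[OF ar_zer assms]])
  show "X \<odot> zer k m = zer k n" by (subst z, unfold total_laws) (rule unit_laws(8)[OF ar_cmp[OF assms ar_zer]])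
  show "zer k l \<boxtimes> X = zer (k + m) (l + n)" by (subst z, unfold total_laws) (rule unit_laws(8)[OF ar_tns[OF ar_zer assms]])
  show "X \<boxtimes> zer k l = zer (m + k) (n + l)" by (subst z, unfold total_laws) (rule unit_laws(8)[OF ar_tns[OF assms ar_zer]])
  show "c \<boxdot> zer k l = zer k l" by (subst z, unfold total_laws) (simp add: unit_laws(8)[OF ar_zer])
qed

lemma interchange:
  assumes "arp p l n X" "arp r l' n' Y" "arp s m l Z" "arp t m' l' W"
  shows "(X \<boxtimes> Y) \<odot> (Z \<boxtimes> W) = koszul_sign r s \<boxdot> ((X \<odot> Z) \<boxtimes> (Y \<odot> W))"
proof -
  obtain f g h k where f: "wtp S p l n f" "X = cls f" and g: "wtp S r l' n' g" "Y = cls g"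
    and h: "wtp S s m l h" "Z = cls h" and k: "wtp S t m' l' k" "W = cls k"
    using assms unfolding arp_def by blast
  show ?thesis unfolding f(2) g(2) h(2) k(2) cls_ops[symmetric]
    by (rule eqv_class_eq[OF eqv_interchange[OF f(1) g(1) h(1) k(1)]])
qed

lemma add_left_commute: "X \<boxplus> (Y \<boxplus> Z) = Y \<boxplus> (X \<boxplus> Z)"
  using total_laws(3)[of X Y Z] total_laws(3)[of Y X Z] total_laws(4)[of X Y] by simp

lemmas add_ac = total_laws(3,4) add_left_commute

lemma homogeneous_parts:
  assumes "ar m n X"
  obtains X0 X1 where "arp 0 m n X0" "arp 1 m n X1" "X = X0 \<boxplus> X1"
proof -
  obtain f where f: "wt S m n f" "X = cls f" using assms by (auto simp: ar_def)
  have "\<exists>X0 X1. arp 0 m n X0 \<and> arp 1 m n X1 \<and> cls f = X0 \<boxplus> X1"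
    using f(1)
  proof (induction rule: wt.induct)
    case (wt_id m)
    have "cls (TId m) = idn m \<boxplus> zer m m" using unit_laws(6)[OF ar_idn] by (simp add: cls_ops)
    then show ?case using arp_idn arp_zer by blast
  next
    case (wt_gen x)
    have x: "arp (gpar S x) (gsrc S x) (gtgt S x) (cls (TGen x))" using wtp_gen[OF wt_gen] by (rule cls_arpI)
    have e: "cls (TGen x) = cls (TGen x) \<boxplus> zer (gsrc S x) (gtgt S x)" using unit_laws(6)[OF arp_ar[OF x]] by simp
    show ?case
    proof (cases "gpar S x")
      case zero
      then show ?thesis using x e arp_zer by metis
    next
      case one
      then show ?thesis using x e arp_zer total_laws(4) by metis
    qed
  next
    case (wt_zero m n)
    have "cls (TZero m n) = zer m n \<boxplus> zer m n" using unit_laws(6)[OF ar_zer] by (simp add: cls_ops)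
    then show ?case using arp_zer by blast
  next
    case (wt_comp l n f m g)
    then obtain X0 X1 Y0 Y1 where *: "arp 0 l n X0" "arp 1 l n X1" "cls f = X0 \<boxplus> X1"
      "arp 0 m l Y0" "arp 1 m l Y1" "cls g = Y0 \<boxplus> Y1" by blast
    have "cls (f \<cdot> g) = (X0 \<odot> Y0 \<boxplus> X1 \<odot> Y1) \<boxplus> (X0 \<odot> Y1 \<boxplus> X1 \<odot> Y0)"
      by (simp only: cls_ops * total_laws(5,6) add_ac)
    moreover have "arp 0 m n (X0 \<odot> Y0 \<boxplus> X1 \<odot> Y1)" "arp 1 m n (X0 \<odot> Y1 \<boxplus> X1 \<odot> Y0)"
      using arp_cmp[OF *(1,4)] arp_cmp[OF *(2,5)] arp_cmp[OF *(1,5)] arp_cmp[OF *(2,4)]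
      by (auto intro!: arp_add simp: add_bit_eq_xor)
    ultimately show ?case by blast
  next
    case (wt_tens m n f m' n' g)
    then obtain X0 X1 Y0 Y1 where *: "arp 0 m n X0" "arp 1 m n X1" "cls f = X0 \<boxplus> X1"
      "arp 0 m' n' Y0" "arp 1 m' n' Y1" "cls g = Y0 \<boxplus> Y1" by blast
    have "cls (f \<star> g) = (X0 \<boxtimes> Y0 \<boxplus> X1 \<boxtimes> Y1) \<boxplus> (X0 \<boxtimes> Y1 \<boxplus> X1 \<boxtimes> Y0)"
      by (simp only: cls_ops * total_laws(7,8) add_ac)
    moreover have "arp 0 (m + m') (n + n') (X0 \<boxtimes> Y0 \<boxplus> X1 \<boxtimes> Y1)" "arp 1 (m + m') (n + n') (X0 \<boxtimes> Y1 \<boxplus> X1 \<boxtimes> Y0)"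
      using arp_tns[OF *(1,4)] arp_tns[OF *(2,5)] arp_tns[OF *(1,5)] arp_tns[OF *(2,4)]
      by (auto intro!: arp_add simp: add_bit_eq_xor)
    ultimately show ?case by blast
  next
    case (wt_add m n f g)
    then obtain X0 X1 Y0 Y1 where *: "arp 0 m n X0" "arp 1 m n X1" "cls f = X0 \<boxplus> X1"
      "arp 0 m n Y0" "arp 1 m n Y1" "cls g = Y0 \<boxplus> Y1" by blast
    have "cls (f +\<^sub>t g) = (X0 \<boxplus> Y0) \<boxplus> (X1 \<boxplus> Y1)"
      by (simp only: cls_ops * add_ac)
    then show ?case using arp_add[OF *(1,4)] arp_add[OF *(2,5)] by blast
  next
    case (wt_smul m n f c)
    then obtain X0 X1 where *: "arp 0 m n X0" "arp 1 m n X1" "cls f = X0 \<boxplus> X1" by blast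
    have "cls (c *\<^sub>t f) = c \<boxdot> X0 \<boxplus> c \<boxdot> X1" by (simp only: cls_ops * total_laws(14))
    then show ?case using arp_sml[OF *(1)] arp_sml[OF *(2)] by blast
  qed
  then show thesis using that f(2) by blast
qed

lemma interchange_even_second:
  assumes "ar l n X" "arp 0 l' n' Y" "ar m l Z" "ar m' l' W"
  shows "(X \<boxtimes> Y) \<odot> (Z \<boxtimes> W) = (X \<odot> Z) \<boxtimes> (Y \<odot> W)"
proof -
  have one: "(X \<boxtimes> Y) \<odot> (Z \<boxtimes> W) = (X \<odot> Z) \<boxtimes> (Y \<odot> W)"
    if "arp p l n X" "arp s m l Z" "arp t m' l' W" for p s t X Z W
    unfolding interchange[OF that(1) assms(2) that(2,3)] koszul_sign_zero
    by (rule unit_laws(5)[OF ar_tns[OF ar_cmp ar_cmp]]) (use that assms(2) arp_ar in blast)+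
  obtain X0 X1 Z0 Z1 W0 W1 where "arp 0 l n X0" "arp 1 l n X1" "X = X0 \<boxplus> X1"
    "arp 0 m l Z0" "arp 1 m l Z1" "Z = Z0 \<boxplus> Z1" "arp 0 m' l' W0" "arp 1 m' l' W1" "W = W0 \<boxplus> W1"
    using homogeneous_parts[OF assms(1)] homogeneous_parts[OF assms(3)] homogeneous_parts[OF assms(4)] by metis
  then show ?thesis by (simp only: total_laws(5-8) one)
qed

lemma interchange_even_third:
  assumes "ar l n X" "ar l' n' Y" "arp 0 m l Z" "ar m' l' W"
  shows "(X \<boxtimes> Y) \<odot> (Z \<boxtimes> W) = (X \<odot> Z) \<boxtimes> (Y \<odot> W)"
proof -
  have one: "(X \<boxtimes> Y) \<odot> (Z \<boxtimes> W) = (X \<odot> Z) \<boxtimes> (Y \<odot> W)"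
    if "arp p l n X" "arp s l' n' Y" "arp t m' l' W" for p s t X Y W
    unfolding interchange[OF that(1,2) assms(3) that(3)] koszul_sign_zero
    by (rule unit_laws(5)[OF ar_tns[OF ar_cmp ar_cmp]]) (use that assms(3) arp_ar in blast)+
  obtain X0 X1 Y0 Y1 W0 W1 where "arp 0 l n X0" "arp 1 l n X1" "X = X0 \<boxplus> X1"
    "arp 0 l' n' Y0" "arp 1 l' n' Y1" "Y = Y0 \<boxplus> Y1" "arp 0 m' l' W0" "arp 1 m' l' W1" "W = W0 \<boxplus> W1"
    using homogeneous_parts[OF assms(1)] homogeneous_parts[OF assms(2)] homogeneous_parts[OF assms(4)] by metis
  then show ?thesis by (simp only: total_laws(5-8) one)
qed

lemma cmp_tns_idn: "ar l n X \<Longrightarrow> ar m l Y \<Longrightarrow> (X \<boxtimes> idn k) \<odot> (Y \<boxtimes> idn k) = (X \<odot> Y) \<boxtimes> idn k"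
  using interchange_even_second[OF _ arp_idn _ ar_idn] by (simp add: idn_idn)

lemma cmp_idn_tns: "ar l n X \<Longrightarrow> ar m l Y \<Longrightarrow> (idn k \<boxtimes> X) \<odot> (idn k \<boxtimes> Y) = idn k \<boxtimes> (X \<odot> Y)"
  using interchange_even_third[OF ar_idn _ arp_idn] by (simp add: idn_idn)

lemma tns_split: "ar a b X \<Longrightarrow> ar c d Y \<Longrightarrow> (X \<boxtimes> idn d) \<odot> (idn a \<boxtimes> Y) = X \<boxtimes> Y"
  using interchange_even_second[OF _ arp_idn ar_idn, of a b X c d Y] by (simp add: unit_laws)

lemma tns_split_even: "ar a b X \<Longrightarrow> ar c d Y \<Longrightarrow> arp 0 a b X \<or> arp 0 c d Y \<Longrightarrow>
    (idn b \<boxtimes> Y) \<odot> (X \<boxtimes> idn c) = X \<boxtimes> Y"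
  using interchange_even_second[of b b "idn b" c d Y a X c "idn c"]
    interchange_even_third[of b b "idn b" c d Y a X c "idn c"]
  by (elim disjE) (simp_all add: unit_laws ar_idn)

lemma tns_split_odd:
  assumes "arp 1 a b X" "arp 1 c d Y"
  shows "(idn b \<boxtimes> Y) \<odot> (X \<boxtimes> idn c) = (- 1) \<boxdot> (X \<boxtimes> Y)"
  using interchange[OF arp_idn assms(2,1) arp_idn] unit_laws[OF arp_ar[OF assms(1)]] unit_laws[OF arp_ar[OF assms(2)]]
  by (simp add: koszul_sign_def)

definition pad where "pad i X j = idn i \<boxtimes> X \<boxtimes> idn j"

lemma ar_pad: "ar m n X \<Longrightarrow> ar (i + m + j) (i + n + j) (pad i X j)"
  unfolding pad_def by (intro ar_tns ar_idn)

lemma arp_pad: "arp p m n X \<Longrightarrow> arp p (i + m + j) (i + n + j) (pad i X j)"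
  unfolding pad_def using arp_tns[OF arp_tns[OF arp_idn] arp_idn] by (metis add_0 add.right_neutral)

lemma pad_cmp: "ar l n X \<Longrightarrow> ar m l Y \<Longrightarrow> pad i X j \<odot> pad i Y j = pad i (X \<odot> Y) j"
  unfolding pad_def using cmp_tns_idn[OF ar_tns[OF ar_idn] ar_tns[OF ar_idn]] cmp_idn_tns by metis

lemma pad_pad: "pad i (pad k X l) j = pad (i + k) X (l + j)"
  unfolding pad_def idn_tns[symmetric] by (simp only: total_laws(2))

lemma pad_add: "pad i (X \<boxplus> Y) j = pad i X j \<boxplus> pad i Y j"
  and pad_sml: "pad i (c \<boxdot> X) j = c \<boxdot> pad i X j"
  and pad_zer: "pad i (zer m n) j = zer (i + m + j) (i + n + j)"
  and pad_idn: "pad i (idn m) j = idn (i + m + j)"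
  by (simp_all only: pad_def total_laws(7,8,11,12) idn_tns zer_laws(3,4)[OF ar_idn])

lemma pad_far:
  assumes "ar a b X" "ar c d Y" "arp 0 a b X \<or> arp 0 c d Y"
  shows "pad i X (k + d + j) \<odot> pad (i + a + k) Y j = pad (i + b + k) Y j \<odot> pad i X (k + c + j)"
proof -
  have "pad i X (k + d + j) \<odot> pad (i + a + k) Y j = pad i ((X \<boxtimes> idn (k + d)) \<odot> (idn a \<boxtimes> (idn k \<boxtimes> Y))) j"
    by (subst pad_cmp[symmetric, of _ "b + (k + d)" _ "a + (k + c)"])
      (auto intro!: ar_tns ar_idn assms simp: pad_def total_laws(2) simp flip: idn_tns)
  also have "(X \<boxtimes> idn (k + d)) \<odot> (idn a \<boxtimes> (idn k \<boxtimes> Y)) = X \<boxtimes> (idn k \<boxtimes> Y)"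
    by (rule tns_split[OF assms(1) ar_tns[OF ar_idn assms(2)]])
  also have "\<dots> = (idn b \<boxtimes> (idn k \<boxtimes> Y)) \<odot> (X \<boxtimes> idn (k + c))"
  proof -
    have "arp 0 c d Y \<Longrightarrow> arp 0 (k + c) (k + d) (idn k \<boxtimes> Y)" using arp_tns[OF arp_idn, of 0 c d Y k] by simp
    then have "arp 0 a b X \<or> arp 0 (k + c) (k + d) (idn k \<boxtimes> Y)" using assms(3) by blast
    from tns_split_even[OF assms(1) ar_tns[OF ar_idn assms(2)] this] show ?thesis by simp
  qed
  also have "pad i \<dots> j = pad (i + b + k) Y j \<odot> pad i X (k + c + j)"
    by (subst pad_cmp[symmetric, of "b + (k + c)" "b + (k + d)" _ "a + (k + c)"])
      (auto intro!: ar_tns ar_idn assms simp: pad_def total_laws(2) simp flip: idn_tns)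
  finally show ?thesis .
qed

lemma wrong_parity_zero:
  assumes "parity_graded S" "arp p m n X" "\<not> (\<exists>k::int. int n - int m = 2 * k \<and> p = of_int k)"
  shows "X = zer m n"
proof -
  obtain f where f: "wtp S p m n f" "X = cls f" using assms(2) by (auto simp: arp_def)
  have "(\<exists>k::int. int n - int m = 2 * k \<and> p = of_int k) \<or> cls f = zer m n" using f(1)
  proof (induction rule: wtp.induct)
    case (wtp_id m)
    then show ?case by (intro disjI1 exI[of _ 0]) simp
  next
    case (wtp_gen x)
    then show ?case using assms(1) by (auto simp: parity_graded_def)
  next
    case (wtp_comp p l n f r m g)
    have z: "cls f = zer l n \<or> cls g = zer m l \<Longrightarrow> cls (f \<cdot> g) = zer m n"
      using zer_laws[OF cls_arI[OF wtp_wt[OF wtp_comp(1)]]] zer_laws[OF cls_arI[OF wtp_wt[OF wtp_comp(2)]]]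
      by (auto simp: cls_ops)
    have "\<exists>k::int. int n - int m = 2 * k \<and> p + r = of_int k"
      if "int n - int l = 2 * a" "p = of_int a" "int l - int m = 2 * b" "r = of_int b" for a b
      using that by (intro exI[of _ "a + b"]) simp
    then show ?case using z wtp_comp.IH by blast
  next
    case (wtp_tens p m n f r m' n' g)
    have z: "cls f = zer m n \<or> cls g = zer m' n' \<Longrightarrow> cls (f \<star> g) = zer (m + m') (n + n')"
      using zer_laws[OF cls_arI[OF wtp_wt[OF wtp_tens(1)]]] zer_laws[OF cls_arI[OF wtp_wt[OF wtp_tens(2)]]]
      by (auto simp: cls_ops)
    have "\<exists>k::int. int (n + n') - int (m + m') = 2 * k \<and> p + r = of_int k"
      if "int n - int m = 2 * a" "p = of_int a" "int n' - int m' = 2 * b" "r = of_int b" for a b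
      using that by (intro exI[of _ "a + b"]) simp
    then show ?case using z wtp_tens.IH by blast
  next
    case (wtp_add p m n f g)
    then show ?case using unit_laws(6)[OF ar_zer] by (auto simp: cls_ops)
  next
    case (wtp_smul p m n f c)
    then show ?case using zer_laws(5)[OF ar_zer] by (auto simp: cls_ops)
  qed (simp_all add: cls_ops)
  then show ?thesis using assms(3) f(2) by blast
qed

lemma cls_empty_iff: "cls f = {} \<longleftrightarrow> \<not> (\<exists>m n. wt S m n f)"
proof
  assume "cls f = {}"
  then show "\<not> (\<exists>m n. wt S m n f)" unfolding eqv_class_def using eqv_refl by fast
next
  assume "\<not> (\<exists>m n. wt S m n f)"
  then show "cls f = {}" unfolding eqv_class_def using eqv_wt by fast
qed

definition isc where "isc X \<longleftrightarrow> X \<in> range cls"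

lemma isc [simp]: "isc (cls f)" "isc (X \<odot> Y)" "isc (X \<boxtimes> Y)" "isc (X \<boxplus> Y)" "isc (c \<boxdot> X)" "isc (idn n)" "isc (zer m n)"
  by (auto simp: isc_def cmp_def tns_def add_def sml_def idn_def zer_def)

lemma ar_isc: "ar m n X \<Longrightarrow> isc X"
  by (auto simp: ar_def)

lemma presented_simps:
  "Ident (presented_supercat S R) m = idn m" "Zero (presented_supercat S R) m n = zer m n"
  "X \<in> Hom (presented_supercat S R) m n \<longleftrightarrow> ar m n X"
  "X \<in> Hom\<^sub>p (presented_supercat S R) p m n \<longleftrightarrow> arp p m n X"
  "Obj (presented_supercat S R) = UNIV" "UnitO (presented_supercat S R) = 0" "TensO (presented_supercat S R) = (+)"
  by (auto simp: presented_supercat_def cls_ops ar_def arp_def)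


end

context presentation begin

lemma presented_ops:
  assumes "isc X"
  shows "isc Y \<Longrightarrow> Cmp (presented_supercat S R) X Y = X \<odot> Y"
    and "isc Y \<Longrightarrow> Tens (presented_supercat S R) X Y = X \<boxtimes> Y"
    and "isc Y \<Longrightarrow> Add (presented_supercat S R) X Y = X \<boxplus> Y"
    and "Smul (presented_supercat S R) c X = c \<boxdot> X"
proof -
  have mem: "h \<in> cls f \<Longrightarrow> cls h = cls f" for h f
  proof -
    assume "h \<in> cls f"
    then have "eqv S R f h" by (simp add: eqv_class_def)
    from eqv_class_eq[OF this] show "cls h = cls f" by (rule sym)
  qed
  have un: "(\<Union>f'\<in>cls f. F (cls f')) = F (cls f)" if "cls f = {} \<Longrightarrow> F {} = {}" for F :: "_ \<Rightarrow> ('g, 'k) tm set" and f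
    using mem[of _ f] that by (cases "cls f = {}") auto
  obtain f where f: "X = cls f" using assms by (auto simp: isc_def)
  have e1: "\<not> (\<exists>m n. wt S m n f) \<Longrightarrow> \<not> (\<exists>m n. wt S m n (f \<cdot> g)) \<and> \<not> (\<exists>m n. wt S m n (g \<cdot> f))
     \<and> \<not> (\<exists>m n. wt S m n (f \<star> g)) \<and> \<not> (\<exists>m n. wt S m n (g \<star> f))
     \<and> \<not> (\<exists>m n. wt S m n (f +\<^sub>t g)) \<and> \<not> (\<exists>m n. wt S m n (g +\<^sub>t f)) \<and> \<not> (\<exists>m n. wt S m n (c *\<^sub>t f))"
    for f g :: "('g, 'k) tm" and c unfolding wt_simps by blast
  have empty: "X \<odot> {} = {}" "{} \<odot> X = {}" "X \<boxtimes> {} = {}" "{} \<boxtimes> X = {}" "X \<boxplus> {} = {}" "{} \<boxplus> X = {}" "c \<boxdot> {} = {}"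
    if "\<exists>f. cls f = {}" for X c
  proof -
    have "cls (rp {}) = {}" using that unfolding rp_def by (rule someI_ex)
    then have "\<not> (\<exists>m n. wt S m n (rp {}))" unfolding cls_empty_iff .
    from e1[OF this] show "X \<odot> {} = {}" "{} \<odot> X = {}" "X \<boxtimes> {} = {}" "{} \<boxtimes> X = {}" "X \<boxplus> {} = {}" "{} \<boxplus> X = {}" "c \<boxdot> {} = {}"
      unfolding cmp_def tns_def add_def sml_def cls_empty_iff by blast+
  qed
  { assume "isc Y"
    then obtain g where g: "Y = cls g" by (auto simp: isc_def)
    have bin: "(\<Union>f'\<in>X. \<Union>g'\<in>Y. F (cls f') (cls g')) = F X Y"
      if "\<exists>f. cls f = {} \<Longrightarrow> (\<forall>X. F X {} = {} \<and> F {} X = {})" for F :: "_ \<Rightarrow> _ \<Rightarrow> ('g, 'k) tm set"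
    proof -
      have "(\<Union>g'\<in>Y. F (cls f') (cls g')) = F (cls f') Y" for f'
        unfolding g using that by (intro un) blast
      moreover have "(\<Union>f'\<in>X. F (cls f') Y) = F X Y"
        unfolding f using that by (intro un) blast
      ultimately show ?thesis by simp
    qed
    show "Cmp (presented_supercat S R) X Y = X \<odot> Y" "Tens (presented_supercat S R) X Y = X \<boxtimes> Y"
      "Add (presented_supercat S R) X Y = X \<boxplus> Y"
      unfolding presented_supercat_def supercat.simps cls_ops by (rule bin; use empty in blast)+ }
  show "Smul (presented_supercat S R) c X = c \<boxdot> X"
    unfolding presented_supercat_def supercat.simps cls_ops f using empty by (intro un) blast
qed

lemmas presented = presented_simps presented_ops ar_isc arp_ar[THEN ar_isc]

lemma hom_space_module: "Module.module scalars (hom_space (presented_supercat S R) m n)"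
proof (rule moduleI)
  show "cring (scalars :: 'k ring)"
    by (rule cringI) (auto simp: scalars_def algebra_simps intro!: abelian_groupI comm_monoidI exI[of _ "- _"])
  show "abelian_group (hom_space (presented_supercat S R) m n)"
  proof (rule abelian_groupI)
    fix X assume "X \<in> carrier (hom_space (presented_supercat S R) m n)"
    then have X: "ar m n X" by (simp add: hom_space_def presented)
    have "(- 1) \<boxdot> X \<boxplus> X = zer m n" using unit_laws(7)[OF X] by (simp add: total_laws(4))
    then show "\<exists>Y\<in>carrier (hom_space (presented_supercat S R) m n). Y \<oplus>\<^bsub>hom_space (presented_supercat S R) m n\<^esub> X =
        \<zero>\<^bsub>hom_space (presented_supercat S R) m n\<^esub>"
      using X ar_sml[OF X] ar_isc[OF X] by (intro bexI[of _ "(- 1) \<boxdot> X"]) (simp_all add: hom_space_def presented)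
    show "\<zero>\<^bsub>hom_space (presented_supercat S R) m n\<^esub> \<oplus>\<^bsub>hom_space (presented_supercat S R) m n\<^esub> X = X"
      using X ar_isc[OF X] unit_laws(6)[OF X] by (simp add: hom_space_def presented total_laws(4))
  qed (simp_all add: hom_space_def presented ar_add ar_zer add_ac)
qed (simp_all add: hom_space_def presented scalars_def ar_sml total_laws(13-15) unit_laws)

lemma arp_submodule: "submodule (Hom\<^sub>p (presented_supercat S R) p m n) scalars (hom_space (presented_supercat S R) m n)"
proof -
  interpret M: Module.module scalars "hom_space (presented_supercat S R) m n" by (rule hom_space_module)
  show ?thesis
  proof (rule M.submoduleI)
    fix X assume "X \<in> Hom\<^sub>p (presented_supercat S R) p m n"
    then have X: "arp p m n X" by (simp add: presented)
    have c: "X \<in> carrier (hom_space (presented_supercat S R) m n)"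
      "(- 1) \<boxdot> X \<in> carrier (hom_space (presented_supercat S R) m n)"
      using arp_ar[OF X] ar_sml[OF arp_ar[OF X]] by (simp_all add: hom_space_def presented)
    have "\<ominus>\<^bsub>hom_space (presented_supercat S R) m n\<^esub> X = (- 1) \<boxdot> X"
      using unit_laws(7)[OF arp_ar[OF X]] arp_ar[OF X, THEN ar_isc]
      by (intro abelian_group.minus_equality[OF M.abelian_group_axioms _ c]) (simp add: hom_space_def presented total_laws(4))
    then show "\<ominus>\<^bsub>hom_space (presented_supercat S R) m n\<^esub> X \<in> Hom\<^sub>p (presented_supercat S R) p m n"
      using arp_sml[OF X] by (simp add: presented)
  qed (auto simp: hom_space_def presented arp_ar arp_zer arp_add arp_sml)
qed

lemma presented_supercat_strict_monoidal:
  assumes "parity_graded S"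
  shows "strict_monoidal_supercategory (presented_supercat S R)"
proof -
  have direct: "\<exists>!(X0, X1). arp 0 m n X0 \<and> arp 1 m n X1 \<and> X = X0 \<boxplus> X1" if X: "ar m n X" for m n X
  proof -
    obtain X0 X1 where p: "arp 0 m n X0" "arp 1 m n X1" "X = X0 \<boxplus> X1" by (rule homogeneous_parts[OF X])
    have "(\<forall>Y. arp 0 m n Y \<longrightarrow> Y = zer m n) \<or> (\<forall>Y. arp 1 m n Y \<longrightarrow> Y = zer m n)"
    proof (rule ccontr)
      assume "\<not> ?thesis"
      then obtain Y0 Y1 where "arp 0 m n Y0" "Y0 \<noteq> zer m n" "arp 1 m n Y1" "Y1 \<noteq> zer m n" by blast
      then obtain k l :: int where "int n - int m = 2 * k" "(0::bit) = of_int k" "int n - int m = 2 * l" "(1::bit) = of_int l"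
        using wrong_parity_zero[OF assms] by metis
      then show False by auto
    qed
    moreover have "Y0 = X0 \<and> Y1 = X1" if "arp 0 m n Y0" "arp 1 m n Y1" "X = Y0 \<boxplus> Y1"
      "(\<forall>Y. arp 0 m n Y \<longrightarrow> Y = zer m n) \<or> (\<forall>Y. arp 1 m n Y \<longrightarrow> Y = zer m n)" for Y0 Y1
      using that(4)
    proof
      assume z: "\<forall>Y. arp 0 m n Y \<longrightarrow> Y = zer m n"
      then have "Y0 = zer m n" "X0 = zer m n" using that(1) p(1) by blast+
      then show ?thesis using that(3) p(3) unit_laws(6)[OF arp_ar[OF p(2)]] unit_laws(6)[OF arp_ar[OF that(2)]]
        by (simp add: total_laws(4))
    next
      assume z: "\<forall>Y. arp 1 m n Y \<longrightarrow> Y = zer m n"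
      then have "Y1 = zer m n" "X1 = zer m n" using that(2) p(2) by blast+
      then show ?thesis using that(3) p(3) unit_laws(6)[OF arp_ar[OF p(1)]] unit_laws(6)[OF arp_ar[OF that(1)]]
        by simp
    qed
    ultimately show ?thesis using p by (intro ex1I[of _ "(X0, X1)"]) (simp, auto)
  qed
  show ?thesis
  proof (rule strict_monoidal_supercategory.intro, goal_cases)
    case 1 then show ?case unfolding presented_simps using ar_unique by blast
  next
    case 2 show ?case by (rule hom_space_module)
  next
    case 3 show ?case by (rule arp_submodule)
  next
    case (4 a b f)
    then have "ar a b f" by (simp add: presented)
    from direct[OF this] show ?case
      by (rule back_subst[of Ex1]) (auto simp: presented intro!: ext dest: arp_ar ar_isc)
  next
    case 7 then show ?case unfolding presented_simps by (simp add: presented arp_cmp del: add_bit_eq_xor)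
  next
    case 21 then show ?case unfolding presented_simps by (simp add: presented arp_tns del: add_bit_eq_xor)
  next
    case (30 a b c a' b' c' f p g r h s k t)
    then show ?case unfolding presented_simps using interchange[of p b c f r b' c' g s a h t a' k]
      by (simp add: presented)
  qed (simp_all add: presented total_laws(1,2,5-12) unit_laws idn_tns arp_idn ar_cmp ar_tns add.assoc)
qed

end

context presentation begin

lemma tns_pad: "ar m n X \<Longrightarrow> X \<boxtimes> idn j = pad 0 X j" "ar m n X \<Longrightarrow> idn i \<boxtimes> X = pad i X 0"
    "ar m n X \<Longrightarrow> pad 0 X 0 = X"
  using unit_laws(3,4)[of m n X] unit_laws(4)[OF ar_tns[OF ar_idn], of m n X i] by (simp_all add: pad_def)

lemma pad_far_odd:
  assumes "arp 1 a b X" "arp 1 c d Y"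
  shows "pad i X (k + d + j) \<odot> pad (i + a + k) Y j = (- 1) \<boxdot> (pad (i + b + k) Y j \<odot> pad i X (k + c + j))"
proof -
  note ar = arp_ar[OF assms(1)] arp_ar[OF assms(2)]
  have "pad i X (k + d + j) \<odot> pad (i + a + k) Y j = pad i ((X \<boxtimes> idn (k + d)) \<odot> (idn a \<boxtimes> (idn k \<boxtimes> Y))) j"
    by (subst pad_cmp[symmetric, of _ "b + (k + d)" _ "a + (k + c)"])
      (auto intro!: ar_tns ar_idn ar simp: pad_def total_laws(2) simp flip: idn_tns)
  also have "(X \<boxtimes> idn (k + d)) \<odot> (idn a \<boxtimes> (idn k \<boxtimes> Y)) = X \<boxtimes> (idn k \<boxtimes> Y)"
    by (rule tns_split[OF ar(1) ar_tns[OF ar_idn ar(2)]])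
  also have "\<dots> = (- 1) \<boxdot> ((idn b \<boxtimes> (idn k \<boxtimes> Y)) \<odot> (X \<boxtimes> idn (k + c)))"
  proof -
    have "arp 1 (k + c) (k + d) (idn k \<boxtimes> Y)" using arp_tns[OF arp_idn assms(2), of k] by simp
    from tns_split_odd[OF assms(1) this] show ?thesis
      using unit_laws(5)[OF ar_tns[OF ar(1) ar_tns[OF ar_idn ar(2)]]] by (simp add: total_laws(13))
  qed
  also have "pad i \<dots> j = (- 1) \<boxdot> (pad (i + b + k) Y j \<odot> pad i X (k + c + j))"
    unfolding pad_sml
    by (subst pad_cmp[symmetric, of "b + (k + c)" "b + (k + d)" _ "a + (k + c)"])
      (auto intro!: ar_tns ar_idn ar simp: pad_def total_laws(2) simp flip: idn_tns)
  finally show ?thesis .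
qed

lemma cmp_assoc_rule: "X \<odot> Y = Z \<Longrightarrow> X \<odot> (Y \<odot> W) = Z \<odot> W"
  by (simp flip: total_laws(1))

lemma sml_neg: "ar m n X \<Longrightarrow> (- 1) \<boxdot> (- 1) \<boxdot> X = X"
  using unit_laws(5) by (simp add: total_laws(13))

end

locale periplectic = presentation S R for S :: "'g signature" and R :: "('g, 'k::field) tm \<Rightarrow> ('g, 'k) tm \<Rightarrow> bool" +
  fixes h hb u a :: "('g, 'k) tm set" and q :: 'k
  assumes h: "arp 0 2 2 h" and hb: "arp 0 2 2 hb" and u: "arp 1 0 2 u" and a: "arp 1 2 0 a"
    and h_hb: "h \<odot> hb = idn 2" and hb_h: "hb \<odot> h = idn 2"
    and zig_au: "pad 0 a 1 \<odot> pad 1 u 0 = idn 1" and zig_ua: "pad 1 a 0 \<odot> pad 0 u 1 = (- 1) \<boxdot> idn 1"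
    and h_u: "h \<odot> u = q \<boxdot> u"
    and u_slide: "pad 1 h 0 \<odot> pad 0 u 1 = pad 0 hb 1 \<odot> pad 1 u 0"
    and q_nonzero: "q \<noteq> 0"
begin

lemmas ars = arp_ar[OF h] arp_ar[OF hb] arp_ar[OF u] arp_ar[OF a]

lemma zig_au_pad: "pad i a (Suc j) \<odot> pad (Suc i) u j = idn (Suc (i + j))"
proof -
  have "pad i a (Suc j) \<odot> pad (Suc i) u j = pad i (pad 0 a 1 \<odot> pad 1 u 0) j"
    using ar_pad[OF ars(4), of 0 1] ar_pad[OF ars(3), of 1 0]
    by (subst pad_cmp[symmetric, of 3 1 _ 1]) (simp_all add: pad_pad eval_nat_numeral)
  then show ?thesis unfolding zig_au pad_idn by (simp add: eval_nat_numeral)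
qed

lemma zig_ua_pad: "pad (Suc i) a j \<odot> pad i u (Suc j) = (- 1) \<boxdot> idn (Suc (i + j))"
proof -
  have "pad (Suc i) a j \<odot> pad i u (Suc j) = pad i (pad 1 a 0 \<odot> pad 0 u 1) j"
    using ar_pad[OF ars(4), of 1 0] ar_pad[OF ars(3), of 0 1]
    by (subst pad_cmp[symmetric, of 3 1 _ 1]) (simp_all add: pad_pad eval_nat_numeral)
  then show ?thesis unfolding zig_ua pad_sml pad_idn by (simp add: eval_nat_numeral)
qed

lemma u_slide_pad: "pad (Suc i) h j \<odot> pad i u (Suc j) = pad i hb (Suc j) \<odot> pad (Suc i) u j"
proof -
  have "pad (Suc i) h j \<odot> pad i u (Suc j) = pad i (pad 1 h 0 \<odot> pad 0 u 1) j"
    using ar_pad[OF ars(1), of 1 0] ar_pad[OF ars(3), of 0 1]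
    by (subst pad_cmp[symmetric, of 3 3 _ 1]) (simp_all add: pad_pad eval_nat_numeral)
  also have "\<dots> = pad i hb (Suc j) \<odot> pad (Suc i) u j" unfolding u_slide
    using ar_pad[OF ars(2), of 0 1] ar_pad[OF ars(3), of 1 0]
    by (subst pad_cmp[symmetric, of 3 3 _ 1]) (simp_all add: pad_pad eval_nat_numeral)
  finally show ?thesis .
qed

lemma a_slide: "pad 1 a 0 \<odot> pad 0 h 1 = pad 0 a 1 \<odot> pad 1 hb 0"
proof -
  define E where "E = pad 0 a 1 \<odot> pad 1 hb 0"
  have E: "ar 3 1 E" unfolding E_def using ar_pad[OF ars(4), of 0 1] ar_pad[OF ars(2), of 1 0]
    by (intro ar_cmp[of 3]) (simp_all add: eval_nat_numeral)
  have ha: "pad 1 hb 0 \<odot> pad 3 a 0 = pad 3 a 0 \<odot> pad 1 hb 2"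
    using pad_far[of 2 2 hb 2 0 a 1 0 0] ars hb by (simp add: eval_nat_numeral)
  have aa: "pad 0 a 1 \<odot> pad 3 a 0 = (- 1) \<boxdot> (pad 1 a 0 \<odot> pad 0 a 3)"
    using pad_far_odd[OF a a, of 0 1 0] by (simp add: eval_nat_numeral)
  have sl: "pad 1 hb 2 \<odot> pad 2 u 1 = pad 2 h 1 \<odot> pad 1 u 2"
    using u_slide_pad[of 1 1] by (simp add: eval_nat_numeral)
  have ah: "pad 0 a 3 \<odot> pad 2 h 1 = pad 0 h 1 \<odot> pad 0 a 3"
    using pad_far[of 2 0 a 2 2 h 0 0 1] ars h by (simp add: eval_nat_numeral)
  have z1: "pad 0 a 3 \<odot> pad 1 u 2 = idn 3" using zig_au_pad[of 0 2] by (simp add: eval_nat_numeral)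
  have z2: "pad 3 a 0 \<odot> pad 2 u 1 = (- 1) \<boxdot> idn 3" using zig_ua_pad[of 2 0] by (simp add: eval_nat_numeral)
  have "E = (- 1) \<boxdot> (E \<odot> (pad 3 a 0 \<odot> pad 2 u 1))"
    unfolding z2 total_laws(10) unit_laws(2)[OF E] sml_neg[OF E] ..
  also have "E \<odot> (pad 3 a 0 \<odot> pad 2 u 1) = pad 0 a 1 \<odot> (pad 3 a 0 \<odot> (pad 1 hb 2 \<odot> pad 2 u 1))"
    unfolding E_def total_laws(1) cmp_assoc_rule[OF ha] ..
  also have "\<dots> = (- 1) \<boxdot> (pad 1 a 0 \<odot> (pad 0 h 1 \<odot> idn 3))"
    unfolding sl cmp_assoc_rule[OF aa] total_laws(1,9) cmp_assoc_rule[OF ah] z1 ..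
  also have "pad 0 h 1 \<odot> idn 3 = pad 0 h 1"
    using unit_laws(2)[OF ar_pad[OF ars(1), of 0 1]] by (simp add: eval_nat_numeral)
  also have "(- 1) \<boxdot> (- 1) \<boxdot> (pad 1 a 0 \<odot> pad 0 h 1) = pad 1 a 0 \<odot> pad 0 h 1"
    using ar_pad[OF ars(4), of 1 0] ar_pad[OF ars(1), of 0 1] by (intro sml_neg[of 3 1] ar_cmp[of 3]) (simp_all add: eval_nat_numeral)
  finally show ?thesis unfolding E_def by (rule sym)
qed

lemma a_hb_u: "pad 0 a 1 \<odot> (pad 1 hb 0 \<odot> pad 0 u 1) = (- q) \<boxdot> idn 1"
proof -
  have hu: "pad 0 h 1 \<odot> pad 0 u 1 = q \<boxdot> pad 0 u 1"
    unfolding pad_sml[symmetric] h_u[symmetric] by (rule pad_cmp[OF ars(1,3)])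
  show ?thesis
    by (simp only: cmp_assoc_rule[OF a_slide[symmetric]] total_laws(1) hu total_laws(10) zig_ua total_laws(13)) simp
qed

lemma a_h:
  assumes "pad 0 a 1 \<odot> (pad 1 h 0 \<odot> pad 0 u 1) = (- q) \<boxdot> idn 1"
  shows "a \<odot> h = (- inverse q) \<boxdot> a"
proof -
  define X where "X = a \<odot> hb"
  have X: "arp 1 2 0 X" using arp_cmp[OF a hb] by (simp add: X_def)
  have Xa: "X \<odot> pad 2 a 0 = (- 1) \<boxdot> (a \<odot> pad 0 X 2)"
    using pad_far_odd[OF X a, of 0 0 0] by (simp add: tns_pad(3)[OF arp_ar[OF X]] tns_pad(3)[OF ars(4)] eval_nat_numeral)
  have z2: "pad 2 a 0 \<odot> pad 1 u 1 = (- 1) \<boxdot> idn 2" using zig_ua_pad[of 1 0] by (simp add: eval_nat_numeral)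
  have "pad 0 X 1 \<odot> pad 1 u 0 = pad 0 a 1 \<odot> (pad 0 hb 1 \<odot> pad 1 u 0)"
    unfolding X_def pad_cmp[OF ars(4,2), symmetric] total_laws(1) ..
  then have Xu: "pad 0 X 1 \<odot> pad 1 u 0 = (- q) \<boxdot> idn 1" unfolding u_slide[symmetric] assms .
  have "pad 0 X 2 \<odot> pad 1 u 1 = pad 0 (pad 0 X 1 \<odot> pad 1 u 0) 1"
    using ar_pad[OF arp_ar[OF X], of 0 1] ar_pad[OF ars(3), of 1 0]
    by (subst pad_cmp[symmetric, of 3 1 _ 1]) (simp_all add: pad_pad eval_nat_numeral)
  then have Xu': "pad 0 X 2 \<odot> pad 1 u 1 = (- q) \<boxdot> idn 2" unfolding Xu pad_sml pad_idn by (simp add: eval_nat_numeral)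
  have "X = (- 1) \<boxdot> (X \<odot> (pad 2 a 0 \<odot> pad 1 u 1))"
    unfolding z2 total_laws(10) unit_laws(2)[OF arp_ar[OF X]] sml_neg[OF arp_ar[OF X]] ..
  also have "\<dots> = (- q) \<boxdot> a"
    unfolding cmp_assoc_rule[OF Xa] total_laws(1,9) Xu' total_laws(10) unit_laws(2)[OF ars(4)] total_laws(13) by simp
  finally have "X \<odot> h = (- q) \<boxdot> (a \<odot> h)" by (simp add: total_laws(9))
  then have "a = (- q) \<boxdot> (a \<odot> h)" unfolding X_def total_laws(1) hb_h unit_laws(2)[OF ars(4)] .
  then have "(- inverse q) \<boxdot> a = (- inverse q) \<boxdot> (- q) \<boxdot> (a \<odot> h)" by simp
  also have "\<dots> = a \<odot> h" using q_nonzero unit_laws(5)[OF ar_cmp[OF ars(4,1)]] by (simp add: total_laws(13))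
  finally show ?thesis by (rule sym)
qed

end

locale q_periplectic = periplectic +
  assumes skein: "h = hb \<boxplus> (q - inverse q) \<boxdot> idn 2" and a_u: "a \<odot> u = zer 0 0"
    and braid: "pad 0 h 1 \<odot> (pad 1 h 0 \<odot> pad 0 h 1) = pad 1 h 0 \<odot> (pad 0 h 1 \<odot> pad 1 h 0)"
begin

lemma skein_pad: "pad i h j = pad i hb j \<boxplus> (q - inverse q) \<boxdot> idn (i + 2 + j)"
  by (subst skein) (simp add: pad_add pad_sml pad_idn)

lemma h_square: "h \<odot> h = idn 2 \<boxplus> (q - inverse q) \<boxdot> h"
  by (subst (2) skein) (simp add: total_laws(5,10) h_hb unit_laws(2)[OF ars(1)])

lemma a_h_u: "pad 0 a 1 \<odot> (pad 1 h 0 \<odot> pad 0 u 1) = (- q) \<boxdot> idn 1"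
proof -
  have "pad 0 a 1 \<odot> pad 0 u 1 = zer 1 1" unfolding pad_cmp[OF ars(4,3)] a_u pad_zer by (simp add: eval_nat_numeral)
  moreover have "idn 3 \<odot> pad 0 u 1 = pad 0 u 1"
    using unit_laws(1)[OF ar_pad[OF ars(3), of 0 1]] by (simp add: eval_nat_numeral)
  ultimately show ?thesis
    using unit_laws(6)[OF ar_sml[OF ar_idn], of "- q" 1] zer_laws(5)[OF ar_idn]
    by (simp add: skein_pad total_laws(5,6,9,10) a_hb_u[simplified] eval_nat_numeral)
qed

lemmas a_h_eq = a_h[OF a_h_u]

lemma h_u_slide: "pad 0 h 1 \<odot> pad 1 u 0 = pad 1 h 0 \<odot> pad 0 u 1 \<boxplus> (q - inverse q) \<boxdot> pad 1 u 0"
proof -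
  have "idn 3 \<odot> pad 1 u 0 = pad 1 u 0"
    using unit_laws(1)[OF ar_pad[OF ars(3), of 1 0]] by (simp add: eval_nat_numeral)
  then show ?thesis unfolding u_slide by (subst skein_pad) (simp add: total_laws(6,9) eval_nat_numeral)
qed

lemma h_h_u: "pad 0 h 1 \<odot> (pad 1 h 0 \<odot> pad 0 u 1) = pad 1 u 0"
proof -
  have "pad 0 h 1 \<odot> pad 0 hb 1 = idn 3" unfolding pad_cmp[OF ars(1,2)] h_hb pad_idn by (simp add: eval_nat_numeral)
  then show ?thesis unfolding u_slide
    using unit_laws(1)[OF ar_pad[OF ars(3), of 1 0]] by (simp add: cmp_assoc_rule eval_nat_numeral)
qed

lemma a_h_slide: "pad 1 a 0 \<odot> pad 0 h 1 = (- (q - inverse q)) \<boxdot> pad 0 a 1 \<boxplus> pad 0 a 1 \<odot> pad 1 h 0"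
proof -
  have ar: "ar 3 1 (pad 0 a 1)" "ar 3 3 (pad 1 hb 0)" using ar_pad[OF ars(4), of 0 1] ar_pad[OF ars(2), of 1 0] by (simp_all add: eval_nat_numeral)
  have "pad 0 a 1 \<odot> pad 1 h 0 = pad 0 a 1 \<odot> pad 1 hb 0 \<boxplus> (q - inverse q) \<boxdot> pad 0 a 1"
    by (subst skein_pad) (simp add: total_laws(5,10) unit_laws(2)[OF ar(1), unfolded eval_nat_numeral, simplified] eval_nat_numeral)
  then have "(- (q - inverse q)) \<boxdot> pad 0 a 1 \<boxplus> pad 0 a 1 \<odot> pad 1 h 0 =
      pad 0 a 1 \<odot> pad 1 hb 0 \<boxplus> (((q - inverse q) \<boxdot> pad 0 a 1) \<boxplus> (- 1) \<boxdot> (q - inverse q) \<boxdot> pad 0 a 1)"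
    by (simp add: add_ac total_laws(13))
  also have "\<dots> = pad 0 a 1 \<odot> pad 1 hb 0"
    unfolding unit_laws(7)[OF ar_sml[OF ar(1)]] by (rule unit_laws(6)[OF ar_cmp[OF ar]])
  finally show ?thesis unfolding a_slide by (rule sym)
qed

lemma a_h_h: "pad 0 a 1 \<odot> (pad 1 h 0 \<odot> pad 0 h 1) =
    ((1 - q\<^sup>2) \<boxdot> pad 0 a 1 \<boxplus> (q - inverse q) \<boxdot> (pad 0 a 1 \<odot> pad 1 h 0)) \<boxplus> pad 1 a 0"
proof -
  let ?z = "q - inverse q"
  have ah: "pad 0 a 1 \<odot> pad 0 h 1 = (- inverse q) \<boxdot> pad 0 a 1"
    unfolding pad_cmp[OF ars(4,1)] a_h_eq pad_sml ..
  have hh: "pad 0 h 1 \<odot> pad 0 h 1 = idn 3 \<boxplus> ?z \<boxdot> pad 0 h 1"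
    unfolding pad_cmp[OF ars(1,1)] h_square pad_add pad_sml pad_idn by (simp add: eval_nat_numeral)
  have i: "idn 3 \<odot> pad 0 h 1 = pad 0 h 1" "pad 1 a 0 \<odot> idn 3 = pad 1 a 0"
    using unit_laws(1)[OF ar_pad[OF ars(1), of 0 1]] unit_laws(2)[OF ar_pad[OF ars(4), of 1 0]]
    by (simp_all add: eval_nat_numeral)
  have "pad 0 a 1 \<odot> (pad 1 h 0 \<odot> pad 0 h 1) =
      pad 0 a 1 \<odot> (pad 1 hb 0 \<odot> pad 0 h 1) \<boxplus> ?z \<boxdot> (pad 0 a 1 \<odot> pad 0 h 1)"
    by (subst skein_pad) (simp add: total_laws(5,6,9,10) i[unfolded eval_nat_numeral, simplified] eval_nat_numeral)
  also have "\<dots> = (pad 1 a 0 \<boxplus> ?z \<boxdot> ((- ?z) \<boxdot> pad 0 a 1 \<boxplus> pad 0 a 1 \<odot> pad 1 h 0)) \<boxplus> (?z * - inverse q) \<boxdot> pad 0 a 1"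
    unfolding cmp_assoc_rule[OF a_slide[symmetric]] total_laws(1) hh ah
    unfolding total_laws(5,10,13) i a_h_slide ..
  also have "\<dots> = ((?z * - ?z + ?z * - inverse q) \<boxdot> pad 0 a 1 \<boxplus> ?z \<boxdot> (pad 0 a 1 \<odot> pad 1 h 0)) \<boxplus> pad 1 a 0"
    by (simp only: total_laws(13-15) add_ac)
  also have "?z * - ?z + ?z * - inverse q = 1 - q\<^sup>2"
    using q_nonzero by (simp add: field_simps power2_eq_square)
  finally show ?thesis .
qed

end

text \<open>In the other direction the two relations of the \<open>q\<close>-Brauer category that are missing from the
  list for \<open>C\<close> follow from invertibility of \<open>H\<close>.\<close>

context presentation begin

lemma skein_of_square:
  assumes "ar 2 2 h" "ar 2 2 hb" "h \<odot> hb = idn 2" "hb \<odot> h = idn 2" "h \<odot> h = idn 2 \<boxplus> z \<boxdot> h"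
  shows "h = hb \<boxplus> z \<boxdot> idn 2"
proof -
  have "hb \<odot> (h \<odot> h) = hb \<boxplus> z \<boxdot> idn 2"
    unfolding assms(5) total_laws(5,10) assms(4) unit_laws(2)[OF assms(2)] ..
  then show ?thesis by (simp add: cmp_assoc_rule[OF assms(4)] unit_laws(1)[OF assms(1)])
qed

lemma slide_of_h_h_u:
  assumes "ar 2 2 h" "ar 2 2 hb" "ar 0 2 u" "hb \<odot> h = idn 2" "pad 0 h 1 \<odot> (pad 1 h 0 \<odot> pad 0 u 1) = pad 1 u 0"
  shows "pad 1 h 0 \<odot> pad 0 u 1 = pad 0 hb 1 \<odot> pad 1 u 0"
proof -
  have inv: "pad 0 hb 1 \<odot> pad 0 h 1 = idn 3" unfolding pad_cmp[OF assms(2,1)] assms(4) pad_idn by (simp add: eval_nat_numeral)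
  have ar: "ar 1 3 (pad 1 h 0 \<odot> pad 0 u 1)"
    using ar_pad[OF assms(1), of 1 0] ar_pad[OF assms(3), of 0 1] by (intro ar_cmp[of 3]) (simp_all add: eval_nat_numeral)
  show ?thesis by (simp only: assms(5)[symmetric] cmp_assoc_rule[OF inv] unit_laws(1)[OF ar])
qed

end

section \<open>Comparison of the presentations\<close>

definition relabel :: "('g \<Rightarrow> 'h) \<Rightarrow> ('g, 'k) tm \<Rightarrow> ('h, 'k) tm" where
  "relabel \<sigma> = map_tm \<sigma> id"

lemma relabel_simps [simp]:
  "relabel \<sigma> (TId m) = TId m" "relabel \<sigma> (TGen x) = TGen (\<sigma> x)" "relabel \<sigma> (TZero m n) = TZero m n"
  "relabel \<sigma> (f \<cdot> g) = relabel \<sigma> f \<cdot> relabel \<sigma> g" "relabel \<sigma> (f \<star> g) = relabel \<sigma> f \<star> relabel \<sigma> g"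
  "relabel \<sigma> (f +\<^sub>t g) = relabel \<sigma> f +\<^sub>t relabel \<sigma> g" "relabel \<sigma> (c *\<^sub>t f) = c *\<^sub>t relabel \<sigma> f"
  by (simp_all add: relabel_def)

lemma relabel_id [simp]: "relabel id f = f"
  by (simp add: relabel_def tm.map_id)

lemma wt_map:
  assumes "\<And>x. x \<in> gens S \<Longrightarrow> \<sigma> x \<in> gens S' \<and> gsrc S' (\<sigma> x) = gsrc S x \<and> gtgt S' (\<sigma> x) = gtgt S x"
  shows "wt S m n f \<Longrightarrow> wt S' m n (relabel \<sigma> f)"
proof (induction rule: wt.induct)
  case (wt_gen x)
  then show ?case using wt.wt_gen[of "\<sigma> x" S'] assms[of x] by simp
qed (simp_all, (blast intro: wt.intros)+)

lemma wtp_map: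
  assumes "\<And>x. x \<in> gens S \<Longrightarrow> \<sigma> x \<in> gens S' \<and> gsrc S' (\<sigma> x) = gsrc S x \<and> gtgt S' (\<sigma> x) = gtgt S x \<and>
    gpar S' (\<sigma> x) = gpar S x"
  shows "wtp S p m n f \<Longrightarrow> wtp S' p m n (relabel \<sigma> f)"
proof (induction rule: wtp.induct)
  case (wtp_gen x)
  then show ?case using wtp.wtp_gen[of "\<sigma> x" S'] assms[of x] by simp
qed (simp_all del: add_bit_eq_xor, (blast intro: wtp.intros)+)

lemma eqv_map:
  assumes gens: "\<And>x. x \<in> gens S \<Longrightarrow> \<sigma> x \<in> gens S' \<and> gsrc S' (\<sigma> x) = gsrc S x \<and> gtgt S' (\<sigma> x) = gtgt S x \<and>
      gpar S' (\<sigma> x) = gpar S x"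
    and rel: "\<And>f g. R f g \<Longrightarrow> eqv S' R' (relabel \<sigma> f) (relabel \<sigma> g)"
  shows "eqv S R f g \<Longrightarrow> eqv S' R' (relabel \<sigma> f) (relabel \<sigma> g)"
proof (induction rule: eqv.induct)
  case (eqv_rel f g m n)
  then show ?case by (intro rel)
next
  case (eqv_sym f g)
  show ?case by (rule eqv.eqv_sym[OF eqv_sym.IH])
next
  case (eqv_trans f g h)
  from eqv_trans.IH show ?case by (rule eqv.eqv_trans)
next
  case (eqv_interchange p l n f r l' n' g s m h t m' k)
  note eqv_interchange[THEN wtp_map[OF gens, rotated]]
  from eqv.eqv_interchange[OF this] show ?case by (simp only: relabel_simps)
qed (simp_all only: relabel_simps, (rule eqv.intros; (assumption | (rule wt_map[rotated]; (assumption | use gens in blast))))+)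

lemma eqv_mono:
  assumes "\<And>f g. R f g \<Longrightarrow> eqv S R' f g"
  shows "eqv S R f g \<Longrightarrow> eqv S R' f g"
  by (rule eqv_map[of S id S R R', unfolded relabel_id id_apply]) (simp_all add: assms)

context
  fixes \<sigma> :: "'g \<Rightarrow> 'h" and S :: "'g signature" and S' :: "'h signature"
    and R :: "('g, 'k::field) tm \<Rightarrow> ('g, 'k) tm \<Rightarrow> bool" and R' :: "('h, 'k) tm \<Rightarrow> ('h, 'k) tm \<Rightarrow> bool"
  assumes gens: "\<And>x. x \<in> gens S \<Longrightarrow> \<sigma> x \<in> gens S' \<and> gsrc S' (\<sigma> x) = gsrc S x \<and> gtgt S' (\<sigma> x) = gtgt S x \<and>
      gpar S' (\<sigma> x) = gpar S x"
    and rel: "\<And>f g. R f g \<Longrightarrow> eqv S' R' (relabel \<sigma> f) (relabel \<sigma> g)"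
begin

definition class_map :: "('g, 'k) tm set \<Rightarrow> ('h, 'k) tm set" where
  "class_map X = (\<Union>f\<in>X. eqv_class S' R' (relabel \<sigma> f))"

lemma class_map: "wt S m n f \<Longrightarrow> class_map (eqv_class S R f) = eqv_class S' R' (relabel \<sigma> f)"
proof -
  assume "wt S m n f"
  then have "f \<in> eqv_class S R f" by (simp add: eqv_class_def eqv_refl)
  moreover have "eqv_class S' R' (relabel \<sigma> g) = eqv_class S' R' (relabel \<sigma> f)" if "g \<in> eqv_class S R f" for g
    using eqv_map[OF gens rel] that by (intro eqv_class_eq[symmetric]) (auto simp: eqv_class_def)
  ultimately show ?thesis unfolding class_map_def by blast
qed

lemma class_map_superfunctor:
  "strict_monoidal_superfunctor (presented_supercat S R) (presented_supercat S' R') id class_map"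
proof -
  interpret P: presentation S R .
  interpret P': presentation S' R' .
  have wtm: "wt S m n f \<Longrightarrow> wt S' m n (relabel \<sigma> f)" for m n f by (rule wt_map) (use gens in blast)
  have hom: "P'.ar m n (class_map X)" if "P.ar m n X" for m n X
    using that unfolding P.ar_def by (auto simp: class_map intro!: P'.cls_arI wtm)
  have part: "P'.arp p m n (class_map X)" if "P.arp p m n X" for p m n X
    using that unfolding P.arp_def by (auto simp: class_map[OF wtp_wt] intro!: P'.cls_arpI wtp_map[OF gens])
  have ident: "class_map (P.idn n) = P'.idn n" for n
    using class_map[OF wt_id[of S n]] by (simp add: P.cls_ops P'.cls_ops)
  have ops: "class_map (P.cmp X Y) = P'.cmp (class_map X) (class_map Y)" if "P.ar l n X" "P.ar m l Y" for l m n X Y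
    using that unfolding P.ar_def
    by (elim exE conjE) (simp only: P.cls_ops[symmetric] P'.cls_ops[symmetric] class_map[OF wt_comp] class_map relabel_simps)
  have tens: "class_map (P.tns X Y) = P'.tns (class_map X) (class_map Y)" if "P.ar m n X" "P.ar m' n' Y" for m n m' n' X Y
    using that unfolding P.ar_def
    by (elim exE conjE) (simp only: P.cls_ops[symmetric] P'.cls_ops[symmetric] class_map[OF wt_tens] class_map relabel_simps)
  have add: "class_map (P.add X Y) = P'.add (class_map X) (class_map Y)" if "P.ar m n X" "P.ar m n Y" for m n X Y
    using that unfolding P.ar_def
    by (elim exE conjE) (simp only: P.cls_ops[symmetric] P'.cls_ops[symmetric] class_map[OF wt_add] class_map relabel_simps)
  have smul: "class_map (P.sml c X) = P'.sml c (class_map X)" if "P.ar m n X" for c m n X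
    using that unfolding P.ar_def
    by (elim exE conjE) (simp only: P.cls_ops[symmetric] P'.cls_ops[symmetric] class_map[OF wt_smul] class_map relabel_simps)
  show ?thesis
    by (rule strict_monoidal_superfunctor.intro)
      (simp_all add: P.presented P'.presented hom part ident ops tens add smul hom[THEN P'.ar_isc])
qed

lemma supercat_isomorphicI:
  assumes "parity_graded S" "parity_graded S'"
    and inj: "\<And>f g m n. eqv S' R' (relabel \<sigma> f) (relabel \<sigma> g) \<Longrightarrow> wt S m n f \<Longrightarrow> wt S m n g \<Longrightarrow> eqv S R f g"
    and surj: "\<And>f m n. wt S' m n f \<Longrightarrow> \<exists>g. wt S m n g \<and> eqv S' R' (relabel \<sigma> g) f"
  shows "supercat_isomorphic (presented_supercat S R) (presented_supercat S' R')"
  unfolding supercat_isomorphic_def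
proof (intro conjI exI ballI)
  show "strict_monoidal_supercategory (presented_supercat S R)"
    by (rule presentation.presented_supercat_strict_monoidal[OF assms(1)])
  show "strict_monoidal_supercategory (presented_supercat S' R')"
    by (rule presentation.presented_supercat_strict_monoidal[OF assms(2)])
  show "strict_monoidal_superfunctor (presented_supercat S R) (presented_supercat S' R') id class_map"
    by (rule class_map_superfunctor)
  show "bij_betw id (Obj (presented_supercat S R)) (Obj (presented_supercat S' R'))"
    by (simp add: presented_supercat_def)
  fix m n
  have wtm: "wt S m n f \<Longrightarrow> wt S' m n (relabel \<sigma> f)" for f by (rule wt_map) (use gens in blast)
  have "inj_on class_map (eqv_class S R ` {f. wt S m n f})"
  proof (rule inj_onI, elim imageE CollectE, hypsubst)
    fix f g assume fg: "wt S m n f" "wt S m n g" "class_map (eqv_class S R f) = class_map (eqv_class S R g)"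
    note eqv_class_eqD[OF fg(3)[unfolded class_map[OF fg(1)] class_map[OF fg(2)]] wtm[OF fg(1)]]
    from inj[OF this fg(1,2)] show "eqv_class S R f = eqv_class S R g" by (rule eqv_class_eq)
  qed
  moreover have "class_map ` eqv_class S R ` {f. wt S m n f} = eqv_class S' R' ` {f. wt S' m n f}"
  proof (intro equalityI subsetI)
    fix X assume "X \<in> eqv_class S' R' ` {f. wt S' m n f}"
    then obtain f g where "X = eqv_class S' R' f" "wt S m n g" "eqv S' R' (relabel \<sigma> g) f" using surj by blast
    then show "X \<in> class_map ` eqv_class S R ` {f. wt S m n f}"
      using class_map eqv_class_eq by (metis (mono_tags, lifting) imageI mem_Collect_eq)
  qed (auto simp: class_map intro!: wtm)
  ultimately show "bij_betw class_map (Hom (presented_supercat S R) m n) (Hom (presented_supercat S' R') (id m) (id n))"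
    by (simp add: bij_betw_def presented_supercat_def)
qed

end

lemma parity_graded_sig: "parity_graded (sig G)"
  unfolding parity_graded_def
proof
  fix x assume "x \<in> gens (sig G)"
  show "\<exists>k::int. int (gtgt (sig G) x) - int (gsrc (sig G) x) = 2 * k \<and> gpar (sig G) x = of_int k"
    by (rule exI[of _ "case x of GA \<Rightarrow> - 1 | GU \<Rightarrow> 1 | _ \<Rightarrow> 0"]) (cases x; simp add: sig_def)
qed

locale sig_presentation = presentation "sig G" R for G and R :: "(gen, 'k::field) tm \<Rightarrow> (gen, 'k) tm \<Rightarrow> bool" +
  assumes gens: "GH \<in> G" "GA \<in> G" "GU \<in> G"
    and homogeneous: "R f g \<Longrightarrow> \<exists>p m n. wtp (sig G) p m n f \<and> wtp (sig G) p m n g"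
begin

notation tns (infixl "\<boxtimes>" 75)

lemma arp_gen: "arp 0 2 2 (cls (TGen GH))" "GH' \<in> G \<Longrightarrow> arp 0 2 2 (cls (TGen GH'))"
    "arp 1 2 0 (cls (TGen GA))" "arp 1 0 2 (cls (TGen GU))"
proof -
  have s: "gens (sig G) = G" "gpar (sig G) GH = 0" "gsrc (sig G) GH = 2" "gtgt (sig G) GH = 2"
    "gpar (sig G) GH' = 0" "gsrc (sig G) GH' = 2" "gtgt (sig G) GH' = 2"
    "gpar (sig G) GA = 1" "gsrc (sig G) GA = 2" "gtgt (sig G) GA = 0"
    "gpar (sig G) GU = 1" "gsrc (sig G) GU = 0" "gtgt (sig G) GU = 2" by (simp_all add: sig_def)
  show "arp 0 2 2 (cls (TGen GH))" "GH' \<in> G \<Longrightarrow> arp 0 2 2 (cls (TGen GH'))"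
    "arp 1 2 0 (cls (TGen GA))" "arp 1 0 2 (cls (TGen GU))"
    using gens cls_arpI[OF wtp_gen[of GH "sig G"]] cls_arpI[OF wtp_gen[of GH' "sig G"]]
      cls_arpI[OF wtp_gen[of GA "sig G"]] cls_arpI[OF wtp_gen[of GU "sig G"]] by (simp_all add: s)
qed

lemma gen_pad:
  "cls (TGen GH) \<boxtimes> idn j = pad 0 (cls (TGen GH)) j" "idn i \<boxtimes> cls (TGen GH) = pad i (cls (TGen GH)) 0"
  "GH' \<in> G \<Longrightarrow> cls (TGen GH') \<boxtimes> idn j = pad 0 (cls (TGen GH')) j"
  "GH' \<in> G \<Longrightarrow> idn i \<boxtimes> cls (TGen GH') = pad i (cls (TGen GH')) 0"
  "cls (TGen GA) \<boxtimes> idn j = pad 0 (cls (TGen GA)) j" "idn i \<boxtimes> cls (TGen GA) = pad i (cls (TGen GA)) 0"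
  "cls (TGen GU) \<boxtimes> idn j = pad 0 (cls (TGen GU)) j" "idn i \<boxtimes> cls (TGen GU) = pad i (cls (TGen GU)) 0"
  using tns_pad(1,2)[OF arp_ar[OF arp_gen(1)]] tns_pad(1,2)[OF arp_ar[OF arp_gen(2)]]
    tns_pad(1,2)[OF arp_ar[OF arp_gen(3)]] tns_pad(1,2)[OF arp_ar[OF arp_gen(4)]] by blast+

lemma rel_eqv: "R f g \<Longrightarrow> eqv (sig G) R f g"
  using homogeneous wtp_wt eqv_rel by metis

lemma rel_cls: "R f g \<Longrightarrow> cls f = cls g"
  by (rule eqv_class_eq[OF rel_eqv])

end

lemma sig_presentation_B: "sig_presentation UNIV (B_rel q)"
  by unfold_locales (auto dest: B_rel_homogeneous)

lemma sig_presentation_C: "sig_presentation UNIV (C_rel q)"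
  by unfold_locales (auto dest: C_rel_homogeneous)

lemma sig_presentation_periplectic: "sig_presentation {GH, GA, GU} periplectic_Brauer_rel"
  by unfold_locales (auto dest: periplectic_Brauer_rel_homogeneous)

lemma q_periplectic_B:
  assumes "q \<noteq> (0::'k::field)"
  shows "q_periplectic (sig UNIV) (B_rel q) (eqv_class (sig UNIV) (B_rel q) (TGen GH))
    (eqv_class (sig UNIV) (B_rel q) (TGen GH')) (eqv_class (sig UNIV) (B_rel q) (TGen GU))
    (eqv_class (sig UNIV) (B_rel q) (TGen GA)) q"
proof -
  interpret sig_presentation UNIV "B_rel q" by (rule sig_presentation_B)
  note rels = B_rel.intros[of q, THEN rel_cls, unfolded cls_ops gen_pad[simplified] total_laws(1)]
  show ?thesis
  proof unfold_locales
    have "add (cls (TGen GH')) (add (cls (TGen GH)) (sml (- 1) (cls (TGen GH')))) = cls (TGen GH)"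
      using unit_laws(6)[OF arp_ar[OF arp_gen(1)]] unit_laws(7)[OF arp_ar[OF arp_gen(2)]]
      by (simp add: add_left_commute)
    then show "cls (TGen GH) = add (cls (TGen GH')) (sml (q - inverse q) (idn 2))" unfolding rels(4) by (rule sym)
  qed (fact assms | rule rels arp_gen | simp)+
qed

lemma C_eqv_B: "q \<noteq> 0 \<Longrightarrow> C_rel q f g \<Longrightarrow> eqv (sig UNIV) (B_rel q) f g"
proof -
  assume "q \<noteq> 0" and C: "C_rel q f g"
  interpret sig_presentation UNIV "B_rel q" by (rule sig_presentation_B)
  interpret q_periplectic "sig UNIV" "B_rel q" "cls (TGen GH)" "cls (TGen GH')" "cls (TGen GU)" "cls (TGen GA)" q
    by (rule q_periplectic_B[OF \<open>q \<noteq> 0\<close>])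
  note red = gen_pad[simplified] total_laws(1) cls_ops
  have "cls f = cls g" using C
    by (cases rule: C_rel.cases; simp only: red)
      (rule h_hb hb_h h_u a_h_eq a_u zig_au zig_ua a_h_u h_square h_u_slide h_h_u a_h_slide a_h_h braid)+
  moreover obtain p m n where "wtp (sig UNIV) p m n f" using C_rel_homogeneous[OF C] by blast
  ultimately show ?thesis using eqv_class_eqD wtp_wt by blast
qed

lemma B_eqv_C: "B_rel q f g \<Longrightarrow> eqv (sig UNIV) (C_rel q) f g"
proof -
  assume B: "B_rel q f g"
  interpret sig_presentation UNIV "C_rel q" by (rule sig_presentation_C)
  note red = gen_pad[simplified] total_laws(1) cls_ops
  note rels = C_rel.intros[of q, THEN rel_cls, unfolded cls_ops gen_pad[simplified] total_laws(1)]
  note ars = arp_gen[THEN arp_ar, simplified]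
  have sk: "cls (TGen GH) = add (cls (TGen GH')) (sml (q - inverse q) (idn 2))"
    by (rule skein_of_square) (rule ars rels)+
  have "add (cls (TGen GH)) (sml (- 1) (cls (TGen GH'))) =
      add (sml (q - inverse q) (idn 2)) (add (cls (TGen GH')) (sml (- 1) (cls (TGen GH'))))"
    by (subst sk) (simp only: add_ac)
  also have "\<dots> = sml (q - inverse q) (idn 2)"
    unfolding unit_laws(7)[OF ars(2)] by (rule unit_laws(6)[OF ar_sml[OF ar_idn]])
  finally have sk': "add (cls (TGen GH)) (sml (- 1) (cls (TGen GH'))) = sml (q - inverse q) (idn 2)" .
  have sl: "cmp (pad 1 (cls (TGen GH)) 0) (pad 0 (cls (TGen GU)) 1) = cmp (pad 0 (cls (TGen GH')) 1) (pad 1 (cls (TGen GU)) 0)"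
    by (rule slide_of_h_h_u) (rule ars rels)+
  have "cls f = cls g" using B
    by (cases rule: B_rel.cases; simp only: red) (rule rels sk' sl)+
  moreover obtain p m n where "wtp (sig UNIV) p m n f" using B_rel_homogeneous[OF B] by blast
  ultimately show ?thesis using eqv_class_eqD wtp_wt by blast
qed

lemma cat_C_eq_cat_B:
  assumes "q \<noteq> 0"
  shows "cat_C q = cat_B q"
proof -
  have "eqv (sig UNIV) (C_rel q) f g \<Longrightarrow> eqv (sig UNIV) (B_rel q) f g" for f g
    by (rule eqv_mono[OF C_eqv_B[OF assms]])
  moreover have "eqv (sig UNIV) (B_rel q) f g \<Longrightarrow> eqv (sig UNIV) (C_rel q) f g" for f g
    by (rule eqv_mono[OF B_eqv_C])
  ultimately have "eqv (sig UNIV) (C_rel q) = eqv (sig UNIV) (B_rel q)" by blast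
  then have "eqv_class (sig UNIV) (C_rel q) = eqv_class (sig UNIV) (B_rel q)" by (simp add: eqv_class_def fun_eq_iff)
  then show ?thesis by (simp add: cat_C_def cat_B_def presented_supercat_def)
qed

lemma cat_C_iso_cat_B: "q \<noteq> 0 \<Longrightarrow> supercat_isomorphic (cat_C q) (cat_B q)"
  unfolding cat_C_eq_cat_B cat_B_def
  by (rule supercat_isomorphicI[of _ id])
    (auto intro: parity_graded_sig sig_presentation.rel_eqv[OF sig_presentation_B] eqv_refl)

definition unbar :: "gen \<Rightarrow> gen" where "unbar x = (if x = GH' then GH else x)"

lemma unbar_simps: "unbar GH = GH" "unbar GH' = GH" "unbar GA = GA" "unbar GU = GU"
  by (simp_all add: unbar_def)

lemma B_eqv_periplectic:
  assumes "CHAR('k::field) \<noteq> 2" "B_rel (1::'k) f g"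
  shows "eqv (sig {GH, GA, GU}) periplectic_Brauer_rel (relabel unbar f) (relabel unbar g)"
proof -
  interpret sig_presentation "{GH, GA, GU}" "periplectic_Brauer_rel :: (gen, 'k) tm \<Rightarrow> (gen, 'k) tm \<Rightarrow> bool"
    by (rule sig_presentation_periplectic)
  note rels = periplectic_Brauer_rel.intros[THEN rel_cls, unfolded cls_ops gen_pad(1,2,5-8) total_laws(1)]
  note ars = arp_gen(1,3,4)[THEN arp_ar]
  interpret periplectic "sig {GH, GA, GU}" periplectic_Brauer_rel "cls (TGen GH)" "cls (TGen GH)" "cls (TGen GU)" "cls (TGen GA)" 1
    by unfold_locales ((rule rels arp_gen | simp add: unit_laws(5)[OF ars(3)] rels)+)
  have ah: "cmp (cls (TGen GA)) (cls (TGen GH)) = sml (- 1) (cls (TGen GA))"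
    using a_h[OF a_hb_u] by simp
  have "cmp (cls (TGen GA)) (cmp (cls (TGen GH)) (cls (TGen GU))) = cmp (cls (TGen GA)) (cls (TGen GU))" unfolding rels(6) ..
  then have neg: "sml (- 1) (cmp (cls (TGen GA)) (cls (TGen GU))) = cmp (cls (TGen GA)) (cls (TGen GU))"
    unfolding cmp_assoc_rule[OF ah] total_laws(9) .
  have au: "ar 0 0 (cmp (cls (TGen GA)) (cls (TGen GU)))" by (rule ar_cmp[OF ars(4,3)])
  have "(2::'k) \<noteq> 0"
  proof
    assume "(2::'k) = 0"
    then have "CHAR('k) dvd 2" using of_nat_eq_0_iff_char_dvd[of 2, where 'a = 'k] by simp
    then have "CHAR('k) = 1" using assms(1) primes_dvd_imp_eq[of 2] two_is_prime_nat by (metis prime_nat_iff)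
    then show False using CHAR_not_1'[where 'a = 'k] by simp
  qed
  then have "cmp (cls (TGen GA)) (cls (TGen GU)) = sml (inverse 2) (sml 2 (cmp (cls (TGen GA)) (cls (TGen GU))))"
    using unit_laws(5)[OF au] by (simp add: total_laws(13))
  also have "sml 2 (cmp (cls (TGen GA)) (cls (TGen GU))) = add (cmp (cls (TGen GA)) (cls (TGen GU))) (cmp (cls (TGen GA)) (cls (TGen GU)))"
    using unit_laws(5)[OF au] total_laws(15)[of 1 1 "cmp (cls (TGen GA)) (cls (TGen GU))"] by simp
  also have "add (cmp (cls (TGen GA)) (cls (TGen GU))) (cmp (cls (TGen GA)) (cls (TGen GU))) = zer 0 0" using unit_laws(7)[OF au] unfolding neg .
  also have "sml (inverse 2) (zer 0 0) = zer 0 0" by (rule zer_laws(5)[OF au])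
  finally have au0: "cmp (cls (TGen GA)) (cls (TGen GU)) = zer 0 0" .
  have sk: "add (cls (TGen GH)) (sml (- 1) (cls (TGen GH))) = sml (1 - inverse 1) (idn 2)"
    using unit_laws(7)[OF ars(1)] unit_laws(8)[OF ar_idn[of 2]] by simp
  have "cls (relabel unbar f) = cls (relabel unbar g)" using assms(2)
    by (cases rule: B_rel.cases; simp only: relabel_simps unbar_simps cls_ops gen_pad(1,2,5-8) total_laws(1))
      (rule rels sk au0 h_u)+
  moreover obtain p m n where f: "wtp (sig UNIV) p m n f" using B_rel_homogeneous[OF assms(2)] by blast
  have "wtp (sig {GH, GA, GU}) p m n (relabel unbar f)"
    by (rule wtp_map[OF _ f]) (case_tac x; simp add: sig_def unbar_def)
  ultimately show ?thesis using eqv_class_eqD wtp_wt by blast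
qed

lemma periplectic_eqv_B:
  assumes "periplectic_Brauer_rel f g"
  shows "eqv (sig UNIV) (B_rel (1::'k::field)) f g" and "eqv (sig UNIV) (B_rel (1::'k)) (TGen GH') (TGen GH)"
proof -
  interpret sig_presentation UNIV "B_rel (1::'k)" by (rule sig_presentation_B)
  interpret q_periplectic "sig UNIV" "B_rel (1::'k)" "cls (TGen GH)" "cls (TGen GH')" "cls (TGen GU)" "cls (TGen GA)" 1
    by (rule q_periplectic_B) simp
  have b: "cls (TGen GH') = cls (TGen GH)"
    using skein unit_laws(8)[OF ar_idn[of 2]] unit_laws(6)[OF ars(2)] by simp
  then show "eqv (sig UNIV) (B_rel (1::'k)) (TGen GH') (TGen GH)"
    using wt_gen[of GH' "sig UNIV"] by (intro eqv_class_eqD) (auto simp: sig_def)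
  have u: "cmp (cls (TGen GH)) (cls (TGen GU)) = cls (TGen GU)" using h_u unit_laws(5)[OF ars(3)] by simp
  have "cls f = cls g" using assms
    by (cases rule: periplectic_Brauer_rel.cases; simp only: gen_pad[simplified] total_laws(1) cls_ops)
      (rule h_hb[unfolded b] braid zig_au zig_ua u_slide[unfolded b] u)+
  moreover obtain p m n where f: "wtp (sig {GH, GA, GU}) p m n f"
    using periplectic_Brauer_rel_homogeneous[OF assms] by blast
  have "wtp (sig UNIV) p m n (relabel id f)"
    by (rule wtp_map[OF _ f]) (auto simp: sig_def)
  ultimately show "eqv (sig UNIV) (B_rel (1::'k)) f g" using eqv_class_eqD wtp_wt by (metis relabel_id)
qed

lemma eqv_unbar: "wt (sig UNIV) m n f \<Longrightarrow> eqv (sig UNIV) (B_rel 1) f (relabel unbar f)"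
proof (induction rule: wt.induct)
  case (wt_gen x)
  have "eqv (sig UNIV) (B_rel 1) (TGen GH') (TGen GH)" by (rule periplectic_eqv_B(2)[OF periplectic_Brauer_rel.intros(1)])
  then show ?case using eqv_refl[OF wt.wt_gen[OF wt_gen]] by (auto simp: unbar_def)
qed (simp_all, (blast intro: eqv.intros wt.intros)+)

lemma map_unbar: "wt (sig {GH, GA, GU}) m n f \<Longrightarrow> relabel unbar f = f"
  by (induction rule: wt.induct) (auto simp: unbar_def sig_def)

lemma cat_B_iso_periplectic:
  assumes "CHAR('k::field) \<noteq> 2"
  shows "supercat_isomorphic (cat_B (1::'k)) periplectic_Brauer_cat"
  unfolding cat_B_def periplectic_Brauer_cat_def
proof (rule supercat_isomorphicI[of _ unbar])
  show gens: "unbar x \<in> gens (sig {GH, GA, GU}) \<and> gsrc (sig {GH, GA, GU}) (unbar x) = gsrc (sig UNIV) x \<and>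
      gtgt (sig {GH, GA, GU}) (unbar x) = gtgt (sig UNIV) x \<and> gpar (sig {GH, GA, GU}) (unbar x) = gpar (sig UNIV) x" for x
    by (cases x) (simp_all add: unbar_def sig_def)
  fix f g :: "(gen, 'k) tm" and m n
  have wtI: "wt (sig UNIV) m n f" if "wt (sig {GH, GA, GU}) m n f" for f :: "(gen, 'k) tm" and m n
    using wt_map[of "sig {GH, GA, GU}" id "sig UNIV", OF _ that] by (simp add: sig_def)
  show "eqv (sig UNIV) (B_rel 1) f g"
    if "eqv (sig {GH, GA, GU}) periplectic_Brauer_rel (relabel unbar f) (relabel unbar g)"
      "wt (sig UNIV) m n f" "wt (sig UNIV) m n g"
  proof -
    have r: "eqv (sig UNIV) (B_rel 1) (relabel unbar f) (relabel unbar g)"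
      by (rule eqv_map[of "sig {GH, GA, GU}" id "sig UNIV" periplectic_Brauer_rel, unfolded relabel_id id_apply, OF _ _ that(1)])
        (simp add: sig_def, rule periplectic_eqv_B(1))
    show ?thesis by (rule eqv_trans[OF eqv_unbar[OF that(2)] eqv_trans[OF r eqv_sym[OF eqv_unbar[OF that(3)]]]])
  qed
  show "\<exists>g. wt (sig UNIV) m n g \<and> eqv (sig {GH, GA, GU}) periplectic_Brauer_rel (relabel unbar g) f"
    if "wt (sig {GH, GA, GU}) m n f"
    using that by (intro exI[of _ f]) (simp add: map_unbar wtI eqv_refl)
  show "eqv (sig {GH, GA, GU}) periplectic_Brauer_rel (relabel unbar f) (relabel unbar g)" if "B_rel 1 f g"
    by (rule B_eqv_periplectic[OF assms that])
qed (rule parity_graded_sig)+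

section \<open>Endomorphisms are generated by crossings and cup-caps\<close>

context presentation begin

abbreviation sh where "sh X \<equiv> pad (Suc 0) X 0"

lemma sh_pad: "sh (pad i X j) = pad (Suc i) X j"
  by (simp add: pad_pad)

lemma sh_sh: "sh (sh X) = pad (Suc (Suc 0)) X 0"
  by (simp add: pad_pad)

lemma cmp_add_sml: "X \<odot> (Y \<boxplus> Z) = X \<odot> Y \<boxplus> X \<odot> Z" "(X \<boxplus> Y) \<odot> Z = X \<odot> Z \<boxplus> Y \<odot> Z"
  "(c \<boxdot> X) \<odot> Y = c \<boxdot> (X \<odot> Y)" "X \<odot> (c \<boxdot> Y) = c \<boxdot> (X \<odot> Y)"
  by (rule total_laws)+

lemma arp_even_cmp: "arp 0 l n X \<Longrightarrow> arp 0 m l Y \<Longrightarrow> arp 0 m n (X \<odot> Y)"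
  using arp_cmp[of 0 l n X 0 m Y] by simp

lemma arp_even_pad: "arp 0 m n X \<Longrightarrow> i + m + j = k \<Longrightarrow> i + n + j = l \<Longrightarrow> arp 0 k l (pad i X j)"
  using arp_pad[of 0 m n X i j] by simp

lemma sh_cmp: "arp 0 m m X \<Longrightarrow> arp 0 m m Y \<Longrightarrow> sh (X \<odot> Y) = sh X \<odot> sh Y"
  by (rule pad_cmp[symmetric]) (auto intro: arp_ar)

end

context q_periplectic begin

inductive Hk :: "nat \<Rightarrow> ('a, 'b) tm set \<Rightarrow> bool" where
  Hk_idn: "Hk m (idn m)"
| Hk_gen: "m = Suc (Suc (i + j)) \<Longrightarrow> Hk m (pad i h j)"
| Hk_cmp: "Hk m X \<Longrightarrow> Hk m Y \<Longrightarrow> Hk m (X \<odot> Y)"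
| Hk_add: "Hk m X \<Longrightarrow> Hk m Y \<Longrightarrow> Hk m (X \<boxplus> Y)"
| Hk_sml: "Hk m X \<Longrightarrow> Hk m (c \<boxdot> X)"

lemma Hk_arp: "Hk m X \<Longrightarrow> arp 0 m m X"
  by (induction rule: Hk.induct) (auto intro: arp_idn arp_even_cmp arp_add arp_sml arp_even_pad[OF h])

lemmas Hk_ar = arp_ar[OF Hk_arp]

lemma Hk_sh: "Hk m X \<Longrightarrow> Hk (Suc m) (sh X)"
proof (induction rule: Hk.induct)
  case (Hk_idn m)
  show ?case using Hk.Hk_idn[of "Suc m"] by (simp add: pad_idn)
next
  case (Hk_gen m i j)
  then show ?case unfolding sh_pad by (intro Hk.Hk_gen) simp
next
  case (Hk_cmp m X Y)
  show ?case unfolding sh_cmp[OF Hk_arp[OF Hk_cmp(1)] Hk_arp[OF Hk_cmp(2)]] by (rule Hk.Hk_cmp[OF Hk_cmp.IH])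
qed (simp_all only: pad_add pad_sml Hk_add Hk_sml)

lemma Hk_hb: "m = Suc (Suc (i + j)) \<Longrightarrow> Hk m (pad i hb j)"
proof -
  assume m: "m = Suc (Suc (i + j))"
  have "pad i h j \<boxplus> (- (q - inverse q)) \<boxdot> idn m =
      pad i hb j \<boxplus> ((q - inverse q) \<boxdot> idn m \<boxplus> (- 1) \<boxdot> (q - inverse q) \<boxdot> idn m)"
    unfolding skein_pad by (simp add: m add_ac total_laws(13))
  also have "\<dots> = pad i hb j"
    unfolding unit_laws(7)[OF ar_sml[OF ar_idn]] using unit_laws(6)[OF ar_pad[OF ars(2), of i j]] by (simp add: m)
  finally show ?thesis using Hk_add[OF Hk_gen[OF m] Hk_sml[OF Hk_idn]] by metis
qed

lemma far:
  assumes "arp 0 m m' X"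
  shows "pad 0 h m' \<odot> pad (Suc (Suc 0)) X 0 = pad (Suc (Suc 0)) X 0 \<odot> pad 0 h m"
    and "pad 0 a m' \<odot> pad (Suc (Suc 0)) X 0 = X \<odot> pad 0 a m"
    and "pad (Suc (Suc 0)) X 0 \<odot> pad 0 u m = pad 0 u m' \<odot> X"
  using pad_far[of 2 2 h m m' X 0 0 0] pad_far[of 2 0 a m m' X 0 0 0] pad_far[of 0 2 u m m' X 0 0 0]
    ars assms arp_ar[OF assms] by (simp_all add: tns_pad(3)[OF arp_ar[OF assms]])

lemma h_h_pad: "pad i h j \<odot> pad i h j = idn (i + 2 + j) \<boxplus> (q - inverse q) \<boxdot> pad i h j"
  unfolding pad_cmp[OF ars(1,1)] h_square pad_add pad_sml pad_idn ..

lemma braid_pad: "pad i h (Suc j) \<odot> (pad (Suc i) h j \<odot> pad i h (Suc j)) =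
    pad (Suc i) h j \<odot> (pad i h (Suc j) \<odot> pad (Suc i) h j)"
proof -
  have a: "ar 3 3 (pad 0 h 1)" "ar 3 3 (pad 1 h 0)"
    using ar_pad[OF ars(1), of 0 1] ar_pad[OF ars(1), of 1 0] by (simp_all add: eval_nat_numeral)
  have p: "pad i h (Suc j) = pad i (pad 0 h 1) j" "pad (Suc i) h j = pad i (pad 1 h 0) j" by (simp_all add: pad_pad)
  show ?thesis unfolding p
    by (simp only: pad_cmp[OF a(1,2)] pad_cmp[OF a(2,1)] pad_cmp[OF a(1) ar_cmp[OF a(2,1)]]
      pad_cmp[OF a(2) ar_cmp[OF a(1,2)]] braid)
qed

inductive Ex :: "nat \<Rightarrow> ('a, 'b) tm set \<Rightarrow> bool" for m where
  Ex_sh: "Hk m X \<Longrightarrow> Ex m (sh X)"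
| Ex_h: "m = Suc l \<Longrightarrow> Hk m X \<Longrightarrow> Hk m Y \<Longrightarrow> Ex m (sh X \<odot> (pad 0 h l \<odot> sh Y))"
| Ex_add: "Ex m X \<Longrightarrow> Ex m Y \<Longrightarrow> Ex m (X \<boxplus> Y)"
| Ex_sml: "Ex m X \<Longrightarrow> Ex m (c \<boxdot> X)"

lemma Ex_Hk: "Ex m X \<Longrightarrow> Hk (Suc m) X"
  by (induction rule: Ex.induct) (blast intro: Hk_sh Hk_cmp Hk_add Hk_sml Hk_gen[OF arg_cong[of _ _ "Suc"]] | simp add: Hk_cmp Hk_sh Hk_gen)+


lemma Ex_left_sh: assumes Z: "Hk m Z" shows "Ex m X \<Longrightarrow> Ex m (sh Z \<odot> X)"
proof (induction rule: Ex.induct)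
  case (Ex_sh X)
  show ?case unfolding sh_cmp[OF Hk_arp[OF Z] Hk_arp[OF Ex_sh], symmetric] by (rule Ex.Ex_sh[OF Hk_cmp[OF Z Ex_sh]])
next
  case (Ex_h l X Y)
  have "sh Z \<odot> (sh X \<odot> (pad 0 h l \<odot> sh Y)) = sh (Z \<odot> X) \<odot> (pad 0 h l \<odot> sh Y)"
    unfolding sh_cmp[OF Hk_arp[OF Z] Hk_arp[OF Ex_h(2)]] total_laws(1) ..
  then show ?case using Ex.Ex_h[OF Ex_h(1) Hk_cmp[OF Z Ex_h(2)] Ex_h(3)] by simp
qed (simp_all only: cmp_add_sml Ex.Ex_add Ex.Ex_sml)

lemma Ex_left_h:
  assumes IH: "\<And>X. Hk (Suc l) X \<Longrightarrow> Ex l X"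
  shows "Ex (Suc l) W \<Longrightarrow> Ex (Suc l) (pad 0 h l \<odot> W)"
proof (induction rule: Ex.induct)
  case (Ex_sh X)
  have "ar (Suc (Suc l)) (Suc (Suc l)) (pad 0 h l \<odot> sh X)"
    using Ex_sh by (intro Hk_ar Hk_cmp Hk_sh Hk_gen) simp_all
  from unit_laws(1)[OF this] have "pad 0 h l \<odot> sh X = sh (idn (Suc l)) \<odot> (pad 0 h l \<odot> sh X)" by (simp add: pad_idn)
  then show ?case using Ex.Ex_h[OF refl Hk_idn Ex_sh] by simp
next
  case (Ex_h l' X Y)
  then have l': "l' = l" and Y: "Hk (Suc l) Y" by simp_all
  have "Ex l X" by (rule IH[OF Ex_h(2)])
  then have "Ex (Suc l) (pad 0 h l \<odot> (sh X \<odot> (pad 0 h l \<odot> sh Y)))"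
  proof (induction rule: Ex.induct)
    case (Ex_sh Z)
    have i: "ar (Suc (Suc l)) (Suc (Suc l)) (sh Y)" by (rule Hk_ar[OF Hk_sh[OF Y]])
    have "pad 0 h l \<odot> (sh (sh Z) \<odot> (pad 0 h l \<odot> sh Y)) = sh (sh Z) \<odot> (pad 0 h l \<odot> (pad 0 h l \<odot> sh Y))"
      unfolding sh_sh cmp_assoc_rule[OF far(1)[OF Hk_arp[OF Ex_sh]]] total_laws(1) ..
    also have "\<dots> = sh (sh Z) \<odot> sh Y \<boxplus> (q - inverse q) \<boxdot> (sh (sh Z) \<odot> (pad 0 h l \<odot> sh Y))"
      unfolding cmp_assoc_rule[OF h_h_pad] cmp_add_sml using unit_laws(1)[OF i] by simp
    also have "sh (sh Z) \<odot> sh Y = sh (sh Z \<odot> Y)"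
      by (rule sh_cmp[OF Hk_arp[OF Hk_sh[OF Ex_sh]] Hk_arp[OF Y], symmetric])
    finally show ?case
      using Ex.Ex_add[OF Ex.Ex_sh[OF Hk_cmp[OF Hk_sh[OF Ex_sh] Y]] Ex.Ex_sml[OF Ex.Ex_h[OF refl Hk_sh[OF Ex_sh] Y]]]
      by simp
  next
    case (Ex_h k Z V)
    have g: "Hk (Suc l) (pad 0 h k)" using Ex_h(1) by (intro Hk_gen) simp
    have "pad 0 h l \<odot> (sh (sh Z \<odot> (pad 0 h k \<odot> sh V)) \<odot> (pad 0 h l \<odot> sh Y)) =
      pad 0 h l \<odot> (sh (sh Z) \<odot> (sh (pad 0 h k) \<odot> (sh (sh V) \<odot> (pad 0 h l \<odot> sh Y))))"
      using Hk_arp[OF Hk_sh[OF Ex_h(2)]] Hk_arp[OF Hk_sh[OF Ex_h(3)]] Hk_arp[OF g]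
      by (simp only: sh_cmp[OF _ arp_even_cmp] sh_cmp total_laws(1))
    also have "\<dots> = sh (sh Z) \<odot> (pad 0 h l \<odot> (sh (pad 0 h k) \<odot> (pad 0 h l \<odot> (sh (sh V) \<odot> sh Y))))"
      unfolding sh_sh cmp_assoc_rule[OF far(1)[OF Hk_arp[OF Ex_h(2)]]]
        cmp_assoc_rule[OF far(1)[OF Hk_arp[OF Ex_h(3)], symmetric]] total_laws(1) ..
    also have "\<dots> = sh (sh Z) \<odot> (sh (pad 0 h k) \<odot> (pad 0 h l \<odot> (sh (pad 0 h k) \<odot> (sh (sh V) \<odot> sh Y))))"
      using cmp_assoc_rule[OF braid_pad[of 0 k]] unfolding sh_pad Ex_h(1) total_laws(1) by simp
    also have "\<dots> = sh (sh Z \<odot> pad 0 h k) \<odot> (pad 0 h l \<odot> sh (pad 0 h k \<odot> (sh V \<odot> Y)))"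
      using Hk_arp[OF Hk_sh[OF Ex_h(2)]] Hk_arp[OF Hk_sh[OF Ex_h(3)]] Hk_arp[OF g] Hk_arp[OF Y]
      by (simp only: sh_cmp[OF _ arp_even_cmp] sh_cmp total_laws(1))
    finally show ?case
      using Ex.Ex_h[OF refl Hk_cmp[OF Hk_sh[OF Ex_h(2)] g] Hk_cmp[OF g Hk_cmp[OF Hk_sh[OF Ex_h(3)] Y]]] by simp
  qed (simp_all only: pad_add pad_sml cmp_add_sml Ex.Ex_add Ex.Ex_sml)
  then show ?case unfolding l' .
qed (simp_all only: cmp_add_sml Ex.Ex_add Ex.Ex_sml)

lemma Hk_Ex: "Hk (Suc m) X \<Longrightarrow> Ex m X"
proof (induction m arbitrary: X)
  case (0 X)
  have "Hk (Suc 0) X \<Longrightarrow> Ex 0 W \<Longrightarrow> Ex 0 (X \<odot> W)" for W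
    by (induction "Suc 0" X arbitrary: W rule: Hk.induct)
      (simp_all only: cmp_add_sml Ex.Ex_add Ex.Ex_sml total_laws(1), simp_all add: unit_laws(1)[OF Hk_ar[OF Ex_Hk]])
  from this[OF 0 Ex_sh[OF Hk_idn]] show ?case using unit_laws(2)[OF Hk_ar[OF 0]] by (simp add: pad_idn)
next
  case (Suc l X)
  have "Hk (Suc (Suc l)) X \<Longrightarrow> Ex (Suc l) W \<Longrightarrow> Ex (Suc l) (X \<odot> W)" for W
  proof (induction "Suc (Suc l)" X arbitrary: W rule: Hk.induct)
    case Hk_idn
    then show ?case using unit_laws(1)[OF Hk_ar[OF Ex_Hk]] by simp
  next
    case (Hk_gen i j)
    show ?case
    proof (cases i)
      case 0
      then show ?thesis using Ex_left_h[OF Suc.IH Hk_gen(2)] Hk_gen(1) by simp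
    next
      case (Suc i')
      then show ?thesis using Ex_left_sh[OF Hk.Hk_gen[of "Suc l" i' j] \<open>Ex (Suc l) W\<close>] Hk_gen(1) by (simp add: sh_pad)
    qed
  qed (simp_all only: cmp_add_sml Ex.Ex_add Ex.Ex_sml total_laws(1))
  from this[OF Suc.prems Ex_sh[OF Hk_idn]] show ?case using unit_laws(2)[OF Hk_ar[OF Suc.prems]] by (simp add: pad_idn)
qed

inductive Y :: "nat \<Rightarrow> ('a, 'b) tm set \<Rightarrow> bool" for w where
  Y_Hk: "Hk w X \<Longrightarrow> Y w X"
| Y_ua: "w = Suc (Suc v) \<Longrightarrow> Hk w X \<Longrightarrow> Hk w Z \<Longrightarrow> Y w (X \<odot> (pad 0 u v \<odot> (pad 0 a v \<odot> Z)))"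
| Y_add: "Y w X \<Longrightarrow> Y w Z \<Longrightarrow> Y w (X \<boxplus> Z)"
| Y_sml: "Y w X \<Longrightarrow> Y w (c \<boxdot> X)"

lemma Y_left: assumes "Hk w K" shows "Y w X \<Longrightarrow> Y w (K \<odot> X)"
proof (induction rule: Y.induct)
  case (Y_ua v X Z)
  then show ?case using Y.Y_ua[OF Y_ua(1) Hk_cmp[OF assms Y_ua(2)] Y_ua(3)] by (simp add: total_laws(1))
qed (simp_all add: cmp_add_sml Y.Y_add Y.Y_sml Y.Y_Hk Hk_cmp assms)

lemma Y_right: assumes "Hk w K" shows "Y w X \<Longrightarrow> Y w (X \<odot> K)"
proof (induction rule: Y.induct)
  case (Y_ua v X Z)
  then show ?case using Y.Y_ua[OF Y_ua(1,2) Hk_cmp[OF Y_ua(3) assms]] by (simp add: total_laws(1))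
qed (simp_all add: cmp_add_sml Y.Y_add Y.Y_sml Y.Y_Hk Hk_cmp assms)

lemma slices:
  shows "pad i a j \<odot> pad i h j = (- inverse q) \<boxdot> pad i a j" and "pad i h j \<odot> pad i u j = q \<boxdot> pad i u j"
    and "pad i a j \<odot> pad i u j = zer (i + j) (i + j)"
  unfolding pad_cmp[OF ars(4,1)] pad_cmp[OF ars(1,3)] pad_cmp[OF ars(4,3)] a_h_eq h_u a_u pad_sml pad_zer by simp_all

lemma slices3:
  shows "pad i a (Suc j) \<odot> (pad (Suc i) h j \<odot> pad i u (Suc j)) = (- q) \<boxdot> idn (Suc (i + j))"
    and "pad i a (Suc j) \<odot> (pad (Suc i) h j \<odot> pad i h (Suc j)) =
      ((1 - q\<^sup>2) \<boxdot> pad i a (Suc j) \<boxplus> (q - inverse q) \<boxdot> (pad i a (Suc j) \<odot> pad (Suc i) h j)) \<boxplus> pad (Suc i) a j"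
proof -
  have a: "ar 3 1 (pad 0 a 1)" "ar 3 3 (pad 1 h 0)" "ar 1 3 (pad 0 u 1)" "ar 3 3 (pad 0 h 1)"
    using ar_pad[OF ars(4), of 0 1] ar_pad[OF ars(1), of 1 0] ar_pad[OF ars(3), of 0 1] ar_pad[OF ars(1), of 0 1]
    by (simp_all add: eval_nat_numeral)
  have p: "pad i a (Suc j) = pad i (pad 0 a 1) j" "pad (Suc i) h j = pad i (pad 1 h 0) j"
    "pad i u (Suc j) = pad i (pad 0 u 1) j" "pad i h (Suc j) = pad i (pad 0 h 1) j"
    "pad (Suc i) a j = pad i (pad 1 a 0) j" by (simp_all add: pad_pad)
  show "pad i a (Suc j) \<odot> (pad (Suc i) h j \<odot> pad i u (Suc j)) = (- q) \<boxdot> idn (Suc (i + j))"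
    unfolding p pad_cmp[OF a(2,3)] pad_cmp[OF a(1) ar_cmp[OF a(2,3)]] a_h_u pad_sml pad_idn by simp
  show "pad i a (Suc j) \<odot> (pad (Suc i) h j \<odot> pad i h (Suc j)) =
      ((1 - q\<^sup>2) \<boxdot> pad i a (Suc j) \<boxplus> (q - inverse q) \<boxdot> (pad i a (Suc j) \<odot> pad (Suc i) h j)) \<boxplus> pad (Suc i) a j"
    unfolding p pad_cmp[OF a(2,4)] pad_cmp[OF a(1) ar_cmp[OF a(2,4)]] a_h_h
    unfolding pad_add pad_sml pad_cmp[OF a(1,2)] ..
qed

lemma Y_zero: "Y w (zer w w)"
  using Y_sml[OF Y_Hk[OF Hk_idn], of w 0] unit_laws(8)[OF ar_idn] by simp

lemma cap_shifted_cup: "Hk (Suc w) X \<Longrightarrow> Y w (pad 0 a w \<odot> (sh X \<odot> pad 0 u w))"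
proof (drule Hk_Ex, induction rule: Ex.induct)
  case (Ex_sh X)
  have "pad 0 a w \<odot> (sh (sh X) \<odot> pad 0 u w) = X \<odot> zer w w"
    unfolding sh_sh cmp_assoc_rule[OF far(2)[OF Hk_arp[OF Ex_sh]]] total_laws(1) slices(3) by simp
  then show ?case using Y_zero zer_laws(2)[OF Hk_ar[OF Ex_sh]] by simp
next
  case (Ex_h v X Z)
  have g: "arp 0 (Suc w) (Suc w) (pad 0 h v)" using Ex_h(1) by (intro Hk_arp Hk_gen) simp
  have "pad 0 a w \<odot> (sh (sh X \<odot> (pad 0 h v \<odot> sh Z)) \<odot> pad 0 u w) =
      pad 0 a w \<odot> (sh (sh X) \<odot> (sh (pad 0 h v) \<odot> (sh (sh Z) \<odot> pad 0 u w)))"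
    using Hk_arp[OF Hk_sh[OF Ex_h(2)]] Hk_arp[OF Hk_sh[OF Ex_h(3)]] g
    by (simp only: sh_cmp[OF _ arp_even_cmp] sh_cmp total_laws(1))
  also have "\<dots> = X \<odot> ((pad 0 a w \<odot> (pad (Suc 0) h v \<odot> pad 0 u w)) \<odot> Z)"
    unfolding sh_sh sh_pad cmp_assoc_rule[OF far(2)[OF Hk_arp[OF Ex_h(2)]]] far(3)[OF Hk_arp[OF Ex_h(3)]] total_laws(1) ..
  also have "\<dots> = (- q) \<boxdot> (X \<odot> Z)"
    unfolding Ex_h(1) slices3(1) cmp_add_sml using unit_laws(1)[OF Hk_ar[OF Ex_h(3)]] Ex_h(1) by simp
  finally show ?case using Y_sml[OF Y_Hk[OF Hk_cmp[OF Ex_h(2,3)]]] by simp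
qed (simp_all only: pad_add pad_sml cmp_add_sml Y_add Y_sml)

lemma far_sh: "arp 0 m m X \<Longrightarrow> pad (Suc 0) a m \<odot> sh (sh (sh X)) = sh X \<odot> pad (Suc 0) a m"
    "arp 0 m m X \<Longrightarrow> sh (sh (sh X)) \<odot> pad (Suc 0) h m = pad (Suc 0) h m \<odot> sh (sh (sh X))"
proof -
  assume X: "arp 0 m m X"
  have p: "pad (Suc 0) a m = sh (pad 0 a m)" "pad (Suc 0) h m = sh (pad 0 h m)" by (simp_all only: sh_pad)
  have ar: "ar (Suc (Suc m)) m (pad 0 a m)" "ar (Suc (Suc m)) (Suc (Suc m)) (sh (sh X))"
    "ar (Suc (Suc m)) (Suc (Suc m)) (pad 0 h m)"
    using ar_pad[OF ars(4), of 0 m] ar_pad[OF ars(1), of 0 m] ar_pad[OF arp_ar[OF X], of 2 0] by (simp_all add: sh_sh numeral_2_eq_2)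
  show "pad (Suc 0) a m \<odot> sh (sh (sh X)) = sh X \<odot> pad (Suc 0) a m"
    unfolding p pad_cmp[OF ar(1,2)] pad_cmp[OF arp_ar[OF X] ar(1)] unfolding sh_sh[of X] far(2)[OF X] ..
  show "sh (sh (sh X)) \<odot> pad (Suc 0) h m = pad (Suc 0) h m \<odot> sh (sh (sh X))"
    unfolding p pad_cmp[OF ar(2,3)] pad_cmp[OF ar(3,2)] unfolding sh_sh[of X] far(1)[OF X] ..
qed

lemma cap_crossing_cup:
  assumes "Hk (Suc v) X"
  shows "Y (Suc v) (pad (Suc 0) a v \<odot> (sh (sh X) \<odot> (pad (Suc 0) h v \<odot> pad 0 u (Suc v))))"
proof -
  have "Ex v X" using assms by (rule Hk_Ex)
  then show ?thesis
  proof (induction rule: Ex.induct)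
    case (Ex_sh X)
    have "pad (Suc 0) a v \<odot> (sh (sh (sh X)) \<odot> (pad (Suc 0) h v \<odot> pad 0 u (Suc v))) =
        sh X \<odot> ((- inverse q) \<boxdot> (- 1) \<boxdot> idn (Suc v))"
      unfolding cmp_assoc_rule[OF far_sh(1)[OF Hk_arp[OF Ex_sh]]] total_laws(1) cmp_assoc_rule[OF slices(1)]
      using zig_ua_pad[of 0 v] by (simp add: cmp_add_sml)
    then show ?case using Y_Hk[OF Hk_cmp[OF Hk_sh[OF Ex_sh] Hk_sml[OF Hk_sml[OF Hk_idn]]]] by simp
  next
    case (Ex_h x X Z)
    let ?u = "pad 0 u (Suc v)" and ?z = "q - inverse q"
    have g: "arp 0 (Suc v) (Suc v) (pad 0 h x)" using Ex_h(1) by (intro Hk_arp Hk_gen) simp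
    note XZ = Hk_arp[OF Hk_sh[OF Ex_h(2)]] Hk_arp[OF Hk_sh[OF Ex_h(3)]]
    have g1: "arp 0 (Suc (Suc v)) (Suc (Suc v)) (sh (pad 0 h x))"
      using Ex_h(1) by (intro Hk_arp Hk_sh Hk_gen) simp
    let ?B = "pad (Suc 0) a v \<odot> (pad (Suc (Suc 0)) h x \<odot> (pad (Suc 0) h v \<odot> ?u))"
    have "pad (Suc 0) a v \<odot> (sh (sh (sh X \<odot> (pad 0 h x \<odot> sh Z))) \<odot> (pad (Suc 0) h v \<odot> ?u)) =
      pad (Suc 0) a v \<odot> (sh (sh (sh X)) \<odot> (sh (sh (pad 0 h x)) \<odot> (sh (sh (sh Z)) \<odot> (pad (Suc 0) h v \<odot> ?u))))"
      using XZ g Hk_arp[OF Hk_sh[OF Hk_sh[OF Ex_h(2)]]] Hk_arp[OF Hk_sh[OF Hk_sh[OF Ex_h(3)]]] g1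
      by (simp only: sh_cmp[OF _ arp_even_cmp] sh_cmp total_laws(1))
    also have "\<dots> = sh X \<odot> (?B \<odot> sh Z)"
      unfolding cmp_assoc_rule[OF far_sh(1)[OF Hk_arp[OF Ex_h(2)]]] cmp_assoc_rule[OF far_sh(2)[OF Hk_arp[OF Ex_h(3)]]] total_laws(1)
      unfolding sh_sh[of "sh Z"] far(3)[OF XZ(2)] by (simp add: sh_pad)
    finally have e: "pad (Suc 0) a v \<odot> (sh (sh (sh X \<odot> (pad 0 h x \<odot> sh Z))) \<odot> (pad (Suc 0) h v \<odot> ?u)) =
      sh X \<odot> (?B \<odot> sh Z)" .
    have u1: "pad (Suc 0) a v \<odot> ?u = (- 1) \<boxdot> idn (Suc v)" using zig_ua_pad[of 0 v] by simp
    have u2: "pad (Suc (Suc 0)) h x \<odot> ?u = ?u \<odot> pad 0 h x" using far(3)[OF g] by (simp add: pad_pad)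
    have "pad 0 u x \<odot> pad 0 a x = (- 1) \<boxdot> (pad (Suc (Suc 0)) a x \<odot> ?u)"
      using pad_far_odd[OF u a, of 0 0 x] Ex_h(1) by (simp add: eval_nat_numeral)
    then have "(- 1) \<boxdot> (pad 0 u x \<odot> pad 0 a x) = (- 1) \<boxdot> (- 1) \<boxdot> (pad (Suc (Suc 0)) a x \<odot> ?u)" by simp
    also have "\<dots> = pad (Suc (Suc 0)) a x \<odot> ?u"
      using ar_pad[OF ars(4), of 2 x] ar_pad[OF ars(3), of 0 "Suc v"] Ex_h(1)
      by (intro sml_neg[of "Suc v" "Suc v"] ar_cmp[of "Suc (Suc (Suc v))"]) (simp_all add: eval_nat_numeral)
    finally have u3: "pad (Suc (Suc 0)) a x \<odot> ?u = (- 1) \<boxdot> (idn (Suc v) \<odot> (pad 0 u x \<odot> (pad 0 a x \<odot> idn (Suc v))))"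
      using unit_laws(1)[OF ar_pad[OF ars(3), of 0 x]] unit_laws(2)[OF ar_pad[OF ars(4), of 0 x]] Ex_h(1)
      by (simp add: total_laws(1)[symmetric])
    have "?B = ((1 - q\<^sup>2) \<boxdot> (- 1) \<boxdot> idn (Suc v) \<boxplus> ?z \<boxdot> ((- 1) \<boxdot> idn (Suc v) \<odot> pad 0 h x)) \<boxplus>
        (- 1) \<boxdot> (idn (Suc v) \<odot> (pad 0 u x \<odot> (pad 0 a x \<odot> idn (Suc v))))"
      using arg_cong[OF slices3(2)[of "Suc 0" x], of "\<lambda>A. A \<odot> ?u"]
      unfolding Ex_h(1)[symmetric] total_laws(1) cmp_add_sml u2 u3 cmp_assoc_rule[OF u1] u1 .
    moreover have "Y (Suc v) \<dots>"
      using Ex_h(1) by (intro Y_add Y_sml Y_ua Y_Hk Hk_sml Hk_cmp Hk_idn Hk_gen) simp_all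
    ultimately have "Y (Suc v) ?B" by simp
    then show ?case unfolding e by (intro Y_left[OF Hk_sh[OF Ex_h(2)]] Y_right[OF Hk_sh[OF Ex_h(3)]])
  qed (simp_all only: pad_add pad_sml cmp_add_sml Y_add Y_sml)
qed

lemma cap_Hk_cup: "Hk (Suc (Suc w)) X \<Longrightarrow> Y w (pad 0 a w \<odot> (X \<odot> pad 0 u w))"
proof (drule Hk_Ex, induction rule: Ex.induct)
  case (Ex_sh X)
  then show ?case by (rule cap_shifted_cup)
next
  case (Ex_h l X1 X2)
  have "Ex w X1" using Hk_Ex[OF Ex_h(2)] .
  then have "Y w (pad 0 a w \<odot> (sh X1 \<odot> (pad 0 h w \<odot> (sh X2 \<odot> pad 0 u w))))"
  proof (induction rule: Ex.induct)
    case (Ex_sh K)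
    have "pad 0 a w \<odot> (sh (sh K) \<odot> (pad 0 h w \<odot> (sh X2 \<odot> pad 0 u w))) =
        K \<odot> ((- inverse q) \<boxdot> (pad 0 a w \<odot> (sh X2 \<odot> pad 0 u w)))"
      unfolding sh_sh cmp_assoc_rule[OF far(2)[OF Hk_arp[OF Ex_sh]]] total_laws(1) cmp_assoc_rule[OF slices(1)] cmp_add_sml ..
    then show ?case using Y_left[OF Ex_sh Y_sml[OF cap_shifted_cup[OF Ex_h(3)]]] by simp
  next
    case X1: (Ex_h v K M)
    have g: "Hk (Suc w) (pad 0 h v)" using X1(1) by (intro Hk_gen) simp
    let ?X1 = "sh K \<odot> (pad 0 h v \<odot> sh M)"
    have hX1: "Hk (Suc w) ?X1" by (intro Hk_cmp Hk_sh X1 g)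
    have "Ex w X2" using Hk_Ex[OF Ex_h(3)] .
    then show ?case
    proof (induction rule: Ex.induct)
      case (Ex_sh L)
      have "pad 0 a w \<odot> (sh ?X1 \<odot> (pad 0 h w \<odot> (sh (sh L) \<odot> pad 0 u w))) =
          q \<boxdot> ((pad 0 a w \<odot> (sh ?X1 \<odot> pad 0 u w)) \<odot> L)"
        unfolding sh_sh far(3)[OF Hk_arp[OF Ex_sh]] cmp_assoc_rule[OF slices(2)] cmp_add_sml total_laws(1) ..
      then show ?case using Y_sml[OF Y_right[OF Ex_sh cap_shifted_cup[OF hX1]]] by simp
    next
      case (Ex_h v' N L)
      have v': "v' = v" using Ex_h(1) X1(1) by simp
      let ?P = "sh (sh (M \<odot> N))" and ?h = "pad (Suc 0) h v" and ?u = "pad 0 u w"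
      let ?A = "pad 0 a w \<odot> (?h \<odot> (pad 0 h w \<odot> (?P \<odot> (?h \<odot> ?u))))"
      have e: "pad 0 a w \<odot> (sh ?X1 \<odot> (pad 0 h w \<odot> (sh (sh N \<odot> (pad 0 h v \<odot> sh L)) \<odot> ?u))) = K \<odot> (?A \<odot> L)"
      proof -
        have "pad 0 a w \<odot> (sh ?X1 \<odot> (pad 0 h w \<odot> (sh (sh N \<odot> (pad 0 h v \<odot> sh L)) \<odot> ?u))) =
          pad 0 a w \<odot> (sh (sh K) \<odot> (?h \<odot> (sh (sh M) \<odot> (pad 0 h w \<odot> (sh (sh N) \<odot> (?h \<odot> (sh (sh L) \<odot> ?u)))))))"
          using Hk_arp[OF Hk_sh[OF X1(2)]] Hk_arp[OF Hk_sh[OF X1(3)]] Hk_arp[OF Hk_sh[OF Ex_h(2)]]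
            Hk_arp[OF Hk_sh[OF Ex_h(3)]] Hk_arp[OF g]
          by (simp only: sh_cmp[OF _ arp_even_cmp] sh_cmp total_laws(1) sh_pad[of 0 h v, symmetric])
        also have "\<dots> = K \<odot> (pad 0 a w \<odot> (?h \<odot> (pad 0 h w \<odot> (sh (sh M) \<odot> (sh (sh N) \<odot> (?h \<odot> (?u \<odot> L)))))))"
          unfolding sh_sh cmp_assoc_rule[OF far(2)[OF Hk_arp[OF X1(2)]]] cmp_assoc_rule[OF far(1)[OF Hk_arp[OF X1(3)], symmetric]]
            far(3)[OF Hk_arp[OF Ex_h(3)]] total_laws(1) ..
        also have "\<dots> = K \<odot> (?A \<odot> L)"
          using Hk_arp[OF X1(3)] Hk_arp[OF Ex_h(2)] Hk_arp[OF Hk_sh[OF X1(3)]] Hk_arp[OF Hk_sh[OF Ex_h(2)]]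
          by (simp only: sh_cmp total_laws(1))
        finally show ?thesis .
      qed
      have P: "Hk w (M \<odot> N)" by (intro Hk_cmp X1 Ex_h)
      note sP = Hk_arp[OF Hk_sh[OF P]]
      have A0: "?A = ((1 - q\<^sup>2) \<boxdot> (pad 0 a w \<odot> (?P \<odot> (?h \<odot> ?u))) \<boxplus>
          (q - inverse q) \<boxdot> (pad 0 a w \<odot> (?h \<odot> (?P \<odot> (?h \<odot> ?u))))) \<boxplus> pad (Suc 0) a v \<odot> (?P \<odot> (?h \<odot> ?u))"
        using arg_cong[OF slices3(2)[of 0 v], of "\<lambda>A. A \<odot> (?P \<odot> (?h \<odot> ?u))"]
        unfolding X1(1)[symmetric] total_laws(1) cmp_add_sml .
      have hP: "?P \<odot> (?h \<odot> ?u) = sh (sh (M \<odot> N) \<odot> pad 0 h v) \<odot> ?u"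
        unfolding sh_cmp[OF sP Hk_arp[OF g]] sh_pad total_laws(1) ..
      have hhP: "?h \<odot> (sh (sh (M \<odot> N) \<odot> pad 0 h v) \<odot> ?u) = sh (pad 0 h v \<odot> (sh (M \<odot> N) \<odot> pad 0 h v)) \<odot> ?u"
        unfolding sh_cmp[OF Hk_arp[OF g] arp_even_cmp[OF sP Hk_arp[OF g]]] sh_pad total_laws(1) ..
      have A: "?A = ((1 - q\<^sup>2) \<boxdot> (pad 0 a w \<odot> (sh (sh (M \<odot> N) \<odot> pad 0 h v) \<odot> ?u)) \<boxplus>
          (q - inverse q) \<boxdot> (pad 0 a w \<odot> (sh (pad 0 h v \<odot> (sh (M \<odot> N) \<odot> pad 0 h v)) \<odot> ?u))) \<boxplus>
          pad (Suc 0) a v \<odot> (sh (sh (M \<odot> N) \<odot> pad 0 h v) \<odot> ?u)"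
        using A0 unfolding hP hhP .
      have "Y w (pad (Suc 0) a v \<odot> (sh (sh (M \<odot> N) \<odot> pad 0 h v) \<odot> ?u))"
        using cap_crossing_cup[of v "M \<odot> N"] P X1(1)
        unfolding sh_cmp[OF sP Hk_arp[OF g]] sh_pad total_laws(1) by simp
      then have "Y w ?A" unfolding A
        by (intro Y_add Y_sml cap_shifted_cup Hk_cmp Hk_sh[OF P] g)
      then show ?case unfolding v' e by (intro Y_left[OF X1(2)] Y_right[OF Ex_h(3)])
    qed (simp_all only: pad_add pad_sml cmp_add_sml Y_add Y_sml)
  qed (simp_all only: pad_add pad_sml cmp_add_sml Y_add Y_sml)
  moreover have "sh (X1 :: ('a, 'b) tm set) \<odot> (pad 0 h l \<odot> sh X2) \<odot> pad 0 u w = sh X1 \<odot> (pad 0 h w \<odot> (sh X2 \<odot> pad 0 u w))"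
    using Ex_h(1) by (simp add: total_laws(1))
  ultimately show ?case by simp
qed (simp_all only: cmp_add_sml Y_add Y_sml)

inductive D :: "nat \<Rightarrow> nat \<Rightarrow> ('a, 'b) tm set \<Rightarrow> bool" where
  D_Hk: "Hk m K \<Longrightarrow> D m m K"
| D_cap: "D m n F \<Longrightarrow> Hk (Suc (Suc m)) K \<Longrightarrow> D (Suc (Suc m)) n (F \<odot> (pad 0 a m \<odot> K))"
| D_cup: "D m n F \<Longrightarrow> Hk (Suc (Suc n)) K \<Longrightarrow> D m (Suc (Suc n)) (K \<odot> (pad 0 u n \<odot> F))"
| D_zer: "D m n (zer m n)"
| D_add: "D m n F \<Longrightarrow> D m n G \<Longrightarrow> D m n (F \<boxplus> G)"
| D_sml: "D m n F \<Longrightarrow> D m n (c \<boxdot> F)"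

lemma D_left: "D m n F \<Longrightarrow> Hk n K \<Longrightarrow> D m n (K \<odot> F)"
proof (induction arbitrary: K rule: D.induct)
  case (D_cap m n F K')
  then show ?case using D.D_cap[OF D_cap.IH[OF D_cap.prems] D_cap(2)] by (simp add: total_laws(1))
next
  case (D_cup m n F K')
  then show ?case using D.D_cup[OF D_cup(1) Hk_cmp[OF D_cup.prems D_cup(2)]] by (simp add: total_laws(1))
next
  case (D_zer m n)
  then show ?case using zer_laws(2)[OF Hk_ar[OF D_zer], of m] D.D_zer by simp
qed (simp_all only: cmp_add_sml D.D_add D.D_sml D.D_Hk[OF Hk_cmp])

lemma D_left_cap: "D m n F \<Longrightarrow> n = Suc (Suc w) \<Longrightarrow> Hk n K \<Longrightarrow> D m w (pad 0 a w \<odot> (K \<odot> F))"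
proof (induction arbitrary: K w rule: D.induct)
  case (D_Hk m K')
  then have "Hk (Suc (Suc w)) (K \<odot> K')" by (intro Hk_cmp) simp_all
  note D_cap[OF D.D_Hk[OF Hk_idn] this]
  moreover have "ar (Suc (Suc w)) w (pad 0 a w \<odot> (K \<odot> K'))"
    using ar_pad[OF ars(4), of 0 w] Hk_ar[OF \<open>Hk (Suc (Suc w)) (K \<odot> K')\<close>] ar_cmp[of "Suc (Suc w)" w] by simp
  ultimately show ?case using unit_laws(1) D_Hk(2) by simp
next
  case (D_cap m n F K')
  then show ?case using D.D_cap[OF D_cap.IH[OF D_cap.prems] D_cap(2)] by (simp add: total_laws(1))
next
  case (D_cup m n F K')
  have w: "w = n" using D_cup.prems by simp
  have "Hk (Suc (Suc n)) (K \<odot> K')" using D_cup.prems D_cup.hyps by (intro Hk_cmp) simp_all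
  then have "Y n (pad 0 a n \<odot> (K \<odot> K' \<odot> pad 0 u n))" by (rule cap_Hk_cup)
  then have "D m n (pad 0 a n \<odot> (K \<odot> K' \<odot> pad 0 u n) \<odot> F)"
  proof (induction rule: Y.induct)
    case (Y_Hk X)
    then show ?case using D_left[OF D_cup.hyps(1)] by blast
  next
    case (Y_ua v X Z)
    then show ?case using D.D_cup[OF D_cup.IH[OF Y_ua(1,3)]] by (simp add: total_laws(1))
  qed (simp_all only: cmp_add_sml D_add D_sml)
  then show ?case unfolding w by (simp add: total_laws(1))
next
  case (D_zer m n)
  then show ?case
    using zer_laws(2)[OF Hk_ar[OF D_zer(2)], of m] zer_laws(2)[OF ar_pad[OF ars(4), of 0 w], of m] D.D_zer[of m w] by simp
qed (simp_all only: cmp_add_sml D.D_add D.D_sml)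

lemma a_slide_pad: "pad (Suc i) a j = pad i a (Suc j) \<odot> (pad (Suc i) hb j \<odot> pad i hb (Suc j))"
proof -
  have a: "ar 3 1 (pad 0 a 1)" "ar 3 1 (pad 1 a 0)" "ar 3 3 (pad 1 hb 0)" "ar 3 3 (pad 0 h 1)"
    using ar_pad[OF ars(4), of 0 1] ar_pad[OF ars(4), of 1 0] ar_pad[OF ars(2), of 1 0] ar_pad[OF ars(1), of 0 1]
    by (simp_all add: eval_nat_numeral)
  have p: "pad i a (Suc j) = pad i (pad 0 a 1) j" "pad (Suc i) hb j = pad i (pad 1 hb 0) j"
    "pad i h (Suc j) = pad i (pad 0 h 1) j" "pad (Suc i) a j = pad i (pad 1 a 0) j" by (simp_all add: pad_pad)
  have e: "pad (Suc i) a j \<odot> pad i h (Suc j) = pad i a (Suc j) \<odot> pad (Suc i) hb j"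
    unfolding p pad_cmp[OF a(2,4)] pad_cmp[OF a(1,3)] a_slide ..
  have "pad (Suc i) a j \<odot> (pad i h (Suc j) \<odot> pad i hb (Suc j)) = pad i a (Suc j) \<odot> (pad (Suc i) hb j \<odot> pad i hb (Suc j))"
    unfolding cmp_assoc_rule[OF e] total_laws(1) ..
  moreover have "pad i h (Suc j) \<odot> pad i hb (Suc j) = idn (Suc (i + 2 + j))"
    unfolding pad_cmp[OF ars(1,2)] h_hb pad_idn by simp
  ultimately show ?thesis using unit_laws(2)[OF ar_pad[OF ars(4), of "Suc i" j]] by simp
qed

lemma u_slide_pad': "pad (Suc i) u j = pad i h (Suc j) \<odot> (pad (Suc i) h j \<odot> pad i u (Suc j))"
proof -
  have inv: "pad i h (Suc j) \<odot> pad i hb (Suc j) = idn (Suc (i + 2 + j))"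
    unfolding pad_cmp[OF ars(1,2)] h_hb pad_idn by simp
  show ?thesis unfolding u_slide_pad cmp_assoc_rule[OF inv] using unit_laws(1)[OF ar_pad[OF ars(3), of "Suc i" j]]
    by simp
qed

lemma cap_pad: "\<exists>K. Hk (Suc (Suc (i + j))) K \<and> pad i a j = pad 0 a (i + j) \<odot> K"
proof (induction i arbitrary: j)
  case 0
  then show ?case using unit_laws(2)[OF ar_pad[OF ars(4), of 0 j]] Hk_idn by (intro exI[of _ "idn (Suc (Suc j))"]) simp
next
  case (Suc i)
  obtain K where K: "Hk (Suc (Suc (i + Suc j))) K" "pad i a (Suc j) = pad 0 a (i + Suc j) \<odot> K" using Suc by blast
  then show ?case unfolding a_slide_pad[of i j]
    by (intro exI[of _ "K \<odot> (pad (Suc i) hb j \<odot> pad i hb (Suc j))"]) (auto simp: total_laws(1) intro!: Hk_cmp Hk_hb)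
qed

lemma cup_pad: "\<exists>K. Hk (Suc (Suc (i + j))) K \<and> pad i u j = K \<odot> pad 0 u (i + j)"
proof (induction i arbitrary: j)
  case 0
  then show ?case using unit_laws(1)[OF ar_pad[OF ars(3), of 0 j]] Hk_idn by (intro exI[of _ "idn (Suc (Suc j))"]) simp
next
  case (Suc i)
  obtain K where K: "Hk (Suc (Suc (i + Suc j))) K" "pad i u (Suc j) = K \<odot> pad 0 u (i + Suc j)" using Suc by blast
  then show ?case unfolding u_slide_pad'[of i j]
    by (intro exI[of _ "pad i h (Suc j) \<odot> (pad (Suc i) h j \<odot> K)"]) (auto simp: total_laws(1) intro!: Hk_cmp Hk_gen)
qed

lemma D_pad_idn: "D l (i + m + j) W \<Longrightarrow> D l (i + m + j) (pad i (idn m) j \<odot> W)"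
  unfolding pad_idn by (rule D_left[OF _ Hk_idn])

lemma D_gen:
  shows "D l (i + 2 + j) W \<Longrightarrow> D l (i + 2 + j) (pad i h j \<odot> W)"
    and "D l (i + 2 + j) W \<Longrightarrow> D l (i + 2 + j) (pad i hb j \<odot> W)"
    and "D l (i + 2 + j) W \<Longrightarrow> D l (i + j) (pad i a j \<odot> W)"
    and "D l (i + j) W \<Longrightarrow> D l (i + 2 + j) (pad i u j \<odot> W)"
proof -
  show "D l (i + 2 + j) W \<Longrightarrow> D l (i + 2 + j) (pad i h j \<odot> W)" by (rule D_left[OF _ Hk_gen]) simp_all
  show "D l (i + 2 + j) W \<Longrightarrow> D l (i + 2 + j) (pad i hb j \<odot> W)" by (rule D_left[OF _ Hk_hb]) simp_all
  obtain K where K: "Hk (Suc (Suc (i + j))) K" "pad i a j = pad 0 a (i + j) \<odot> K" using cap_pad by blast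
  show "D l (i + 2 + j) W \<Longrightarrow> D l (i + j) (pad i a j \<odot> W)"
    unfolding K(2) total_laws(1) using K(1) by (intro D_left_cap) simp_all
  obtain K' where K': "Hk (Suc (Suc (i + j))) K'" "pad i u j = K' \<odot> pad 0 u (i + j)" using cup_pad by blast
  show "D l (i + j) W \<Longrightarrow> D l (i + 2 + j) (pad i u j \<odot> W)"
    unfolding K'(2) total_laws(1) using D_cup[OF _ K'(1)] by simp
qed

lemma D_ar: "D m n F \<Longrightarrow> ar m n F"
proof (induction rule: D.induct)
  case (D_cap m n F K)
  show ?case
    by (rule ar_cmp[OF D_cap.IH ar_cmp[OF _ Hk_ar[OF D_cap.hyps(2)]]])
      (use ar_pad[OF ars(4), of 0 m] in simp)
next
  case (D_cup m n F K)
  show ?case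
    by (rule ar_cmp[OF Hk_ar[OF D_cup.hyps(2)] ar_cmp[OF _ D_cup.IH]])
      (use ar_pad[OF ars(3), of 0 n] in simp)
qed (auto intro: Hk_ar ar_zer ar_add ar_sml)

lemma D_pad:
  assumes gens: "\<And>x. x \<in> gens S \<Longrightarrow> cls (TGen x) \<in> {h, hb, u, a}"
  shows "wt S m n f \<Longrightarrow> D l (i + m + j) W \<Longrightarrow> D l (i + n + j) (pad i (cls f) j \<odot> W)"
proof (induction arbitrary: i j l W rule: wt.induct)
  case (wt_id m)
  then show ?case unfolding cls_ops by (rule D_pad_idn)
next
  case (wt_gen x)
  have x: "ar (gsrc S x) (gtgt S x) (cls (TGen x))" using wt_gen(1) by (intro cls_arI wt.wt_gen)
  from gens[OF wt_gen(1)] consider "cls (TGen x) = h" | "cls (TGen x) = hb" | "cls (TGen x) = u" | "cls (TGen x) = a"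
    by blast
  then show ?case
  proof cases
    case 1
    then show ?thesis using D_gen(1) wt_gen(2) ar_unique[OF x] ars(1) by metis
  next
    case 2
    then show ?thesis using D_gen(2) wt_gen(2) ar_unique[OF x] ars(2) by metis
  next
    case 3
    then have "gsrc S x = 0 \<and> gtgt S x = 2" using ar_unique[OF x] ars(3) by metis
    then show ?thesis using 3 D_gen(4)[of l i j W] wt_gen(2) by simp
  next
    case 4
    then have "gsrc S x = 2 \<and> gtgt S x = 0" using ar_unique[OF x] ars(4) by metis
    then show ?thesis using 4 D_gen(3)[of l i j W] wt_gen(2) by simp
  qed
next
  case (wt_zero m n)
  show ?case unfolding cls_ops pad_zer zer_laws(1)[OF D_ar[OF wt_zero]] by (rule D_zer)
next
  case (wt_comp k n f m g)
  show ?case unfolding cls_ops pad_cmp[OF cls_arI[OF wt_comp(1)] cls_arI[OF wt_comp(2)], symmetric] total_laws(1)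
    by (intro wt_comp.IH wt_comp.prems)
next
  case (wt_tens m n f m' n' g)
  have "pad i (cls f \<boxtimes> cls g) j = pad i (cls f) (n' + j) \<odot> pad (i + m) (cls g) j"
    unfolding tns_split[OF cls_arI[OF wt_tens(1)] cls_arI[OF wt_tens(2)], symmetric]
    by (subst pad_cmp[symmetric, of _ "n + n'" _ "m + m'"])
      (auto intro!: ar_tns ar_idn cls_arI wt_tens.hyps simp: pad_def total_laws(2) simp flip: idn_tns)
  moreover have "D l (i + n + (n' + j)) (pad i (cls f) (n' + j) \<odot> (pad (i + m) (cls g) j \<odot> W))"
    using wt_tens.IH(2)[of l "i + m" j W] wt_tens.prems by (intro wt_tens.IH(1)) (simp_all add: ac_simps)
  ultimately show ?case unfolding cls_ops by (simp add: total_laws(1) ac_simps)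
qed (simp_all only: cls_ops pad_add pad_sml cmp_add_sml D_add D_sml)

lemma D_all:
  assumes "\<And>x. x \<in> gens S \<Longrightarrow> cls (TGen x) \<in> {h, hb, u, a}" and f: "wt S m n f"
  shows "D m n (cls f)"
  using D_pad[OF assms, of m 0 0 "idn m"] D_Hk[OF Hk_idn, of m] unit_laws(2)[OF cls_arI[OF f]]
  by (simp add: tns_pad(3)[OF cls_arI[OF f]])

inductive End :: "nat \<Rightarrow> ('a, 'b) tm set \<Rightarrow> bool" for n where
  End_idn: "End n (idn n)"
| End_h: "n = Suc (Suc (i + j)) \<Longrightarrow> End n (pad i h j)"
| End_ua: "n = Suc (Suc (i + j)) \<Longrightarrow> End n (pad i (u \<odot> a) j)"
| End_cmp: "End n X \<Longrightarrow> End n Z \<Longrightarrow> End n (X \<odot> Z)"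
| End_add: "End n X \<Longrightarrow> End n Z \<Longrightarrow> End n (X \<boxplus> Z)"
| End_sml: "End n X \<Longrightarrow> End n (c \<boxdot> X)"

lemma arp_ua: "arp 0 2 2 (u \<odot> a)"
  using arp_cmp[OF u a] by simp

lemma End_arp: "End m X \<Longrightarrow> arp 0 m m X"
  by (induction rule: End.induct)
    (auto intro: arp_idn arp_even_cmp arp_add arp_sml arp_even_pad[OF h] arp_even_pad[OF arp_ua])

lemma End_Hk: "Hk m X \<Longrightarrow> End m X"
  by (induction rule: Hk.induct) (simp_all only: End.intros)

lemma End_sh: "End m X \<Longrightarrow> End (Suc m) (sh X)"
proof (induction rule: End.induct)
  case End_idn
  show ?case using End.End_idn[of "Suc m"] by (simp add: pad_idn)
next
  case (End_h i j)
  then show ?case unfolding sh_pad by (intro End.End_h) simp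
next
  case (End_ua i j)
  then show ?case unfolding sh_pad by (intro End.End_ua) simp
next
  case (End_cmp X Z)
  show ?case unfolding sh_cmp[OF End_arp[OF End_cmp(1)] End_arp[OF End_cmp(2)]] by (rule End.End_cmp[OF End_cmp.IH])
qed (simp_all only: pad_add pad_sml End_add End_sml)

primrec caps where "caps 0 n = idn n" | "caps (Suc r) n = caps r n \<odot> pad 0 a (n + 2 * r)"
primrec cups where "cups 0 m = idn m" | "cups (Suc r) m = pad 0 u (m + 2 * r) \<odot> cups r m"

lemma caps_ar: "ar (n + 2 * r) n (caps r n)" and cups_ar: "ar m (m + 2 * r) (cups r m)"
proof (induction r)
  case (Suc r)
  case 1
  show ?case using ar_cmp[OF Suc(1) ar_pad[OF ars(4), of 0 "n + 2 * r", simplified]] by simp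
  case 2
  show ?case using ar_cmp[OF ar_pad[OF ars(3), of 0 "m + 2 * r", simplified] Suc(2)] by simp
qed (simp_all add: ar_idn)

lemma caps_Suc: "caps (Suc r) n = pad 0 a n \<odot> caps r (n + 2)"
proof (induction r)
  case 0
  then show ?case
    using unit_laws(1,2)[OF ar_pad[OF ars(4), of 0 n]] by simp
next
  case (Suc r)
  have "caps (Suc (Suc r)) n = caps (Suc r) n \<odot> pad 0 a (n + 2 * Suc r)" by simp
  also have "\<dots> = pad 0 a n \<odot> (caps r (n + 2) \<odot> pad 0 a (n + 2 + 2 * r))" unfolding Suc total_laws(1) by simp
  finally show ?case by simp
qed

lemma cups_Suc: "cups (Suc r) m = cups r (m + 2) \<odot> pad 0 u m"
proof (induction r)
  case 0
  then show ?case
    using unit_laws(1,2)[OF ar_pad[OF ars(3), of 0 m]] by simp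
next
  case (Suc r)
  have "cups (Suc (Suc r)) m = pad 0 u (m + 2 * Suc r) \<odot> cups (Suc r) m" by simp
  also have "\<dots> = pad 0 u (m + 2 + 2 * r) \<odot> cups r (m + 2) \<odot> pad 0 u m" unfolding Suc total_laws(1) by simp
  finally show ?case by simp
qed

lemma caps_far: "End n Z \<Longrightarrow> \<exists>Z'. End (n + 2 * r) Z' \<and> Z \<odot> caps r n = caps r n \<odot> Z'"
proof (induction r)
  case 0
  then show ?case using unit_laws(1,2)[OF arp_ar[OF End_arp[OF 0]]] by auto
next
  case (Suc r)
  then obtain Z' where Z': "End (n + 2 * r) Z'" "Z \<odot> caps r n = caps r n \<odot> Z'" by blast
  have "Z \<odot> caps (Suc r) n = caps (Suc r) n \<odot> sh (sh Z')"
    by (simp only: caps.simps cmp_assoc_rule[OF Z'(2)] total_laws(1) sh_sh far(2)[OF End_arp[OF Z'(1)]])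
  then show ?case using End_sh[OF End_sh[OF Z'(1)]] by auto
qed

lemma cups_far: "End m Z \<Longrightarrow> \<exists>Z'. End (m + 2 * r) Z' \<and> cups r m \<odot> Z = Z' \<odot> cups r m"
proof (induction r)
  case 0
  then show ?case using unit_laws(1,2)[OF arp_ar[OF End_arp[OF 0]]] by auto
next
  case (Suc r)
  then obtain Z' where Z': "End (m + 2 * r) Z'" "cups r m \<odot> Z = Z' \<odot> cups r m" by blast
  have "cups (Suc r) m \<odot> Z = sh (sh Z') \<odot> cups (Suc r) m"
    by (simp only: cups.simps total_laws(1) Z'(2) sh_sh cmp_assoc_rule[OF far(3)[OF End_arp[OF Z'(1)]]])
  then show ?case using End_sh[OF End_sh[OF Z'(1)]] by auto
qed

lemma pad_ua: "pad 0 u m \<odot> pad 0 a m = pad 0 (u \<odot> a) m"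
  by (rule pad_cmp[OF ars(3,4)])

lemma D_caps_cups:
  "D m n F \<Longrightarrow> (\<forall>r. m = n + 2 * r \<longrightarrow> (\<exists>X. End m X \<and> F = caps r n \<odot> X)) \<and>
    (\<forall>r. n = m + 2 * r \<longrightarrow> (\<exists>X. End n X \<and> F = X \<odot> cups r m))"
proof (induction rule: D.induct)
  case (D_Hk m K)
  then show ?case using unit_laws(1,2)[OF Hk_ar[OF D_Hk]] by (auto intro!: exI[of _ K] End_Hk)
next
  case (D_cap m n F K)
  have K: "End (Suc (Suc m)) K" by (rule End_Hk[OF D_cap.hyps(2)])
  have e: "End (m + 2) (pad 0 (u \<odot> a) m \<odot> K)" using K by (auto intro!: End_cmp End_ua)
  show ?case
  proof (intro conjI allI impI)
    fix r assume r: "Suc (Suc m) = n + 2 * r"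
    show "\<exists>X. End (Suc (Suc m)) X \<and> F \<odot> (pad 0 a m \<odot> K) = caps r n \<odot> X"
    proof (cases r)
      case 0
      then obtain X where X: "End n X" "F = X \<odot> cups 1 m" using D_cap.IH r by fastforce
      have "F \<odot> (pad 0 a m \<odot> K) = X \<odot> (pad 0 u m \<odot> (pad 0 a m \<odot> K))"
        using unit_laws(2)[OF ar_pad[OF ars(3), of 0 m]] by (simp add: X(2) total_laws(1))
      also have "\<dots> = X \<odot> (pad 0 (u \<odot> a) m \<odot> K)" unfolding cmp_assoc_rule[OF pad_ua] ..
      finally show ?thesis using 0 r End_cmp[OF X(1)] e unit_laws(1)[OF arp_ar[OF End_arp]] by fastforce
    next
      case (Suc r')
      then obtain X where X: "End m X" "F = caps r' n \<odot> X" using D_cap.IH r by fastforce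
      have "F \<odot> (pad 0 a m \<odot> K) = caps r n \<odot> (sh (sh X) \<odot> K)"
        unfolding X(2) total_laws(1) cmp_assoc_rule[OF far(2)[OF End_arp[OF X(1)], symmetric]] sh_sh
        using Suc r by (simp add: total_laws(1))
      then show ?thesis using End_cmp[OF End_sh[OF End_sh[OF X(1)]] K] by blast
    qed
  next
    fix r assume r: "n = Suc (Suc m) + 2 * r"
    then have "n = m + 2 * Suc r" by simp
    then obtain X where X: "End n X" "F = X \<odot> cups (Suc r) m" using D_cap.IH by blast
    obtain Z where Z: "End (m + 2 + 2 * r) Z" "cups r (m + 2) \<odot> (pad 0 (u \<odot> a) m \<odot> K) = Z \<odot> cups r (m + 2)"
      using cups_far[OF e] by blast
    have "F \<odot> (pad 0 a m \<odot> K) = X \<odot> (Z \<odot> cups r (m + 2))"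
      unfolding X(2) cups_Suc total_laws(1) cmp_assoc_rule[OF pad_ua] Z(2) ..
    then show "\<exists>X. End n X \<and> F \<odot> (pad 0 a m \<odot> K) = X \<odot> cups r (Suc (Suc m))"
      using X(1) Z(1) r by (intro exI[of _ "X \<odot> Z"]) (auto simp: total_laws(1) intro!: End_cmp)
  qed
next
  case (D_cup m n F K)
  have K: "End (Suc (Suc n)) K" by (rule End_Hk[OF D_cup.hyps(2)])
  have e: "End (n + 2) (K \<odot> pad 0 (u \<odot> a) n)" using K by (auto intro!: End_cmp End_ua)
  show ?case
  proof (intro conjI allI impI)
    fix r assume r: "Suc (Suc n) = m + 2 * r"
    show "\<exists>X. End (Suc (Suc n)) X \<and> K \<odot> (pad 0 u n \<odot> F) = X \<odot> cups r m"
    proof (cases r)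
      case 0
      then obtain X where X: "End m X" "F = caps 1 n \<odot> X" using D_cup.IH r by fastforce
      have "K \<odot> (pad 0 u n \<odot> F) = K \<odot> (pad 0 u n \<odot> (pad 0 a n \<odot> X))"
        using unit_laws(1)[OF ar_pad[OF ars(4), of 0 n]] by (simp add: X(2) total_laws(1))
      also have "\<dots> = (K \<odot> pad 0 (u \<odot> a) n) \<odot> X" unfolding cmp_assoc_rule[OF pad_ua] total_laws(1) ..
      finally show ?thesis using 0 r End_cmp[OF _ X(1)] e unit_laws(2)[OF arp_ar[OF End_arp]] by fastforce
    next
      case (Suc r')
      then obtain X where X: "End n X" "F = X \<odot> cups r' m" using D_cup.IH r by fastforce
      have "K \<odot> (pad 0 u n \<odot> F) = (K \<odot> sh (sh X)) \<odot> cups r m"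
        unfolding X(2) cmp_assoc_rule[OF far(3)[OF End_arp[OF X(1)], symmetric]] sh_sh
        using Suc r by (simp add: total_laws(1))
      then show ?thesis using End_cmp[OF K End_sh[OF End_sh[OF X(1)]]] by blast
    qed
  next
    fix r assume r: "m = Suc (Suc n) + 2 * r"
    then have "m = n + 2 * Suc r" by simp
    then obtain X where X: "End m X" "F = caps (Suc r) n \<odot> X" using D_cup.IH by blast
    obtain Z where Z: "End (n + 2 + 2 * r) Z" "(K \<odot> pad 0 (u \<odot> a) n) \<odot> caps r (n + 2) = caps r (n + 2) \<odot> Z"
      using caps_far[OF e] by blast
    have "K \<odot> (pad 0 u n \<odot> F) = caps r (n + 2) \<odot> Z \<odot> X"
      unfolding X(2) caps_Suc Z(2)[symmetric] total_laws(1) cmp_assoc_rule[OF pad_ua] ..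
    then show "\<exists>X. End m X \<and> K \<odot> (pad 0 u n \<odot> F) = caps r (Suc (Suc n)) \<odot> X"
      using X(1) Z(1) r by (intro exI[of _ "Z \<odot> X"]) (auto simp: total_laws(1) intro!: End_cmp)
  qed
next
  case (D_zer m n)
  have z: "End k (zer k k)" for k using End_sml[OF End_idn, of k 0] unit_laws(8)[OF ar_idn] by simp
  then show ?case using zer_laws(1)[OF cups_ar] zer_laws(2)[OF caps_ar] by metis
next
  case (D_add m n F G)
  then show ?case unfolding conj_imp_eq_imp_imp by (metis End_add cmp_add_sml(1,2))
next
  case (D_sml m n F c)
  then show ?case by (metis End_sml cmp_add_sml(3,4))
qed

theorem End_all:
  assumes "\<And>x. x \<in> gens S \<Longrightarrow> cls (TGen x) \<in> {h, hb, u, a}" "wt S n n f"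
  shows "End n (cls f)"
proof -
  obtain X where "End n X" "cls f = X \<odot> cups 0 n" using D_caps_cups[OF D_all[OF assms]] by fastforce
  then show ?thesis using unit_laws(2)[OF arp_ar[OF End_arp]] by simp
qed

end

section \<open>The matrix representation\<close>

definition lsign :: "int \<Rightarrow> int \<Rightarrow> 'f::field" where
  "lsign x y = (if x < 0 \<and> y < 0 then - 1 else 1)"

definition hop :: "'f::field \<Rightarrow> (int \<Rightarrow> int \<Rightarrow> 'f) \<Rightarrow> int \<Rightarrow> int \<Rightarrow> 'f" where
  "hop q f x y =
    (if x = y then (if 0 < x then q else - inverse q) * f x x
     else if y = - x then
       (if 0 < x then inverse q * f (- x) x + (q - inverse q) * f x (- x) else q * f (- x) x)
       - (q - inverse q) * (\<Sum>c\<in>{1..<\<bar>x\<bar>}. f (- c) c - f c (- c))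
     else lsign x y * f y x + (if \<bar>y\<bar> < \<bar>x\<bar> then (q - inverse q) * f x y else 0))"

lemma hop_same: "hop q f x x = (if 0 < x then q else - inverse q) * f x x"
  by (simp add: hop_def)

lemma hop_opp: "x \<noteq> 0 \<Longrightarrow> hop q f x (- x) =
    (if 0 < x then inverse q * f (- x) x + (q - inverse q) * f x (- x) else q * f (- x) x)
       - (q - inverse q) * (\<Sum>c\<in>{1..<\<bar>x\<bar>}. f (- c) c - f c (- c))"
  by (simp add: hop_def)

lemma hop_opp': "x \<noteq> 0 \<Longrightarrow> hop q f (- x) x =
    (if x < 0 then inverse q * f x (- x) + (q - inverse q) * f (- x) x else q * f x (- x))
       - (q - inverse q) * (\<Sum>c\<in>{1..<\<bar>x\<bar>}. f (- c) c - f c (- c))"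
  using hop_opp[of "- x" q f] by simp

lemma hop_diff: "\<bar>x\<bar> \<noteq> \<bar>y\<bar> \<Longrightarrow> hop q f x y =
    lsign x y * f y x + (if \<bar>y\<bar> < \<bar>x\<bar> then (q - inverse q) * f x y else 0)"
  by (auto simp: hop_def)

lemma hop_add: "hop q (\<lambda>a b. f a b + f' a b) x y = hop q f x y + hop q f' x y"
  by (simp add: hop_def algebra_simps sum.distrib sum_subtractf)
lemma hop_scale: "hop q (\<lambda>a b. c * f a b) x y = c * hop q f x y"
  by (simp add: hop_def algebra_simps sum_distrib_left sum_subtractf)

lemma hop_hop:
  assumes "q \<noteq> 0" "x \<noteq> 0" "y \<noteq> 0"
  shows "hop q (hop q f) x y = f x y + (q - inverse q) * hop q f x y"
proof -
  have S: "(\<Sum>c\<in>{1..<\<bar>x\<bar>}. hop q f (- c) c - hop q f c (- c)) =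
     - inverse q * (\<Sum>c\<in>{1..<\<bar>x\<bar>}. f (- c) c - f c (- c))"
    unfolding sum_distrib_left by (intro sum.cong) (auto simp: hop_opp hop_opp' algebra_simps)
  consider "x = y" | "y = - x" | "\<bar>x\<bar> \<noteq> \<bar>y\<bar>" by linarith
  then show ?thesis
  proof cases
    case 1
    then show ?thesis using assms by (simp add: hop_same field_simps)
  next
    case 2
    show ?thesis unfolding 2 hop_opp[OF assms(2)] S using assms
      by (simp add: hop_opp hop_opp' field_simps)
  next
    case 3
    then show ?thesis using assms by (auto simp: hop_diff lsign_def algebra_simps)
  qed
qed


definition hop12 :: "'f::field \<Rightarrow> (int \<Rightarrow> int \<Rightarrow> int \<Rightarrow> 'f) \<Rightarrow> int \<Rightarrow> int \<Rightarrow> int \<Rightarrow> 'f" where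
  "hop12 q G x y w = hop q (\<lambda>a b. G a b w) x y"
definition hop23 :: "'f::field \<Rightarrow> (int \<Rightarrow> int \<Rightarrow> int \<Rightarrow> 'f) \<Rightarrow> int \<Rightarrow> int \<Rightarrow> int \<Rightarrow> 'f" where
  "hop23 q G x y w = hop q (\<lambda>a b. G x a b) y w"

definition tr12 :: "(int \<Rightarrow> int \<Rightarrow> int \<Rightarrow> 'f::field) \<Rightarrow> int \<Rightarrow> int set \<Rightarrow> 'f" where
  "tr12 G w C = (\<Sum>c\<in>C. G (- c) c w - G c (- c) w)"
definition tr23 :: "(int \<Rightarrow> int \<Rightarrow> int \<Rightarrow> 'f::field) \<Rightarrow> int \<Rightarrow> int set \<Rightarrow> 'f" where
  "tr23 G w C = (\<Sum>c\<in>C. G w (- c) c - G w c (- c))"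
definition tr13 :: "(int \<Rightarrow> int \<Rightarrow> int \<Rightarrow> 'f::field) \<Rightarrow> int \<Rightarrow> int set \<Rightarrow> 'f" where
  "tr13 G w C = (\<Sum>c\<in>C. G (- c) w c - lsign (- 1) w * G c w (- c))"

context
  fixes q :: "'f::field"
  assumes q: "q \<noteq> 0"
begin

abbreviation (input) "z \<equiv> q - inverse q"

lemma hop12_opp: "x \<noteq> 0 \<Longrightarrow> hop12 q G x (- x) w =
    (if 0 < x then inverse q * G (- x) x w + z * G x (- x) w else q * G (- x) x w)
    - z * tr12 G w {1..<\<bar>x\<bar>}"
  and hop12_opp': "x \<noteq> 0 \<Longrightarrow> hop12 q G (- x) x w =
    (if x < 0 then inverse q * G x (- x) w + z * G (- x) x w else q * G x (- x) w)
    - z * tr12 G w {1..<\<bar>x\<bar>}"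
  and hop23_opp: "x \<noteq> 0 \<Longrightarrow> hop23 q G w x (- x) =
    (if 0 < x then inverse q * G w (- x) x + z * G w x (- x) else q * G w (- x) x)
    - z * tr23 G w {1..<\<bar>x\<bar>}"
  and hop23_opp': "x \<noteq> 0 \<Longrightarrow> hop23 q G w (- x) x =
    (if x < 0 then inverse q * G w x (- x) + z * G w (- x) x else q * G w x (- x))
    - z * tr23 G w {1..<\<bar>x\<bar>}"
  by (simp_all add: hop12_def hop23_def tr12_def tr23_def hop_opp hop_opp')

lemma hop12_same: "hop12 q G x x w = (if 0 < x then q else - inverse q) * G x x w"
  and hop23_same: "hop23 q G w x x = (if 0 < x then q else - inverse q) * G w x x"
  by (simp_all add: hop12_def hop23_def hop_same)

lemma hop12_diff: "\<bar>x\<bar> \<noteq> \<bar>y\<bar> \<Longrightarrow> hop12 q G x y w =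
    lsign x y * G y x w + (if \<bar>y\<bar> < \<bar>x\<bar> then z * G x y w else 0)"
  and hop23_diff: "\<bar>x\<bar> \<noteq> \<bar>y\<bar> \<Longrightarrow> hop23 q G w x y =
    lsign x y * G w y x + (if \<bar>y\<bar> < \<bar>x\<bar> then z * G w x y else 0)"
  by (simp_all add: hop12_def hop23_def hop_diff)

lemma tr12_hop12: "C \<subseteq> {0<..} \<Longrightarrow> tr12 (hop12 q G) w C = - inverse q * tr12 G w C"
  and tr23_hop23: "C \<subseteq> {0<..} \<Longrightarrow> tr23 (hop23 q G) w C = - inverse q * tr23 G w C"
  unfolding tr12_def tr23_def sum_distrib_left
  by (auto intro!: sum.cong simp: hop12_opp hop12_opp' hop23_opp hop23_opp' algebra_simps dest: subsetD)

lemma tr_hop_low: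
  assumes "C \<subseteq> {0<..<\<bar>w\<bar>}"
  shows "tr12 (hop23 q G) w C = tr13 G w C"
    and "tr13 (hop12 q G) w C = lsign (- 1) w * tr23 G w C"
    and "tr23 (hop12 q G) w C = lsign (- 1) w * tr13 G w C + z * tr23 G w C"
    and "tr13 (hop23 q G) w C = tr12 G w C + z * tr13 G w C"
proof -
  have c: "0 < c \<and> c < \<bar>w\<bar>" if "c \<in> C" for c using assms that by auto
  show "tr12 (hop23 q G) w C = tr13 G w C"
    and "tr13 (hop12 q G) w C = lsign (- 1) w * tr23 G w C"
    and "tr23 (hop12 q G) w C = lsign (- 1) w * tr13 G w C + z * tr23 G w C"
    and "tr13 (hop23 q G) w C = tr12 G w C + z * tr13 G w C"
    unfolding tr12_def tr23_def tr13_def sum_distrib_left sum.distrib[symmetric]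
    by (intro sum.cong refl; drule c; simp add: hop12_diff hop23_diff lsign_def algebra_simps)+
qed

lemma tr_hop_high:
  assumes "C \<subseteq> {\<bar>w\<bar><..}"
  shows "tr12 (hop23 q G) w C = tr13 G w C + z * tr12 G w C"
    and "tr13 (hop12 q G) w C = lsign (- 1) w * tr23 G w C + z * tr13 G w C"
    and "tr23 (hop12 q G) w C = lsign (- 1) w * tr13 G w C"
    and "tr13 (hop23 q G) w C = tr12 G w C"
proof -
  have c: "0 < c \<and> \<bar>w\<bar> < c" if "c \<in> C" for c using assms that by auto
  show "tr12 (hop23 q G) w C = tr13 G w C + z * tr12 G w C"
    and "tr13 (hop12 q G) w C = lsign (- 1) w * tr23 G w C + z * tr13 G w C"
    and "tr23 (hop12 q G) w C = lsign (- 1) w * tr13 G w C"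
    and "tr13 (hop23 q G) w C = tr12 G w C"
    unfolding tr12_def tr23_def tr13_def sum_distrib_left sum.distrib[symmetric]
    by (intro sum.cong refl; drule c; simp add: hop12_diff hop23_diff lsign_def algebra_simps)+
qed

lemma tr_split:
  assumes "w \<noteq> 0" "\<bar>w\<bar> < n"
  shows "tr12 G v {1..<n} = tr12 G v {1..<\<bar>w\<bar>} + (G (- \<bar>w\<bar>) \<bar>w\<bar> v - G \<bar>w\<bar> (- \<bar>w\<bar>) v)
      + tr12 G v {\<bar>w\<bar><..<n}"
    and "tr23 G v {1..<n} = tr23 G v {1..<\<bar>w\<bar>} + (G v (- \<bar>w\<bar>) \<bar>w\<bar> - G v \<bar>w\<bar> (- \<bar>w\<bar>))
      + tr23 G v {\<bar>w\<bar><..<n}"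
proof -
  have "{1..<n} = insert \<bar>w\<bar> ({1..<\<bar>w\<bar>} \<union> {\<bar>w\<bar><..<n})" using assms by auto
  moreover have "{1..<\<bar>w\<bar>} \<inter> {\<bar>w\<bar><..<n} = {}" by auto
  ultimately show "tr12 G v {1..<n} = tr12 G v {1..<\<bar>w\<bar>} + (G (- \<bar>w\<bar>) \<bar>w\<bar> v - G \<bar>w\<bar> (- \<bar>w\<bar>) v)
      + tr12 G v {\<bar>w\<bar><..<n}"
    and "tr23 G v {1..<n} = tr23 G v {1..<\<bar>w\<bar>} + (G v (- \<bar>w\<bar>) \<bar>w\<bar> - G v \<bar>w\<bar> (- \<bar>w\<bar>))
      + tr23 G v {\<bar>w\<bar><..<n}"
    by (simp_all add: tr12_def tr23_def sum.union_disjoint)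
qed

lemma hop_braid:
  assumes nz: "x \<noteq> 0" "y \<noteq> 0" "w \<noteq> 0"
  shows "hop12 q (hop23 q (hop12 q G)) x y w = hop23 q (hop12 q (hop23 q G)) x y w"
proof -
  define r where "r = inverse q"
  have qr: "q * r = 1" "q * (r * a) = a" for a using q by (simp_all add: r_def)
  note fold = r_def[symmetric]
  have lo: "{1..<n} \<subseteq> {0<..<\<bar>v\<bar>}" if "n \<le> \<bar>v\<bar>" for n v :: int using that by auto
  have hi: "{m<..<n} \<subseteq> {\<bar>v\<bar><..}" if "\<bar>v\<bar> \<le> m" for m n v :: int using that by auto
  have pos: "{1..<n} \<subseteq> {0<..}" "0 \<le> m \<Longrightarrow> {m<..<n} \<subseteq> {0<..}" for m n :: int by auto
  note defs = hop12_diff hop23_diff hop12_same hop23_same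
  note opp = hop12_opp hop12_opp' hop23_opp hop23_opp'
  note trs = tr_hop_low[OF lo] tr_hop_high[OF hi] tr12_hop12[OF pos(1)] tr23_hop23[OF pos(1)]
    tr12_hop12[OF pos(2)] tr23_hop23[OF pos(2)]
  note trs0 = tr_hop_low tr12_hop12 tr23_hop23 lo pos
  consider "\<bar>x\<bar> \<noteq> \<bar>y\<bar>" "\<bar>x\<bar> \<noteq> \<bar>w\<bar>" "\<bar>y\<bar> \<noteq> \<bar>w\<bar>" | "x = y" "\<bar>x\<bar> \<noteq> \<bar>w\<bar>"
    | "y = w" "\<bar>x\<bar> \<noteq> \<bar>y\<bar>" | "x = w" "\<bar>x\<bar> \<noteq> \<bar>y\<bar>" | "x = y" "y = w"
    | "y = - x" "\<bar>x\<bar> < \<bar>w\<bar>" | "y = - x" "\<bar>w\<bar> < \<bar>x\<bar>" 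
    | "w = - y" "\<bar>y\<bar> < \<bar>x\<bar>" | "w = - y" "\<bar>x\<bar> < \<bar>y\<bar>"
    | "w = - x" "\<bar>x\<bar> < \<bar>y\<bar>" | "w = - x" "\<bar>y\<bar> < \<bar>x\<bar>"
    | "y = x" "w = - x" | "y = - x" "w = x" | "y = - x" "w = - x"
    by (smt (verit))
  then show ?thesis
  proof cases
    case 1
    then show ?thesis by (simp add: defs) (auto simp: lsign_def algebra_simps)
  next
    case 2
    then show ?thesis using nz by (simp add: defs fold) (auto simp: lsign_def algebra_simps qr)
  next
    case 3
    then show ?thesis using nz by (simp add: defs fold) (auto simp: lsign_def algebra_simps qr)
  next
    case 4
    then show ?thesis using nz by (simp add: defs fold) (auto simp: lsign_def algebra_simps qr)
  next
    case 5
    then show ?thesis by (simp add: defs)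
  next
    case 6
    then show ?thesis using nz
      by (simp add: defs opp trs0 fold) (auto simp: lsign_def algebra_simps qr)
  next
    case 7
    then show ?thesis using nz
      by (cases "0 < x"; cases "0 < w"; simp add: defs opp trs fold tr_split[of w] lsign_def;
          simp add: algebra_simps qr)
  next
    case 8
    then show ?thesis using nz
      by (simp add: defs opp trs0 fold) (auto simp: lsign_def algebra_simps qr)
  next
    case 9
    then show ?thesis using nz
      by (cases "0 < x"; cases "0 < y"; simp add: defs opp trs fold tr_split[of x] lsign_def;
          simp add: algebra_simps qr)
  next
    case 10
    then show ?thesis using nz
      by (simp add: defs opp trs0 fold) (auto simp: lsign_def algebra_simps qr)
  next
    case 11
    then show ?thesis using nz
      by (cases "0 < x"; cases "0 < y"; simp add: defs opp trs fold tr_split[of y] lsign_def;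
          simp add: algebra_simps qr)
  next
    case 12
    then show ?thesis using nz
      by (cases "0 < x"; simp add: defs opp trs fold lsign_def;
          simp add: algebra_simps qr)
  next
    case 13
    then show ?thesis using nz
      by (cases "0 < x"; simp add: defs opp trs fold lsign_def;
          simp add: algebra_simps qr)
  next
    case 14
    then show ?thesis using nz
      by (cases "0 < x"; simp add: defs opp trs fold lsign_def;
          simp add: algebra_simps qr)
  qed
qed

end

declare add_bit_eq_xor [simp del]

lemma bit_add_self [simp]: "(x::bit) + x = 0" "x + (x + y) = y"
  by (cases x; simp add: add_bit_eq_xor) (cases x; cases y; simp add: add_bit_eq_xor)

definition lpar :: "int \<Rightarrow> bit" where "lpar a = (if a < 0 then 1 else 0)"
definition tpar :: "int list \<Rightarrow> bit" where "tpar t = sum_list (map lpar t)"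

lemma tpar_simps [simp]: "tpar [] = 0" "tpar (a # t) = lpar a + tpar t" "tpar (t @ t') = tpar t + tpar t'"
  by (simp_all add: tpar_def)

lemma lpar_opp: "a \<noteq> 0 \<Longrightarrow> lpar a + lpar (- a) = 1" "a \<noteq> 0 \<Longrightarrow> lpar (- a) + lpar a = 1"
  by (auto simp: lpar_def)

definition letters :: "nat \<Rightarrow> int set" where "letters N = {a. a \<noteq> 0 \<and> \<bar>a\<bar> \<le> int N}"
definition labels :: "nat \<Rightarrow> nat \<Rightarrow> int list set" where
  "labels N m = {t. length t = m \<and> set t \<subseteq> letters N}"

lemma finite_letters [simp]: "finite (letters N)"
  by (rule finite_subset[of _ "{- int N..int N}"]) (auto simp: letters_def)

lemma finite_labels [simp]: "finite (labels N m)"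
  using finite_lists_length_eq[OF finite_letters, of N m] by (simp add: labels_def conj_commute)

lemma labels_0 [simp]: "labels N 0 = {[]}"
  by (auto simp: labels_def)

lemma letters_uminus [simp]: "- a \<in> letters N \<longleftrightarrow> a \<in> letters N"
  by (simp add: letters_def)

lemma Cons_in_labels [simp]: "a # t \<in> labels N (Suc m) \<longleftrightarrow> a \<in> letters N \<and> t \<in> labels N m"
  by (auto simp: labels_def)

lemma append_in_labels: "t1 \<in> labels N a \<Longrightarrow> t2 \<in> labels N b \<Longrightarrow> t1 @ t2 \<in> labels N (a + b)"
  by (auto simp: labels_def)

lemma labels_length: "t \<in> labels N m \<Longrightarrow> length t = m"
  by (simp add: labels_def)

lemma labels_appendE:
  assumes "t \<in> labels N (a + b)"
  obtains t1 t2 where "t = t1 @ t2" "t1 \<in> labels N a" "t2 \<in> labels N b"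
proof
  show "t = take a t @ drop a t" by simp
  show "take a t \<in> labels N a" "drop a t \<in> labels N b"
    using assms by (auto simp: labels_def dest: in_set_takeD in_set_dropD)
qed

lemma labels_SucE:
  assumes "t \<in> labels N (Suc m)"
  obtains a t' where "t = a # t'" "a \<in> letters N" "t' \<in> labels N m"
  using assms by (cases t) (auto simp: labels_def)

lemma labels_2E:
  assumes "t \<in> labels N 2"
  obtains x y where "t = [x, y]" "x \<in> letters N" "y \<in> letters N"
proof -
  obtain x t' where t: "t = x # t'" "x \<in> letters N" "t' \<in> labels N 1"
    using assms unfolding numeral_2_eq_2 One_nat_def by (rule labels_SucE)
  obtain y t'' where "t' = y # t''" "y \<in> letters N" "t'' \<in> labels N 0"
    using t(3) unfolding One_nat_def by (rule labels_SucE)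
  with t that show thesis by simp
qed

lemma sum_labels_append:
  "(\<Sum>u\<in>labels N (a + b). F u) = (\<Sum>u\<in>labels N a. \<Sum>v\<in>labels N b. F (u @ v))"
proof -
  have bij: "bij_betw (\<lambda>p. fst p @ snd p) (labels N a \<times> labels N b) (labels N (a + b))"
    unfolding bij_betw_def
  proof
    show "inj_on (\<lambda>p. fst p @ snd p) (labels N a \<times> labels N b)"
      by (auto simp: inj_on_def labels_def)
    show "(\<lambda>p. fst p @ snd p) ` (labels N a \<times> labels N b) = labels N (a + b)"
    proof (intro equalityI subsetI)
      fix t assume "t \<in> labels N (a + b)"
      then obtain t1 t2 where "t = t1 @ t2" "t1 \<in> labels N a" "t2 \<in> labels N b"
        by (rule labels_appendE)
      then show "t \<in> (\<lambda>p. fst p @ snd p) ` (labels N a \<times> labels N b)" by force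
    qed (auto simp: append_in_labels)
  qed
  show ?thesis unfolding sum.cartesian_product
    using sum.reindex_bij_betw[OF bij, of F] by (simp add: case_prod_unfold)
qed

fun tsrc :: "(gen, 'k) tm \<Rightarrow> nat" where
  "tsrc (TId m) = m"
| "tsrc (TGen x) = gsrc (sig UNIV) x"
| "tsrc (TZero m n) = m"
| "tsrc (f \<cdot> g) = tsrc g"
| "tsrc (f \<star> g) = tsrc f + tsrc g"
| "tsrc (f +\<^sub>t g) = tsrc f"
| "tsrc (c *\<^sub>t f) = tsrc f"

fun ttgt :: "(gen, 'k) tm \<Rightarrow> nat" where
  "ttgt (TId m) = m"
| "ttgt (TGen x) = gtgt (sig UNIV) x"
| "ttgt (TZero m n) = n"
| "ttgt (f \<cdot> g) = ttgt f"
| "ttgt (f \<star> g) = ttgt f + ttgt g"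
| "ttgt (f +\<^sub>t g) = ttgt f"
| "ttgt (c *\<^sub>t f) = ttgt f"

lemma wt_src_tgt: "wt (sig UNIV) m n f \<Longrightarrow> tsrc f = m \<and> ttgt f = n"
  by (induction rule: wt.induct) auto

lemma sig_simps [simp]:
  "gsrc (sig G) GH = 2" "gsrc (sig G) GH' = 2" "gsrc (sig G) GA = 2" "gsrc (sig G) GU = 0"
  "gtgt (sig G) GH = 2" "gtgt (sig G) GH' = 2" "gtgt (sig G) GA = 0" "gtgt (sig G) GU = 2"
  "gpar (sig G) GH = 0" "gpar (sig G) GH' = 0" "gpar (sig G) GA = 1" "gpar (sig G) GU = 1"
  "gens (sig G) = G"
  by (simp_all add: sig_def)

lemma hop_minus: "hop q (\<lambda>a b. f a b - f' a b) x y = hop q f x y - hop q f' x y"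
  using hop_add[of q f "\<lambda>a b. (- 1) * f' a b" x y] unfolding hop_scale by simp

definition hopb :: "'f::field \<Rightarrow> (int \<Rightarrow> int \<Rightarrow> 'f) \<Rightarrow> int \<Rightarrow> int \<Rightarrow> 'f" where
  "hopb q f x y = hop q f x y - (q - inverse q) * f x y"

lemma hop_hopb: "q \<noteq> 0 \<Longrightarrow> x \<noteq> 0 \<Longrightarrow> y \<noteq> 0 \<Longrightarrow> hop q (hopb q f) x y = f x y"
  and hopb_hop: "q \<noteq> 0 \<Longrightarrow> x \<noteq> 0 \<Longrightarrow> y \<noteq> 0 \<Longrightarrow> hopb q (hop q f) x y = f x y"
proof -
  have "hop q (hopb q f) x y = hop q (hop q f) x y - (q - inverse q) * hop q f x y"
    unfolding hopb_def[abs_def] hop_minus hop_scale ..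
  then show "q \<noteq> 0 \<Longrightarrow> x \<noteq> 0 \<Longrightarrow> y \<noteq> 0 \<Longrightarrow> hop q (hopb q f) x y = f x y"
    by (simp add: hop_hop)
qed (simp add: hopb_def hop_hop)

lemma hop_cong:
  assumes "x \<in> letters N" "y \<in> letters N"
    "\<And>a b. a \<in> letters N \<Longrightarrow> b \<in> letters N \<Longrightarrow> f a b = f' a b"
  shows "hop q f x y = hop q f' x y" "hopb q f x y = hopb q f' x y"
proof -
  have "(\<Sum>c\<in>{1..<\<bar>x\<bar>}. f (- c) c - f c (- c)) = (\<Sum>c\<in>{1..<\<bar>x\<bar>}. f' (- c) c - f' c (- c))"
    using assms by (intro sum.cong refl) (auto simp: letters_def)
  then show "hop q f x y = hop q f' x y" unfolding hop_def using assms by auto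
  then show "hopb q f x y = hopb q f' x y" unfolding hopb_def using assms by auto
qed

lemma hop_sum: "hop q (\<lambda>a b. \<Sum>u\<in>S. k u a b) x y = (\<Sum>u\<in>S. hop q (k u) x y)"
proof (induction S rule: infinite_finite_induct)
  case (insert u S)
  then show ?case by (simp add: hop_add)
qed (use hop_scale[of q 0 "\<lambda>_ _. 0" x y] in simp_all)

lemma hop_expand:
  assumes "x \<in> letters N" "y \<in> letters N" "finite S"
    "\<And>a b. a \<in> letters N \<Longrightarrow> b \<in> letters N \<Longrightarrow> \<iota> a b \<in> S"
  shows "(\<Sum>u\<in>S. hop q (\<lambda>a b. of_bool (u = \<iota> a b)) x y * F u) = hop q (\<lambda>a b. F (\<iota> a b)) x y" (is "?l = ?r")
    and "(\<Sum>u\<in>S. hopb q (\<lambda>a b. of_bool (u = \<iota> a b)) x y * F u) = hopb q (\<lambda>a b. F (\<iota> a b)) x y"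
proof -
  have delta: "(\<Sum>u\<in>S. F u * of_bool (u = \<iota> a b)) = F (\<iota> a b)" if "a \<in> letters N" "b \<in> letters N" for a b
    using assms(3) assms(4)[OF that] by (simp add: of_bool_def if_distrib cong: if_cong)
  have "?r = hop q (\<lambda>a b. \<Sum>u\<in>S. F u * of_bool (u = \<iota> a b)) x y"
    using delta by (intro hop_cong(1)[OF assms(1,2)]) simp
  also have "\<dots> = ?l" by (simp add: hop_sum hop_scale mult.commute)
  finally show eq: "?l = ?r" by simp
  show "(\<Sum>u\<in>S. hopb q (\<lambda>a b. of_bool (u = \<iota> a b)) x y * F u) = hopb q (\<lambda>a b. F (\<iota> a b)) x y"
  proof -
    have "(\<Sum>u\<in>S. (q - inverse q) * of_bool (u = \<iota> x y) * F u) = (q - inverse q) * F (\<iota> x y)"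
      using delta[OF assms(1,2)] by (simp add: mult.assoc mult.commute[of "of_bool _"] flip: sum_distrib_left)
    then show ?thesis using eq by (simp add: hopb_def left_diff_distrib sum_subtractf)
  qed
qed

fun rep_gen :: "'f::field \<Rightarrow> gen \<Rightarrow> int list \<Rightarrow> int list \<Rightarrow> 'f" where
  "rep_gen q GH [x, y] s = hop q (\<lambda>a b. of_bool (s = [a, b])) x y"
| "rep_gen q GH' [x, y] s = hopb q (\<lambda>a b. of_bool (s = [a, b])) x y"
| "rep_gen q GA [] [a, b] = of_bool (b = - a) * koszul_sign 1 (lpar a)"
| "rep_gen q GU [a, b] [] = of_bool (b = - a)"
| "rep_gen q _ _ _ = 0"

text \<open>The matrix entry of \<open>f\<close> at row \<open>t\<close> and column \<open>s\<close>. In a tensor product, the sign is the one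
  for moving \<open>g\<close>, whose parity is that of \<open>t\<close> and \<open>s\<close> restricted to its strands, past the input of \<open>f\<close>.\<close>

fun rep :: "'f::field \<Rightarrow> nat \<Rightarrow> (gen, 'f) tm \<Rightarrow> int list \<Rightarrow> int list \<Rightarrow> 'f" where
  "rep q N (TId m) t s = of_bool (t = s)"
| "rep q N (TGen x) t s = rep_gen q x t s"
| "rep q N (TZero m n) t s = 0"
| "rep q N (f \<cdot> g) t s = (\<Sum>u\<in>labels N (tsrc f). rep q N f t u * rep q N g u s)"
| "rep q N (f \<star> g) t s =
     koszul_sign (tpar (drop (ttgt f) t) + tpar (drop (tsrc f) s)) (tpar (take (tsrc f) s)) *
     (rep q N f (take (ttgt f) t) (take (tsrc f) s) * rep q N g (drop (ttgt f) t) (drop (tsrc f) s))"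
| "rep q N (f +\<^sub>t g) t s = rep q N f t s + rep q N g t s"
| "rep q N (c *\<^sub>t f) t s = c * rep q N f t s"

lemma rep_tens:
  assumes "length t1 = ttgt f" "length s1 = tsrc f"
  shows "rep q N (f \<star> g) (t1 @ t2) (s1 @ s2) =
    koszul_sign (tpar t2 + tpar s2) (tpar s1) * (rep q N f t1 s1 * rep q N g t2 s2)"
  using assms by simp

declare rep.simps(5) [simp del]

lemma rep_comp_assoc: "rep q N (f \<cdot> g \<cdot> h) t s = rep q N (f \<cdot> (g \<cdot> h)) t s"
  by (simp add: sum_distrib_left sum_distrib_right mult.assoc) (rule sum.swap)

lemma hop_delta_parity:
  assumes "a \<noteq> 0" "b \<noteq> 0" "x \<noteq> 0" "y \<noteq> 0" "lpar x + lpar y \<noteq> lpar a + lpar b"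
  shows "hop q (\<lambda>a' b'. of_bool ([a, b] = [a', b'])) x y = 0"
proof -
  consider "x = y" | "y = - x" | "\<bar>x\<bar> \<noteq> \<bar>y\<bar>" by linarith
  then show ?thesis
  proof cases
    case 1
    then show ?thesis using assms by (auto simp: hop_same)
  next
    case 2
    then have "a \<noteq> - b" using assms lpar_opp(1)[of x] lpar_opp(2)[of b] by auto
    then have *: "of_bool (a = - c \<and> b = c) = (0::'a)" "of_bool (a = c \<and> b = - c) = (0::'a)" for c by auto
    show ?thesis unfolding 2 hop_opp[OF assms(3)] list.inject simp_thms by (simp only: *) simp
  next
    case 3
    have "\<not> (a = y \<and> b = x)" using assms(5) add.commute[of "lpar x" "lpar y"] by metis
    moreover have "\<not> (a = x \<and> b = y)" using assms(5) by metis
    ultimately have "[a, b] \<noteq> [y, x]" "[a, b] \<noteq> [x, y]" by simp_all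
    then show ?thesis unfolding hop_diff[OF 3] by (simp only: of_bool_eq if_False) simp
  qed
qed

lemma rep_parity:
  assumes "wtp (sig UNIV) p m n f" "t \<in> labels N n" "s \<in> labels N m" "rep q N f t s \<noteq> 0"
  shows "tpar t + tpar s = p"
  using assms
proof (induction arbitrary: t s rule: wtp.induct)
  case (wtp_id m)
  then have "t = s" by (simp split: if_splits)
  then show ?case by simp
next
  case (wtp_gen v)
  have par: "lpar x + lpar y = lpar a + lpar b" 
    if "hop q (\<lambda>a' b'. of_bool ([a, b] = [a', b'])) x y \<noteq> 0"
     "a \<in> letters N" "b \<in> letters N" "x \<in> letters N" "y \<in> letters N" for a b x y
  proof -
    have "a \<noteq> 0" "b \<noteq> 0" "x \<noteq> 0" "y \<noteq> 0" using that(2-) by (auto simp: letters_def)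
    with hop_delta_parity that(1) show ?thesis by blast
  qed
  have H: "tpar t + tpar s = 0" if ts: "t \<in> labels N 2" "s \<in> labels N 2" 
    and nz: "rep_gen q GH t s \<noteq> 0 \<or> rep_gen q GH' t s \<noteq> 0"
  proof -
    obtain x y where t: "t = [x, y]" "x \<in> letters N" "y \<in> letters N" using ts(1) by (rule labels_2E)
    obtain a b where s: "s = [a, b]" "a \<in> letters N" "b \<in> letters N" using ts(2) by (rule labels_2E)
    have "[a, b] = [x, y] \<or> hop q (\<lambda>a' b'. of_bool ([a, b] = [a', b'])) x y \<noteq> 0"
      using nz unfolding t s rep_gen.simps hopb_def by fastforce
    then have "lpar x + lpar y = lpar a + lpar b" using par[of a b x y] t s by blast
    then have "tpar t = tpar s" using t s by simp
    then show ?thesis by simp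
  qed
  have opp: "tpar t = 1" if t: "t \<in> labels N 2" "rep_gen q GU t [] \<noteq> 0 \<or> rep_gen q GA [] t \<noteq> 0" for t
  proof -
    obtain x y where t': "t = [x, y]" "x \<in> letters N" "y \<in> letters N" using t(1) by (rule labels_2E)
    then have "y = - x" "x \<noteq> 0" using t(2) by (auto simp: letters_def split: if_splits)
    then show ?thesis using t' lpar_opp(1)[of x] by simp
  qed
  show ?case using wtp_gen opp H by (cases v) auto
next
  case (wtp_comp p l n f r m g)
  then have src: "tsrc f = l" using wtp_wt wt_src_tgt by blast
  from wtp_comp.prems(3) obtain u where u: "u \<in> labels N l" "rep q N f t u * rep q N g u s \<noteq> 0"
    unfolding rep.simps src by (metis (no_types, lifting) sum.neutral)
  then have "tpar t + tpar u = p" "tpar u + tpar s = r"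
    using wtp_comp.IH(1)[of t u] wtp_comp.IH(2)[of u s] wtp_comp.prems by auto
  moreover have "tpar t + tpar s = (tpar t + tpar u) + (tpar u + tpar s)" by (simp add: add.assoc)
  ultimately show ?case by simp
next
  case (wtp_tens p m n f r m' n' g)
  then have src: "tsrc f = m" "ttgt f = n" using wtp_wt wt_src_tgt by blast+
  obtain t1 t2 where t: "t = t1 @ t2" "t1 \<in> labels N n" "t2 \<in> labels N n'"
    using wtp_tens.prems(1) by (rule labels_appendE)
  obtain s1 s2 where s: "s = s1 @ s2" "s1 \<in> labels N m" "s2 \<in> labels N m'"
    using wtp_tens.prems(2) by (rule labels_appendE)
  have "rep q N f t1 s1 \<noteq> 0" "rep q N g t2 s2 \<noteq> 0"
    using wtp_tens.prems(3) t s src by (auto simp: rep_tens labels_length)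
  then have "tpar t1 + tpar s1 = p" "tpar t2 + tpar s2 = r"
    using wtp_tens.IH t s by auto
  then show ?case using t s by (auto simp: ac_simps)
next
  case (wtp_add p m n f g)
  from wtp_add.prems(3) have "rep q N f t s \<noteq> 0 \<or> rep q N g t s \<noteq> 0" by auto
  with wtp_add show ?case by blast
qed auto

definition rep_eq :: "'f::field \<Rightarrow> nat \<Rightarrow> (gen, 'f) tm \<Rightarrow> (gen, 'f) tm \<Rightarrow> bool" where
  "rep_eq q N f g \<longleftrightarrow> tsrc f = tsrc g \<and> ttgt f = ttgt g \<and>
     (\<forall>t\<in>labels N (ttgt f). \<forall>s\<in>labels N (tsrc f). rep q N f t s = rep q N g t s)"

lemma rep_eqI:
  assumes "tsrc f = m" "tsrc g = m" "ttgt f = n" "ttgt g = n"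
    "\<And>t s. t \<in> labels N n \<Longrightarrow> s \<in> labels N m \<Longrightarrow> rep q N f t s = rep q N g t s"
  shows "rep_eq q N f g"
  using assms by (simp add: rep_eq_def)

lemma rep_eqD:
  assumes "rep_eq q N f g" "t \<in> labels N (ttgt f)" "s \<in> labels N (tsrc f)"
  shows "rep q N f t s = rep q N g t s"
  using assms by (simp add: rep_eq_def)

lemma rep_tens_eqI:
  assumes "tsrc f = m + m'" "tsrc g = m + m'" "ttgt f = n + n'" "ttgt g = n + n'"
    "\<And>t1 t2 s1 s2. t1 \<in> labels N n \<Longrightarrow> t2 \<in> labels N n' \<Longrightarrow> s1 \<in> labels N m \<Longrightarrow> s2 \<in> labels N m' \<Longrightarrow>
      rep q N f (t1 @ t2) (s1 @ s2) = rep q N g (t1 @ t2) (s1 @ s2)"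
  shows "rep_eq q N f g"
proof (rule rep_eqI[OF assms(1-4)])
  fix t s assume t: "t \<in> labels N (n + n')" and s: "s \<in> labels N (m + m')"
  obtain t1 t2 where "t = t1 @ t2" "t1 \<in> labels N n" "t2 \<in> labels N n'" using t by (rule labels_appendE)
  moreover obtain s1 s2 where "s = s1 @ s2" "s1 \<in> labels N m" "s2 \<in> labels N m'"
    using s by (rule labels_appendE)
  ultimately show "rep q N f t s = rep q N g t s" using assms(5) by simp
qed

lemma rep_eq_comp:
  assumes "rep_eq q N f f'" "rep_eq q N g g'" "tsrc f = l" "ttgt g = l"
  shows "rep_eq q N (f \<cdot> g) (f' \<cdot> g')"
  using assms unfolding rep_eq_def by (auto intro!: sum.cong)

lemma rep_eq_tens:
  assumes "rep_eq q N f f'" "rep_eq q N g g'"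
  shows "rep_eq q N (f \<star> g) (f' \<star> g')"
  using assms
  by (intro rep_tens_eqI[of _ "tsrc f" "tsrc g" _ "ttgt f" "ttgt g"])
    (auto simp: rep_eq_def rep_tens labels_length)

lemma rep_eq_tens_assoc: "rep_eq q N (f \<star> g \<star> h) (f \<star> (g \<star> h))"
proof (rule rep_tens_eqI[of _ "tsrc f" "tsrc g + tsrc h" _ "ttgt f" "ttgt g + ttgt h"])
  fix t1 t' s1 s'
  assume *: "t1 \<in> labels N (ttgt f)" "t' \<in> labels N (ttgt g + ttgt h)"
    "s1 \<in> labels N (tsrc f)" "s' \<in> labels N (tsrc g + tsrc h)"
  obtain t2 t3 where t: "t' = t2 @ t3" "t2 \<in> labels N (ttgt g)" "t3 \<in> labels N (ttgt h)"
    using *(2) by (rule labels_appendE)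
  obtain s2 s3 where s: "s' = s2 @ s3" "s2 \<in> labels N (tsrc g)" "s3 \<in> labels N (tsrc h)"
    using *(4) by (rule labels_appendE)
  have "rep q N (f \<star> g \<star> h) ((t1 @ t2) @ t3) ((s1 @ s2) @ s3) =
    koszul_sign (tpar t3 + tpar s3) (tpar s1 + tpar s2) * (koszul_sign (tpar t2 + tpar s2) (tpar s1) *
      (rep q N f t1 s1 * rep q N g t2 s2) * rep q N h t3 s3)"
    using * t s by (subst rep_tens) (auto simp: labels_length rep_tens)
  moreover have "rep q N (f \<star> (g \<star> h)) (t1 @ (t2 @ t3)) (s1 @ (s2 @ s3)) =
    koszul_sign (tpar t2 + tpar t3 + (tpar s2 + tpar s3)) (tpar s1) *
      (rep q N f t1 s1 * (koszul_sign (tpar t3 + tpar s3) (tpar s2) * (rep q N g t2 s2 * rep q N h t3 s3)))"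
    using * t s by (subst rep_tens) (auto simp: labels_length rep_tens)
  ultimately show "rep q N (f \<star> g \<star> h) (t1 @ t') (s1 @ s') = rep q N (f \<star> (g \<star> h)) (t1 @ t') (s1 @ s')"
    unfolding t s by (simp add: koszul_sign_add_left koszul_sign_add_right mult_ac)
qed (simp_all add: add.assoc)

lemma rep_tens_unit_left: "rep q N (TId 0 \<star> f) t s = rep q N f t s"
  by (simp add: rep.simps(5))

lemma rep_tens_unit_right:
  "length t = ttgt f \<Longrightarrow> length s = tsrc f \<Longrightarrow> rep q N (f \<star> TId 0) t s = rep q N f t s"
  by (simp add: rep.simps(5))

lemma rep_eq_tens_id: "rep_eq q N (TId m \<star> TId n) (TId (m + n))"
  by (rule rep_tens_eqI[of _ m n _ m n]) (auto simp: rep_tens labels_length)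

lemma rep_eq_interchange:
  assumes "wtp (sig UNIV) p l n f" "wtp (sig UNIV) r l' n' g" "wtp (sig UNIV) s m l h" "wtp (sig UNIV) t m' l' k"
  shows "rep_eq q N ((f \<star> g) \<cdot> (h \<star> k)) (koszul_sign r s *\<^sub>t ((f \<cdot> h) \<star> (g \<cdot> k)))"
proof -
  have src: "tsrc f = l" "ttgt f = n" "tsrc g = l'" "ttgt g = n'" "tsrc h = m" "ttgt h = l"
    "tsrc k = m'" "ttgt k = l'"
    using assms wtp_wt wt_src_tgt by blast+
  show ?thesis
  proof (rule rep_tens_eqI[of _ m m' _ n n'])
    fix t1 t2 s1 s2
    assume *: "t1 \<in> labels N n" "t2 \<in> labels N n'" "s1 \<in> labels N m" "s2 \<in> labels N m'"
    have sgn: "koszul_sign (tpar t2 + tpar v) (tpar u) * koszul_sign (tpar v + tpar s2) (tpar s1) *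
        (rep q N f t1 u * rep q N g t2 v * (rep q N h u s1 * rep q N k v s2)) =
        koszul_sign r s * koszul_sign (tpar t2 + tpar s2) (tpar s1) *
        (rep q N f t1 u * rep q N g t2 v * (rep q N h u s1 * rep q N k v s2))"
      if uv: "u \<in> labels N l" "v \<in> labels N l'" for u v
    proof (cases "rep q N g t2 v = 0 \<or> rep q N h u s1 = 0")
      case False
      then have r: "tpar t2 + tpar v = r" "tpar u + tpar s1 = s"
        using rep_parity[OF assms(2) *(2) uv(2)] rep_parity[OF assms(3) uv(1) *(3)] by auto
      then have "tpar u = s + tpar s1" "tpar t2 + tpar s2 = r + (tpar v + tpar s2)"
        by (auto simp: add.assoc)
      then show ?thesis by (simp add: r koszul_sign_add_right koszul_sign_add_left mult_ac)
    qed auto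
    have "rep q N ((f \<star> g) \<cdot> (h \<star> k)) (t1 @ t2) (s1 @ s2) =
      (\<Sum>u\<in>labels N l. \<Sum>v\<in>labels N l'. koszul_sign (tpar t2 + tpar v) (tpar u) * koszul_sign (tpar v + tpar s2) (tpar s1) *
        (rep q N f t1 u * rep q N g t2 v * (rep q N h u s1 * rep q N k v s2)))"
      using * by (auto simp: src sum_labels_append rep_tens labels_length mult_ac intro!: sum.cong)
    also have "\<dots> = (\<Sum>u\<in>labels N l. \<Sum>v\<in>labels N l'. koszul_sign r s * koszul_sign (tpar t2 + tpar s2) (tpar s1) *
        (rep q N f t1 u * rep q N g t2 v * (rep q N h u s1 * rep q N k v s2)))"
      by (intro sum.cong refl sgn)
    also have "\<dots> = rep q N (koszul_sign r s *\<^sub>t ((f \<cdot> h) \<star> (g \<cdot> k))) (t1 @ t2) (s1 @ s2)"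
    proof -
      have "rep q N ((f \<cdot> h) \<star> (g \<cdot> k)) (t1 @ t2) (s1 @ s2) = koszul_sign (tpar t2 + tpar s2) (tpar s1) *
        ((\<Sum>u\<in>labels N l. rep q N f t1 u * rep q N h u s1) * (\<Sum>v\<in>labels N l'. rep q N g t2 v * rep q N k v s2))"
        using * by (subst rep_tens) (auto simp: src labels_length)
      then show ?thesis unfolding rep.simps(7) by (simp add: sum_product sum_distrib_left mult_ac) (rule sum.swap)
    qed
    finally show "rep q N ((f \<star> g) \<cdot> (h \<star> k)) (t1 @ t2) (s1 @ s2) =
      rep q N (koszul_sign r s *\<^sub>t ((f \<cdot> h) \<star> (g \<cdot> k))) (t1 @ t2) (s1 @ s2)" .
  qed (simp_all add: src)
qed

lemma rep_id_tens:
  assumes "length t1 = i" "length s = i + tsrc f"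
  shows "rep q N (TId i \<star> f) (t1 @ t2) s =
    koszul_sign (tpar t2 + tpar (drop i s)) (tpar t1) * (of_bool (take i s = t1) * rep q N f t2 (drop i s))"
  using assms by (auto simp: rep.simps(5))

lemma rep_tens_id:
  assumes "length t1 = ttgt f" "length t2 = j" "length s = tsrc f + j"
  shows "rep q N (f \<star> TId j) (t1 @ t2) s = rep q N f t1 (take (tsrc f) s) * of_bool (drop (tsrc f) s = t2)"
  using assms by (auto simp: rep.simps(5))

lemma rep_H_tens:
  assumes "length t2 = j" "length s = 2 + j"
  shows "rep q N (TGen GH \<star> TId j) (x # y # t2) s = hop q (\<lambda>a b. of_bool (s = a # b # t2)) x y"
    and "rep q N (TGen GH' \<star> TId j) (x # y # t2) s = hopb q (\<lambda>a b. of_bool (s = a # b # t2)) x y"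
proof -
  obtain a b s' where s: "s = a # b # s'" using assms(2) by (cases s; cases "tl s") auto
  have len: "length [x, y] = ttgt (TGen GH)" "length [x, y] = ttgt (TGen GH')" by simp_all
  have *: "(\<lambda>a' b'. of_bool (s = a' # b' # t2)) = (\<lambda>a' b'. of_bool (s' = t2) * (of_bool ([a, b] = [a', b']) :: 'a))"
    by (auto simp: s fun_eq_iff)
  show "rep q N (TGen GH \<star> TId j) (x # y # t2) s = hop q (\<lambda>a b. of_bool (s = a # b # t2)) x y"
    using rep_tens_id[OF len(1) assms(1), of s q N] assms(2)
    unfolding * hop_scale by (simp add: s mult.commute numeral_2_eq_2)
  then show "rep q N (TGen GH' \<star> TId j) (x # y # t2) s = hopb q (\<lambda>a b. of_bool (s = a # b # t2)) x y"
    using rep_tens_id[OF len(1) assms(1), of s q N] rep_tens_id[OF len(2) assms(1), of s q N] assms(2)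
    by (auto simp: s hopb_def of_bool_def)
qed

lemma rep_id_H_tens:
  assumes "length t1 = i" "length t2 = j" "length s = i + (2 + j)" "x \<in> letters N" "y \<in> letters N" "set s \<subseteq> letters N"
  shows "rep q N (TId i \<star> (TGen GH \<star> TId j)) (t1 @ x # y # t2) s = hop q (\<lambda>a b. of_bool (s = t1 @ a # b # t2)) x y"
    and "rep q N (TId i \<star> (TGen GH' \<star> TId j)) (t1 @ x # y # t2) s = hopb q (\<lambda>a b. of_bool (s = t1 @ a # b # t2)) x y"
proof -
  define s2 where "s2 = drop i s"
  have s: "s = take i s @ s2" "length s2 = 2 + j" using assms by (auto simp: s2_def)
  obtain a b s' where s2: "s2 = a # b # s'" using s(2) by (cases s2; cases "tl s2") auto
  have ab: "a \<noteq> 0" "b \<noteq> 0" "x \<noteq> 0" "y \<noteq> 0" using assms(4-6) s(1) s2 by (auto simp: letters_def dest!: arg_cong[of s _ set])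
  have sgn: "koszul_sign (tpar (x # y # t2) + tpar s2) p * hop q (\<lambda>a b. of_bool (s2 = a # b # t2)) x y =
     hop q (\<lambda>a b. of_bool (s2 = a # b # t2)) x y"
    "koszul_sign (tpar (x # y # t2) + tpar s2) p * hopb q (\<lambda>a b. of_bool (s2 = a # b # t2)) x y =
     hopb q (\<lambda>a b. of_bool (s2 = a # b # t2)) x y" for p
  proof -
    have *: "(\<lambda>a' b'. of_bool (s2 = a' # b' # t2)) = (\<lambda>a' b'. of_bool (s' = t2) * (of_bool ([a, b] = [a', b']) :: 'a))"
      by (auto simp: s2 fun_eq_iff)
    have "koszul_sign (tpar (x # y # t2) + tpar s2) p * hop q (\<lambda>a b. of_bool (s2 = a # b # t2)) x y =
     hop q (\<lambda>a b. of_bool (s2 = a # b # t2)) x y \<and> 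
     koszul_sign (tpar (x # y # t2) + tpar s2) p * of_bool (s2 = x # y # t2) = (of_bool (s2 = x # y # t2) :: 'a)"
    proof (cases "s' = t2 \<and> lpar x + lpar y = lpar a + lpar b")
      case True
      then have "tpar (x # y # t2) = tpar s2" by (simp add: s2 flip: add.assoc)
      then show ?thesis by simp
    next
      case False
      then show ?thesis unfolding * hop_scale using hop_delta_parity[OF ab, of q] by (auto simp: s2)
    qed
    then show "koszul_sign (tpar (x # y # t2) + tpar s2) p * hop q (\<lambda>a b. of_bool (s2 = a # b # t2)) x y =
     hop q (\<lambda>a b. of_bool (s2 = a # b # t2)) x y"
    "koszul_sign (tpar (x # y # t2) + tpar s2) p * hopb q (\<lambda>a b. of_bool (s2 = a # b # t2)) x y =
     hopb q (\<lambda>a b. of_bool (s2 = a # b # t2)) x y"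
      unfolding hopb_def right_diff_distrib mult.left_commute[of "koszul_sign _ _" "q - inverse q"]
      by (simp_all only:)
  qed
  have *: "(\<lambda>a b. of_bool (s = t1 @ a # b # t2)) = (\<lambda>a b. of_bool (take i s = t1) * (of_bool (s2 = a # b # t2) :: 'a))"
  proof (intro ext)
    fix a b
    have "s = t1 @ a # b # t2 \<longleftrightarrow> take i s = t1 \<and> s2 = a # b # t2"
      using assms(1) append_take_drop_id[of i s] unfolding s2_def by (metis append_eq_conv_conj)
    then show "of_bool (s = t1 @ a # b # t2) = of_bool (take i s = t1) * (of_bool (s2 = a # b # t2) :: 'a)"
      by (simp flip: of_bool_conj)
  qed
  have len: "length s = i + tsrc (TGen GH \<star> TId j)" "length s = i + tsrc (TGen GH' \<star> TId j)"
    using assms by simp_all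
  note H = rep_H_tens[OF assms(2) s(2)]
  show "rep q N (TId i \<star> (TGen GH \<star> TId j)) (t1 @ x # y # t2) s = hop q (\<lambda>a b. of_bool (s = t1 @ a # b # t2)) x y"
    unfolding rep_id_tens[OF assms(1) len(1)] * hop_scale s2_def[symmetric] H mult.left_commute[of "koszul_sign _ _"] sgn ..
  have hopb_scale: "hopb q (\<lambda>a b. c * f a b) x y = c * hopb q f x y" for c f
    by (simp add: hopb_def hop_scale algebra_simps)
  show "rep q N (TId i \<star> (TGen GH' \<star> TId j)) (t1 @ x # y # t2) s = hopb q (\<lambda>a b. of_bool (s = t1 @ a # b # t2)) x y"
    unfolding rep_id_tens[OF assms(1) len(2)] * hopb_scale s2_def[symmetric] H mult.left_commute[of "koszul_sign _ _"] sgn ..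
qed

lemma rep_id_H_tens_comp:
  assumes "t1 \<in> labels N i" "t2 \<in> labels N j" "x \<in> letters N" "y \<in> letters N"
  shows "rep q N ((TId i \<star> (TGen GH \<star> TId j)) \<cdot> f) (t1 @ x # y # t2) s = hop q (\<lambda>a b. rep q N f (t1 @ a # b # t2) s) x y"
    and "rep q N ((TId i \<star> (TGen GH' \<star> TId j)) \<cdot> f) (t1 @ x # y # t2) s = hopb q (\<lambda>a b. rep q N f (t1 @ a # b # t2) s) x y"
proof -
  have in_S: "t1 @ a # b # t2 \<in> labels N (i + (2 + j))" if "a \<in> letters N" "b \<in> letters N" for a b
    using assms that by (auto simp: labels_def)
  have set: "length t1 = i" "length t2 = j" "\<And>u. u \<in> labels N (i + (2 + j)) \<Longrightarrow> length u = i + (2 + j) \<and> set u \<subseteq> letters N"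
    using assms by (auto simp: labels_def)
  have "rep q N ((TId i \<star> (TGen GH \<star> TId j)) \<cdot> f) (t1 @ x # y # t2) s =
     (\<Sum>u\<in>labels N (i + (2 + j)). hop q (\<lambda>a b. of_bool (u = t1 @ a # b # t2)) x y * rep q N f u s)"
    unfolding rep.simps(4) tsrc.simps sig_simps
    by (intro sum.cong refl arg_cong2[where f = "(*)"] rep_id_H_tens(1)[OF set(1,2) _ assms(3,4)]) (use set(3) in blast)+
  also have "\<dots> = hop q (\<lambda>a b. rep q N f (t1 @ a # b # t2) s) x y"
    by (rule hop_expand(1)[OF assms(3,4) finite_labels in_S])
  finally show "rep q N ((TId i \<star> (TGen GH \<star> TId j)) \<cdot> f) (t1 @ x # y # t2) s = \<dots>" .
  have "rep q N ((TId i \<star> (TGen GH' \<star> TId j)) \<cdot> f) (t1 @ x # y # t2) s =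
     (\<Sum>u\<in>labels N (i + (2 + j)). hopb q (\<lambda>a b. of_bool (u = t1 @ a # b # t2)) x y * rep q N f u s)"
    unfolding rep.simps(4) tsrc.simps sig_simps
    by (intro sum.cong refl arg_cong2[where f = "(*)"] rep_id_H_tens(2)[OF set(1,2) _ assms(3,4)]) (use set(3) in blast)+
  also have "\<dots> = hopb q (\<lambda>a b. rep q N f (t1 @ a # b # t2) s) x y"
    by (rule hop_expand(2)[OF assms(3,4) finite_labels in_S])
  finally show "rep q N ((TId i \<star> (TGen GH' \<star> TId j)) \<cdot> f) (t1 @ x # y # t2) s = \<dots>" .
qed

lemma labels_1E:
  assumes "t \<in> labels N 1"
  obtains x where "t = [x]" "x \<in> letters N"
  using labels_SucE[of t N 0] assms by auto

lemma labels_3E: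
  assumes "t \<in> labels N 3"
  obtains x y w where "t = [x, y, w]" "x \<in> letters N" "y \<in> letters N" "w \<in> letters N"
proof -
  obtain x t' where t: "t = x # t'" "x \<in> letters N" "t' \<in> labels N 2"
    using assms labels_SucE[of t N 2] by (auto simp: numeral_3_eq_3 numeral_2_eq_2)
  from t(3) show thesis by (rule labels_2E) (use t that in auto)
qed

lemma rep_U_tens:
  assumes "length t2 = j" "length s = j"
  shows "rep q N (TGen GU \<star> TId j) (x # y # t2) s = of_bool (y = - x) * of_bool (s = t2)"
  using assms by (auto simp: rep.simps(5))

lemma rep_A_tens_comp:
  assumes "t2 \<in> labels N j"
  shows "rep q N ((TGen GA \<star> TId j) \<cdot> f) t2 s =
    (\<Sum>a\<in>letters N. koszul_sign 1 (lpar a) * rep q N f (a # (- a) # t2) s)"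
proof -
  have len: "length t2 = j" using assms by (simp add: labels_def)
  have sum2: "(\<Sum>u\<in>labels N 2. F u) = (\<Sum>a\<in>letters N. \<Sum>b\<in>letters N. F [a, b])" for F :: "int list \<Rightarrow> 'a"
  proof -
    have "labels N 2 = (\<lambda>(a, b). [a, b]) ` (letters N \<times> letters N)"
      by (auto simp: numeral_2_eq_2 elim!: labels_2E[unfolded numeral_2_eq_2])
    then have "(\<Sum>u\<in>labels N 2. F u) = (\<Sum>p\<in>letters N \<times> letters N. F [fst p, snd p])"
      by (simp add: sum.reindex inj_on_def case_prod_unfold)
    then show ?thesis by (simp add: sum.cartesian_product case_prod_unfold)
  qed
  have "rep q N ((TGen GA \<star> TId j) \<cdot> f) t2 s =
    (\<Sum>u\<in>labels N 2. \<Sum>v\<in>labels N j. rep q N (TGen GA \<star> TId j) ([] @ t2) (u @ v) * rep q N f (u @ v) s)"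
    by (simp only: rep.simps(4) tsrc.simps sig_simps sum_labels_append append_Nil)
  also have "\<dots> = (\<Sum>u\<in>labels N 2. \<Sum>v\<in>labels N j. if v = t2 then rep_gen q GA [] u * rep q N f (u @ t2) s else 0)"
    using len by (intro sum.cong refl) (subst rep_tens_id, auto simp: labels_length)
  also have "\<dots> = (\<Sum>a\<in>letters N. \<Sum>b\<in>letters N. rep_gen q GA [] [a, b] * rep q N f (a # b # t2) s)"
    using assms by (simp add: sum2)
  also have "\<dots> = (\<Sum>a\<in>letters N. \<Sum>b\<in>letters N. if b = - a then koszul_sign 1 (lpar a) * rep q N f (a # (- a) # t2) s else 0)"
    by (intro sum.cong refl) auto
  also have "\<dots> = (\<Sum>a\<in>letters N. koszul_sign 1 (lpar a) * rep q N f (a # (- a) # t2) s)"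
    by simp
  finally show ?thesis .
qed

lemma rep_H1_comp:
  assumes "x \<in> letters N" "y \<in> letters N" "t2 \<in> labels N j"
  shows "rep q N ((TGen GH \<star> TId j) \<cdot> f) (x # y # t2) s = hop q (\<lambda>a b. rep q N f (a # b # t2) s) x y"
    and "rep q N ((TGen GH' \<star> TId j) \<cdot> f) (x # y # t2) s = hopb q (\<lambda>a b. rep q N f (a # b # t2) s) x y"
proof -
  have *: "rep q N ((TGen v \<star> TId j) \<cdot> f) t s = rep q N ((TId 0 \<star> (TGen v \<star> TId j)) \<cdot> f) t s" for v t
    by (simp add: rep_tens_unit_left)
  show "rep q N ((TGen GH \<star> TId j) \<cdot> f) (x # y # t2) s = hop q (\<lambda>a b. rep q N f (a # b # t2) s) x y"
    and "rep q N ((TGen GH' \<star> TId j) \<cdot> f) (x # y # t2) s = hopb q (\<lambda>a b. rep q N f (a # b # t2) s) x y"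
    unfolding * using rep_id_H_tens_comp[of "[]" N 0 t2 j x y q f s] assms by simp_all
qed

lemma rep_H0_comp:
  assumes "x \<in> letters N" "y \<in> letters N"
  shows "rep q N (TGen GH \<cdot> f) [x, y] s = hop q (\<lambda>a b. rep q N f [a, b] s) x y"
    and "rep q N (TGen GH' \<cdot> f) [x, y] s = hopb q (\<lambda>a b. rep q N f [a, b] s) x y"
proof -
  have *: "rep q N (TGen v \<cdot> f) t s = rep q N ((TGen v \<star> TId 0) \<cdot> f) t s" if "length t = ttgt (TGen v)" for v t
    using that by (auto simp: rep_tens_unit_right labels_length simp del: rep.simps(2) intro!: sum.cong)
  show "rep q N (TGen GH \<cdot> f) [x, y] s = hop q (\<lambda>a b. rep q N f [a, b] s) x y"
    and "rep q N (TGen GH' \<cdot> f) [x, y] s = hopb q (\<lambda>a b. rep q N f [a, b] s) x y"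
    using rep_H1_comp[OF assms, of "[]" 0 q f s] by (subst *; simp)+
qed

lemma rep_H2_unit:
  assumes "length t = 3" "length u = 3"
  shows "rep q N (TId 1 \<star> TGen GH) t u = rep q N (TId 1 \<star> (TGen GH \<star> TId 0)) t u"
proof -
  have "rep q N (TGen GH \<star> TId 0) (drop 1 t) (drop 1 u) = rep q N (TGen GH) (drop 1 t) (drop 1 u)"
    using assms by (intro rep_tens_unit_right) simp_all
  then show ?thesis
    unfolding rep.simps(5)[of q N "TId 1" "TGen GH" t u] rep.simps(5)[of q N "TId 1" "TGen GH \<star> TId 0" t u]
      tsrc.simps ttgt.simps by (simp only:)
qed

lemma rep_H2_comp:
  assumes "x \<in> letters N" "y \<in> letters N" "w \<in> letters N"
  shows "rep q N ((TId 1 \<star> TGen GH) \<cdot> f) [x, y, w] s = hop q (\<lambda>a b. rep q N f [x, a, b] s) y w"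
proof -
  have "rep q N ((TId 1 \<star> TGen GH) \<cdot> f) [x, y, w] s = rep q N ((TId 1 \<star> (TGen GH \<star> TId 0)) \<cdot> f) [x, y, w] s"
    unfolding rep.simps(4)
    by (rule sum.cong) (simp, subst rep_H2_unit, auto dest!: labels_length)
  then show ?thesis using rep_id_H_tens_comp(1)[of "[x]" N 1 "[]" 0 y w q f s] assms by simp
qed

lemma rep_H2:
  assumes "length s = 3" "x \<in> letters N" "y \<in> letters N" "w \<in> letters N" "set s \<subseteq> letters N"
  shows "rep q N (TId 1 \<star> TGen GH) [x, y, w] s = hop q (\<lambda>a b. of_bool (s = [x, a, b])) y w"
  using rep_H2_unit[of "[x, y, w]" s q N] rep_id_H_tens(1)[of "[x]" 1 "[]" 0 s y N w q] assms by simp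

lemma hop_opp_delta: "x \<noteq> 0 \<Longrightarrow> y \<noteq> 0 \<Longrightarrow> hop q (\<lambda>a b. of_bool (b = - a)) x y = q * of_bool (y = - x)"
  by (auto simp: hop_def of_bool_def)

lemma hop_slide:
  assumes "x \<noteq> 0" "y \<noteq> 0" "w \<noteq> 0" "s \<noteq> 0"
  shows "hop q (\<lambda>a b. of_bool (a = - x) * of_bool (b = s)) y w =
    hopb q (\<lambda>a b. koszul_sign 1 (lpar a) * (of_bool (a = s) * of_bool (w = - b))) x y"
proof -
  have ks: "koszul_sign 1 (lpar a) = (if a < 0 then - 1 else 1 :: 'a)" for a
    by (simp add: koszul_sign_def lpar_def)
  have S1: "(\<Sum>c\<in>{1..<n}. of_bool (- c = - x) * of_bool (c = s) - of_bool (c = - x) * of_bool (- c = s)) =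
     (if x = s \<and> \<bar>x\<bar> < n then (if x < 0 then - 1 else 1) else 0 :: 'a)" for n :: int
  proof -
    have "(\<Sum>c\<in>{1..<n}. of_bool (- c = - x) * of_bool (c = s) - of_bool (c = - x) * of_bool (- c = s)) =
      (\<Sum>c\<in>{1..<n}. if c = \<bar>x\<bar> then (if x = s then (if x < 0 then - 1 else 1) else 0) else 0 :: 'a)"
      using assms by (intro sum.cong refl) auto
    then show ?thesis using assms by auto
  qed
  have S2: "(\<Sum>c\<in>{1..<n}. koszul_sign 1 (lpar (- c)) * (of_bool (- c = s) * of_bool (w = - c))
     - koszul_sign 1 (lpar c) * (of_bool (c = s) * of_bool (w = - (- c)))) =
     (if w = s \<and> \<bar>s\<bar> < n then - 1 else 0 :: 'a)" for n :: int
  proof -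
    have "(\<Sum>c\<in>{1..<n}. koszul_sign 1 (lpar (- c)) * (of_bool (- c = s) * of_bool (w = - c))
     - koszul_sign 1 (lpar c) * (of_bool (c = s) * of_bool (w = - (- c)))) =
      (\<Sum>c\<in>{1..<n}. if c = \<bar>s\<bar> then (if w = s then - 1 else 0) else 0 :: 'a)"
      using assms by (intro sum.cong refl) (auto simp: ks)
    then show ?thesis using assms by auto
  qed
  let ?f = "\<lambda>a b. of_bool (a = - x) * of_bool (b = s) :: 'a"
  let ?g = "\<lambda>a b. koszul_sign 1 (lpar a) * (of_bool (a = s) * of_bool (w = - b)) :: 'a"
  have f: "w = y \<Longrightarrow> hop q ?f y w = (if 0 < y then q else - inverse q) * ?f y y"
    "w = - y \<Longrightarrow> hop q ?f y w = (if 0 < y then inverse q * ?f (- y) y + (q - inverse q) * ?f y (- y)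
       else q * ?f (- y) y) - (q - inverse q) * (if x = s \<and> \<bar>x\<bar> < \<bar>y\<bar> then (if x < 0 then - 1 else 1) else 0)"
    "\<bar>y\<bar> \<noteq> \<bar>w\<bar> \<Longrightarrow> hop q ?f y w = lsign y w * ?f w y + (if \<bar>w\<bar> < \<bar>y\<bar> then (q - inverse q) * ?f y w else 0)"
    using hop_same[of q ?f y] hop_opp[OF assms(2), of q ?f] hop_diff[of y w q ?f] unfolding S1 by metis+
  have g: "x = y \<Longrightarrow> hop q ?g x y = (if 0 < x then q else - inverse q) * ?g x x"
    "y = - x \<Longrightarrow> hop q ?g x y = (if 0 < x then inverse q * ?g (- x) x + (q - inverse q) * ?g x (- x)
       else q * ?g (- x) x) - (q - inverse q) * (if w = s \<and> \<bar>s\<bar> < \<bar>x\<bar> then - 1 else 0)"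
    "\<bar>x\<bar> \<noteq> \<bar>y\<bar> \<Longrightarrow> hop q ?g x y = lsign x y * ?g y x + (if \<bar>y\<bar> < \<bar>x\<bar> then (q - inverse q) * ?g x y else 0)"
    using hop_same[of q ?g x] hop_opp[OF assms(1), of q ?g] hop_diff[of x y q ?g] unfolding S2 by metis+
  consider "w = y" | "w = - y" | "\<bar>y\<bar> \<noteq> \<bar>w\<bar>" by linarith
  then show ?thesis
  proof cases
    case 1
    note w = this
    consider "x = y" | "y = - x" | "\<bar>x\<bar> \<noteq> \<bar>y\<bar>" by linarith
    then show ?thesis
    proof cases
      case 1
      note xy = this
      show ?thesis unfolding hopb_def f(1)[OF w] g(1)[OF xy]
        using assms by (simp add: ks lsign_def algebra_simps w xy; cases "s = x"; cases "s = w"; auto)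
    next
      case 2
      note xy = this
      show ?thesis unfolding hopb_def f(1)[OF w] g(2)[OF xy]
        using assms by (simp add: ks lsign_def algebra_simps w xy; cases "s = x"; cases "s = w"; auto)
    next
      case 3
      note xy = this
      show ?thesis unfolding hopb_def f(1)[OF w] g(3)[OF xy]
        using assms xy by (simp add: ks lsign_def algebra_simps w; cases "s = x"; cases "s = w"; auto)
    qed
  next
    case 2
    note w = this
    consider "x = y" | "y = - x" | "\<bar>x\<bar> \<noteq> \<bar>y\<bar>" by linarith
    then show ?thesis
    proof cases
      case 1
      note xy = this
      show ?thesis unfolding hopb_def f(2)[OF w] g(1)[OF xy]
        using assms by (simp add: ks lsign_def algebra_simps w xy; cases "s = x"; cases "s = w"; auto)
    next
      case 2
      note xy = this
      show ?thesis unfolding hopb_def f(2)[OF w] g(2)[OF xy]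
        using assms by (simp add: ks lsign_def algebra_simps w xy; cases "s = x"; cases "s = w"; auto)
    next
      case 3
      note xy = this
      show ?thesis unfolding hopb_def f(2)[OF w] g(3)[OF xy]
        using assms xy by (simp add: ks lsign_def algebra_simps w; cases "s = x"; cases "s = w"; auto)
    qed
  next
    case 3
    note w = this
    consider "x = y" | "y = - x" | "\<bar>x\<bar> \<noteq> \<bar>y\<bar>" by linarith
    then show ?thesis
    proof cases
      case 1
      note xy = this
      show ?thesis unfolding hopb_def f(3)[OF w] g(1)[OF xy]
        using assms w by (simp add: ks lsign_def algebra_simps xy; cases "s = x"; cases "s = w"; auto)
    next
      case 2
      note xy = this
      show ?thesis unfolding hopb_def f(3)[OF w] g(2)[OF xy]
        using assms w by (simp add: ks lsign_def algebra_simps xy; cases "s = x"; cases "s = w"; auto)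
    next
      case 3
      note xy = this
      have ne: "y \<noteq> - x" "w \<noteq> - y" "- y \<noteq> w" "- x \<noteq> y" using w xy by auto
      show ?thesis unfolding hopb_def f(3)[OF w] g(3)[OF xy]
        using assms w xy by (cases "w = - x"; cases "y = s"; simp add: ks lsign_def ne)
    qed
  qed
qed

lemma B_rel_rep_eq:
  assumes "B_rel q f g" "q \<noteq> 0"
  shows "rep_eq q N f g"
  using assms(1)
proof cases
  case 1
  show ?thesis unfolding 1
  proof (rule rep_eqI)
    fix t s :: "int list" assume t: "t \<in> labels N 2" and s: "s \<in> labels N 2"
    obtain x y where t': "t = [x, y]" "x \<in> letters N" "y \<in> letters N" using t by (rule labels_2E)
    then show "rep q N (TGen GH \<cdot> TGen GH') t s = rep q N (TId 2) t s"
      using hop_hopb[OF assms(2), of x y] unfolding t'(1) rep_H0_comp(1)[OF t'(2,3)]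
      by (auto simp: letters_def eq_commute[of s])
  qed simp_all
next
  case 2
  show ?thesis unfolding 2
  proof (rule rep_eqI)
    fix t s :: "int list" assume t: "t \<in> labels N 2" and s: "s \<in> labels N 2"
    obtain x y where t': "t = [x, y]" "x \<in> letters N" "y \<in> letters N" using t by (rule labels_2E)
    then show "rep q N (TGen GH' \<cdot> TGen GH) t s = rep q N (TId 2) t s"
      using hopb_hop[OF assms(2), of x y] unfolding t'(1) rep_H0_comp(2)[OF t'(2,3)]
      by (auto simp: letters_def eq_commute[of s])
  qed simp_all
next
  case 3
  show ?thesis unfolding 3
  proof (rule rep_eqI)
    fix t s :: "int list" assume t: "t \<in> labels N 3" and s: "s \<in> labels N 3"
    obtain x y w where t': "t = [x, y, w]" "x \<in> letters N" "y \<in> letters N" "w \<in> letters N"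
      using t by (rule labels_3E)
    have s': "length s = 3" "set s \<subseteq> letters N" using s by (auto simp: labels_def)
    define G where "G = (\<lambda>x y w. of_bool (s = [x, y, w]) :: 'a)"
    have w: "[b] \<in> labels N 1" if "b \<in> letters N" for b using that by (simp add: labels_def)
    have E1: "rep q N (TGen GH \<star> TId 1) [a, b, c] s = hop12 q G a b c" for a b c
      unfolding hop12_def G_def by (rule rep_H_tens(1)) (use s' in simp_all)
    have F1: "rep q N (TId 1 \<star> TGen GH) [a, b, c] s = hop23 q G a b c"
      if "a \<in> letters N" "b \<in> letters N" "c \<in> letters N" for a b c
      unfolding hop23_def G_def by (rule rep_H2) (use s' that in simp_all)
    have E2: "rep q N ((TId 1 \<star> TGen GH) \<cdot> (TGen GH \<star> TId 1)) [a, b, c] s = hop23 q (hop12 q G) a b c"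
      if "a \<in> letters N" "b \<in> letters N" "c \<in> letters N" for a b c
      unfolding hop23_def rep_H2_comp[OF that] E1 ..
    have F2: "rep q N ((TGen GH \<star> TId 1) \<cdot> (TId 1 \<star> TGen GH)) [a, b, c] s = hop12 q (hop23 q G) a b c"
      if "a \<in> letters N" "b \<in> letters N" "c \<in> letters N" for a b c
      unfolding hop12_def rep_H1_comp(1)[OF that(1,2) w[OF that(3)]]
      by (rule hop_cong(1)[OF that(1,2)]) (rule F1; use that in simp)
    have "rep q N ((TGen GH \<star> TId 1) \<cdot> ((TId 1 \<star> TGen GH) \<cdot> (TGen GH \<star> TId 1))) [x, y, w] s =
      hop12 q (hop23 q (hop12 q G)) x y w"
      unfolding hop12_def[of q "hop23 q _"] rep_H1_comp(1)[OF t'(2,3) w[OF t'(4)]]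
      by (rule hop_cong(1)[OF t'(2,3)]) (rule E2; use t' in simp)
    moreover have "rep q N ((TId 1 \<star> TGen GH) \<cdot> ((TGen GH \<star> TId 1) \<cdot> (TId 1 \<star> TGen GH))) [x, y, w] s =
      hop23 q (hop12 q (hop23 q G)) x y w"
      unfolding hop23_def[of q "hop12 q _"] rep_H2_comp[OF t'(2-4)]
      by (rule hop_cong(1)[OF t'(3,4)]) (rule F2; use t' in simp)
    ultimately show "rep q N ((TGen GH \<star> TId 1) \<cdot> (TId 1 \<star> TGen GH) \<cdot> (TGen GH \<star> TId 1)) t s =
      rep q N ((TId 1 \<star> TGen GH) \<cdot> (TGen GH \<star> TId 1) \<cdot> (TId 1 \<star> TGen GH)) t s"
      unfolding rep_comp_assoc t'(1) using hop_braid[OF assms(2), of x y w G] t' by (auto simp: letters_def)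
  qed simp_all
next
  case 4
  show ?thesis unfolding 4
  proof (rule rep_eqI)
    fix t s :: "int list" assume t: "t \<in> labels N 2" and s: "s \<in> labels N 2"
    obtain x y where t': "t = [x, y]" "x \<in> letters N" "y \<in> letters N" using t by (rule labels_2E)
    then show "rep q N (TGen GH +\<^sub>t - 1 *\<^sub>t TGen GH') t s = rep q N ((q - inverse q) *\<^sub>t TId 2) t s"
      by (auto simp: hopb_def)
  qed simp_all
next
  case 5
  show ?thesis unfolding 5
  proof (rule rep_eqI)
    fix t s :: "int list" assume t: "t \<in> labels N 1" and s: "s \<in> labels N 1"
    obtain x where t': "t = [x]" "x \<in> letters N" using t by (rule labels_1E)
    obtain y where s': "s = [y]" "y \<in> letters N" using s by (rule labels_1E)
    have "rep q N ((TGen GA \<star> TId 1) \<cdot> (TId 1 \<star> TGen GU)) t s =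
      (\<Sum>a\<in>letters N. if a = x then of_bool (x = y) else 0)"
      unfolding t'(1) rep_A_tens_comp[OF t[unfolded t'(1)]]
      by (intro sum.cong refl) (auto simp: s' rep.simps(5) lpar_opp letters_def koszul_sign_square)
    then show "rep q N ((TGen GA \<star> TId 1) \<cdot> (TId 1 \<star> TGen GU)) t s = rep q N (TId 1) t s"
      using t' s' by simp
  qed simp_all
next
  case 6
  show ?thesis unfolding 6
  proof (rule rep_eqI)
    fix t s :: "int list" assume t: "t \<in> labels N 1" and s: "s \<in> labels N 1"
    obtain x where t': "t = [x]" "x \<in> letters N" using t by (rule labels_1E)
    obtain y where s': "s = [y]" "y \<in> letters N" using s by (rule labels_1E)
    have "rep q N ((TId 1 \<star> TGen GA) \<cdot> (TGen GU \<star> TId 1)) [x] [y] =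
      (\<Sum>u\<in>labels N 3. if u = [x, - x, x] then - of_bool (x = y) else 0)"
      unfolding rep.simps(4) tsrc.simps sig_simps
    proof (intro sum.cong)
      fix u assume "u \<in> labels N 3"
      then obtain a b c where u: "u = [a, b, c]" "a \<in> letters N" "b \<in> letters N" "c \<in> letters N"
        by (rule labels_3E)
      have "koszul_sign 1 (lpar x) * koszul_sign 1 (lpar (- x)) = (- 1 :: 'a)"
        using t' by (auto simp: lpar_def koszul_sign_def letters_def)
      then show "rep q N (TId 1 \<star> TGen GA) [x] u * rep q N (TGen GU \<star> TId 1) u [y] =
         (if u = [x, - x, x] then - of_bool (x = y) else 0)"
        using t' by (auto simp: u rep.simps(5) lpar_opp letters_def)
    qed (simp add: numeral_3_eq_3)
    also have "\<dots> = - of_bool (x = y)"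
    proof -
      have "[x, - x, x] \<in> labels N 3" using t' by (simp add: labels_def)
      then show ?thesis unfolding sum.delta[OF finite_labels] by simp
    qed
    finally show "rep q N ((TId 1 \<star> TGen GA) \<cdot> (TGen GU \<star> TId 1)) t s = rep q N (- 1 *\<^sub>t TId 1) t s"
      using t' s' by simp
  qed simp_all
next
  case 7
  show ?thesis unfolding 7
  proof (rule rep_eqI)
    fix t s :: "int list" assume t: "t \<in> labels N 2" and s: "s \<in> labels N 0"
    obtain x y where t': "t = [x, y]" "x \<in> letters N" "y \<in> letters N" using t by (rule labels_2E)
    then show "rep q N (TGen GH \<cdot> TGen GU) t s = rep q N (q *\<^sub>t TGen GU) t s"
      unfolding t'(1) rep_H0_comp(1)[OF t'(2,3)] using s hop_opp_delta[of x y q] by (auto simp: letters_def)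
  qed simp_all
next
  case 8
  show ?thesis unfolding 8
  proof (rule rep_eqI)
    fix t s :: "int list" assume t: "t \<in> labels N 3" and s: "s \<in> labels N 1"
    obtain x y w where t': "t = [x, y, w]" "x \<in> letters N" "y \<in> letters N" "w \<in> letters N"
      using t by (rule labels_3E)
    obtain v where s': "s = [v]" "v \<in> letters N" using s by (rule labels_1E)
    have w: "[w] \<in> labels N 1" using t' by (simp add: labels_def)
    have "rep q N ((TId 1 \<star> TGen GH) \<cdot> (TGen GU \<star> TId 1)) [x, y, w] [v] =
      hop q (\<lambda>a b. of_bool (a = - x) * of_bool (b = v)) y w"
      unfolding rep_H2_comp[OF t'(2-4)] by (rule hop_cong(1)[OF t'(3,4)]) (auto simp: rep_U_tens)
    also have "\<dots> = hopb q (\<lambda>a b. koszul_sign 1 (lpar a) * (of_bool (a = v) * of_bool (w = - b))) x y"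
      using t' s' by (intro hop_slide) (auto simp: letters_def)
    also have "\<dots> = rep q N ((TGen GH' \<star> TId 1) \<cdot> (TId 1 \<star> TGen GU)) [x, y, w] [v]"
      unfolding rep_H1_comp(2)[OF t'(2,3) w]
      by (rule hop_cong(2)[OF t'(2,3)]) (auto simp: rep.simps(5) lpar_opp letters_def)
    finally show "rep q N ((TId 1 \<star> TGen GH) \<cdot> (TGen GU \<star> TId 1)) t s =
      rep q N ((TGen GH' \<star> TId 1) \<cdot> (TId 1 \<star> TGen GU)) t s" unfolding t' s' .
  qed simp_all
next
  case 9
  show ?thesis unfolding 9
  proof (rule rep_eqI)
    fix t s :: "int list" assume t: "t \<in> labels N 0" and s: "s \<in> labels N 0"
    have sum: "(\<Sum>a\<in>letters N. koszul_sign 1 (lpar a)) = (0 :: 'a)"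
    proof -
      have L: "letters N = {1..int N} \<union> uminus ` {1..int N}" "{1..int N} \<inter> uminus ` {1..int N} = {}"
        by (auto simp: letters_def image_iff)
      have "(\<Sum>a\<in>uminus ` {1..int N}. koszul_sign 1 (lpar a)) = (\<Sum>a\<in>{1..int N}. - 1 :: 'a)"
        by (subst sum.reindex) (auto simp: lpar_def koszul_sign_def intro!: sum.cong)
      moreover have "(\<Sum>a\<in>{1..int N}. koszul_sign 1 (lpar a)) = (\<Sum>a\<in>{1..int N}. 1 :: 'a)"
        by (auto simp: lpar_def koszul_sign_def intro!: sum.cong)
      ultimately show ?thesis unfolding L(1) using L(2) by (subst sum.union_disjoint) auto
    qed
    have "rep q N (TGen GA \<cdot> TGen GU) [] [] = rep q N ((TGen GA \<star> TId 0) \<cdot> TGen GU) [] []"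
      by (auto simp: rep_tens_unit_right labels_length simp del: rep.simps(2) intro!: sum.cong)
    also have "\<dots> = 0" by (subst rep_A_tens_comp) (auto simp: sum)
    finally show "rep q N (TGen GA \<cdot> TGen GU) t s = rep q N (TZero 0 0) t s" using t s by simp
  qed simp_all
qed

theorem eqv_rep_eq:
  assumes "eqv (sig UNIV) (B_rel q) f g" "q \<noteq> 0"
  shows "rep_eq q N f g"
  using assms(1)
proof (induction rule: eqv.induct)
  case (eqv_rel f g m n)
  then show ?case using B_rel_rep_eq assms(2) by blast
next
  case (eqv_sym f g)
  then show ?case by (simp add: rep_eq_def)
next
  case (eqv_trans f g h)
  then show ?case by (simp add: rep_eq_def)
next
  case (eqv_cong_comp f f' g g' l n m)
  then show ?case using rep_eq_comp[of q N f f' g g' l] wt_src_tgt by blast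
next
  case (eqv_cong_tens f f' g g')
  then show ?case by (simp add: rep_eq_tens)
next
  case (eqv_cong_add f f' g g' m n)
  then have "tsrc f = m" "ttgt f = n" "tsrc g = m" "ttgt g = n" using wt_src_tgt by blast+
  with eqv_cong_add.IH show ?case by (simp add: rep_eq_def)
next
  case (eqv_comp_assoc k n f l g m h)
  show ?case by (simp only: rep_eq_def rep_comp_assoc tsrc.simps ttgt.simps) simp
next
  case (eqv_comp_id_left m n f)
  then have "tsrc f = m" "ttgt f = n" using wt_src_tgt by blast+
  then show ?case
    by (intro rep_eqI[of _ m _ n]) (auto simp: of_bool_def if_distrib[of "\<lambda>c. c * _"] cong: if_cong)
next
  case (eqv_comp_id_right m n f)
  then have "tsrc f = m" "ttgt f = n" using wt_src_tgt by blast+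
  then show ?case
    by (intro rep_eqI[of _ m _ n]) (auto simp: of_bool_def if_distrib[of "\<lambda>c. _ * c"] cong: if_cong)
next
  case (eqv_comp_add_left l n f f' m g)
  then have "tsrc f = l" "tsrc f' = l" using wt_src_tgt by blast+
  then show ?case by (simp add: rep_eq_def distrib_right sum.distrib)
next
  case (eqv_comp_add_right l n f m g g')
  then have "tsrc g = m" "tsrc g' = m" using wt_src_tgt by blast+
  then show ?case by (simp add: rep_eq_def distrib_left sum.distrib)
next
  case (eqv_comp_smul_right l n f m g c)
  then show ?case by (simp add: rep_eq_def sum_distrib_left mult_ac)
next
  case (eqv_comp_smul_left l n f m g c)
  then show ?case by (simp add: rep_eq_def sum_distrib_left mult_ac)
next
  case (eqv_tens_assoc m n f m' n' g m'' n'' h)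
  then show ?case by (simp add: rep_eq_tens_assoc)
next
  case (eqv_tens_unit_left m n f)
  then show ?case by (simp add: rep_eq_def rep_tens_unit_left)
next
  case (eqv_tens_unit_right m n f)
  then show ?case by (simp add: rep_eq_def rep_tens_unit_right labels_length)
next
  case (eqv_tens_id m n)
  then show ?case by (simp add: rep_eq_tens_id)
next
  case (eqv_tens_add_left m n f f' m' n' g)
  then have "tsrc f = m" "tsrc f' = m" "ttgt f = n" "ttgt f' = n" using wt_src_tgt by blast+
  then show ?case by (simp add: rep_eq_def rep.simps(5) algebra_simps)
next
  case (eqv_tens_add_right m n f m' n' g g')
  then have "tsrc g = m'" "tsrc g' = m'" "ttgt g = n'" "ttgt g' = n'" using wt_src_tgt by blast+
  then show ?case by (simp add: rep_eq_def rep.simps(5) algebra_simps)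
next
  case (eqv_interchange p l n f r l' n' g s m h t m' k)
  then show ?case by (rule rep_eq_interchange)
next
  case (eqv_add_zero m n f)
  then show ?case using wt_src_tgt[of m n f] by (simp add: rep_eq_def)
next
  case (eqv_add_inverse m n f)
  then show ?case using wt_src_tgt[of m n f] by (simp add: rep_eq_def)
next
  case (eqv_add_commute m n f g)
  then show ?case using wt_src_tgt[of m n f] wt_src_tgt[of m n g] by (simp add: rep_eq_def)
qed (simp_all add: rep_eq_def rep.simps(5) algebra_simps)

fun codes :: "nat \<Rightarrow> nat list set" where
  "codes 0 = {[]}"
| "codes (Suc r) = (\<Union>c\<in>{..2 * r}. (#) c ` codes r)"

lemma finite_codes [simp]: "finite (codes r)"
  by (induction r) auto

lemma codes_length: "cs \<in> codes r \<Longrightarrow> length cs = r"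
  by (induction r arbitrary: cs) auto

lemma sum_codes_Suc: "(\<Sum>cs\<in>codes (Suc r). F cs) = (\<Sum>c\<le>2 * r. \<Sum>cs\<in>codes r. F (c # cs))"
proof -
  have "(\<Sum>cs\<in>codes (Suc r). F cs) = (\<Sum>c\<le>2 * r. \<Sum>cs\<in>(#) c ` codes r. F cs)"
    unfolding codes.simps by (rule sum.UNION_disjoint) auto
  then show ?thesis by (simp add: sum.reindex)
qed

fun cross :: "nat \<Rightarrow> nat \<Rightarrow> (gen, 'k) tm \<Rightarrow> (gen, 'k) tm" where
  "cross n 0 f = f"
| "cross n (Suc c) f = (TId (Suc c) \<star> (TGen GH \<star> TId (n - (c + 3)))) \<cdot> cross n c f"

fun cups :: "nat list \<Rightarrow> (gen, 'k) tm" where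
  "cups [] = TId 0"
| "cups (c # cs) = cross (2 * length cs + 2) c (TGen GU \<star> cups cs)"

lemma wt_H: "i + 2 + j = n \<Longrightarrow> wt (sig UNIV) n n (TId i \<star> (TGen GH \<star> TId j))"
  using wt_tens[OF wt_id wt_tens[OF wt_gen wt_id], of GH "sig UNIV" i j] by (auto simp: add.assoc)

lemma wt_cross: "wt (sig UNIV) m n f \<Longrightarrow> c + 2 \<le> n \<Longrightarrow> wt (sig UNIV) m n (cross n c f)"
  by (induction c) (auto intro!: wt_comp wt_H)

lemma wt_cups: "cs \<in> codes r \<Longrightarrow> wt (sig UNIV) 0 (2 * r) (cups cs :: (gen, 'k) tm)"
proof (induction r arbitrary: cs)
  case (Suc r)
  then obtain c cs' where cs: "cs = c # cs'" "c \<le> 2 * r" "cs' \<in> codes r" by auto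
  have "wt (sig UNIV) (0 + 0) (2 + 2 * r) (TGen GU \<star> (cups cs' :: (gen, 'k) tm))"
    using wt_tens[OF wt_gen Suc.IH[OF cs(3)], of GU] by simp
  then show ?case using cs by (auto simp: codes_length intro!: wt_cross)
qed (auto intro: wt_id)

lemma rep_cross_zero:
  assumes "\<And>t. t \<in> labels N n \<Longrightarrow> t ! 0 = int p \<Longrightarrow> \<bar>t ! 1\<bar> < int p \<Longrightarrow> rep q N f t s = 0"
    and "c + 2 \<le> n" "t \<in> labels N n" "t ! 0 = int p" "p \<le> N" "\<And>i. 1 \<le> i \<Longrightarrow> i \<le> c + 1 \<Longrightarrow> \<bar>t ! i\<bar> < int p"
  shows "rep q N (cross n c f) t s = 0"
  using assms(2-)
proof (induction c arbitrary: t)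
  case 0
  then show ?case using assms(1) by simp
next
  case (Suc c)
  have len: "length t = n" using Suc.prems(2) by (simp add: labels_def)
  define t1 x y t2 where "t1 = take (Suc c) t" and "x = t ! Suc c" and "y = t ! (c + 2)" and "t2 = drop (c + 3) t"
  have t: "t = t1 @ x # y # t2"
    using Suc.prems(1) len unfolding t1_def x_def y_def t2_def
    by (simp add: Cons_nth_drop_Suc id_take_nth_drop[symmetric] add.commute numeral_3_eq_3)
  have ls: "t1 \<in> labels N (Suc c)" "t2 \<in> labels N (n - (c + 3))" "x \<in> letters N" "y \<in> letters N"
    using Suc.prems(1,2) len t unfolding t1_def t2_def x_def y_def
    by (auto simp: labels_def dest: in_set_takeD in_set_dropD intro!: subsetD[OF _ nth_mem])
  have xy: "\<bar>x\<bar> < int p" "\<bar>y\<bar> < int p" using Suc.prems(5)[of "Suc c"] Suc.prems(5)[of "c + 2"] by (auto simp: x_def y_def)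
  have z: "rep q N (cross n c f) (t1 @ a # b # t2) s = 0" if ab: "a \<in> letters (p - 1)" "b \<in> letters (p - 1)" for a b
  proof (rule Suc.IH)
    have ab': "\<bar>a\<bar> < int p" "\<bar>b\<bar> < int p" "a \<in> letters N" "b \<in> letters N"
      using ab Suc.prems(4) by (auto simp: letters_def)
    have l1: "length t1 = Suc c" using ls(1) by (simp add: labels_def)
    have n: "n = Suc c + (2 + (n - (c + 3)))" using Suc.prems(1) by simp
    show "t1 @ a # b # t2 \<in> labels N n"
    proof -
      have "a # b # t2 \<in> labels N (2 + (n - (c + 3)))" using ls(2) ab' by simp
      from append_in_labels[OF ls(1) this] show ?thesis by (simp only: flip: n)
    qed
    show "(t1 @ a # b # t2) ! 0 = int p" using Suc.prems(3) l1 by (simp add: nth_append t)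
    fix i assume i: "1 \<le> i" "i \<le> c + 1"
    show "\<bar>(t1 @ a # b # t2) ! i\<bar> < int p"
    proof (cases "i = Suc c")
      case False
      then have "(t1 @ a # b # t2) ! i = t ! i" using i l1 by (simp add: nth_append t)
      then show ?thesis using Suc.prems(5)[of i] i by simp
    qed (use ab' l1 in \<open>simp add: nth_append\<close>)
  qed (use Suc.prems in auto)
  have "hop q (\<lambda>a b. rep q N (cross n c f) (t1 @ a # b # t2) s) x y = hop q (\<lambda>a b. 0) x y"
    using ls(3,4) xy z by (intro hop_cong(1)[of _ "p - 1"]) (auto simp: letters_def)
  also have "\<dots> = 0" using hop_scale[of q 0 "\<lambda>_ _. 0" x y] by simp
  finally show ?case unfolding cross.simps t rep_id_H_tens_comp(1)[OF ls] .
qed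

lemma rep_cross_lead:
  assumes "u @ w \<in> labels (p - 1) k" "length u = c" "n = k + 2" "1 \<le> p" "p \<le> N"
  shows "\<exists>\<sigma>. \<sigma> \<noteq> 0 \<and> (\<forall>f. rep q N (cross n c f) (int p # u @ (- int p) # w) s =
     \<sigma> * rep q N f (int p # (- int p) # u @ w) s)"
  using assms(1,2)
proof (induction c arbitrary: u w)
  case 0
  then show ?case by (intro exI[of _ 1]) simp
next
  case (Suc c)
  then obtain u' x where u: "u = u' @ [x]" "length u' = c" by (metis length_Suc_conv_rev)
  from Suc.IH[of u' "x # w"] Suc.prems u obtain \<sigma> where \<sigma>: "\<sigma> \<noteq> 0"
    "\<And>f. rep q N (cross n c f) (int p # u' @ (- int p) # x # w) s = \<sigma> * rep q N f (int p # (- int p) # u' @ x # w) s"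
    by auto
  have mem: "set u' \<subseteq> letters (p - 1)" "set w \<subseteq> letters (p - 1)" "x \<in> letters (p - 1)" "length w + Suc c = k"
    using Suc.prems u by (auto simp: labels_def)
  have sub: "letters (p - 1) \<subseteq> letters N" "int p \<in> letters N" "- int p \<in> letters N" using assms(4,5) by (auto simp: letters_def)
  have ls: "int p # u' \<in> labels N (Suc c)" "w \<in> labels N (n - (c + 3))"
    using mem sub u(2) assms(3) by (auto simp: labels_def)
  have x: "x \<in> letters N" "\<bar>x\<bar> < int p" using mem(3) sub assms(4) by (auto simp: letters_def)
  have "rep q N (cross n (Suc c) f) (int p # u @ (- int p) # w) s =
     lsign x (- int p) * \<sigma> * rep q N f (int p # (- int p) # u @ w) s" for f
  proof -
    have "rep q N (cross n (Suc c) f) ((int p # u') @ x # (- int p) # w) s =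
       hop q (\<lambda>a b. rep q N (cross n c f) ((int p # u') @ a # b # w) s) x (- int p)"
      unfolding cross.simps by (rule rep_id_H_tens_comp(1)[OF ls x(1) sub(3)])
    also have "\<dots> = lsign x (- int p) * rep q N (cross n c f) ((int p # u') @ (- int p) # x # w) s"
      using x(2) by (subst hop_diff) auto
    finally show ?thesis using \<sigma>(2)[of f] u by simp
  qed
  moreover have "lsign x (- int p) * \<sigma> \<noteq> 0" using \<sigma>(1) by (simp add: lsign_def)
  ultimately show ?case by blast
qed

lemma rep_U_tens0:
  "ttgt f = length t \<Longrightarrow> tsrc f = 0 \<Longrightarrow> rep q N (TGen GU \<star> f) (x # y # t) [] = of_bool (y = - x) * rep q N f t []"
  using rep_tens[of "[x, y]" "TGen GU" "[]" q N f t "[]"] by simp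

text \<open>The coefficient of the code \<open>c # cs\<close> is isolated by giving the ends of the outermost cup, at the
  positions \<open>0\<close> and \<open>c + 1\<close>, the label of largest absolute value, for \<open>c\<close> running downwards.\<close>

lemma cups_independent:
  assumes "r \<le> N" "\<And>t. t \<in> labels r (2 * r) \<Longrightarrow> (\<Sum>cs\<in>codes r. k cs * rep q N (cups cs) t []) = 0"
    "cs \<in> codes r"
  shows "k cs = 0"
  using assms
proof (induction r arbitrary: k cs)
  case 0
  then show ?case by simp
next
  case (Suc r)
  define p where "p = Suc r"
  have src: "tsrc (cups cs :: (gen, 'a) tm) = 0" "ttgt (cups cs :: (gen, 'a) tm) = 2 * r" if "cs \<in> codes r" for cs
    using wt_src_tgt[OF wt_cups[OF that]] by auto
  have "\<forall>cs\<in>codes r. k (c # cs) = 0" if "c \<le> 2 * r" for c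
    using that
  proof (induction "2 * r - c" arbitrary: c rule: less_induct)
    case less
    have "(\<Sum>cs\<in>codes r. k (c # cs) * rep q N (cups cs) v []) = 0" if v: "v \<in> labels r (2 * r)" for v
    proof -
      define u w where "u = take c v" and "w = drop c v"
      have uw: "u @ w = v" "length u = c" using v less.prems by (auto simp: u_def w_def labels_def)
      have "u @ w \<in> labels (p - 1) (2 * r)" using v uw by (simp add: p_def)
      from rep_cross_lead[OF this uw(2) refl _ , of N q "[]"] Suc.prems(1)
      obtain \<sigma> where \<sigma>: "\<sigma> \<noteq> 0" "\<And>f. rep q N (cross (2 * r + 2) c f) (int p # u @ (- int p) # w) [] =
        \<sigma> * rep q N f (int p # (- int p) # v) []" unfolding uw(1) by (auto simp: p_def)
      let ?t = "int p # u @ (- int p) # w"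
      have sub: "letters r \<subseteq> letters p" "int p \<in> letters p" "- int p \<in> letters p" "letters p \<subseteq> letters N"
        using Suc.prems(1) by (auto simp: letters_def p_def)
      have t: "?t \<in> labels p (2 * p)"
        using v uw sub by (auto simp: labels_def p_def subset_iff)
      have tN: "?t \<in> labels N (2 * r + 2)" using t sub(4) by (auto simp: labels_def p_def)
      have low: "\<bar>u ! i\<bar> < int p" if "i < c" for i
      proof -
        have "u ! i \<in> letters r" using that v uw nth_mem[of i u] by (auto simp: labels_def)
        then show ?thesis by (auto simp: letters_def p_def)
      qed
      have small: "rep q N (cups (c' # cs)) ?t [] = 0" if c': "c' < c" and cs: "cs \<in> codes r" for c' cs
      proof -
        have "rep q N (cross (2 * r + 2) c' (TGen GU \<star> cups cs)) ?t [] = 0"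
        proof (rule rep_cross_zero[of N _ p])
          fix t assume "t \<in> labels N (2 * r + 2)" "t ! 0 = int p" "\<bar>t ! 1\<bar> < int p"
          then show "rep q N (TGen GU \<star> cups cs) t [] = 0"
            using src[OF cs] by (cases t; cases "tl t") (auto simp: labels_def rep_U_tens0)
        next
          fix i assume "1 \<le> i" "i \<le> c' + 1"
          then show "\<bar>?t ! i\<bar> < int p" using low[of "i - 1"] c' uw(2) by (auto simp: nth_Cons' nth_append)
        qed (use tN c' less.prems Suc.prems(1) in \<open>auto simp: p_def\<close>)
        then show ?thesis using codes_length[OF cs] by simp
      qed
      have "0 = (\<Sum>c'\<le>2 * r. \<Sum>cs\<in>codes r. k (c' # cs) * rep q N (cups (c' # cs)) ?t [])"
        using Suc.prems(2)[of ?t] t unfolding sum_codes_Suc p_def by simp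
      also have "\<dots> = (\<Sum>c'\<le>2 * r. if c' = c then (\<Sum>cs\<in>codes r. k (c # cs) * rep q N (cups (c # cs)) ?t []) else 0)"
      proof (intro sum.cong refl)
        fix c' assume "c' \<in> {..2 * r}"
        then show "(\<Sum>cs\<in>codes r. k (c' # cs) * rep q N (cups (c' # cs)) ?t []) =
          (if c' = c then (\<Sum>cs\<in>codes r. k (c # cs) * rep q N (cups (c # cs)) ?t []) else 0)"
          using small[of c'] less.hyps[of c'] by (cases "c' = c"; cases "c' < c") (auto intro!: sum.neutral)
      qed
      also have "\<dots> = (\<Sum>cs\<in>codes r. k (c # cs) * rep q N (cups (c # cs)) ?t [])"
        using less.prems by simp
      also have "\<dots> = (\<Sum>cs\<in>codes r. \<sigma> * (k (c # cs) * rep q N (cups cs) v []))"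
      proof (intro sum.cong refl)
        fix cs assume cs: "cs \<in> codes r"
        have "rep q N (cups (c # cs)) ?t [] = \<sigma> * rep q N (cups cs) v []"
          using \<sigma>(2) codes_length[OF cs] src[OF cs] v by (simp add: rep_U_tens0 labels_def)
        then show "k (c # cs) * rep q N (cups (c # cs)) ?t [] = \<sigma> * (k (c # cs) * rep q N (cups cs) v [])"
          by simp
      qed
      finally show ?thesis using \<sigma>(1) by (simp flip: sum_distrib_left)
    qed
    then show ?case using Suc.IH[of "\<lambda>cs. k (c # cs)"] Suc.prems(1) by auto
  qed
  then show ?case using Suc.prems(3) by auto
qed

fun unbend :: "nat \<Rightarrow> nat \<Rightarrow> (gen, 'k) tm \<Rightarrow> (gen, 'k) tm" where
  "unbend n 0 f = f"
| "unbend n (Suc k) f = (TGen GA \<star> TId (n - Suc k)) \<cdot> (TId 1 \<star> unbend n k f)"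

lemma wt_unbend:
  assumes "wt (sig UNIV) 0 n f" "k \<le> n"
  shows "wt (sig UNIV) k (n - k) (unbend n k f)"
  using assms(2)
proof (induction k)
  case (Suc k)
  have "wt (sig UNIV) (2 + (n - Suc k)) (0 + (n - Suc k)) (TGen GA \<star> TId (n - Suc k))"
    using wt_tens[OF wt_gen wt_id, of GA "sig UNIV"] by simp
  moreover have "wt (sig UNIV) (1 + k) (1 + (n - k)) (TId 1 \<star> unbend n k f)"
    using Suc by (intro wt_tens wt_id) auto
  moreover have "1 + (n - k) = 2 + (n - Suc k)" using Suc.prems by simp
  ultimately show ?case by (auto intro: wt_comp)
qed (use assms in simp)

lemma rep_unbend:
  assumes "k \<le> n" "s \<in> labels N k" "t \<in> labels N (n - k)"
  shows "\<exists>\<sigma>. \<sigma> \<noteq> 0 \<and> (\<forall>f. wt (sig UNIV) 0 n f \<longrightarrow> rep q N (unbend n k f) t s = \<sigma> * rep q N f (map uminus (rev s) @ t) [])"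
  using assms
proof (induction k arbitrary: s t)
  case 0
  then show ?case by (intro exI[of _ 1]) simp
next
  case (Suc k)
  from Suc.prems(2) obtain x s' where s: "s = x # s'" "x \<in> letters N" "s' \<in> labels N k" by (rule labels_SucE)
  have xt: "- x # t \<in> labels N (n - k)"
    using Suc.prems s by (auto simp: labels_def)
  from Suc.IH[OF _ s(3) xt] Suc.prems obtain \<sigma> where \<sigma>: "\<sigma> \<noteq> 0"
    "\<And>f. wt (sig UNIV) 0 n f \<Longrightarrow> rep q N (unbend n k f) (- x # t) s' = \<sigma> * rep q N f (map uminus (rev s') @ - x # t) []"
    by auto
  let ?\<tau> = "koszul_sign 1 (lpar x) * koszul_sign (tpar (- x # t) + tpar s') (lpar x) :: 'a"
  have "rep q N (unbend n (Suc k) f) t s = (?\<tau> * \<sigma>) * rep q N f (map uminus (rev s) @ t) []"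
    if f: "wt (sig UNIV) 0 n f" for f
  proof -
    have src: "tsrc (unbend n k f) = k" using wt_src_tgt[OF wt_unbend[OF f, of k]] Suc.prems by simp
    have "rep q N (unbend n (Suc k) f) t s =
      (\<Sum>a\<in>letters N. koszul_sign 1 (lpar a) * rep q N (TId 1 \<star> unbend n k f) ([a] @ (- a # t)) s)"
      unfolding unbend.simps using rep_A_tens_comp[OF Suc.prems(3)] by simp
    also have "\<dots> = (\<Sum>a\<in>letters N. if a = x then ?\<tau> * rep q N (unbend n k f) (- x # t) s' else 0)"
    proof (intro sum.cong refl)
      fix a
      have "rep q N (TId 1 \<star> unbend n k f) ([a] @ (- a # t)) s = koszul_sign (tpar (- a # t) + tpar s') (tpar [a]) *
        (of_bool ([x] = [a]) * rep q N (unbend n k f) (- a # t) s')"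
        using s(3) src by (subst rep_id_tens) (auto simp: s(1) labels_def)
      then show "koszul_sign 1 (lpar a) * rep q N (TId 1 \<star> unbend n k f) ([a] @ (- a # t)) s =
        (if a = x then ?\<tau> * rep q N (unbend n k f) (- x # t) s' else 0)" by auto
    qed
    also have "\<dots> = ?\<tau> * rep q N (unbend n k f) (- x # t) s'" using s(2) by simp
    finally show ?thesis using \<sigma>(2)[OF f] by (simp add: s(1))
  qed
  moreover have "?\<tau> * \<sigma> \<noteq> 0" using \<sigma>(1) by (simp add: koszul_sign_def)
  ultimately show ?case by blast
qed

definition unbent :: "nat list \<Rightarrow> (gen, 'k) tm" where
  "unbent cs = unbend (2 * length cs) (length cs) (cups cs)"

lemma wt_unbent: "cs \<in> codes n \<Longrightarrow> wt (sig UNIV) n n (unbent cs)"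
  using wt_unbend[OF wt_cups, of cs n n] by (simp add: unbent_def codes_length)

theorem unbent_independent:
  assumes "\<And>t s. t \<in> labels n n \<Longrightarrow> s \<in> labels n n \<Longrightarrow> (\<Sum>cs\<in>codes n. k cs * rep q n (unbent cs) t s) = 0"
    "cs \<in> codes n"
  shows "k cs = 0"
proof (rule cups_independent[OF order_refl _ assms(2), of k q])
  fix t assume "t \<in> labels n (2 * n)"
  then obtain t1 t2 where t: "t = t1 @ t2" "t1 \<in> labels n n" "t2 \<in> labels n n"
    using labels_appendE[of t n n n] by (auto simp: mult_2)
  define s where "s = map uminus (rev t1)"
  have s: "s \<in> labels n n" "map uminus (rev s) = t1" using t(2) by (auto simp: s_def labels_def rev_map comp_def)
  obtain \<sigma> where \<sigma>: "\<sigma> \<noteq> 0" "\<And>f. wt (sig UNIV) 0 (2 * n) f \<Longrightarrow>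
      rep q n (unbend (2 * n) n f) t2 s = \<sigma> * rep q n f (t1 @ t2) []"
    using rep_unbend[of n "2 * n" s n t2 q] s t(3) by auto
  have "0 = (\<Sum>cs\<in>codes n. k cs * rep q n (unbent cs) t2 s)" using assms(1) t(3) s(1) by simp
  also have "\<dots> = (\<Sum>cs\<in>codes n. \<sigma> * (k cs * rep q n (cups cs) t []))"
    using \<sigma>(2)[OF wt_cups] by (auto intro!: sum.cong simp: unbent_def codes_length t(1))
  finally show "(\<Sum>cs\<in>codes n. k cs * rep q n (cups cs) t []) = 0"
    using \<sigma>(1) by (simp flip: sum_distrib_left)
qed

section \<open>Algebras given by generators and relations\<close>

lemma scalars_cring: "cring (scalars :: 'k::field ring)"
  by (rule cringI) (auto simp: scalars_def algebra_simps intro!: abelian_groupI comm_monoidI exI[of _ "- _"])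

lemma atms_simps:
  "AOne \<in> atms G" "AZero \<in> atms G" "AGen w \<in> atms G \<longleftrightarrow> w \<in> G" "x *\<^sub>a y \<in> atms G \<longleftrightarrow> x \<in> atms G \<and> y \<in> atms G"
  "x +\<^sub>a y \<in> atms G \<longleftrightarrow> x \<in> atms G \<and> y \<in> atms G" "c \<cdot>\<^sub>a x \<in> atms G \<longleftrightarrow> x \<in> atms G"
  by (auto simp: atms_def)

lemma aeqv_atms: "aeqv G R x y \<Longrightarrow> x \<in> atms G \<and> y \<in> atms G"
  by (induction rule: aeqv.induct) (auto simp: atms_simps)

lemma aeqv_zero_left: "x \<in> atms G \<Longrightarrow> aeqv G R (AZero +\<^sub>a x) x"
  by (rule aeqv_trans[OF aadd_commute aadd_zero]) (simp_all add: atms_simps)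

lemma aeqv_minus_left: "x \<in> atms G \<Longrightarrow> aeqv G R ((- 1) \<cdot>\<^sub>a x +\<^sub>a x) AZero"
  by (rule aeqv_trans[OF aadd_commute aadd_inverse]) (simp_all add: atms_simps)

lemma aeqv_smul_zero:
  assumes "x \<in> atms G"
  shows "aeqv G R (0 \<cdot>\<^sub>a x) AZero"
proof -
  have "aeqv G R ((1 + - 1) \<cdot>\<^sub>a x) (1 \<cdot>\<^sub>a x +\<^sub>a (- 1) \<cdot>\<^sub>a x)" by (rule aadd_smul[OF assms])
  moreover have "aeqv G R (1 \<cdot>\<^sub>a x +\<^sub>a (- 1) \<cdot>\<^sub>a x) (x +\<^sub>a (- 1) \<cdot>\<^sub>a x)"
    using assms by (intro acong_add asmul_one aeqv_refl) (simp_all add: atms_simps)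
  ultimately show ?thesis using aadd_inverse[OF assms] aeqv_trans by (metis add.right_inverse)
qed

lemma aeqv_class_eq: "aeqv G R x y \<Longrightarrow> aeqv_class G R x = aeqv_class G R y"
  unfolding aeqv_class_def using aeqv_sym aeqv_trans by blast

lemma aeqv_class_UN:
  assumes "x \<in> atms G" "\<And>y. aeqv G R x y \<Longrightarrow> F y = F x"
  shows "(\<Union>y\<in>aeqv_class G R x. F y) = F x"
  using assms aeqv_refl[OF assms(1), of R] unfolding aeqv_class_def by blast

lemma presented_algebra_simps:
  assumes "x \<in> atms G"
  shows "y \<in> atms G \<Longrightarrow> aeqv_class G R x \<otimes>\<^bsub>presented_algebra G R\<^esub> aeqv_class G R y = aeqv_class G R (x *\<^sub>a y)"
    and "y \<in> atms G \<Longrightarrow> aeqv_class G R x \<oplus>\<^bsub>presented_algebra G R\<^esub> aeqv_class G R y = aeqv_class G R (x +\<^sub>a y)"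
    and "c \<odot>\<^bsub>presented_algebra G R\<^esub> aeqv_class G R x = aeqv_class G R (c \<cdot>\<^sub>a x)"
    and "aeqv_class G R x \<in> carrier (presented_algebra G R)"
    and "\<one>\<^bsub>presented_algebra G R\<^esub> = aeqv_class G R AOne" and "\<zero>\<^bsub>presented_algebra G R\<^esub> = aeqv_class G R AZero"
proof -
  { assume y: "y \<in> atms G"
    have "(\<Union>x'\<in>aeqv_class G R x. \<Union>y'\<in>aeqv_class G R y. aeqv_class G R (x' *\<^sub>a y')) = (\<Union>y'\<in>aeqv_class G R y. aeqv_class G R (x *\<^sub>a y'))"
    proof (rule aeqv_class_UN[OF assms], rule SUP_cong[OF refl])
      fix x' y' assume "aeqv G R x x'" "y' \<in> aeqv_class G R y"
      then have "aeqv G R x' x" "aeqv G R y' y'"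
        using aeqv_sym aeqv_refl aeqv_atms[of G R y y'] by (auto simp: aeqv_class_def)
      then show "aeqv_class G R (x' *\<^sub>a y') = aeqv_class G R (x *\<^sub>a y')" by (intro aeqv_class_eq acong_mul)
    qed
    also have "\<dots> = aeqv_class G R (x *\<^sub>a y)"
    proof (rule aeqv_class_UN[OF y])
      fix y' assume "aeqv G R y y'"
      from aeqv_class_eq[OF acong_mul[OF aeqv_refl[OF assms] aeqv_sym[OF this]]]
      show "aeqv_class G R (x *\<^sub>a y') = aeqv_class G R (x *\<^sub>a y)" .
    qed
    finally show "aeqv_class G R x \<otimes>\<^bsub>presented_algebra G R\<^esub> aeqv_class G R y = aeqv_class G R (x *\<^sub>a y)"
      by (simp add: presented_algebra_def)
    have "(\<Union>x'\<in>aeqv_class G R x. \<Union>y'\<in>aeqv_class G R y. aeqv_class G R (x' +\<^sub>a y')) = (\<Union>y'\<in>aeqv_class G R y. aeqv_class G R (x +\<^sub>a y'))"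
    proof (rule aeqv_class_UN[OF assms], rule SUP_cong[OF refl])
      fix x' y' assume "aeqv G R x x'" "y' \<in> aeqv_class G R y"
      then have "aeqv G R x' x" "aeqv G R y' y'"
        using aeqv_sym aeqv_refl aeqv_atms[of G R y y'] by (auto simp: aeqv_class_def)
      then show "aeqv_class G R (x' +\<^sub>a y') = aeqv_class G R (x +\<^sub>a y')" by (intro aeqv_class_eq acong_add)
    qed
    also have "\<dots> = aeqv_class G R (x +\<^sub>a y)"
    proof (rule aeqv_class_UN[OF y])
      fix y' assume "aeqv G R y y'"
      from aeqv_class_eq[OF acong_add[OF aeqv_refl[OF assms] aeqv_sym[OF this]]]
      show "aeqv_class G R (x +\<^sub>a y') = aeqv_class G R (x +\<^sub>a y)" .
    qed
    finally show "aeqv_class G R x \<oplus>\<^bsub>presented_algebra G R\<^esub> aeqv_class G R y = aeqv_class G R (x +\<^sub>a y)"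
      by (simp add: presented_algebra_def) }
  have "(\<Union>x'\<in>aeqv_class G R x. aeqv_class G R (c \<cdot>\<^sub>a x')) = aeqv_class G R (c \<cdot>\<^sub>a x)"
    by (rule aeqv_class_UN[OF assms]) (rule aeqv_class_eq[OF acong_smul[OF aeqv_sym]])
  then show "c \<odot>\<^bsub>presented_algebra G R\<^esub> aeqv_class G R x = aeqv_class G R (c \<cdot>\<^sub>a x)" by (simp add: presented_algebra_def)
  show "aeqv_class G R x \<in> carrier (presented_algebra G R)" "\<one>\<^bsub>presented_algebra G R\<^esub> = aeqv_class G R AOne"
    "\<zero>\<^bsub>presented_algebra G R\<^esub> = aeqv_class G R AZero" using assms by (simp_all add: presented_algebra_def)
qed

lemma presented_carrierE:
  assumes "X \<in> carrier (presented_algebra G R)"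
  obtains x where "x \<in> atms G" "X = aeqv_class G R x"
  using assms by (auto simp: presented_algebra_def)

lemma assoc_algebra_presented:
  fixes R :: "('g, 'k::field) atm \<Rightarrow> ('g, 'k) atm \<Rightarrow> bool"
  shows "assoc_algebra (presented_algebra G R)"
proof -
  let ?A = "presented_algebra G R"
  note simps = presented_algebra_simps atms_simps presented_algebra_simps(5,6)[of AZero G R, OF atms_simps(2)]
  have ab: "abelian_group ?A"
  proof (rule abelian_groupI; (elim presented_carrierE)?; (hypsubst)?; (simp only: simps)?)
    fix x :: "('g, 'k) atm" assume x: "x \<in> atms G"
    show "aeqv_class G R (AZero +\<^sub>a x) = aeqv_class G R x" by (rule aeqv_class_eq[OF aeqv_zero_left[OF x]])
    show "\<exists>Y\<in>carrier ?A. Y \<oplus>\<^bsub>?A\<^esub> aeqv_class G R x = aeqv_class G R AZero"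
      using aeqv_class_eq[OF aeqv_minus_left[OF x, of R]] x
      by (intro bexI[of _ "aeqv_class G R ((- 1) \<cdot>\<^sub>a x)"]) (simp_all only: simps)
  qed ((rule aeqv_class_eq, (rule aadd_assoc aadd_commute; assumption)) | auto)+
  have mon: "monoid ?A"
    by (rule monoidI; (elim presented_carrierE)?; (hypsubst)?; (simp only: simps)?)
      ((rule aeqv_class_eq, (rule amul_assoc amul_one_left amul_one_right; assumption)) | auto)+
  show ?thesis
  proof (rule assoc_algebra.intro)
    show "Ring.ring ?A"
      by (rule ringI[OF ab mon]; (elim presented_carrierE)?; (hypsubst)?; (simp only: simps)?)
        ((rule aeqv_class_eq, (rule amul_add_left amul_add_right; assumption)) | auto)+
    show "Module.module scalars ?A"
      by (rule moduleI[OF scalars_cring ab]; (elim presented_carrierE)?; (hypsubst)?; (simp only: simps scalars_def ring_record_simps monoid.simps ring.simps)?)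
        ((rule aeqv_class_eq, (rule aadd_smul asmul_add asmul_one aeqv_sym[OF asmul_smul]; assumption)) | auto)+
  qed ((elim presented_carrierE)?; (hypsubst)?; (simp only: simps)?; ((rule aeqv_class_eq, (rule amul_smul_left amul_smul_right; assumption)) | auto))+
qed

lemma (in presentation) assoc_algebra_End: "assoc_algebra (End_algebra (presented_supercat S R) n)"
proof -
  let ?E = "End_algebra (presented_supercat S R) n"
  interpret M: Module.module scalars ?E by (rule hom_space_module)
  have c: "X \<in> carrier ?E \<longleftrightarrow> ar n n X" for X by (simp add: hom_space_def presented)
  show ?thesis
  proof (rule assoc_algebra.intro)
    show "Module.module scalars ?E" by (rule hom_space_module)
    show "Ring.ring ?E"
    proof (rule ringI)
      show "abelian_group ?E" by (rule M.abelian_group_axioms)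
      show "monoid ?E"
        by (rule monoidI) (auto simp: hom_space_def presented ar_isc intro!: ar_cmp ar_idn total_laws(1) unit_laws)
    qed (auto simp: hom_space_def presented ar_isc total_laws)
  qed (auto simp: hom_space_def presented ar_isc total_laws)
qed

section \<open>The algebras as one ring\<close>

text \<open>The spanning set was constructed in a type of class \<open>ring_1\<close>. The quotients depend on the
  parameters \<open>q\<close> and \<open>n\<close>, hence are not types; their product over all parameters is.\<close>

definition agens :: "nat \<Rightarrow> agen set" where
  "agens n = {x. \<exists>i. 1 \<le> i \<and> i + 1 \<le> n \<and> (x = Gg i \<or> x = Ge i)}"

definition prel :: "('f::field \<times> nat \<Rightarrow> (agen, 'f) atm) \<Rightarrow> ('f \<times> nat \<Rightarrow> (agen, 'f) atm) \<Rightarrow> bool" where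
  "prel F G \<longleftrightarrow> (\<forall>q n. aeqv (agens n) (A_rel q) (F (q, n)) (G (q, n)))"

lemma prelI: "(\<And>q n. aeqv (agens n) (A_rel q) (F (q, n)) (G (q, n))) \<Longrightarrow> prel F G"
  by (simp add: prel_def)

lemma prelD: "prel F G \<Longrightarrow> aeqv (agens n) (A_rel q) (F (q, n)) (G (q, n))"
  by (simp add: prel_def)

lemma prel_atms: "prel F F \<Longrightarrow> F (q, n) \<in> atms (agens n)"
  using aeqv_atms prelD by blast

quotient_type (overloaded) 'f pq = "'f::field \<times> nat \<Rightarrow> (agen, 'f) atm" / partial: prel
proof (rule part_equivpI)
  show "\<exists>F :: 'f \<times> nat \<Rightarrow> (agen, 'f) atm. prel F F"
    by (rule exI[of _ "\<lambda>_. AZero"]) (simp add: prel_def aeqv_refl atms_simps)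
  show "symp (prel :: ('f \<times> nat \<Rightarrow> (agen, 'f) atm) \<Rightarrow> _)" by (rule sympI) (simp add: prel_def aeqv_sym)
  show "transp (prel :: ('f \<times> nat \<Rightarrow> (agen, 'f) atm) \<Rightarrow> _)" by (rule transpI) (meson prel_def aeqv_trans)
qed

primrec ev :: "'f::field \<Rightarrow> (agen, 'f) atm \<Rightarrow> 'f" where
  "ev q AOne = 1"
| "ev q (AGen x) = (case x of Gg i \<Rightarrow> q | Ge i \<Rightarrow> 0)"
| "ev q AZero = 0"
| "ev q (x *\<^sub>a y) = ev q x * ev q y"
| "ev q (x +\<^sub>a y) = ev q x + ev q y"
| "ev q (c \<cdot>\<^sub>a x) = c * ev q x"

lemma ev_rel: "A_rel q x y \<Longrightarrow> ev q x = ev q y"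
  by (induction rule: A_rel.induct) simp_all

lemma ev_aeqv: "aeqv G (A_rel q) x y \<Longrightarrow> ev q x = ev q y"
  by (induction rule: aeqv.induct) (simp_all add: ev_rel algebra_simps)

instantiation pq :: (field) ring_1
begin

lift_definition zero_pq :: "'a pq" is "\<lambda>_. AZero" by (rule prelI) (simp add: aeqv_refl atms_simps)
lift_definition one_pq :: "'a pq" is "\<lambda>_. AOne" by (rule prelI) (simp add: aeqv_refl atms_simps)
lift_definition plus_pq :: "'a pq \<Rightarrow> 'a pq \<Rightarrow> 'a pq" is "\<lambda>F G p. F p +\<^sub>a G p"
  by (rule prelI) (rule acong_add; erule prelD)
lift_definition times_pq :: "'a pq \<Rightarrow> 'a pq \<Rightarrow> 'a pq" is "\<lambda>F G p. F p *\<^sub>a G p"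
  by (rule prelI) (rule acong_mul; erule prelD)
lift_definition uminus_pq :: "'a pq \<Rightarrow> 'a pq" is "\<lambda>F p. (- 1) \<cdot>\<^sub>a F p"
  by (rule prelI) (rule acong_smul; erule prelD)
definition minus_pq :: "'a pq \<Rightarrow> 'a pq \<Rightarrow> 'a pq" where "minus_pq x y = x + - y"

instance
proof
  fix a b c :: "'a pq"
  show "a * b * c = a * (b * c)" by (transfer, rule prelI, rule amul_assoc; erule prel_atms)
  show "1 * a = a" by (transfer, rule prelI, rule amul_one_left; erule prel_atms)
  show "a * 1 = a" by (transfer, rule prelI, rule amul_one_right; erule prel_atms)
  show "a + b + c = a + (b + c)" by (transfer, rule prelI, rule aadd_assoc; erule prel_atms)
  show "a + b = b + a" by (transfer, rule prelI, rule aadd_commute; erule prel_atms)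
  show "0 + a = a" by (transfer, rule prelI, rule aeqv_zero_left; erule prel_atms)
  show "- a + a = 0" by (transfer, rule prelI, rule aeqv_minus_left; erule prel_atms)
  show "a - b = a + - b" by (rule minus_pq_def)
  show "(a + b) * c = a * c + b * c" by (transfer, rule prelI, rule amul_add_left; erule prel_atms)
  show "a * (b + c) = a * b + a * c" by (transfer, rule prelI, rule amul_add_right; erule prel_atms)
  show "(0 :: 'a pq) \<noteq> 1"
  proof (transfer, rule notI)
    assume "prel (\<lambda>_ :: 'a \<times> nat. AZero) (\<lambda>_. AOne)"
    from ev_aeqv[OF prelD[OF this, of 0 1]] show False by simp
  qed
qed

end

lift_definition scale_pq :: "'f::field \<Rightarrow> 'f pq \<Rightarrow> 'f pq" is "\<lambda>c F p. c \<cdot>\<^sub>a F p"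
  by (rule prelI) (rule acong_smul; erule prelD)

lemma vector_space_pq: "vector_space (scale_pq :: 'f::field \<Rightarrow> _)"
proof
  fix a b :: 'f and x y :: "'f pq"
  show "scale_pq a (x + y) = scale_pq a x + scale_pq a y" by (transfer, rule prelI, rule asmul_add; erule prel_atms)
  show "scale_pq (a + b) x = scale_pq a x + scale_pq b x" by (transfer, rule prelI, rule aadd_smul; erule prel_atms)
  show "scale_pq a (scale_pq b x) = scale_pq (a * b) x" by (transfer, rule prelI, rule asmul_smul; erule prel_atms)
  show "scale_pq 1 x = x" by (transfer, rule prelI, rule asmul_one; erule prel_atms)
qed

lemma scale_pq_mult: "scale_pq c x * y = scale_pq c (x * y)" "x * scale_pq c y = scale_pq c (x * y)"
  by (transfer, rule prelI, rule amul_smul_left; erule prel_atms)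
    (transfer, rule prelI, rule amul_smul_right; erule prel_atms)

text \<open>An expression is put into the component \<open>(q, n)\<close>; in the other components it acts through the
  one-dimensional representation \<open>ev q\<close>, so that the relations with parameter \<open>q\<close> hold everywhere.\<close>

definition raw :: "'f::field \<Rightarrow> nat \<Rightarrow> (agen, 'f) atm \<Rightarrow> 'f \<times> nat \<Rightarrow> (agen, 'f) atm" where
  "raw q n x = (\<lambda>p. if p = (q, n) then x else ev q x \<cdot>\<^sub>a AOne)"

definition el :: "'f::field \<Rightarrow> nat \<Rightarrow> (agen, 'f) atm \<Rightarrow> 'f pq" where
  "el q n x = abs_pq (raw q n x)"

lemma prel_raw: "aeqv (agens n) (A_rel q) x y \<Longrightarrow> prel (raw q n x) (raw q n y)"
  by (rule prelI) (auto simp: raw_def ev_aeqv atms_simps intro!: aeqv_refl)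

lemma abs_pq_eqI: "prel F G \<Longrightarrow> abs_pq F = abs_pq G"
  by (rule Quotient_rel_abs[OF Quotient_pq])

lemma el_eq: "aeqv (agens n) (A_rel q) x y \<Longrightarrow> el q n x = el q n y"
  unfolding el_def by (rule abs_pq_eqI[OF prel_raw])

lemma el_eqD: "el q n x = el q n y \<Longrightarrow> x \<in> atms (agens n) \<Longrightarrow> y \<in> atms (agens n) \<Longrightarrow> aeqv (agens n) (A_rel q) x y"
  using prelD[of "raw q n x" "raw q n y" n q] Quotient_rel[OF Quotient_pq, of "raw q n x" "raw q n y"]
    prel_raw[OF aeqv_refl, of x n q] prel_raw[OF aeqv_refl, of y n q]
  by (simp add: el_def raw_def)

lemma ascal: "aeqv G R ((c \<cdot>\<^sub>a AOne) *\<^sub>a (d \<cdot>\<^sub>a AOne)) ((c * d) \<cdot>\<^sub>a AOne)"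
  by (rule aeqv_trans[OF amul_smul_left aeqv_trans[OF acong_smul[OF amul_one_left] asmul_smul]])
    (simp_all add: atms_simps)

lemma el_ops:
  assumes "x \<in> atms (agens n)"
  shows "y \<in> atms (agens n) \<Longrightarrow> el q n (x *\<^sub>a y) = el q n x * el q n y"
    and "y \<in> atms (agens n) \<Longrightarrow> el q n (x +\<^sub>a y) = el q n x + el q n y"
    and "el q n (c \<cdot>\<^sub>a x) = scale_pq c (el q n x)"
    and "el q n AOne = 1" and "el q n AZero = 0"
proof -
  note r = prel_raw[OF aeqv_refl]
  { assume y: "y \<in> atms (agens n)"
    show "el q n (x *\<^sub>a y) = el q n x * el q n y"
      unfolding el_def times_pq.abs_eq[OF r[OF assms] r[OF y]]
      by (rule abs_pq_eqI, rule prelI)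
        (use assms y in \<open>auto simp: raw_def atms_simps intro!: aeqv_refl aeqv_sym[OF ascal]\<close>)
    show "el q n (x +\<^sub>a y) = el q n x + el q n y"
      unfolding el_def plus_pq.abs_eq[OF r[OF assms] r[OF y]]
      by (rule abs_pq_eqI, rule prelI)
        (use assms y in \<open>auto simp: raw_def atms_simps intro!: aeqv_refl aadd_smul\<close>) }
  show "el q n (c \<cdot>\<^sub>a x) = scale_pq c (el q n x)"
    unfolding el_def scale_pq.abs_eq[OF r[OF assms]]
    by (rule abs_pq_eqI, rule prelI)
      (use assms in \<open>auto simp: raw_def atms_simps intro!: aeqv_refl aeqv_sym[OF asmul_smul]\<close>)
  show "el q n AOne = 1" unfolding el_def one_pq.abs_eq
    by (rule abs_pq_eqI, rule prelI)
      (auto simp: raw_def atms_simps intro!: aeqv_refl asmul_one)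
  show "el q n AZero = 0" unfolding el_def zero_pq.abs_eq
    by (rule abs_pq_eqI, rule prelI)
      (auto simp: raw_def atms_simps intro!: aeqv_refl aeqv_smul_zero)
qed

lemma agens_iff: "Gg i \<in> agens n \<longleftrightarrow> 1 \<le> i \<and> i < n" "Ge i \<in> agens n \<longleftrightarrow> 1 \<le> i \<and> i < n"
  by (auto simp: agens_def)

lemma uminus_pq_scale: "scale_pq (- 1) x = - x"
  by transfer (rule prelI, rule aeqv_refl, simp add: atms_simps prel_atms)

lemma q_Brauer_elements_pq:
  fixes q :: "'f::field"
  assumes "q \<noteq> 0"
  shows "q_Brauer_elements scale_pq q n (\<lambda>i. el q n (AGen (Gg i))) (\<lambda>i. el q n (AGen (Ge i)))"
proof -
  interpret vector_space "scale_pq :: 'f \<Rightarrow> _" by (rule vector_space_pq)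
  have rel: "el q n x = el q n y" if "A_rel q x y" "x \<in> atms (agens n)" "y \<in> atms (agens n)" for x y
    by (rule el_eq[OF aeqv_rel[of "A_rel q" x y "agens n", OF that]])
  note ops = el_ops atms_simps agens_iff uminus_pq_scale
  show ?thesis
  proof (unfold_locales, goal_cases)
    case 1 show ?case by (rule assms)
  next
    case 2 show ?case by (rule scale_pq_mult)
  next
    case 3 show ?case by (rule scale_pq_mult)
  next
    case (4 i)
    let ?g = "el q n (AGen (Gg i))"
    have "(?g + scale_pq (- q) 1) * (?g + scale_pq (inverse q) 1) = 0"
      using rel[OF A_rel.intros(1)[of q i]] 4 by (simp add: ops el_ops(4,5)[OF atms_simps(1)])
    then have "?g * ?g = scale_pq (q * inverse q) 1 + (scale_pq q ?g - scale_pq (inverse q) ?g)"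
      by (simp add: distrib_left distrib_right scale_pq_mult add_eq_0_iff2 algebra_simps scale_minus_left)
    then show ?case using assms by (simp add: scale_left_diff_distrib)
  next
    case (5 i) then show ?case using rel[OF A_rel.intros(2)[of q i]] by (simp add: ops el_ops(4,5)[OF atms_simps(1)])
  next
    case (6 i) then show ?case using rel[OF A_rel.intros(3)[of q i]] by (simp add: ops)
  next
    case (7 i) then show ?case using rel[OF A_rel.intros(4)[of q i]] by (simp add: ops)
  next
    case (8 i j) then show ?case using rel[OF A_rel.intros(5)[of j i q]] by (simp add: ops)
  next
    case (9 i j) then show ?case using rel[OF A_rel.intros(6)[of j i q]] by (simp add: ops)
  next
    case (10 i j) then show ?case using rel[OF A_rel.intros(6)[of i j q]] by (simp add: ops)
  next
    case (11 i j) then show ?case using rel[OF A_rel.intros(7)[of j i q]] by (simp add: ops)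
  next
    case (12 i) then show ?case using rel[OF A_rel.intros(8)[of q i]] by (simp add: ops)
  next
    case (13 i) then show ?case using rel[OF A_rel.intros(9)[of q i]] by (simp add: ops)
  next
    case (14 i) then show ?case using rel[OF A_rel.intros(10)[of q i]] by (simp add: ops)
  next
    case (15 i) then show ?case using rel[OF A_rel.intros(11)[of q i]] by (simp add: ops)
  next
    case (16 i) then show ?case using rel[OF A_rel.intros(12)[of q i]] by (simp add: ops)
  qed
qed

lemma el_spanned:
  fixes q :: "'f::field"
  assumes "q \<noteq> 0"
  shows "\<exists>B. finite B \<and> card B \<le> odd_fact n \<and> el q n ` atms (agens n) \<subseteq> module.span scale_pq B"
proof -
  interpret q_Brauer_elements scale_pq q n "\<lambda>i. el q n (AGen (Gg i))" "\<lambda>i. el q n (AGen (Ge i))"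
    by (rule q_Brauer_elements_pq[OF assms])
  have "x \<in> atms (agens n) \<Longrightarrow> el q n x \<in> Alg n" for x
  proof (induction x)
    case (AGen x)
    then show ?case by (cases x) (auto simp: atms_simps agens_iff intro: Alg_g Alg_e)
  next
    case AZero
    then show ?case using Alg_scale[OF Alg_one, where c = 0] by (simp add: el_ops(5)[OF atms_simps(1)])
  qed (simp_all add: atms_simps el_ops el_ops(4)[OF atms_simps(1)] Alg_one Alg_mult Alg_add Alg_scale)
  then show ?thesis using Alg_spanned by blast
qed

section \<open>The isomorphism with the endomorphism algebra\<close>

context q_periplectic begin

definition "ggen n i = pad (i - 1) h (n - i - 1)"
definition "egen n i = pad (i - 1) (u \<odot> a) (n - i - 1)"

lemma adjacent_cases:
  assumes "1 \<le> i" "i + 1 < n"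
  obtains k j where "i = Suc k" "n = Suc (Suc (Suc (k + j)))"
proof
  show "i = Suc (i - 1)" "n = Suc (Suc (Suc (i - 1 + (n - i - 2))))" using assms by simp_all
qed

lemma single_cases:
  assumes "1 \<le> i" "i < n"
  obtains k j where "i = Suc k" "n = Suc (Suc (k + j))"
proof
  show "i = Suc (i - 1)" "n = Suc (Suc (i - 1 + (n - i - 1)))" using assms by simp_all
qed

lemma ua_pad: "pad i (u \<odot> a) j = pad i u j \<odot> pad i a j"
  by (rule pad_cmp[OF ars(3,4), symmetric])

lemma quadratic:
  assumes "1 \<le> i" "i < n"
  shows "(ggen n i \<boxplus> (- q) \<boxdot> idn n) \<odot> (ggen n i \<boxplus> inverse q \<boxdot> idn n) = zer n n"
proof -
  obtain k j where kj: "i = Suc k" "n = Suc (Suc (k + j))" using single_cases[OF assms] .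
  let ?X = "pad k h j"
  have X: "ar n n ?X" using ar_pad[OF ars(1), of k j] kj by simp
  have XX: "?X \<odot> ?X = idn n \<boxplus> (q - inverse q) \<boxdot> ?X" using h_h_pad[of k j] kj by simp
  have "(?X \<boxplus> (- q) \<boxdot> idn n) \<odot> (?X \<boxplus> inverse q \<boxdot> idn n) =
      ((idn n \<boxplus> (q - inverse q) \<boxdot> ?X) \<boxplus> (- q) \<boxdot> ?X) \<boxplus> (inverse q \<boxdot> ?X \<boxplus> (inverse q * - q) \<boxdot> idn n)"
    by (simp only: cmp_add_sml XX unit_laws(1,2)[OF X] idn_idn total_laws(13,14))
  also have "inverse q * - q = - 1" using q_nonzero by simp
  also have "((idn n \<boxplus> (q - inverse q) \<boxdot> ?X) \<boxplus> (- q) \<boxdot> ?X) \<boxplus> (inverse q \<boxdot> ?X \<boxplus> (- 1) \<boxdot> idn n) =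
      (idn n \<boxplus> (- 1) \<boxdot> idn n) \<boxplus> ((q - inverse q) + - q + inverse q) \<boxdot> ?X"
    by (simp only: total_laws(15) add_ac)
  also have "\<dots> = zer n n"
    unfolding unit_laws(7)[OF ar_idn] using unit_laws(8)[OF X] unit_laws(6)[OF ar_zer] by simp
  finally show ?thesis by (simp add: ggen_def kj)
qed

lemma single_relations:
  assumes "1 \<le> i" "i < n"
  shows "egen n i \<odot> egen n i = zer n n" and "egen n i \<odot> ggen n i = (- inverse q) \<boxdot> egen n i"
    and "ggen n i \<odot> egen n i = q \<boxdot> egen n i"
proof -
  obtain k j where kj: "i = Suc k" "n = Suc (Suc (k + j))" using single_cases[OF assms] .
  have d: "ggen n i = pad k h j" "egen n i = pad k u j \<odot> pad k a j"
    by (simp_all add: ggen_def egen_def kj ua_pad)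
  have z: "zer (k + j) (k + j) \<odot> pad k a j = zer n (k + j)" "pad k u j \<odot> zer n (k + j) = zer n n"
    using zer_laws(1)[OF ar_pad[OF ars(4), of k j]] zer_laws(2)[OF ar_pad[OF ars(3), of k j]] kj by simp_all
  show "egen n i \<odot> egen n i = zer n n" "egen n i \<odot> ggen n i = (- inverse q) \<boxdot> egen n i"
    "ggen n i \<odot> egen n i = q \<boxdot> egen n i"
    unfolding d
    by (simp_all only: total_laws(1) cmp_assoc_rule[OF slices(3)] cmp_assoc_rule[OF slices(2)] slices(1) cmp_add_sml z)
qed

lemma far_relations:
  assumes "1 \<le> i" "i < n" "1 \<le> j" "j < n" "2 \<le> \<bar>int i - int j\<bar>"
    and X: "arp 0 2 2 X" and Z: "arp 0 2 2 Z"
  shows "pad (i - 1) X (n - i - 1) \<odot> pad (j - 1) Z (n - j - 1) = pad (j - 1) Z (n - j - 1) \<odot> pad (i - 1) X (n - i - 1)"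
proof -
  have far: "pad (i - 1) X (n - i - 1) \<odot> pad (j - 1) Z (n - j - 1) = pad (j - 1) Z (n - j - 1) \<odot> pad (i - 1) X (n - i - 1)"
    if "1 \<le> i" "j < n" "i + 2 \<le> j" "arp 0 2 2 X" "arp 0 2 2 Z" for i j X Z
  proof -
    have e: "n - i - 1 = (j - i - 2) + 2 + (n - j - 1)" "j - 1 = (i - 1) + 2 + (j - i - 2)" using that by simp_all
    show ?thesis unfolding e by (rule pad_far[OF arp_ar[OF that(4)] arp_ar[OF that(5)] disjI1[OF that(4)]])
  qed
  have "i + 2 \<le> j \<or> j + 2 \<le> i" using assms(5) by linarith
  then show ?thesis using far[OF assms(1,4) _ X Z] far[OF assms(3,2) _ Z X] by (elim disjE) simp_all
qed

lemma h_u_slide_pad: "pad i h (Suc j) \<odot> pad (Suc i) u j = pad (Suc i) h j \<odot> pad i u (Suc j) \<boxplus> (q - inverse q) \<boxdot> pad (Suc i) u j"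
  unfolding u_slide_pad by (subst skein_pad) (use unit_laws(1)[OF ar_pad[OF ars(3), of "Suc i" j]] in \<open>simp add: cmp_add_sml\<close>)

lemma a_h_slide_pad: "pad i a (Suc j) \<odot> pad (Suc i) h j = pad (Suc i) a j \<odot> pad i h (Suc j) \<boxplus> (q - inverse q) \<boxdot> pad i a (Suc j)"
proof -
  have inv: "pad i hb (Suc j) \<odot> pad i h (Suc j) = idn (i + 2 + Suc j)" unfolding pad_cmp[OF ars(2,1)] hb_h pad_idn ..
  have i: "pad (Suc i) hb j \<odot> idn (i + 2 + Suc j) = pad (Suc i) hb j" "pad i a (Suc j) \<odot> idn (Suc (i + 2 + j)) = pad i a (Suc j)"
    using unit_laws(2)[OF ar_pad[OF ars(2), of "Suc i" j]] unit_laws(2)[OF ar_pad[OF ars(4), of i "Suc j"]] by simp_all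
  have "pad (Suc i) a j \<odot> pad i h (Suc j) = pad i a (Suc j) \<odot> pad (Suc i) hb j"
    unfolding a_slide_pad total_laws(1) inv i ..
  moreover have "pad (Suc i) h j = pad (Suc i) hb j \<boxplus> (q - inverse q) \<boxdot> idn (Suc (i + 2 + j))"
    using skein_pad[of "Suc i" j] by simp
  ultimately show ?thesis by (simp only: cmp_add_sml i)
qed

lemma adjacent_relations:
  assumes "1 \<le> i" "i + 1 < n"
  shows "ggen n i \<odot> ggen n (i + 1) \<odot> ggen n i = ggen n (i + 1) \<odot> ggen n i \<odot> ggen n (i + 1)"
    and "egen n (i + 1) \<odot> egen n i \<odot> egen n (i + 1) = (- 1) \<boxdot> egen n (i + 1)"
    and "egen n i \<odot> egen n (i + 1) \<odot> egen n i = (- 1) \<boxdot> egen n i"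
    and "ggen n i \<odot> egen n (i + 1) \<odot> egen n i =
      (- 1) \<boxdot> (ggen n (i + 1) \<odot> egen n i) \<boxplus> (q - inverse q) \<boxdot> (egen n (i + 1) \<odot> egen n i)"
    and "egen n (i + 1) \<odot> egen n i \<odot> ggen n (i + 1) =
      (- 1) \<boxdot> (egen n (i + 1) \<odot> ggen n i) \<boxplus> (q - inverse q) \<boxdot> (egen n (i + 1) \<odot> egen n i)"
proof -
  obtain k j where kj: "i = Suc k" "n = Suc (Suc (Suc (k + j)))" using adjacent_cases[OF assms] .
  have d: "ggen n i = pad k h (Suc j)" "ggen n (i + 1) = pad (Suc k) h j"
    "egen n i = pad k u (Suc j) \<odot> pad k a (Suc j)" "egen n (i + 1) = pad (Suc k) u j \<odot> pad (Suc k) a j"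
    by (simp_all add: ggen_def egen_def kj ua_pad)
  have i: "idn (Suc (k + j)) \<odot> pad k a (Suc j) = pad k a (Suc j)" "idn (Suc (k + j)) \<odot> pad (Suc k) a j = pad (Suc k) a j"
    using unit_laws(1)[OF ar_pad[OF ars(4), of k "Suc j"]] unit_laws(1)[OF ar_pad[OF ars(4), of "Suc k" j]] by simp_all
  have i': "idn (Suc (k + j)) \<odot> (pad k a (Suc j) \<odot> W) = pad k a (Suc j) \<odot> W"
    "idn (Suc (k + j)) \<odot> (pad (Suc k) a j \<odot> W) = pad (Suc k) a j \<odot> W" for W
    using cmp_assoc_rule[OF i(1)] cmp_assoc_rule[OF i(2)] by simp_all
  note zz = zig_au_pad zig_ua_pad cmp_assoc_rule[OF zig_au_pad] cmp_assoc_rule[OF zig_ua_pad]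
  show "ggen n i \<odot> ggen n (i + 1) \<odot> ggen n i = ggen n (i + 1) \<odot> ggen n i \<odot> ggen n (i + 1)"
    unfolding d total_laws(1) by (rule braid_pad)
  show "egen n (i + 1) \<odot> egen n i \<odot> egen n (i + 1) = (- 1) \<boxdot> egen n (i + 1)"
    "egen n i \<odot> egen n (i + 1) \<odot> egen n i = (- 1) \<boxdot> egen n i"
    unfolding d by (simp_all only: total_laws(1) zz i i' cmp_add_sml)
  show "ggen n i \<odot> egen n (i + 1) \<odot> egen n i =
      (- 1) \<boxdot> (ggen n (i + 1) \<odot> egen n i) \<boxplus> (q - inverse q) \<boxdot> (egen n (i + 1) \<odot> egen n i)"
    unfolding d by (simp only: total_laws(1,13,14) zz i i' cmp_add_sml cmp_assoc_rule[OF h_u_slide_pad] mult.commute)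
  show "egen n (i + 1) \<odot> egen n i \<odot> ggen n (i + 1) =
      (- 1) \<boxdot> (egen n (i + 1) \<odot> ggen n i) \<boxplus> (q - inverse q) \<boxdot> (egen n (i + 1) \<odot> egen n i)"
    unfolding d by (simp only: total_laws(1,13,14) zz i i' cmp_add_sml a_h_slide_pad mult.commute)
qed

end

primrec interp :: "nat \<Rightarrow> (agen, 'f) atm \<Rightarrow> (gen, 'f) tm" where
  "interp n AOne = TId n"
| "interp n (AGen x) = (case x of Gg i \<Rightarrow> TId (i - 1) \<star> TGen GH \<star> TId (n - i - 1)
     | Ge i \<Rightarrow> TId (i - 1) \<star> (TGen GU \<cdot> TGen GA) \<star> TId (n - i - 1))"
| "interp n AZero = TZero n n"
| "interp n (x *\<^sub>a y) = interp n x \<cdot> interp n y"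
| "interp n (x +\<^sub>a y) = interp n x +\<^sub>t interp n y"
| "interp n (c \<cdot>\<^sub>a x) = c *\<^sub>t interp n x"

lemma wt_interp: "x \<in> atms (agens n) \<Longrightarrow> wt (sig UNIV) n n (interp n x)"
proof (induction x)
  case (AGen x)
  have w: "wt (sig UNIV) 2 2 (TGen GH)" "wt (sig UNIV) 0 2 (TGen GU)" "wt (sig UNIV) 2 0 (TGen GA)"
    using wt_gen[of GH "sig UNIV"] wt_gen[of GU "sig UNIV"] wt_gen[of GA "sig UNIV"] by (simp_all add: sig_def)
  have *: "wt (sig UNIV) n n (TId (i - 1) \<star> f \<star> TId (n - i - 1))" if "1 \<le> i" "i < n" "wt (sig UNIV) 2 2 f"
    for i and f :: "(gen, 'a) tm"
  proof -
    have "i - 1 + 2 + (n - i - 1) = n" using that by simp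
    then show ?thesis using wt_tens[OF wt_tens[OF wt_id that(3)] wt_id, of "i - 1" "n - i - 1"] by simp
  qed
  show ?case
    using AGen *[OF _ _ w(1)] *[OF _ _ wt_comp[OF w(2,3)]] by (cases x) (auto simp: atms_simps agens_iff)
qed (auto simp: atms_simps intro: wt.intros)

lemma interp_eqv:
  fixes q :: "'f::field"
  assumes q: "q \<noteq> 0" and xy: "aeqv (agens n) (A_rel q) x y"
  shows "eqv (sig UNIV) (B_rel q) (interp n x) (interp n y)"
proof -
  interpret sig_presentation UNIV "B_rel q" by (rule sig_presentation_B)
  interpret q_periplectic "sig UNIV" "B_rel q" "cls (TGen GH)" "cls (TGen GH')" "cls (TGen GU)" "cls (TGen GA)" q
    by (rule q_periplectic_B[OF q])
  have ar: "x \<in> atms (agens n) \<Longrightarrow> ar n n (cls (interp n x))" for x by (rule cls_arI[OF wt_interp])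
  have g: "cls (interp n (AGen (Gg i))) = ggen n i" "cls (interp n (AGen (Ge i))) = egen n i" for i
    by (simp_all add: cls_ops ggen_def egen_def pad_def)
  note i = interp.simps(1,3-6) cls_ops g
  have rel: "cls (interp n x) = cls (interp n y)" if "A_rel q x y" "x \<in> atms (agens n)" "y \<in> atms (agens n)" for x y
    using that
  proof (cases rule: A_rel.cases)
    case (1 i) then show ?thesis using that(2) quadratic[of i n] by (simp only: i atms_simps agens_iff)
  next
    case (2 i) then show ?thesis using that(2) single_relations[of i n] by (simp only: i atms_simps agens_iff)
  next
    case (3 i) then show ?thesis using that(2) single_relations[of i n] by (simp only: i atms_simps agens_iff)
  next
    case (4 i) then show ?thesis using that(2) single_relations[of i n] by (simp only: i atms_simps agens_iff)
  next
    case (5 i j) then show ?thesis using that(2) far_relations[of i n j, OF _ _ _ _ _ h h] by (simp only: i atms_simps agens_iff ggen_def egen_def)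
  next
    case (6 i j) then show ?thesis using that(2) far_relations[of i n j, OF _ _ _ _ _ h arp_ua] by (simp only: i atms_simps agens_iff ggen_def egen_def)
  next
    case (7 i j) then show ?thesis using that(2) far_relations[of i n j, OF _ _ _ _ _ arp_ua arp_ua] by (simp only: i atms_simps agens_iff ggen_def egen_def)
  next
    case (8 i) then show ?thesis using that(2) adjacent_relations[of i n] by (simp only: i atms_simps agens_iff)
  next
    case (9 i) then show ?thesis using that(2) adjacent_relations[of i n] by (simp only: i atms_simps agens_iff)
  next
    case (10 i) then show ?thesis using that(2) adjacent_relations[of i n] by (simp only: i atms_simps agens_iff)
  next
    case (11 i) then show ?thesis using that(2) adjacent_relations[of i n] by (simp only: i atms_simps agens_iff)
  next
    case (12 i) then show ?thesis using that(2) adjacent_relations[of i n] by (simp only: i atms_simps agens_iff)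
  qed
  have "cls (interp n x) = cls (interp n y)" using xy
  proof (induction rule: aeqv.induct)
    case (aeqv_rel x y)
    then show ?case by (rule rel)
  qed (simp_all only: i total_laws(1,3,5,6,9,10,13-15) unit_laws[OF ar], simp_all only: total_laws(4))
  then show ?thesis using eqv_class_eqD wt_interp aeqv_atms[OF xy] by blast
qed

lemma interp_surj:
  fixes q :: "'f::field"
  assumes q: "q \<noteq> 0" and f: "wt (sig UNIV) n n f"
  shows "\<exists>x\<in>atms (agens n). eqv (sig UNIV) (B_rel q) (interp n x) f"
proof -
  interpret sig_presentation UNIV "B_rel q" by (rule sig_presentation_B)
  interpret q_periplectic "sig UNIV" "B_rel q" "cls (TGen GH)" "cls (TGen GH')" "cls (TGen GU)" "cls (TGen GA)" q
    by (rule q_periplectic_B[OF q])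
  have "End n X \<Longrightarrow> \<exists>x\<in>atms (agens n). cls (interp n x) = X" for X
  proof (induction rule: End.induct)
    case End_idn
    show ?case by (rule bexI[of _ AOne]) (simp_all add: cls_ops atms_simps)
  next
    case (End_h i j)
    then show ?case by (intro bexI[of _ "AGen (Gg (Suc i))"]) (simp_all add: cls_ops atms_simps agens_iff pad_def)
  next
    case (End_ua i j)
    then show ?case by (intro bexI[of _ "AGen (Ge (Suc i))"]) (simp_all add: cls_ops atms_simps agens_iff pad_def)
  next
    case (End_cmp X Z)
    then obtain x z where "x \<in> atms (agens n)" "z \<in> atms (agens n)" "cls (interp n x) = X" "cls (interp n z) = Z" by blast
    then show ?case by (intro bexI[of _ "x *\<^sub>a z"]) (simp_all add: cls_ops atms_simps)
  next
    case (End_add X Z)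
    then obtain x z where "x \<in> atms (agens n)" "z \<in> atms (agens n)" "cls (interp n x) = X" "cls (interp n z) = Z" by blast
    then show ?case by (intro bexI[of _ "x +\<^sub>a z"]) (simp_all add: cls_ops atms_simps)
  next
    case (End_sml X c)
    then obtain x where "x \<in> atms (agens n)" "cls (interp n x) = X" by blast
    then show ?case by (intro bexI[of _ "c \<cdot>\<^sub>a x"]) (simp_all add: cls_ops atms_simps)
  qed
  moreover have "End n (cls f)"
  proof (rule End_all[OF _ f])
    fix x show "cls (TGen x) \<in> {cls (TGen GH), cls (TGen GH'), cls (TGen GU), cls (TGen GA)}" by (cases x) simp_all
  qed
  ultimately obtain x where "x \<in> atms (agens n)" "cls (interp n x) = cls f" by blast
  then show ?thesis using eqv_class_eqD[OF _ wt_interp] by blast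
qed

lift_definition entry :: "'f::field \<Rightarrow> nat \<Rightarrow> 'f pq \<Rightarrow> int list \<Rightarrow> int list \<Rightarrow> 'f" is
  "\<lambda>q n F t s. if q \<noteq> 0 \<and> t \<in> labels n n \<and> s \<in> labels n n then rep q n (interp n (F (q, n))) t s else 0"
proof -
  fix q :: 'f and n :: nat and F G :: "'f \<times> nat \<Rightarrow> (agen, 'f) atm" assume FG: "prel F G"
  let ?f = "interp n (F (q, n))" and ?g = "interp n (G (q, n))"
  have "rep q n ?f t s = rep q n ?g t s" if "q \<noteq> 0" "t \<in> labels n n" "s \<in> labels n n" for t s
  proof -
    have "rep_eq q n ?f ?g" by (rule eqv_rep_eq[OF interp_eqv[OF that(1) prelD[OF FG]] that(1)])
    moreover have "tsrc ?f = n" "ttgt ?f = n"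
      using wt_src_tgt[OF wt_interp] aeqv_atms[OF prelD[OF FG]] by blast+
    ultimately show ?thesis using rep_eqD that by metis
  qed
  then show "(\<lambda>t s. if q \<noteq> 0 \<and> t \<in> labels n n \<and> s \<in> labels n n then rep q n ?f t s else 0) =
      (\<lambda>t s. if q \<noteq> 0 \<and> t \<in> labels n n \<and> s \<in> labels n n then rep q n ?g t s else 0)"
    by (intro ext) simp
qed

lemma entry_linear: "entry q n (x + y) t s = entry q n x t s + entry q n y t s"
    "entry q n (scale_pq c x) t s = c * entry q n x t s" "entry q n 0 t s = 0"
  by (transfer; simp)+

lemma entry_sum: "entry q n (\<Sum>b\<in>B. scale_pq (k b) (v b)) t s = (\<Sum>b\<in>B. k b * entry q n (v b) t s)"
  by (induction B rule: infinite_finite_induct) (simp_all add: entry_linear)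

lemma entry_el:
  assumes "x \<in> atms (agens n)" "q \<noteq> 0" "t \<in> labels n n" "s \<in> labels n n"
  shows "entry q n (el q n x) t s = rep q n (interp n x) t s"
  unfolding el_def entry.abs_eq[OF prel_raw[OF aeqv_refl[OF assms(1)]]] using assms by (simp add: raw_def)

lemma card_codes: "card (codes r) = odd_fact r"
proof (induction r)
  case (Suc r)
  have "card (codes (Suc r)) = (\<Sum>c\<le>2 * r. card ((#) c ` codes r))"
    unfolding codes.simps by (rule card_UN_disjoint) auto
  also have "\<dots> = (2 * r + 1) * odd_fact r" using Suc by (simp add: card_image)
  finally show ?case by simp
qed simp

lemma interp_inj:
  fixes q :: "'f::field"
  assumes q: "q \<noteq> 0" and x: "x \<in> atms (agens n)" and y: "y \<in> atms (agens n)"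
    and xy: "eqv (sig UNIV) (B_rel q) (interp n x) (interp n y)"
  shows "aeqv (agens n) (A_rel q) x y"
proof -
  interpret V: vector_space "scale_pq :: 'f \<Rightarrow> _" by (rule vector_space_pq)
  obtain B where B: "finite B" "card B \<le> odd_fact n" "el q n ` atms (agens n) \<subseteq> V.span B"
    using el_spanned[OF q] by blast
  have "\<forall>cs\<in>codes n. \<exists>x\<in>atms (agens n). eqv (sig UNIV) (B_rel q) (interp n x) (unbent cs)"
    using interp_surj[OF q wt_unbent] by blast
  then obtain w where w: "\<And>cs. cs \<in> codes n \<Longrightarrow> w cs \<in> atms (agens n)"
    "\<And>cs. cs \<in> codes n \<Longrightarrow> eqv (sig UNIV) (B_rel q) (interp n (w cs)) (unbent cs)" by metis
  define v where "v cs = el q n (w cs)" for cs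
  have ent: "entry q n (v cs) t s = rep q n (unbent cs) t s"
    if "cs \<in> codes n" "t \<in> labels n n" "s \<in> labels n n" for cs t s
    unfolding v_def entry_el[OF w(1)[OF that(1)] q that(2,3)]
    using rep_eqD[OF eqv_rep_eq[OF w(2)[OF that(1)] q]] wt_src_tgt[OF wt_interp[OF w(1)[OF that(1)]]] that by metis
  have indep: "k cs = 0" if "(\<Sum>cs\<in>codes n. scale_pq (k cs) (v cs)) = 0" "cs \<in> codes n" for k cs
  proof (rule unbent_independent[OF _ that(2)])
    fix t s assume ts: "t \<in> labels n n" "s \<in> labels n n"
    have "(\<Sum>cs\<in>codes n. k cs * rep q n (unbent cs) t s) = (\<Sum>cs\<in>codes n. k cs * entry q n (v cs) t s)"
      by (rule sum.cong) (simp_all add: ent ts)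
    also have "\<dots> = 0" unfolding entry_sum[symmetric] that(1) entry_linear(3) ..
    finally show "(\<Sum>cs\<in>codes n. k cs * rep q n (unbent cs) t s) = 0" .
  qed
  have inj: "inj_on v (codes n)"
  proof (rule inj_onI, rule ccontr)
    fix c d assume cd: "c \<in> codes n" "d \<in> codes n" "v c = v d" "c \<noteq> d"
    let ?k = "\<lambda>x. if x = c then 1 else if x = d then - 1 else (0::'f)"
    have "(\<Sum>x\<in>codes n. scale_pq (?k x) (v x)) = (\<Sum>x\<in>{c, d}. scale_pq (?k x) (v x))"
      by (rule sum.mono_neutral_right) (use cd in auto)
    also have "\<dots> = 0" using cd by (simp add: uminus_pq_scale)
    finally show False using indep[of ?k c] cd(1) by simp
  qed
  have ind: "V.independent (v ` codes n)"
  proof (rule V.independent_if_scalars_zero)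
    fix f z assume "(\<Sum>z\<in>v ` codes n. scale_pq (f z) z) = 0" "z \<in> v ` codes n"
    then show "f z = 0" using indep[of "\<lambda>cs. f (v cs)"] by (auto simp: sum.reindex[OF inj])
  qed simp
  have vB: "v ` codes n \<subseteq> V.span B" using B(3) w(1) by (auto simp: v_def)
  have span: "X \<in> V.span (v ` codes n)" if X: "X \<in> V.span B" for X
  proof (rule ccontr)
    assume n: "X \<notin> V.span (v ` codes n)"
    have "V.independent (insert X (v ` codes n))" by (rule V.independent_insertI[OF n ind])
    then have "card (insert X (v ` codes n)) \<le> card B"
      using V.independent_span_bound[OF B(1)] vB X by blast
    moreover have "X \<notin> v ` codes n" using n V.span_base by blast
    ultimately show False using B(2) card_image[OF inj] card_codes[of n] by simp
  qed
  have "el q n x - el q n y \<in> V.span B" using B(3) x y by (intro V.span_diff) auto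
  then have "el q n x - el q n y \<in> V.span (v ` codes n)" by (rule span)
  then have "el q n x - el q n y \<in> range (\<lambda>k. \<Sum>z\<in>v ` codes n. scale_pq (k z) z)"
    by (simp only: V.span_finite[OF finite_imageI[OF finite_codes]])
  then obtain k where k: "el q n x - el q n y = (\<Sum>cs\<in>codes n. scale_pq (k (v cs)) (v cs))"
    by (auto simp: sum.reindex[OF inj])
  have "k (v cs) = 0" if cs: "cs \<in> codes n" for cs
  proof (rule unbent_independent[OF _ cs, of "\<lambda>cs. k (v cs)"])
    fix t s assume ts: "t \<in> labels n n" "s \<in> labels n n"
    have "entry q n (el q n x) t s = entry q n (el q n y) t s"
      unfolding entry_el[OF x q ts] entry_el[OF y q ts]
      using rep_eqD[OF eqv_rep_eq[OF xy q]] wt_src_tgt[OF wt_interp[OF x]] ts by metis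
    moreover have "entry q n (el q n x) t s = entry q n (el q n x - el q n y) t s + entry q n (el q n y) t s"
      unfolding entry_linear(1)[symmetric] by simp
    ultimately have "(\<Sum>cs\<in>codes n. k (v cs) * entry q n (v cs) t s) = 0" unfolding k entry_sum by simp
    then show "(\<Sum>cs\<in>codes n. k (v cs) * rep q n (unbent cs) t s) = 0" by (simp add: ent ts)
  qed
  then have "el q n x - el q n y = 0" unfolding k by simp
  then show ?thesis using el_eqD[OF _ x y] by simp
qed

lemma End_algebra_iso:
  fixes q :: "'f::field"
  assumes q: "q \<noteq> 0"
  shows "algebra_isomorphic (End_algebra (cat_B q) n) (periplectic_q_Brauer_algebra q n)"
proof -
  interpret P: presentation "sig UNIV" "B_rel q" .
  let ?E = "End_algebra (cat_B q) n" and ?A = "presented_algebra (agens n) (A_rel q)"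
  let ?acls = "aeqv_class (agens n) (A_rel q)"
  have E: "assoc_algebra ?E" unfolding cat_B_def by (rule P.assoc_algebra_End)
  have A: "assoc_algebra ?A" by (rule assoc_algebra_presented)
  define \<Phi> where "\<Phi> X = (\<Union>x\<in>X. P.cls (interp n x))" for X
  have \<Phi>: "\<Phi> (?acls x) = P.cls (interp n x)" if "x \<in> atms (agens n)" for x
    unfolding \<Phi>_def by (rule aeqv_class_UN[OF that]) (rule eqv_class_eq[OF interp_eqv[OF q aeqv_sym]])
  have c: "P.cls (interp n x) \<in> carrier ?E" if "x \<in> atms (agens n)" for x
    using P.cls_arI[OF wt_interp[OF that]] by (simp add: hom_space_def cat_B_def P.presented)
  have ops: "P.cls (interp n x) \<otimes>\<^bsub>?E\<^esub> P.cls (interp n y) = P.cls (interp n (x *\<^sub>a y))"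
    "P.cls (interp n x) \<oplus>\<^bsub>?E\<^esub> P.cls (interp n y) = P.cls (interp n (x +\<^sub>a y))"
    "k \<odot>\<^bsub>?E\<^esub> P.cls (interp n x) = P.cls (interp n (k \<cdot>\<^sub>a x))" "\<one>\<^bsub>?E\<^esub> = P.cls (interp n AOne)" for x y k
    by (simp_all add: hom_space_def cat_B_def P.presented P.cls_ops)
  note simps = presented_algebra_simps atms_simps \<Phi> ops
  have "\<Phi> \<in> ring_hom ?A ?E"
  proof (rule ring_hom_memI; (elim presented_carrierE)?; (hypsubst)?)
    show "\<Phi> \<one>\<^bsub>?A\<^esub> = \<one>\<^bsub>?E\<^esub>" by (simp only: presented_algebra_simps(5)[OF atms_simps(1)] simps)
  qed (simp_all only: simps c)
  moreover have "bij_betw \<Phi> (carrier ?A) (carrier ?E)"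
    unfolding bij_betw_def
  proof (intro conjI equalityI subsetI)
    show "inj_on \<Phi> (carrier ?A)"
    proof (rule inj_onI, elim presented_carrierE, hypsubst)
      fix x y assume xy: "x \<in> atms (agens n)" "y \<in> atms (agens n)" "\<Phi> (?acls x) = \<Phi> (?acls y)"
      have "eqv (sig UNIV) (B_rel q) (interp n x) (interp n y)"
        using eqv_class_eqD[OF _ wt_interp[OF xy(1)]] xy(3) unfolding \<Phi>[OF xy(1)] \<Phi>[OF xy(2)] by blast
      from aeqv_class_eq[OF interp_inj[OF q xy(1,2) this]] show "?acls x = ?acls y" .
    qed
  next
    fix X assume "X \<in> \<Phi> ` carrier ?A"
    then show "X \<in> carrier ?E" by (auto elim!: presented_carrierE simp only: \<Phi> c)
  next
    fix X assume "X \<in> carrier ?E"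
    then obtain f where f: "wt (sig UNIV) n n f" "X = P.cls f" by (auto simp: hom_space_def cat_B_def P.presented P.ar_def)
    obtain x where x: "x \<in> atms (agens n)" "eqv (sig UNIV) (B_rel q) (interp n x) f" using interp_surj[OF q f(1)] by blast
    then have "X = \<Phi> (?acls x)" using eqv_class_eq[OF x(2)] by (simp add: f(2) \<Phi>)
    then show "X \<in> \<Phi> ` carrier ?A" using presented_algebra_simps(4)[OF x(1)] by blast
  qed
  ultimately have iso: "\<Phi> \<in> ring_iso ?A ?E" by (simp add: ring_iso_def)
  let ?\<Psi> = "inv_into (carrier ?A) \<Phi>"
  have "?\<Psi> \<in> ring_iso ?E ?A" by (rule ring_iso_set_sym[OF assoc_algebra.is_ring[OF A] iso])
  moreover have "?\<Psi> (k \<odot>\<^bsub>?E\<^esub> X) = k \<odot>\<^bsub>?A\<^esub> ?\<Psi> X" if "X \<in> carrier ?E" for k X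
  proof -
    have b: "bij_betw \<Phi> (carrier ?A) (carrier ?E)" using iso by (simp add: ring_iso_def)
    have "X \<in> \<Phi> ` carrier ?A" using that bij_betw_imp_surj_on[OF b] by simp
    then obtain Y where Y: "Y \<in> carrier ?A" "X = \<Phi> Y" by blast
    then obtain y where y: "y \<in> atms (agens n)" "Y = ?acls y" by (auto elim: presented_carrierE)
    have "k \<odot>\<^bsub>?E\<^esub> X = \<Phi> (k \<odot>\<^bsub>?A\<^esub> Y)" using y by (simp add: Y(2) simps)
    moreover have "k \<odot>\<^bsub>?A\<^esub> Y \<in> carrier ?A" using y by (simp add: simps)
    ultimately show ?thesis using Y bij_betw_inv_into_left[OF b] by simp
  qed
  ultimately show ?thesis
    using E A unfolding algebra_isomorphic_def periplectic_q_Brauer_algebra_def agens_def by blast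
qed

theorem proposition10p7:
  assumes "CHAR('k::field) \<noteq> 2"
  shows "supercat_isomorphic (cat_C (qvar :: 'k poly fract)) (cat_B (qvar :: 'k poly fract))
    \<and> (\<forall>n. algebra_isomorphic (End_algebra (cat_C (qvar :: 'k poly fract)) n)
            (periplectic_q_Brauer_algebra (qvar :: 'k poly fract) n))
    \<and> supercat_isomorphic (cat_B (1 :: 'k)) periplectic_Brauer_cat
    \<and> supercat_isomorphic (cat_C (1 :: 'k)) periplectic_Brauer_cat"
proof -
  have q: "(qvar :: 'k poly fract) \<noteq> 0"
    by (simp add: qvar_def Zero_fract_def eq_fract)
  show ?thesis
    using cat_C_iso_cat_B[OF q] End_algebra_iso[OF q] cat_B_iso_periplectic[OF assms]
    by (simp add: cat_C_eq_cat_B[OF q] cat_C_eq_cat_B[of "1 :: 'k"])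
qed

end
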